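(* Fix an integer $d\ge 3$, a real number $\mu$ with $2\sqrt{d-1}<\mu<d$, and $\epsilon>0$. Fix any $R>0$. Then there exists a simple (perhaps infinite) $d$-regular graph $\mathcal G$ such that: (1) $\mathcal G=T^\infty\mathcal G_0$ for some finite graph $\mathcal G_0$ (of maximum degree at most $d$); (2) $\mathcal G$ has girth $\ge R$; (3) $|\lambda_1(\mathcal G)-\mu|<\epsilon$ and $\lambda_2(\mathcal G)<2\sqrt{d-1}+\epsilon$.
   Context: For a graph $\mathcal G_0$ of maximum degree at most $d$, the infinite tree extension $T^\infty\mathcal G_0$ is the $d$-regular graph obtained by attaching to each vertex $v$ of $\mathcal G_0$ exactly $d-\deg_{\mathcal G_0}(v)$ disjoint infinite rooted $(d-1)$-ary trees (every vertex of such a tree, including its root, has $d-1$ children; the root of each attached tree is joined to $v$ by an edge). For a possibly infinite graph with vertex set $V$ and adjacency operator $A$ on $\ell^2(V)$, $\lambda_i(\mathcal G)=\sup_{S}\inf_{v\in S,\|v\|=1}\langle v,Av\rangle$, the supremum being over $i$-dimensional subspaces $S$ of $\ell^2(V)$. The girth is the length of a shortest cycle ($\infty$ if there is none). *)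

theory Defs
  imports "HOL-Analysis.Analysis" "HOL-Library.Function_Algebras" "HOL-Library.Extended_Real"
begin

(* Pointwise scalar multiplication; together with the pointwise addition of Function_Algebras
   it makes the library notions "subspace" and "dim" available for sets of functions. *)
instantiation "fun" :: (type, real_vector) real_vector
begin

definition scaleR_fun :: "real \<Rightarrow> ('a \<Rightarrow> 'b) \<Rightarrow> 'a \<Rightarrow> 'b"
  where "scaleR_fun c f = (\<lambda>x. c *\<^sub>R f x)"

instance
  by standard (auto simp: scaleR_fun_def fun_eq_iff scaleR_add_right scaleR_add_left)

end

record 'v sgraph =
  verts :: "'v set"
  adj :: "'v \<Rightarrow> 'v \<Rightarrow> bool"

(* Graphs are nonempty, possibly infinite, without loops and multiple edges. *)
definition simple_graph :: "'v sgraph \<Rightarrow> bool" where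
  "simple_graph G \<longleftrightarrow>
     verts G \<noteq> {} \<and>
     (\<forall>x y. adj G x y \<longrightarrow> x \<in> verts G \<and> y \<in> verts G) \<and>
     (\<forall>x y. adj G x y \<longrightarrow> adj G y x) \<and>
     (\<forall>x. \<not> adj G x x)"

definition finite_graph :: "'v sgraph \<Rightarrow> bool" where
  "finite_graph G \<longleftrightarrow> simple_graph G \<and> finite (verts G)"

definition neighbours :: "'v sgraph \<Rightarrow> 'v \<Rightarrow> 'v set" where
  "neighbours G x = {y. adj G x y}"

definition degree :: "'v sgraph \<Rightarrow> 'v \<Rightarrow> nat" where
  "degree G x = card (neighbours G x)"

(* Finiteness of the neighbourhoods is required explicitly, since card is 0 on infinite sets. *)
definition max_degree_le :: "'v sgraph \<Rightarrow> nat \<Rightarrow> bool" where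
  "max_degree_le G d \<longleftrightarrow> (\<forall>x\<in>verts G. finite (neighbours G x) \<and> degree G x \<le> d)"

definition regular :: "nat \<Rightarrow> 'v sgraph \<Rightarrow> bool" where
  "regular d G \<longleftrightarrow> (\<forall>x\<in>verts G. finite (neighbours G x) \<and> degree G x = d)"

definition is_cycle :: "'v sgraph \<Rightarrow> 'v list \<Rightarrow> bool" where
  "is_cycle G c \<longleftrightarrow>
     length c \<ge> 3 \<and> distinct c \<and>
     (\<forall>i<length c. adj G (c ! i) (c ! ((i + 1) mod length c)))"

(* The infimum of the empty set is \<infinity>. *)
definition girth :: "'v sgraph \<Rightarrow> enat" where
  "girth G = (INF c\<in>{c. is_cycle G c}. enat (length c))"

(* The vertex (v, []) is the vertex v of G itself.  The vertices (v, k # ks) with a fixed k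
   form the k-th of the d - deg v trees attached to v: its root is (v, [k]), and ks lists the
   choices, among d - 1 children each, along the path from that root. *)
definition tree_ext :: "nat \<Rightarrow> 'v sgraph \<Rightarrow> ('v \<times> nat list) sgraph" where
  "tree_ext d G =
     (let V = {(v, ks). v \<in> verts G \<and>
                 (ks = [] \<or> (hd ks < d - degree G v \<and> (\<forall>k\<in>set (tl ks). k < d - 1)))}
      in \<lparr> verts = V,
           adj = (\<lambda>(v, ks) (w, ls).
             (v, ks) \<in> V \<and> (w, ls) \<in> V \<and>
             (ks = [] \<and> ls = [] \<and> adj G v w \<or>
              v = w \<and> ((\<exists>k. ls = ks @ [k]) \<or> (\<exists>k. ks = ls @ [k])))) \<rparr>)"

(* The real Hilbert space of square summable functions on V; a function on V is represented
   by its extension by 0 to the whole type. *)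
definition ell2 :: "'v set \<Rightarrow> ('v \<Rightarrow> real) set" where
  "ell2 V = {f. (\<forall>x. x \<notin> V \<longrightarrow> f x = 0) \<and> (\<lambda>x. (f x)\<^sup>2) summable_on V}"

definition ell2_inner :: "'v set \<Rightarrow> ('v \<Rightarrow> real) \<Rightarrow> ('v \<Rightarrow> real) \<Rightarrow> real" where
  "ell2_inner V f g = (\<Sum>\<^sub>\<infinity>x\<in>V. f x * g x)"

definition ell2_norm :: "'v set \<Rightarrow> ('v \<Rightarrow> real) \<Rightarrow> real" where
  "ell2_norm V f = sqrt (ell2_inner V f f)"

(* Intended for graphs of bounded degree, where this is a bounded operator on ell2 (verts G). *)
definition adj_op :: "'v sgraph \<Rightarrow> ('v \<Rightarrow> real) \<Rightarrow> 'v \<Rightarrow> real" where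
  "adj_op G f = (\<lambda>x. if x \<in> verts G then \<Sum>y\<in>neighbours G x. f y else 0)"

(* Meaningful for i \<ge> 1 and graphs of bounded degree with at least i vertices: then the supremum
   and the infima range over nonempty bounded sets of reals, and "dim S = i" says that S is
   i-dimensional (for i = 0 it would also hold for infinite-dimensional S). *)
definition graph_eigenvalue :: "nat \<Rightarrow> 'v sgraph \<Rightarrow> real" where
  "graph_eigenvalue i G =
     (SUP S\<in>{S. subspace S \<and> S \<subseteq> ell2 (verts G) \<and> dim S = i}.
        INF v\<in>{v \<in> S. ell2_norm (verts G) v = 1}.
          ell2_inner (verts G) v (adj_op G v))"

end

theory Submission
  imports Defs "Jordan_Normal_Form.Determinant" "HOL-Combinatorics.Cycles"
begin

text \<open>
  Write \<open>\<lambda>(g) = (d - 1) g + 1 / g\<close>, a decreasing bijection from \<open>[1 / (d - 1), 1 / sqrt (d - 1))\<close> onto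
  the levels between \<open>2 sqrt (d - 1)\<close> (excluded) and \<open>d\<close>.  Letting values decay by the factor \<open>g\<close> along
  the attached trees turns spectral bounds at level \<open>\<lambda>(g)\<close> for the infinite tree extension of a finite
  graph \<open>F\<close> into sign conditions on a quadratic form \<open>Q\<close> on functions on \<open>F\<close>, with diagonal
  \<open>(deg v - 1) g + 1 / g\<close> and off-diagonal part minus the adjacency matrix: the top eigenvalue is at
  most \<open>\<lambda>(g)\<close> if \<open>Q\<close> is nonnegative and at least \<open>\<lambda>(g)\<close> if it is not, and the second eigenvalue is
  at most \<open>\<lambda>(g)\<close> if \<open>Q\<close> is nonnegative on a hyperplane.

  One starts with a \<open>d\<close>-regular graph of large girth whose form is nonnegative on the functions
  of sum zero; it comes from a complete graph by repeated 2-lifts, where expected characteristic polynomials in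
  the manner of Marcus, Spielman and Srivastava give a signing with nonnegative form that is in
  addition negative on a prescribed disjoint family of short cycles, so that short cycles die out.
  Then one alternates a lift of large fixed degree \<open>N\<close> with the removal of one lift of every edge of
  the base, the removed edges being far apart.  The new functions of the lift absorb the effect of the
  removal up to a gain, so the form stays nonnegative on a hyperplane, and the top eigenvalue drops by
  at least a fixed amount but by at most \<open>d / N\<close>; hence it cannot jump over the window around \<open>\<mu>\<close>
  on its way from \<open>d\<close> down to \<open>\<mu>\<close>.
\<close>

section \<open>Determinants summed over signings\<close>

text \<open>Prescribing negative cycles is compatible with averaging over the remaining signs: in
  the determinant of level minus signed adjacency matrix, a rotation of a cycle whose signs multiply
  to -1 has coefficient +1. So the prescribed cycles only add nonnegative terms to the recursion of
  the matching polynomial. The obstacle in the cutting step is that deleting an edge changes the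
  form on new functions by an amount that no choice of \<open>N\<close> makes small. The remedy is
  comparison with a tree: the lift is a tree to large depth around a deleted edge, so a new function
  costs at least about as much as the geometrically decaying extension of its values at the two
  ends. Optimising over these values leaves, before error terms, a gain of 1/g - (deg - 1) g at each
  vertex of the base, positive because (d - 1) g^2 < 1. Deleting exactly one lift of each edge turns
  sums of lifted functions over deleted edges into sums over the base, so gain and loss are measured
  by the form of the base. All constants depend on \<open>d\<close> and the levels only, not on the
  current graph, so the descent has a uniform step.\<close>

definition leibniz_det :: "nat set \<Rightarrow> (nat \<Rightarrow> nat \<Rightarrow> real) \<Rightarrow> (nat \<Rightarrow> 'a) \<Rightarrow> 'a :: real_normed_field" where
  "leibniz_det V B z = (\<Sum>p | p permutes V. of_int (sign p) *
     (\<Prod>x\<in>V. of_real (B x (p x)) + (if p x = x then z x else 0)))"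

definition set_edge :: "(nat \<Rightarrow> nat \<Rightarrow> real) \<Rightarrow> nat \<times> nat \<Rightarrow> real \<Rightarrow> nat \<Rightarrow> nat \<Rightarrow> real" where
  "set_edge B e c = (\<lambda>x y. if (x, y) = e \<or> (y, x) = e then c else B x y)"

fun sign_sum :: "(nat \<times> nat) list \<Rightarrow> ((nat \<Rightarrow> nat \<Rightarrow> real) \<Rightarrow> 'b) \<Rightarrow> (nat \<Rightarrow> nat \<Rightarrow> real) \<Rightarrow> 'b :: ab_group_add" where
  "sign_sum [] F B = F B"
| "sign_sum (e # es) F B = sign_sum es F (set_edge B e 1) + sign_sum es F (set_edge B e (-1))"

text \<open>Up to the factor 2 ^ \<open>length es\<close>, this is the expected characteristic
  polynomial under independent signs on \<open>es\<close>, with a separate variable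
  \<open>z x\<close> at each vertex. Using a vertex set \<open>V\<close> in place of a dimension
  gives principal minors without renumbering.\<close>

definition det_sum :: "(nat \<times> nat) list \<Rightarrow> nat set \<Rightarrow> (nat \<Rightarrow> nat \<Rightarrow> real) \<Rightarrow> (nat \<Rightarrow> 'a) \<Rightarrow> 'a :: real_normed_field" where
  "det_sum es V B z = sign_sum es (\<lambda>B. leibniz_det V B z) B"

lemma det_sum_Nil [simp]: "det_sum [] V B z = leibniz_det V B z"
  by (simp add: det_sum_def)

lemma det_sum_Cons [simp]:
  "det_sum (e # es) V B z = det_sum es V (set_edge B e 1) z + det_sum es V (set_edge B e (-1)) z"
  by (simp add: det_sum_def)

lemma leibniz_det_cong:
  assumes "\<And>x y. x \<in> V \<Longrightarrow> y \<in> V \<Longrightarrow> B x y = B' x y" "\<And>x. x \<in> V \<Longrightarrow> z x = z' x"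
  shows "leibniz_det V B z = leibniz_det V B' z'"
  unfolding leibniz_det_def
  by (intro sum.cong refl arg_cong2[where f = "(*)"] prod.cong arg_cong2[where f = "(+)"])
     (auto simp: assms permutes_in_image)

lemma det_sum_cong:
  assumes "\<And>x y. x \<in> V \<Longrightarrow> y \<in> V \<Longrightarrow> B x y = B' x y" "\<And>x. x \<in> V \<Longrightarrow> z x = z' x"
  shows "det_sum es V B z = det_sum es V B' z'"
  using assms(1)
proof (induction es arbitrary: B B')
  case Nil
  then show ?case using assms(2) by (auto intro: leibniz_det_cong)
next
  case (Cons e es)
  show ?case
    unfolding det_sum_Cons
    by (intro arg_cong2[where f = "(+)"] Cons.IH) (auto simp: set_edge_def Cons.prems)
qed

lemma of_real_leibniz_det:
  "of_real (leibniz_det V B z) = (leibniz_det V B (\<lambda>x. of_real (z x)) :: 'a :: real_normed_field)"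
  unfolding leibniz_det_def by (simp add: if_distrib cong: if_cong)

lemma of_real_det_sum:
  "of_real (det_sum es V B z) = (det_sum es V B (\<lambda>x. of_real (z x)) :: 'a :: real_normed_field)"
  by (induction es arbitrary: B) (simp_all add: of_real_leibniz_det)

lemma permutes_fix_iff: "u \<in> V \<Longrightarrow> p permutes V \<and> p u = u \<longleftrightarrow> p permutes (V - {u})"
  unfolding permutes_def by auto

text \<open>Only permutations fixing \<open>u\<close> see \<open>z u\<close>, and these are the
  permutations of \<open>V - {u}\<close>.\<close>

lemma leibniz_det_affine:
  assumes "finite V" "u \<in> V"
  shows "leibniz_det V B (z(u := z u + t)) = leibniz_det V B z + t * leibniz_det (V - {u}) B z"
proof -
  let ?m = "\<lambda>(z :: nat \<Rightarrow> 'a) p x. of_real (B x (p x)) + (if p x = x then z x else 0)"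
  let ?z = "z(u := z u + t)"
  have split: "(\<Prod>x\<in>V. ?m y p x) = ?m y p u * (\<Prod>x\<in>V - {u}. ?m y p x)" for y p
    using assms by (simp add: prod.remove)
  have rest: "(\<Prod>x\<in>V - {u}. ?m ?z p x) = (\<Prod>x\<in>V - {u}. ?m z p x)" for p
    by (intro prod.cong) auto
  have fin: "finite {p. p permutes V}"
    using assms by (simp add: finite_permutations)
  have "leibniz_det V B ?z = (\<Sum>p | p permutes V. of_int (sign p) * (\<Prod>x\<in>V. ?m z p x)
      + (if p u = u then t * (of_int (sign p) * (\<Prod>x\<in>V - {u}. ?m z p x)) else 0))"
    unfolding leibniz_det_def
  proof (intro sum.cong refl)
    fix p
    show "of_int (sign p) * (\<Prod>x\<in>V. ?m ?z p x) = of_int (sign p) * (\<Prod>x\<in>V. ?m z p x)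
      + (if p u = u then t * (of_int (sign p) * (\<Prod>x\<in>V - {u}. ?m z p x)) else 0)"
      unfolding split[of p ?z] split[of p z] rest by (simp add: distrib_left distrib_right)
  qed
  also have "\<dots> = leibniz_det V B z
      + (\<Sum>p | p permutes V \<and> p u = u. t * (of_int (sign p) * (\<Prod>x\<in>V - {u}. ?m z p x)))"
    using sum.inter_filter[OF fin, of "\<lambda>p. t * (of_int (sign p) * (\<Prod>x\<in>V - {u}. ?m z p x))" "\<lambda>p. p u = u"]
    by (simp only: sum.distrib leibniz_det_def mem_Collect_eq)
  also have "{p. p permutes V \<and> p u = u} = {p. p permutes (V - {u})}"
    using permutes_fix_iff[OF assms(2)] by auto
  finally show ?thesis
    unfolding leibniz_det_def sum_distrib_left by simp
qed

lemma det_sum_affine: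
  assumes "finite V" "u \<in> V"
  shows "det_sum es V B (z(u := z u + t)) = det_sum es V B z + t * det_sum es (V - {u}) B z"
  by (induction es arbitrary: B)
    (simp_all add: leibniz_det_affine[OF assms] distrib_left del: fun_upd_apply)

lemma leibniz_det_eq_0_iff:
  assumes fin: "finite V"
  shows "leibniz_det V B z = 0 \<longleftrightarrow>
    (\<exists>w. (\<exists>x\<in>V. w x \<noteq> 0) \<and> (\<forall>x\<in>V. (\<Sum>y\<in>V. of_real (B x y) * w y) + z x * w x = 0))"
proof -
  obtain n where n: "V \<subseteq> {..<n}"
    using fin finite_nat_iff_bounded by blast
  \<comment> \<open>Padding with the identity outside \<open>V\<close> gives a square matrix of the
    same determinant, to which the kernel criterion applies.\<close>
  define b where "b x y = (if x \<in> V \<and> y \<in> V then of_real (B x y) + (if y = x then z x else 0)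
    else if x = y then 1 else 0)" for x y
  define M where "M = Matrix.mat n n (\<lambda>(x, y). b x y)"
  have M: "M \<in> carrier_mat n n" by (simp add: M_def)
  have nz: "p permutes V" if "p permutes {0..<n}" "(\<Prod>x=0..<n. b x (p x)) \<noteq> 0" for p
  proof (rule permutes_superset[OF that(1)])
    fix x assume "x \<in> {0..<n} - V"
    then have "b x (p x) \<noteq> 0" using that(2) by auto
    then show "p x = x" using \<open>x \<in> {0..<n} - V\<close> by (auto simp: b_def split: if_splits)
  qed
  have "det M = (\<Sum>p | p permutes {0..<n}. of_int (sign p) * (\<Prod>x=0..<n. b x (p x)))"
    unfolding det_def'[OF M] unfolding M_def
    by (intro sum.cong refl arg_cong2[where f = "(*)"] prod.cong) auto
  also have "\<dots> = (\<Sum>p | p permutes V. of_int (sign p) * (\<Prod>x=0..<n. b x (p x)))"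
    using n by (intro sum.mono_neutral_right)
      (auto simp: finite_permutations intro!: permutes_subset[of _ V "{0..<n}"] dest: nz)
  also have "\<dots> = leibniz_det V B z"
    unfolding leibniz_det_def
  proof (intro sum.cong refl arg_cong2[where f = "(*)"])
    fix p assume "p \<in> {p. p permutes V}"
    then have p: "p permutes V" by simp
    have "(\<Prod>x=0..<n. b x (p x)) = (\<Prod>x\<in>V. b x (p x))"
      using n p by (intro prod.mono_neutral_right) (auto simp: b_def permutes_not_in)
    also have "\<dots> = (\<Prod>x\<in>V. of_real (B x (p x)) + (if p x = x then z x else 0))"
      using p by (intro prod.cong) (auto simp: b_def permutes_in_image)
    finally show "(\<Prod>x=0..<n. b x (p x)) = \<dots>" .
  qed
  finally have det: "det M = leibniz_det V B z" .
  have rows: "(\<Sum>y<n. b x y * w y) = (\<Sum>y\<in>V. of_real (B x y) * w y) + z x * w x"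
    if "x \<in> V" for x w
  proof -
    have "(\<Sum>y<n. b x y * w y) = (\<Sum>y\<in>V. b x y * w y)"
      using n that by (intro sum.mono_neutral_right) (auto simp: b_def)
    also have "\<dots> = (\<Sum>y\<in>V. of_real (B x y) * w y + (if y = x then z x * w x else 0))"
      using that by (intro sum.cong) (auto simp: b_def algebra_simps)
    finally show ?thesis using that fin by (simp add: sum.distrib)
  qed
  have row_out: "(\<Sum>y<n. b x y * w y) = w x" if "x < n" "x \<notin> V" for x w
  proof -
    have "(\<Sum>y<n. b x y * w y) = (\<Sum>y<n. if y = x then w y else 0)"
      using that by (intro sum.cong) (auto simp: b_def)
    then show ?thesis using that by simp
  qed
  have mult: "vec_index (M *\<^sub>v v) x = (\<Sum>y<n. b x y * vec_index v y)" if "v \<in> carrier_vec n" "x < n" for v x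
    using that by (simp add: M_def scalar_prod_def lessThan_atLeast0 mult_mat_vec_def)
  show ?thesis
  proof
    assume "leibniz_det V B z = 0"
    then obtain v where v: "v \<in> carrier_vec n" "v \<noteq> 0\<^sub>v n" "M *\<^sub>v v = 0\<^sub>v n"
      using det det_0_iff_vec_prod_zero_field[OF M] by auto
    have row: "(\<Sum>y<n. b x y * vec_index v y) = 0" if "x < n" for x
      using mult[OF v(1) that] v(3) that by simp
    have "\<exists>x\<in>V. vec_index v x \<noteq> 0"
    proof (rule ccontr)
      assume *: "\<not> ?thesis"
      have "vec_index v x = 0" if "x < n" for x
        using * row[OF that] row_out[OF that] by (cases "x \<in> V") auto
      then have "v = 0\<^sub>v n"
        using v(1) by (intro eq_vecI) auto
      with v(2) show False by simp
    qed
    moreover have "(\<Sum>y\<in>V. of_real (B x y) * vec_index v y) + z x * vec_index v x = 0" if "x \<in> V" for x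
      using rows[OF that, of "vec_index v"] row[of x] n that by auto
    ultimately show "\<exists>w. (\<exists>x\<in>V. w x \<noteq> 0) \<and> (\<forall>x\<in>V. (\<Sum>y\<in>V. of_real (B x y) * w y) + z x * w x = 0)"
      by blast
  next
    assume "\<exists>w. (\<exists>x\<in>V. w x \<noteq> 0) \<and> (\<forall>x\<in>V. (\<Sum>y\<in>V. of_real (B x y) * w y) + z x * w x = 0)"
    then obtain w x where w: "x \<in> V" "w x \<noteq> 0"
      "\<And>x. x \<in> V \<Longrightarrow> (\<Sum>y\<in>V. of_real (B x y) * w y) + z x * w x = 0" by blast
    define v where "v = Matrix.vec n (\<lambda>x. if x \<in> V then w x else 0)"
    have v: "v \<in> carrier_vec n" by (simp add: v_def)
    have "vec_index v x \<noteq> vec_index (0\<^sub>v n) x"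
      using w(1,2) n by (auto simp: v_def)
    then have "v \<noteq> 0\<^sub>v n" by metis
    moreover have "M *\<^sub>v v = 0\<^sub>v n"
    proof (rule eq_vecI)
      fix x assume "x < dim_vec (0\<^sub>v n :: 'a Matrix.vec)"
      then have x: "x < n" by simp
      show "vec_index (M *\<^sub>v v) x = vec_index (0\<^sub>v n) x"
      proof (cases "x \<in> V")
        case True
        have "(\<Sum>y\<in>V. of_real (B x y) * vec_index v y) = (\<Sum>y\<in>V. of_real (B x y) * w y)"
          using n by (intro sum.cong) (auto simp: v_def)
        then show ?thesis
          using True x w(3)[OF True] by (simp add: mult[OF v x] rows) (simp add: v_def)
      next
        case False
        then show ?thesis using x by (simp add: mult[OF v x] row_out) (simp add: v_def)
      qed
    qed (use M in simp)
    ultimately show "leibniz_det V B z = 0"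
      using v det det_0_iff_vec_prod_zero_field[OF M] by auto
  qed
qed

text \<open>For a kernel vector \<open>w\<close> the sesquilinear form of the matrix at
  \<open>w\<close> vanishes. The part coming from \<open>B\<close> is real by symmetry, so the
  imaginary part is the sum of Im (z x) |w x|^2, which is positive.\<close>

lemma leibniz_det_nonzero:
  fixes z :: "nat \<Rightarrow> complex"
  assumes fin: "finite V" and sym: "\<And>x y. B x y = B y x" and Im: "\<And>x. x \<in> V \<Longrightarrow> Im (z x) > 0"
  shows "leibniz_det V B z \<noteq> 0"
proof
  assume "leibniz_det V B z = 0"
  then obtain w x0 where x0: "x0 \<in> V" "w x0 \<noteq> 0"
    and rowV: "\<And>x. x \<in> V \<Longrightarrow> (\<Sum>y\<in>V. of_real (B x y) * w y) + z x * w x = 0"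
    using leibniz_det_eq_0_iff[OF fin] by blast
  have "(\<Sum>x\<in>V. cnj (w x) * ((\<Sum>y\<in>V. of_real (B x y) * w y) + z x * w x)) = 0"
    using rowV by simp
  then have eq: "(\<Sum>x\<in>V. \<Sum>y\<in>V. of_real (B x y) * (cnj (w x) * w y)) + (\<Sum>x\<in>V. z x * (cnj (w x) * w x)) = 0"
    by (simp add: distrib_left sum.distrib sum_distrib_left mult_ac)
  let ?H = "\<Sum>x\<in>V. \<Sum>y\<in>V. of_real (B x y) * (cnj (w x) * w y)"
  have "cnj ?H = (\<Sum>x\<in>V. \<Sum>y\<in>V. of_real (B y x) * (cnj (w y) * w x))"
    by (simp add: sym mult_ac)
  also have "\<dots> = ?H"
    by (rule sum.swap)
  finally have "cnj ?H = ?H" .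
  from arg_cong[OF this, of Im] have "Im ?H = 0"
    by (simp only: cnj.sel neg_equal_zero)
  moreover have "Im (\<Sum>x\<in>V. z x * (cnj (w x) * w x)) = (\<Sum>x\<in>V. Im (z x) * (cmod (w x))\<^sup>2)"
    by (simp only: Im_sum mult.commute[of "cnj _"] complex_norm_square[symmetric] Im_complex_of_real
      times_complex.sel Re_complex_of_real) simp
  ultimately have "(\<Sum>x\<in>V. Im (z x) * (cmod (w x))\<^sup>2) = 0"
    using arg_cong[OF eq, of Im] by (simp only: plus_complex.sel zero_complex.sel add_0)
  then have "\<forall>x\<in>V. Im (z x) * (cmod (w x))\<^sup>2 = 0"
    using fin Im by (subst (asm) sum_nonneg_eq_0_iff) (auto simp: less_imp_le)
  then show False
    using x0 Im[OF x0(1)] by auto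
qed

section \<open>Nonvanishing in the upper half-plane and interlacing\<close>

lemma set_edge_sym: "(\<And>x y. B x y = B y x) \<Longrightarrow> set_edge B e c x y = set_edge B e c y x"
  by (auto simp: set_edge_def)

text \<open>The sum is affine in \<open>z u\<close> with the minor as slope. If the ratio had
  nonpositive imaginary part, moving \<open>z u\<close> by minus the ratio would stay in the upper
  half-plane and hit a zero.\<close>

lemma Im_det_sum_ratio:
  fixes z :: "nat \<Rightarrow> complex"
  assumes "finite V" "u \<in> V" "\<And>x. x \<in> V \<Longrightarrow> Im (z x) > 0"
    and nz: "\<And>z. (\<And>x. x \<in> V \<Longrightarrow> Im (z x) > 0) \<Longrightarrow> det_sum es V B z \<noteq> 0"
    and nz': "det_sum es (V - {u}) B z \<noteq> 0"
  shows "Im (det_sum es V B z / det_sum es (V - {u}) B z) > 0"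
proof (rule ccontr)
  define t where "t = - (det_sum es V B z / det_sum es (V - {u}) B z)"
  assume "\<not> ?thesis"
  then have "Im t \<ge> 0" by (simp add: t_def)
  then have "det_sum es V B (z(u := z u + t)) \<noteq> 0"
    using assms(3) by (intro nz) (auto simp: add_pos_nonneg)
  moreover have "det_sum es V B (z(u := z u + t)) = 0"
    unfolding det_sum_affine[OF assms(1,2)] using nz' by (simp add: t_def)
  ultimately show False by simp
qed

text \<open>The two signings of an edge at \<open>u\<close> share the minor on
  \<open>V - {u}\<close>. Divided by it, both partial sums lie in the upper half-plane, which is
  closed under addition. This is common interlacing in multivariate form.\<close>

lemma det_sum_nonzero:
  fixes z :: "nat \<Rightarrow> complex"
  assumes "finite V" "\<And>x y. B x y = B y x" "\<And>x. x \<in> V \<Longrightarrow> Im (z x) > 0"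
    "\<And>e. e \<in> set es \<Longrightarrow> fst e \<noteq> snd e"
  shows "det_sum es V B z \<noteq> 0"
  using assms
proof (induction es arbitrary: B V z)
  case Nil
  then show ?case by (simp add: leibniz_det_nonzero)
next
  case (Cons e es)
  obtain u v where e: "e = (u, v)" "u \<noteq> v"
    using Cons.prems(4) by (cases e) auto
  have nz: "det_sum es V' (set_edge B e c) z' \<noteq> 0"
    if "finite V'" "\<And>x. x \<in> V' \<Longrightarrow> Im (z' x) > 0" for V' z' c
    using that Cons.prems by (intro Cons.IH) (auto simp: set_edge_def)
  show ?case
  proof (cases "u \<in> V \<and> v \<in> V")
    case False
    then have "det_sum es V (set_edge B e c) z = det_sum es V B z" for c
      by (intro det_sum_cong) (auto simp: set_edge_def e)
    then have "det_sum (e # es) V B z = 2 * det_sum es V (set_edge B e 1) z"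
      by simp
    then show ?thesis using nz[of V z 1] Cons.prems by simp
  next
    case True
    let ?\<eta> = "det_sum es (V - {u}) B z"
    have \<eta>: "det_sum es (V - {u}) (set_edge B e c) z = ?\<eta>" for c
      by (intro det_sum_cong) (auto simp: set_edge_def e)
    have "Im (det_sum es V (set_edge B e c) z / det_sum es (V - {u}) (set_edge B e c) z) > 0" for c
    proof (rule Im_det_sum_ratio)
      show "det_sum es (V - {u}) (set_edge B e c) z \<noteq> 0"
        using Cons.prems by (intro nz) auto
    qed (use True Cons.prems nz in auto)
    then have "Im (det_sum es V (set_edge B e c) z / ?\<eta>) > 0" for c
      by (simp add: \<eta>)
    then have "Im (det_sum (e # es) V B z / ?\<eta>) > 0"
      by (simp add: add_divide_distrib add_pos_pos)
    then show ?thesis by auto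
  qed
qed

text \<open>The derivative at a real point is the slope along the axis and also the rate at which
  the imaginary part grows on leaving the axis upwards. A negative value would push the quotient
  into the lower half-plane.\<close>

lemma herglotz_mono:
  fixes f g :: "complex \<Rightarrow> complex" and fr gr :: "real \<Rightarrow> real"
  assumes hol: "f holomorphic_on UNIV" "g holomorphic_on UNIV"
    and real: "\<And>x. f (of_real x) = of_real (fr x)" "\<And>x. g (of_real x) = of_real (gr x)"
    and Im: "\<And>w. Im w > 0 \<Longrightarrow> Im (f w / g w) \<ge> 0"
    and nz: "\<And>x. a \<le> x \<Longrightarrow> x \<le> b \<Longrightarrow> gr x \<noteq> 0" and "a \<le> b"
  shows "fr a / gr a \<le> fr b / gr b"
proof (rule DERIV_nonneg_imp_nondecreasing[OF \<open>a \<le> b\<close>])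
  fix x assume x: "a \<le> x" "x \<le> b"
  let ?\<phi> = "\<lambda>w. f w / g w"
  have "f field_differentiable at (of_real x)" "g field_differentiable at (of_real x)"
    using hol by (auto simp: holomorphic_on_def)
  moreover have "g (of_real x) \<noteq> 0"
    using nz[OF x] by (simp add: real)
  ultimately obtain D where D: "(?\<phi> has_field_derivative D) (at (of_real x))"
    using field_differentiable_divide unfolding field_differentiable_def by blast
  have \<phi>_real: "?\<phi> (of_real y) = of_real (fr y / gr y)" for y
    by (simp add: real)
  have "((\<lambda>y. ?\<phi> (of_real y)) has_vector_derivative D) (at x)"
    by (rule has_vector_derivative_real_field[OF D])
  then have "((\<lambda>y. Re (?\<phi> (of_real y))) has_vector_derivative Re D) (at x)"
    by (rule bounded_linear.has_vector_derivative[OF bounded_linear_Re])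
  then have deriv: "((\<lambda>y. fr y / gr y) has_real_derivative Re D) (at x)"
    unfolding \<phi>_real by (simp add: has_real_derivative_iff_has_vector_derivative)
  have "((\<lambda>y. ?\<phi> (of_real x + y *\<^sub>R \<i>)) has_vector_derivative \<i> * D) (at 0)"
  proof -
    have "((\<lambda>y. of_real x + y *\<^sub>R \<i>) has_vector_derivative \<i>) (at 0)"
      by (auto intro!: derivative_eq_intros)
    then show ?thesis
      using field_vector_diff_chain_at[of "\<lambda>y. of_real x + y *\<^sub>R \<i>" \<i> 0 ?\<phi> D] D
      by (simp add: o_def)
  qed
  then have "((\<lambda>y. Im (?\<phi> (of_real x + y *\<^sub>R \<i>))) has_vector_derivative Im (\<i> * D)) (at 0)"
    by (rule bounded_linear.has_vector_derivative[OF bounded_linear_Im])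
  then have DI: "((\<lambda>y. Im (?\<phi> (of_real x + y *\<^sub>R \<i>))) has_real_derivative Re D) (at 0)"
    by (simp add: has_real_derivative_iff_has_vector_derivative)
  have "Re D \<ge> 0"
  proof (rule ccontr)
    assume "\<not> Re D \<ge> 0"
    then obtain d where d: "d > 0"
      "\<And>h. 0 < h \<Longrightarrow> h < d \<Longrightarrow> Im (?\<phi> (of_real x + (0 + h) *\<^sub>R \<i>)) < Im (?\<phi> (of_real x + 0 *\<^sub>R \<i>))"
      using DERIV_neg_dec_right[OF DI] by force
    have "Im (?\<phi> (of_real x + (0 + d / 2) *\<^sub>R \<i>)) < 0"
      using d(2)[of "d / 2"] d(1) \<phi>_real[of x] by simp
    moreover have "Im (?\<phi> (of_real x + (0 + d / 2) *\<^sub>R \<i>)) \<ge> 0"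
      using d(1) by (intro Im) auto
    ultimately show False by linarith
  qed
  with deriv show "\<exists>y. ((\<lambda>y. fr y / gr y) has_real_derivative y) (at x) \<and> y \<ge> 0"
    by blast
qed

lemma holomorphic_det_sum [holomorphic_intros]:
  "(\<lambda>w. det_sum es V B (\<lambda>x. z x + w)) holomorphic_on A"
proof (induction es arbitrary: B)
  case Nil
  show ?case
    unfolding det_sum_Nil leibniz_det_def
  proof (intro holomorphic_intros)
    fix p x
    show "(\<lambda>w. if p x = x then z x + w else 0) holomorphic_on A" for p :: "nat \<Rightarrow> nat" and x
      by (cases "p x = x") (auto intro!: holomorphic_intros)
  qed
next
  case (Cons e es)
  then show ?case by (auto intro!: holomorphic_intros)
qed

lemma continuous_det_sum:
  fixes z :: "nat \<Rightarrow> real"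
  shows "continuous_on A (\<lambda>t. det_sum es V B (\<lambda>x. z x + t))"
proof (induction es arbitrary: B)
  case Nil
  show ?case
    unfolding det_sum_Nil leibniz_det_def
  proof (intro continuous_intros)
    show "continuous_on A (\<lambda>t. if p x = x then z x + t else 0)" for p :: "nat \<Rightarrow> nat" and x
      by (cases "p x = x") (auto intro!: continuous_intros)
  qed
next
  case (Cons e es)
  then show ?case by (auto intro!: continuous_intros)
qed

text \<open>After division by t ^ \<open>card V\<close>, only the identity permutation has a nonzero
  limit.\<close>

lemma leibniz_det_eventually_pos:
  fixes z :: "nat \<Rightarrow> real"
  assumes fin: "finite V"
  shows "eventually (\<lambda>t. leibniz_det V B (\<lambda>x. z x + t) > 0) at_top"
proof -
  have inv: "((\<lambda>t. c / t) \<longlongrightarrow> 0) at_top" for c :: real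
    by (rule real_tendsto_divide_at_top[OF tendsto_const filterlim_ident])
  have fac: "((\<lambda>t. (B x (p x) + (if p x = x then z x + t else 0)) / t) \<longlongrightarrow> (if p x = x then 1 else 0)) at_top"
    for p x
  proof (cases "p x = x")
    case True
    have "((\<lambda>t. (B x x + z x) / t + 1) \<longlongrightarrow> 0 + 1) at_top"
      by (intro tendsto_intros inv)
    then have "((\<lambda>t. (B x x + z x) / t + 1) \<longlongrightarrow> 1) at_top" by simp
    moreover have "eventually (\<lambda>t. (B x x + z x) / t + 1 = (B x x + (z x + t)) / t) at_top"
      using eventually_gt_at_top[of 0] by eventually_elim (simp add: field_simps)
    ultimately show ?thesis using True by (simp add: tendsto_cong)
  next
    case False
    then show ?thesis using inv by simp
  qed
  have "((\<lambda>t. \<Sum>p | p permutes V. of_int (sign p) *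
      (\<Prod>x\<in>V. (B x (p x) + (if p x = x then z x + t else 0)) / t)) \<longlongrightarrow>
      (\<Sum>p | p permutes V. of_int (sign p) * (\<Prod>x\<in>V. if p x = x then 1 else 0))) at_top"
    by (intro tendsto_intros fac)
  also have "(\<Sum>p | p permutes V. of_int (sign p) * (\<Prod>x\<in>V. if p x = x then 1 else 0 :: real)) =
      (\<Sum>p | p permutes V. if p = id then 1 else 0)"
  proof (intro sum.cong refl)
    fix p assume "p \<in> {p. p permutes V}"
    then have "p permutes V" by simp
    moreover have "(\<forall>x\<in>V. p x = x) \<longleftrightarrow> p = id"
      using \<open>p permutes V\<close> by (metis eq_id_iff permutes_not_in)
    ultimately show "of_int (sign p) * (\<Prod>x\<in>V. if p x = x then 1 else 0 :: real) = (if p = id then 1 else 0)"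
      using fin by (auto intro!: prod_zero)
  qed
  also have "\<dots> = 1"
    using fin by (simp add: finite_permutations permutes_id)
  finally have "eventually (\<lambda>t. (\<Sum>p | p permutes V. of_int (sign p) *
      (\<Prod>x\<in>V. (B x (p x) + (if p x = x then z x + t else 0)) / t)) > 0) at_top"
    by (rule order_tendstoD) simp
  then show ?thesis
    using eventually_gt_at_top[of 0]
  proof eventually_elim
    case (elim t)
    have "(\<Sum>p | p permutes V. of_int (sign p) *
      (\<Prod>x\<in>V. (B x (p x) + (if p x = x then z x + t else 0)) / t)) =
      leibniz_det V B (\<lambda>x. z x + t) / t ^ card V"
      by (simp add: leibniz_det_def prod_dividef sum_divide_distrib)
    then show ?case using elim by (simp add: zero_less_divide_iff)
  qed
qed

lemma det_sum_eventually_pos: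
  fixes z :: "nat \<Rightarrow> real"
  assumes "finite V"
  shows "eventually (\<lambda>t. det_sum es V B (\<lambda>x. z x + t) > 0) at_top"
proof (induction es arbitrary: B)
  case Nil
  then show ?case using leibniz_det_eventually_pos[OF assms] by simp
next
  case (Cons e es)
  show ?case
    using Cons[of "set_edge B e 1"] Cons[of "set_edge B e (-1)"]
    by eventually_elim (simp add: add_pos_pos)
qed

text \<open>One step of the interlacing method. Divided by the common minor \<open>\<eta>\<close>,
  both summands are nondecreasing wherever \<open>\<eta>\<close> has no zero, so a summand that is
  positive at 0 stays positive once \<open>\<eta>\<close> is known to be positive.\<close>

lemma det_sum_select:
  fixes z :: "nat \<Rightarrow> real"
  assumes fin: "finite V" and uv: "u \<in> V" "u \<noteq> v"
    and sym: "\<And>x y. B x y = B y x" and es: "\<And>e. e \<in> set es \<Longrightarrow> fst e \<noteq> snd e"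
    and pos: "\<And>t. t \<ge> 0 \<Longrightarrow> det_sum ((u, v) # es) V B (\<lambda>x. z x + t) > 0"
  obtains c where "c = 1 \<or> c = -1"
    "\<And>t. t \<ge> 0 \<Longrightarrow> det_sum es V (set_edge B (u, v) c) (\<lambda>x. z x + t) > 0"
proof -
  define q where "q c t = det_sum es V (set_edge B (u, v) c) (\<lambda>x. z x + t)" for c t
  define \<eta> where "\<eta> t = det_sum es (V - {u}) B (\<lambda>x. z x + t)" for t
  define qc where "qc c w = det_sum es V (set_edge B (u, v) c) (\<lambda>x. of_real (z x) + w)" for c and w :: complex
  define \<eta>c where "\<eta>c w = det_sum es (V - {u}) B (\<lambda>x. of_real (z x) + w)" for w :: complex
  have pos': "q 1 t + q (-1) t > 0" if "t \<ge> 0" for t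
    using pos[OF that] by (simp add: q_def)
  have hol: "qc c holomorphic_on UNIV" "\<eta>c holomorphic_on UNIV" for c
    unfolding qc_def[abs_def] \<eta>c_def[abs_def] by (intro holomorphic_intros)+
  have real: "qc c (of_real t) = of_real (q c t)" "\<eta>c (of_real t) = of_real (\<eta> t)" for c t
    unfolding qc_def \<eta>c_def q_def \<eta>_def of_real_det_sum by simp_all
  have \<eta>eq: "det_sum es (V - {u}) (set_edge B (u, v) c) z' = det_sum es (V - {u}) B z'" for c and z' :: "nat \<Rightarrow> complex"
    by (intro det_sum_cong) (auto simp: set_edge_def)
  have Imq: "Im (qc c w / \<eta>c w) > 0" if "Im w > 0" for c w
  proof -
    have "Im (det_sum es V (set_edge B (u, v) c) (\<lambda>x. of_real (z x) + w) /
        det_sum es (V - {u}) (set_edge B (u, v) c) (\<lambda>x. of_real (z x) + w)) > 0"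
    proof (rule Im_det_sum_ratio)
      show "det_sum es V (set_edge B (u, v) c) z' \<noteq> 0" if "\<And>x. x \<in> V \<Longrightarrow> Im (z' x) > 0" for z'
        using fin sym es that by (intro det_sum_nonzero set_edge_sym) auto
      show "det_sum es (V - {u}) (set_edge B (u, v) c) (\<lambda>x. of_real (z x) + w) \<noteq> 0"
        using fin sym es that by (intro det_sum_nonzero set_edge_sym) auto
    qed (use fin uv that in auto)
    then show ?thesis by (simp add: \<eta>eq qc_def \<eta>c_def)
  qed
  have mono: "q c a / \<eta> a \<le> q c b / \<eta> b" if "a \<le> b" "\<And>x. a \<le> x \<Longrightarrow> x \<le> b \<Longrightarrow> \<eta> x \<noteq> 0" for a b c
    using that less_imp_le[OF Imq] by (intro herglotz_mono[OF hol real]) auto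
  have cont: "continuous_on A \<eta>" "continuous_on A (q c)" for A c
    unfolding \<eta>_def[abs_def] q_def[abs_def] by (rule continuous_det_sum)+
  \<comment> \<open>Otherwise take the largest \<open>r\<close> with
    \<open>\<eta> r \<le> 0\<close>. Just to the right of \<open>r\<close> monotonicity bounds the
    sum of both summands by a constant times \<open>\<eta>\<close>, and the limit at
    \<open>r\<close> contradicts the positivity of the sum there.\<close>
  have \<eta>_pos: "\<eta> t > 0" if "t \<ge> 0" for t
  proof (rule ccontr)
    assume neg: "\<not> \<eta> t > 0"
    obtain T where T: "\<And>s. s \<ge> T \<Longrightarrow> \<eta> s > 0"
      using det_sum_eventually_pos[of "V - {u}" es B z] fin
      unfolding eventually_at_top_linorder \<eta>_def by auto
    define Z where "Z = {s \<in> {0..T}. \<eta> s \<le> 0}"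
    have "Z = {0..T} \<inter> {s. \<eta> s \<le> 0}"
      by (auto simp: Z_def)
    then have "compact Z"
      using compact_Int_closed[OF compact_Icc closed_Collect_le[OF cont(1) continuous_on_const]] by simp
    moreover have "t \<in> Z"
      using neg T[of t] that by (cases "t \<le> T") (auto simp: Z_def)
    ultimately obtain r where r: "r \<in> Z" "\<And>s. s \<in> Z \<Longrightarrow> s \<le> r"
      using compact_attains_sup[of Z] by blast
    have r0: "r \<ge> 0" using r(1) by (simp add: Z_def)
    have gt: "\<eta> s > 0" if "s > r" for s
    proof (rule ccontr)
      assume "\<not> \<eta> s > 0"
      then have "s \<in> Z" using T[of s] that r0 by (cases "s \<le> T") (auto simp: Z_def)
      with r(2) that show False by force
    qed
    have lim: "(f \<longlongrightarrow> f r) (at_right r)" if "continuous_on UNIV f" for f :: "real \<Rightarrow> real"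
      using that by (simp add: continuous_on_def tendsto_within_subset) (metis UNIV_I subset_UNIV tendsto_within_subset)
    have ev: "eventually (\<lambda>s. s \<in> {r<..<r + 1}) (at_right r)"
      by (rule eventually_at_right_real) simp
    define M where "M = q 1 (r + 1) / \<eta> (r + 1) + q (-1) (r + 1) / \<eta> (r + 1)"
    have "q 1 r + q (-1) r \<le> M * \<eta> r"
    proof (rule tendsto_le[OF _ _ _ eventually_mono[OF ev]])
      show "((\<lambda>s. q 1 s + q (-1) s) \<longlongrightarrow> q 1 r + q (-1) r) (at_right r)"
        "((\<lambda>s. M * \<eta> s) \<longlongrightarrow> M * \<eta> r) (at_right r)"
        by (intro lim continuous_intros cont)+
      fix s assume s: "s \<in> {r<..<r + 1}"
      have "\<eta> x \<noteq> 0" if "s \<le> x" for x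
        using gt[of x] s that by force
      then have "q 1 s / \<eta> s + q (-1) s / \<eta> s \<le> M"
        unfolding M_def using s by (intro add_mono mono) auto
      then show "q 1 s + q (-1) s \<le> M * \<eta> s"
        using gt[of s] s by (simp add: add_divide_distrib[symmetric] pos_divide_le_eq)
    qed simp
    moreover have "\<eta> r = 0"
    proof (rule antisym)
      show "\<eta> r \<le> 0" using r(1) by (simp add: Z_def)
      show "0 \<le> \<eta> r"
        by (rule tendsto_lowerbound[OF lim[OF cont(1)] eventually_mono[OF ev]]) (use gt in force)+
    qed
    ultimately show False using pos'[OF r0] by simp
  qed
  have "q 1 0 > 0 \<or> q (-1) 0 > 0"
    using pos'[of 0] by linarith
  then obtain c where c: "c = 1 \<or> c = -1" "q c 0 > 0" by blast
  have "q c t > 0" if "t \<ge> 0" for t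
  proof -
    have "0 < q c 0 / \<eta> 0" using c(2) \<eta>_pos[of 0] by simp
    also have "\<dots> \<le> q c t / \<eta> t" using that \<eta>_pos by (intro mono) force+
    finally show ?thesis using \<eta>_pos[OF that] by (simp add: zero_less_divide_iff)
  qed
  then show ?thesis using that c(1) unfolding q_def by blast
qed

section \<open>Permutation expansion of the signed sums\<close>

lemma sign_sum_sum:
  "sign_sum es (\<lambda>B. \<Sum>p\<in>P. F p B) B = (\<Sum>p\<in>P. sign_sum es (F p) B)"
  by (induction es arbitrary: B) (simp_all add: sum.distrib)

lemma sign_sum_scale:
  fixes F :: "(nat \<Rightarrow> nat \<Rightarrow> real) \<Rightarrow> 'b :: comm_ring_1"
  shows "sign_sum es (\<lambda>B. k * F B) B = k * sign_sum es F B"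
  by (induction es arbitrary: B) (simp_all add: distrib_left)

definition is_signed :: "(nat \<times> nat) list \<Rightarrow> nat \<Rightarrow> nat \<Rightarrow> bool" where
  "is_signed es x y \<longleftrightarrow> (x, y) \<in> set es \<or> (y, x) \<in> set es"

definition signing :: "(nat \<times> nat) list \<Rightarrow> (nat \<Rightarrow> nat \<Rightarrow> real) \<Rightarrow> (nat \<Rightarrow> nat \<Rightarrow> real) \<Rightarrow> bool" where
  "signing es B B' \<longleftrightarrow> (\<forall>x y. if is_signed es x y then B' x y = B' y x \<and> (B' x y)\<^sup>2 = 1 else B' x y = B x y)"

lemma signing_set_edge:
  assumes "signing es (set_edge B e c) B'" "c = 1 \<or> c = -1"
  shows "signing (e # es) B B'"
  unfolding signing_def
proof (intro allI)
  fix x y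
  have signed: "is_signed (e # es) x y \<longleftrightarrow> (x, y) = e \<or> (y, x) = e \<or> is_signed es x y"
    "is_signed es y x \<longleftrightarrow> is_signed es x y" for x y
    unfolding is_signed_def by auto
  have es: "B' x y = B' y x \<and> (B' x y)\<^sup>2 = 1" if "is_signed es x y" for x y
    using assms(1) that unfolding signing_def by meson
  have not_es: "B' x y = set_edge B e c x y" if "\<not> is_signed es x y" for x y
    using assms(1) that unfolding signing_def by meson
  have c: "c\<^sup>2 = 1" using assms(2) by auto
  consider "is_signed es x y" | "\<not> is_signed es x y" "(x, y) = e \<or> (y, x) = e"
    | "\<not> is_signed es x y" "\<not> ((x, y) = e \<or> (y, x) = e)" by blast
  then show "if is_signed (e # es) x y then B' x y = B' y x \<and> (B' x y)\<^sup>2 = 1 else B' x y = B x y"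
  proof cases
    case 1
    then show ?thesis unfolding signed(1) using es[OF 1] by meson
  next
    case 2
    then have "B' x y = c" "B' y x = c"
      using not_es[of x y] not_es[of y x] signed(2)[of y x] by (simp_all add: set_edge_def disj_commute)
    then show ?thesis using c by (simp only: signed(1) 2 simp_thms if_True)
  next
    case 3
    then have "B' x y = B x y"
      using not_es[of x y] by (simp only: set_edge_def if_False not_False_eq_True)
    then show ?thesis using 3 by (simp only: signed(1) simp_thms if_False)
  qed
qed

lemma sign_sum_cong:
  assumes "\<And>B'. signing es B B' \<Longrightarrow> F B' = G B'"
  shows "sign_sum es F B = sign_sum es G B"
  using assms
proof (induction es arbitrary: B)
  case Nil
  have "signing [] B B" by (simp add: signing_def is_signed_def)
  then show ?case using Nil by simp
next
  case (Cons e es)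
  have "sign_sum es F (set_edge B e c) = sign_sum es G (set_edge B e c)" if "c = 1 \<or> c = -1" for c
    by (intro Cons.IH Cons.prems signing_set_edge[OF _ that])
  then show ?case by simp
qed

definition neg_edge :: "nat \<times> nat \<Rightarrow> (nat \<Rightarrow> nat \<Rightarrow> real) \<Rightarrow> nat \<Rightarrow> nat \<Rightarrow> real" where
  "neg_edge e B = (\<lambda>x y. if (x, y) = e \<or> (y, x) = e then - B x y else B x y)"

lemma sign_sum_neg_edge:
  fixes F :: "(nat \<Rightarrow> nat \<Rightarrow> real) \<Rightarrow> 'b :: ab_group_add"
  assumes "\<And>B. F (neg_edge e B) = - F B" "set es \<subseteq> {(a, b). a < b}" "fst e < snd e" "e \<notin> set es"
  shows "sign_sum es F (neg_edge e B) = - sign_sum es F B"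
  using assms(2,4)
proof (induction es arbitrary: B)
  case Nil
  then show ?case using assms(1) by simp
next
  case (Cons e' es)
  have "set_edge (neg_edge e B) e' c = neg_edge e (set_edge B e' c)" for c
    using Cons.prems assms(3) by (cases e; cases e') (auto simp: set_edge_def neg_edge_def fun_eq_iff)
  then show ?case using Cons by simp
qed

text \<open>The two choices of sign for \<open>e\<close> cancel. Hence a permutation survives the
  summation only if it uses each signed edge in both directions or not at all.\<close>

lemma sign_sum_odd:
  fixes F :: "(nat \<Rightarrow> nat \<Rightarrow> real) \<Rightarrow> 'b :: ab_group_add"
  assumes odd: "\<And>B. F (neg_edge e B) = - F B"
    and es: "set es \<subseteq> {(a, b). a < b}" "distinct es" "e \<in> set es"
  shows "sign_sum es F B = 0"
  using es
proof (induction es arbitrary: B)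
  case (Cons e' es)
  show ?case
  proof (cases "e = e'")
    case True
    have "neg_edge e (set_edge B e 1) = set_edge B e (-1)"
      by (auto simp: set_edge_def neg_edge_def fun_eq_iff)
    moreover have "sign_sum es F (neg_edge e (set_edge B e 1)) = - sign_sum es F (set_edge B e 1)"
      using Cons.prems True by (intro sign_sum_neg_edge[where F = F, OF odd]) auto
    ultimately show ?thesis using True by simp
  next
    case False
    then show ?thesis using Cons by simp
  qed
qed simp

definition perm_term :: "nat set \<Rightarrow> (nat \<Rightarrow> nat) \<Rightarrow> (nat \<Rightarrow> real) \<Rightarrow> (nat \<Rightarrow> nat \<Rightarrow> real) \<Rightarrow> real" where
  "perm_term V p z B = (\<Prod>x\<in>V. B x (p x) + (if p x = x then z x else 0))"

lemma det_sum_perms: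
  fixes z :: "nat \<Rightarrow> real"
  shows "det_sum es V B z = (\<Sum>p | p permutes V. of_int (sign p) * sign_sum es (perm_term V p z) B)"
  unfolding det_sum_def leibniz_det_def sign_sum_sum sign_sum_scale
  by (simp add: perm_term_def[abs_def])

lemma perm_term_neg_edge:
  assumes "finite V" "x \<in> V" "p x \<noteq> x" "p (p x) \<noteq> x" "e = (x, p x) \<or> e = (p x, x)"
  shows "perm_term V p z (neg_edge e B) = - perm_term V p z B"
proof -
  have "perm_term V p z (neg_edge e B) = (\<Prod>y\<in>V. (if y = x then -1 else 1) * (B y (p y) + (if p y = y then z y else 0)))"
    unfolding perm_term_def using assms(3-) by (intro prod.cong) (auto simp: neg_edge_def)
  also have "\<dots> = (\<Prod>y\<in>V. if y = x then -1 else 1) * perm_term V p z B"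
    by (simp add: prod.distrib perm_term_def)
  finally show ?thesis using assms(1,2) by simp
qed

lemma perms_agreeing:
  assumes c: "c permutes C" and "C \<subseteq> V"
  shows "{p. p permutes V \<and> (\<forall>x\<in>C. p x = c x)} = (\<lambda>q. c \<circ> q) ` {q. q permutes (V - C)}"
proof (intro equalityI subsetI)
  fix p assume "p \<in> {p. p permutes V \<and> (\<forall>x\<in>C. p x = c x)}"
  then have p: "p permutes V" "\<And>x. x \<in> C \<Longrightarrow> p x = c x" by auto
  have "inv_into UNIV c \<circ> p permutes V"
    by (meson permutes_compose permutes_inv permutes_subset assms p(1))
  moreover have "(inv_into UNIV c \<circ> p) x = x" if "x \<in> V - (V - C)" for x
    using that p(2) c by (simp add: permutes_inverses(2))
  ultimately have "inv_into UNIV c \<circ> p permutes (V - C)"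
    using permutes_superset by blast
  moreover have "p = c \<circ> (inv_into UNIV c \<circ> p)"
    using c by (auto simp: fun_eq_iff permutes_inverses(1))
  ultimately show "p \<in> (\<lambda>q. c \<circ> q) ` {q. q permutes (V - C)}" by blast
next
  fix p assume "p \<in> (\<lambda>q. c \<circ> q) ` {q. q permutes (V - C)}"
  then obtain q where q: "p = c \<circ> q" "q permutes (V - C)" by blast
  have "p permutes V"
    unfolding q(1) using permutes_subset[OF c] permutes_subset[OF q(2)] assms(2)
    by (intro permutes_compose) auto
  moreover have "p x = c x" if "x \<in> C" for x
    using q that by (simp add: permutes_not_in)
  ultimately show "p \<in> {p. p permutes V \<and> (\<forall>x\<in>C. p x = c x)}" by blast
qed

text \<open>The factor over \<open>C\<close> has the same value \<open>K\<close> for all signings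
  and comes out of the sum; the permutations that agree with \<open>c\<close> on \<open>C\<close>
  are \<open>c\<close> composed with the permutations of \<open>V - C\<close>.\<close>

lemma det_sum_factor:
  fixes z :: "nat \<Rightarrow> real"
  assumes "finite V" "C \<subseteq> V" and c: "c permutes C"
    and K: "\<And>B'. signing es B B' \<Longrightarrow> perm_term C c z B' = K"
  shows "(\<Sum>p | p permutes V \<and> (\<forall>x\<in>C. p x = c x). of_int (sign p) * sign_sum es (perm_term V p z) B)
     = of_int (sign c) * K * det_sum es (V - C) B z"
proof -
  have inj: "inj_on (\<lambda>q. c \<circ> q) {q. q permutes (V - C)}"
    using permutes_inj[OF c] by (auto simp: inj_on_def fun_eq_iff inj_def)
  have "(\<Sum>p | p permutes V \<and> (\<forall>x\<in>C. p x = c x). of_int (sign p) * sign_sum es (perm_term V p z) B) =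
    (\<Sum>q | q permutes (V - C). of_int (sign (c \<circ> q)) * sign_sum es (perm_term V (c \<circ> q) z) B)"
    unfolding perms_agreeing[OF c assms(2)] by (simp add: sum.reindex[OF inj])
  also have "\<dots> = (\<Sum>q | q permutes (V - C). of_int (sign c) * K *
       (of_int (sign q) * sign_sum es (perm_term (V - C) q z) B))"
  proof (intro sum.cong refl)
    fix q assume "q \<in> {q. q permutes (V - C)}"
    then have q: "q permutes (V - C)" by simp
    have cq: "c (q x) = q x" if "x \<in> V - C" for x
      using that permutes_in_image[OF q, of x] permutes_not_in[OF c, of "q x"] by blast
    have pt: "perm_term V (c \<circ> q) z B' = perm_term C c z B' * perm_term (V - C) q z B'" for B'
    proof -
      have "perm_term V (c \<circ> q) z B' = perm_term C (c \<circ> q) z B' * perm_term (V - C) (c \<circ> q) z B'"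
        unfolding perm_term_def
        using prod.union_disjoint[of C "V - C"] assms(1,2) by (simp add: finite_subset Un_absorb1)
      also have "perm_term C (c \<circ> q) z B' = perm_term C c z B'"
        unfolding perm_term_def using q by (intro prod.cong) (auto simp: permutes_not_in)
      also have "perm_term (V - C) (c \<circ> q) z B' = perm_term (V - C) q z B'"
        unfolding perm_term_def by (intro prod.cong refl) (simp add: cq)
      finally show ?thesis .
    qed
    have "sign_sum es (perm_term V (c \<circ> q) z) B = sign_sum es (\<lambda>B'. K * perm_term (V - C) q z B') B"
      by (intro sign_sum_cong) (simp add: pt K)
    moreover have "sign (c \<circ> q) = sign c * sign q"
    proof (rule sign_compose)
      show "permutation c" "permutation q"
        unfolding permutation_permutes using assms(1,2) c q by (meson finite_subset finite_Diff)+
    qed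
    ultimately show "of_int (sign (c \<circ> q)) * sign_sum es (perm_term V (c \<circ> q) z) B =
      of_int (sign c) * K * (of_int (sign q) * sign_sum es (perm_term (V - C) q z) B)"
      by (simp add: sign_sum_scale)
  qed
  also have "\<dots> = of_int (sign c) * K * det_sum es (V - C) B z"
    by (simp add: det_sum_perms sum_distrib_left)
  finally show ?thesis .
qed

section \<open>From positive determinants to a nonnegative quadratic form\<close>

lemma compact_unit_sphere:
  fixes V :: "nat set"
  assumes "finite V"
  shows "compact {f :: nat \<Rightarrow> real. (\<forall>x. x \<notin> V \<longrightarrow> f x = 0) \<and> (\<Sum>x\<in>V. (f x)\<^sup>2) = 1}"
proof -
  let ?K = "PiE UNIV (\<lambda>x. if x \<in> V then {-1..1::real} else {0})"
  have "compactin (product_topology (\<lambda>_. euclidean) UNIV) ?K"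
    unfolding compactin_PiE by auto
  then have "compact ?K"
    by (simp add: euclidean_product_topology)
  moreover have "closed {f :: nat \<Rightarrow> real. (\<Sum>x\<in>V. (f x)\<^sup>2) = 1}"
    by (intro closed_Collect_eq continuous_on_sum continuous_on_power continuous_on_const
        continuous_on_product_coordinates)
  ultimately have "compact (?K \<inter> {f. (\<Sum>x\<in>V. (f x)\<^sup>2) = 1})"
    by (rule compact_Int_closed)
  also have "?K \<inter> {f. (\<Sum>x\<in>V. (f x)\<^sup>2) = 1} = {f. (\<forall>x. x \<notin> V \<longrightarrow> f x = 0) \<and> (\<Sum>x\<in>V. (f x)\<^sup>2) = 1}"
  proof (intro equalityI subsetI)
    fix f assume f: "f \<in> {f :: nat \<Rightarrow> real. (\<forall>x. x \<notin> V \<longrightarrow> f x = 0) \<and> (\<Sum>x\<in>V. (f x)\<^sup>2) = 1}"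
    have "\<bar>f x\<bar> \<le> 1" if "x \<in> V" for x
    proof -
      have "(f x)\<^sup>2 \<le> (\<Sum>x\<in>V. (f x)\<^sup>2)"
        using assms that by (intro member_le_sum) auto
      then show ?thesis using f by (simp add: abs_square_le_1)
    qed
    then show "f \<in> ?K \<inter> {f. (\<Sum>x\<in>V. (f x)\<^sup>2) = 1}"
      using f by (auto simp: PiE_def Pi_def abs_le_iff)
  next
    fix f assume "f \<in> ?K \<inter> {f. (\<Sum>x\<in>V. (f x)\<^sup>2) = 1}"
    then show "f \<in> {f. (\<forall>x. x \<notin> V \<longrightarrow> f x = 0) \<and> (\<Sum>x\<in>V. (f x)\<^sup>2) = 1}"
      by (auto simp: PiE_def Pi_def) (metis singletonD)
  qed
  finally show ?thesis .
qed

text \<open>The first-order condition at a minimiser: for small \<open>s\<close> of the right sign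
  the linear term would dominate.\<close>

lemma linear_term_zero:
  fixes b c :: real
  assumes "\<And>s. 2 * s * b + s\<^sup>2 * c \<ge> 0"
  shows "b = 0"
proof (rule ccontr)
  assume b: "b \<noteq> 0"
  define k where "k = \<bar>c\<bar> + 1"
  have k: "k > 0" "c \<le> k" by (auto simp: k_def)
  have "0 \<le> 2 * (- b / k) * b + (- b / k)\<^sup>2 * c" by (rule assms)
  also have "\<dots> \<le> 2 * (- b / k) * b + (- b / k)\<^sup>2 * k"
    using k by (intro add_left_mono mult_left_mono) auto
  also have "\<dots> = - (b\<^sup>2 / k)"
    using k by (simp add: field_simps power2_eq_square)
  also have "\<dots> < 0" using b k by simp
  finally show False by simp
qed

text \<open>If the minimum over the unit sphere were -t < 0, the form shifted by \<open>t\<close>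
  would be positive semidefinite and vanish at the minimiser. The minimiser then lies in the kernel,
  so the determinant vanishes at \<open>t\<close>.\<close>

lemma quadratic_form_nonneg:
  fixes z :: "nat \<Rightarrow> real"
  assumes fin: "finite V" and sym: "\<And>x y. B x y = B y x"
    and pos: "\<And>t. t \<ge> 0 \<Longrightarrow> leibniz_det V B (\<lambda>x. z x + t) > 0"
  shows "0 \<le> (\<Sum>x\<in>V. z x * (f x)\<^sup>2) + (\<Sum>x\<in>V. \<Sum>y\<in>V. B x y * (f x * f y))"
proof (rule ccontr)
  define q where "q f = (\<Sum>x\<in>V. z x * (f x)\<^sup>2) + (\<Sum>x\<in>V. \<Sum>y\<in>V. B x y * (f x * f y))" for f
  define S where "S = {f :: nat \<Rightarrow> real. (\<forall>x. x \<notin> V \<longrightarrow> f x = 0) \<and> (\<Sum>x\<in>V. (f x)\<^sup>2) = 1}"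
  have q_scale: "q (\<lambda>x. c * h x) = c\<^sup>2 * q h" for c h
    by (simp add: q_def sum_distrib_left algebra_simps power2_eq_square)
  have q_cong: "q h = q h'" if "\<And>x. x \<in> V \<Longrightarrow> h x = h' x" for h h'
    unfolding q_def using that by (intro arg_cong2[where f = "(+)"] sum.cong) auto
  have q0: "q h = 0" if "(\<Sum>x\<in>V. (h x)\<^sup>2) = 0" for h
  proof -
    have "\<forall>x\<in>V. h x = 0" using that fin by (simp add: sum_nonneg_eq_0_iff)
    then show ?thesis by (simp add: q_def)
  qed
  have normalize: "\<exists>h'\<in>S. q h = (\<Sum>x\<in>V. (h x)\<^sup>2) * q h'" if "(\<Sum>x\<in>V. (h x)\<^sup>2) \<noteq> 0" for h
  proof -
    define r where "r = (\<Sum>x\<in>V. (h x)\<^sup>2)"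
    have r: "r > 0" using that sum_nonneg[of V "\<lambda>x. (h x)\<^sup>2"] by (simp add: r_def)
    define h' where "h' x = (if x \<in> V then h x / sqrt r else 0)" for x
    have "(\<Sum>x\<in>V. (h' x)\<^sup>2) = (\<Sum>x\<in>V. (h x)\<^sup>2 / r)"
      using r by (intro sum.cong) (auto simp: h'_def power_divide)
    also have "\<dots> = 1" using r by (simp add: sum_divide_distrib[symmetric] r_def[symmetric])
    finally have "h' \<in> S" by (simp add: S_def h'_def)
    moreover have "q h = q (\<lambda>x. sqrt r * h' x)"
      using r by (intro q_cong) (simp add: h'_def)
    then have "q h = r * q h'" using r by (simp add: q_scale)
    ultimately show ?thesis unfolding r_def by blast
  qed
  assume "\<not> ?thesis"
  then have neg: "q f < 0" by (simp add: q_def)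
  then have "(\<Sum>x\<in>V. (f x)\<^sup>2) \<noteq> 0" using q0[of f] by auto
  then obtain f' where f': "f' \<in> S" "q f = (\<Sum>x\<in>V. (f x)\<^sup>2) * q f'" using normalize by blast
  have "q f' < 0"
    using neg unfolding f'(2) by (meson mult_nonneg_nonneg not_less sum_nonneg zero_le_power2)
  have "continuous_on S q"
    unfolding q_def[abs_def]
    by (intro continuous_intros continuous_on_subset[OF continuous_on_product_coordinates]) auto
  then obtain h where h: "h \<in> S" "\<And>h'. h' \<in> S \<Longrightarrow> q h \<le> q h'"
    using continuous_attains_inf[of S q] compact_unit_sphere[OF fin] f'(1) unfolding S_def by blast
  define t where "t = - q h"
  have t: "t > 0" using h(2)[OF f'(1)] \<open>q f' < 0\<close> by (simp add: t_def)
  define a where "a x y = B x y + (if x = y then z x + t else 0)" for x y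
  have a_sym: "a x y = a y x" for x y by (auto simp: a_def sym)
  define A where "A k = (\<Sum>x\<in>V. \<Sum>y\<in>V. a x y * (k x * k y))" for k
  have A_eq: "A k = q k + t * (\<Sum>x\<in>V. (k x)\<^sup>2)" for k
  proof -
    have "A k = (\<Sum>x\<in>V. (\<Sum>y\<in>V. B x y * (k x * k y)) + (\<Sum>y\<in>V. if x = y then (z x + t) * (k x)\<^sup>2 else 0))"
      unfolding A_def a_def sum.distrib[symmetric]
      by (intro sum.cong refl) (auto simp: algebra_simps power2_eq_square)
    also have "\<dots> = (\<Sum>x\<in>V. (\<Sum>y\<in>V. B x y * (k x * k y)) + (z x * (k x)\<^sup>2 + t * (k x)\<^sup>2))"
      using fin by (intro sum.cong) (auto simp: algebra_simps)
    finally show ?thesis by (simp add: q_def sum.distrib sum_distrib_left)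
  qed
  have A_nonneg: "A k \<ge> 0" for k
  proof (cases "(\<Sum>x\<in>V. (k x)\<^sup>2) = 0")
    case True
    then show ?thesis using q0[OF True] by (simp add: A_eq)
  next
    case False
    then obtain k' where k': "k' \<in> S" "q k = (\<Sum>x\<in>V. (k x)\<^sup>2) * q k'" using normalize by blast
    have "A k = (\<Sum>x\<in>V. (k x)\<^sup>2) * (q k' - q h)"
      by (simp add: A_eq k'(2) t_def algebra_simps)
    also have "\<dots> \<ge> 0" using h(2)[OF k'(1)] by (intro mult_nonneg_nonneg sum_nonneg) auto
    finally show ?thesis .
  qed
  have A_h: "A h = 0" using h(1) by (simp add: A_eq S_def t_def)
  have kernel: "(\<Sum>y\<in>V. a u y * h y) = 0" if u: "u \<in> V" for u
  proof (rule linear_term_zero)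
    fix s
    have "0 \<le> A (\<lambda>x. h x + s * (if x = u then 1 else 0))" by (rule A_nonneg)
    also have "\<dots> = (\<Sum>x\<in>V. \<Sum>y\<in>V. a x y * (h x * h y) + (if y = u then s * (a x u * h x) else 0) +
        (if x = u then s * (a u y * h y) + (if y = u then s\<^sup>2 * a u u else 0) else 0))"
      unfolding A_def
    proof (intro sum.cong refl)
      fix x y
      show "a x y * ((h x + s * (if x = u then 1 else 0)) * (h y + s * (if y = u then 1 else 0))) =
        a x y * (h x * h y) + (if y = u then s * (a x u * h x) else 0) +
        (if x = u then s * (a u y * h y) + (if y = u then s\<^sup>2 * a u u else 0) else 0)"
        by (cases "x = u"; cases "y = u") (simp_all add: distrib_left distrib_right power2_eq_square)
    qed
    also have "\<dots> = (\<Sum>x\<in>V. (\<Sum>y\<in>V. a x y * (h x * h y)) + s * (a x u * h x) +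
        (if x = u then s * (\<Sum>y\<in>V. a u y * h y) + s\<^sup>2 * a u u else 0))"
    proof (intro sum.cong refl)
      fix x
      show "(\<Sum>y\<in>V. a x y * (h x * h y) + (if y = u then s * (a x u * h x) else 0) +
        (if x = u then s * (a u y * h y) + (if y = u then s\<^sup>2 * a u u else 0) else 0)) =
        (\<Sum>y\<in>V. a x y * (h x * h y)) + s * (a x u * h x) +
        (if x = u then s * (\<Sum>y\<in>V. a u y * h y) + s\<^sup>2 * a u u else 0)"
        using fin u by (cases "x = u") (simp_all add: sum.distrib sum_distrib_left)
    qed
    also have "\<dots> = A h + s * (\<Sum>x\<in>V. a x u * h x) +
        (\<Sum>x\<in>V. if x = u then s * (\<Sum>y\<in>V. a u y * h y) + s\<^sup>2 * a u u else 0)"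
      by (simp only: sum.distrib A_def sum_distrib_left[symmetric])
    also have "\<dots> = 2 * s * (\<Sum>y\<in>V. a u y * h y) + s\<^sup>2 * a u u"
    proof -
      have "(\<Sum>x\<in>V. a x u * h x) = (\<Sum>y\<in>V. a u y * h y)"
        by (rule sum.cong[OF refl]) (rule arg_cong2[where f = "(*)", OF a_sym refl])
      then show ?thesis using fin u by (simp add: A_h)
    qed
    finally show "2 * s * (\<Sum>y\<in>V. a u y * h y) + s\<^sup>2 * a u u \<ge> 0" .
  qed
  have "leibniz_det V B (\<lambda>x. z x + t) = 0"
    unfolding leibniz_det_eq_0_iff[OF fin]
  proof (intro exI[of _ h] conjI ballI)
    show "\<exists>x\<in>V. h x \<noteq> 0"
      using h(1) by (force simp: S_def intro: ccontr)
    fix x assume x: "x \<in> V"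
    have "(\<Sum>y\<in>V. a x y * h y) = (\<Sum>y\<in>V. B x y * h y + (if y = x then (z x + t) * h x else 0))"
      by (intro sum.cong) (auto simp: a_def algebra_simps)
    then show "(\<Sum>y\<in>V. of_real (B x y) * h y) + (z x + t) * h x = 0"
      using kernel[OF x] fin x by (simp add: sum.distrib)
  qed
  with pos[of t] t show False by simp
qed

lemma exists_signing:
  fixes z :: "nat \<Rightarrow> real"
  assumes "finite V" "set es \<subseteq> {(a, b). a \<in> V \<and> b \<in> V \<and> a \<noteq> b}" "\<And>x y. B x y = B y x"
    "\<And>t. t \<ge> 0 \<Longrightarrow> det_sum es V B (\<lambda>x. z x + t) > 0"
  obtains B' where "signing es B B'" "\<And>x y. B' x y = B' y x"
    "\<And>t. t \<ge> 0 \<Longrightarrow> leibniz_det V B' (\<lambda>x. z x + t) > 0"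
  using assms(2-)
proof (induction es arbitrary: B thesis)
  case Nil
  have "signing [] B B" by (simp add: signing_def is_signed_def)
  then show ?case using Nil by (intro Nil.prems(1)[of B]) auto
next
  case (Cons e es)
  obtain u v where e: "e = (u, v)" "u \<in> V" "v \<in> V" "u \<noteq> v"
    using Cons.prems(2) by auto
  obtain c where c: "c = 1 \<or> c = -1"
    "\<And>t. t \<ge> 0 \<Longrightarrow> det_sum es V (set_edge B (u, v) c) (\<lambda>x. z x + t) > 0"
  proof (rule det_sum_select[of V u v B es z])
    show "fst e \<noteq> snd e" if "e \<in> set es" for e using that Cons.prems(2) by auto
    show "det_sum ((u, v) # es) V B (\<lambda>x. z x + t) > 0" if "t \<ge> 0" for t
      using Cons.prems(4)[OF that] by (simp add: e)
  qed (use assms(1) e Cons.prems(3) in auto)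
  show ?case
  proof (rule Cons.IH[of "set_edge B (u, v) c"])
    fix B' assume "signing es (set_edge B (u, v) c) B'" "\<And>x y. B' x y = B' y x"
      "\<And>t. t \<ge> 0 \<Longrightarrow> leibniz_det V B' (\<lambda>x. z x + t) > 0"
    then show thesis
      using signing_set_edge[OF _ c(1)] e(1) by (intro Cons.prems(1)[of B']) auto
  next
    show "set_edge B (u, v) c x y = set_edge B (u, v) c y x" for x y
      by (rule set_edge_sym[OF Cons.prems(3)])
  qed (use Cons.prems(2) c(2) in auto)
qed

text \<open>The edges along the cycles in \<open>\<C>\<close> keep the signs they have in
  \<open>B\<close>; all other edges, chords of these cycles included, are listed in
  \<open>es\<close>. \<open>rot_weight\<close> makes a rotation of a cycle contribute +1 to the
  determinant, and \<open>rot_transitive\<close> expresses that \<open>nx\<close> runs through each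
  vertex set as a single cycle.\<close>

locale cycle_signing =
  fixes E :: "nat \<Rightarrow> nat \<Rightarrow> bool" and n :: nat and B :: "nat \<Rightarrow> nat \<Rightarrow> real"
    and es :: "(nat \<times> nat) list" and nx :: "nat \<Rightarrow> nat" and \<C> :: "nat set set" and g :: real
  assumes E_sym: "E x y \<Longrightarrow> E y x" and E_irrefl: "\<not> E x x" and E_less: "E x y \<Longrightarrow> x < n"
    and B_sym: "B x y = B y x" and B_nonadj: "\<not> E x y \<Longrightarrow> B x y = 0" and B_adj: "E x y \<Longrightarrow> (B x y)\<^sup>2 = 1"
    and es_edges: "set es \<subseteq> {(a, b). a < b \<and> E a b}" and es_distinct: "distinct es"
    and rot_permutes: "C \<in> \<C> \<Longrightarrow> (\<lambda>x. if x \<in> C then nx x else x) permutes C"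
    and rot_transitive: "C \<in> \<C> \<Longrightarrow> D \<subseteq> C \<Longrightarrow> D \<noteq> {} \<Longrightarrow> nx ` D \<subseteq> D \<Longrightarrow> D = C"
    and rot_weight: "C \<in> \<C> \<Longrightarrow> of_int (sign (\<lambda>x. if x \<in> C then nx x else x)) * (\<Prod>x\<in>C. B x (nx x)) = 1"
    and rot_long: "C \<in> \<C> \<Longrightarrow> x \<in> C \<Longrightarrow> nx (nx x) \<noteq> x"
    and rot_unsigned: "C \<in> \<C> \<Longrightarrow> x \<in> C \<Longrightarrow> \<not> is_signed es x (nx x)"
    and unsigned: "E x y \<Longrightarrow> \<not> is_signed es x y \<Longrightarrow> \<exists>C\<in>\<C>. x \<in> C \<and> y \<in> C \<and> (y = nx x \<or> x = nx y)"
    and \<C>_disjoint: "C \<in> \<C> \<Longrightarrow> C' \<in> \<C> \<Longrightarrow> x \<in> C \<Longrightarrow> x \<in> C' \<Longrightarrow> C = C'"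
    and g_pos: "0 < g" and g_less: "g < 1"
begin

lemma is_signed_adj: "is_signed es x y \<Longrightarrow> E x y"
  using es_edges E_sym by (auto simp: is_signed_def)

lemma is_signed_sym: "is_signed es x y \<longleftrightarrow> is_signed es y x"
  by (auto simp: is_signed_def)

lemma signing_entries:
  assumes "signing es B B'"
  shows "B' x y = B' y x" "B' x y * B' x y = (if E x y then 1 else 0)" "\<not> is_signed es x y \<Longrightarrow> B' x y = B x y"
proof -
  have *: "is_signed es x y \<Longrightarrow> B' x y = B' y x \<and> (B' x y)\<^sup>2 = 1" "\<not> is_signed es x y \<Longrightarrow> B' x y = B x y" for x y
    using assms unfolding signing_def by meson+
  show "B' x y = B' y x"
    using *(1)[of x y] *(2)[of x y] *(2)[of y x] is_signed_sym[of x y] B_sym[of x y]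
    by (cases "is_signed es x y") auto
  show "B' x y * B' x y = (if E x y then 1 else 0)"
    using *(1)[of x y] *(2)[of x y] is_signed_adj[of x y] B_adj[of x y] B_nonadj[of x y]
    by (cases "is_signed es x y") (auto simp: power2_eq_square)
  show "\<not> is_signed es x y \<Longrightarrow> B' x y = B x y" by (rule *(2))
qed

lemma sign_sum_nonadj:
  assumes "finite V" "x \<in> V" "p x \<noteq> x" "\<not> E x (p x)"
  shows "sign_sum es (perm_term V p z) B = 0"
proof -
  have "sign_sum es (perm_term V p z) B = sign_sum es (\<lambda>_. 0 * 0) B"
  proof (rule sign_sum_cong)
    fix B' assume "signing es B B'"
    then have "B' x (p x) * B' x (p x) = 0" using signing_entries(2) assms(4) by auto
    then show "perm_term V p z B' = 0 * 0"
      unfolding perm_term_def using assms(1-3) by (auto intro!: prod_zero bexI[of _ x])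
  qed
  then show ?thesis unfolding sign_sum_scale by simp
qed

lemma sign_sum_single:
  assumes "finite V" "x \<in> V" "p (p x) \<noteq> x" "is_signed es x (p x)"
  shows "sign_sum es (perm_term V p z) B = 0"
proof -
  have "p x \<noteq> x" using assms(3) by auto
  obtain e where e: "e \<in> set es" "e = (x, p x) \<or> e = (p x, x)"
    using assms(4) by (auto simp: is_signed_def)
  show ?thesis
    using es_edges es_distinct e(1)
    by (intro sign_sum_odd[of "perm_term V p z" e es]
        perm_term_neg_edge[of V x p e z, OF assms(1,2) \<open>p x \<noteq> x\<close> assms(3) e(2)]) auto
qed

text \<open>If \<open>p\<close> does not return to \<open>x\<close> after two steps, the edge from
  \<open>x\<close> to \<open>p x\<close> is used in one direction only. Were it signed, the term
  would cancel, so it belongs to a prescribed cycle.\<close>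

lemma nonzero_term_step:
  assumes "finite V" "p permutes V" "sign_sum es (perm_term V p z) B \<noteq> 0" "p (p x) \<noteq> x"
  shows "x \<in> V" "\<exists>C\<in>\<C>. x \<in> C \<and> p x \<in> C \<and> (p x = nx x \<or> x = nx (p x))" "p x \<noteq> x"
proof -
  show "p x \<noteq> x" using assms(4) by auto
  then show "x \<in> V" using assms(2) by (meson permutes_not_in)
  then show "\<exists>C\<in>\<C>. x \<in> C \<and> p x \<in> C \<and> (p x = nx x \<or> x = nx (p x))"
    using sign_sum_nonadj[of V x p z] sign_sum_single[of V x p z] assms \<open>p x \<noteq> x\<close>
    by (intro unsigned) auto
qed

lemma nx_inj: "C \<in> \<C> \<Longrightarrow> x \<in> C \<Longrightarrow> y \<in> C \<Longrightarrow> nx x = nx y \<Longrightarrow> x = y"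
  using permutes_inj[OF rot_permutes, THEN injD, of C x y] by auto

lemma nx_in: "C \<in> \<C> \<Longrightarrow> x \<in> C \<Longrightarrow> nx x \<in> C"
  using permutes_in_image[OF rot_permutes, of C x] by auto

text \<open>Once \<open>p\<close> moves along an edge of \<open>C\<close>, disjointness of the
  cycles keeps it on \<open>C\<close>, and injectivity forbids a change of direction, so it goes all
  the way round.\<close>

lemma nonzero_term_cycle:
  assumes "finite V" and p: "p permutes V" and nz: "sign_sum es (perm_term V p z) B \<noteq> 0"
    and u: "p (p u) \<noteq> u" and C: "C \<in> \<C>" "u \<in> C"
  shows "C \<subseteq> V \<and> ((\<forall>x\<in>C. p x = nx x) \<or> (\<forall>x\<in>C. nx (p x) = x \<and> p x \<in> C))"
proof -
  note step = nonzero_term_step[OF assms(1) p nz]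
  have inj: "p x = p y \<Longrightarrow> x = y" for x y using permutes_inj[OF p] by (auto dest: injD)
  have stepC: "p x \<in> C \<and> (p x = nx x \<or> x = nx (p x))" if "x \<in> C" "p (p x) \<noteq> x" for x
    using step(2)[OF that(2)] \<C>_disjoint C(1) that(1) by metis
  have next_moves: "p (p (p x)) \<noteq> p x" if "p (p x) \<noteq> x" for x
    using inj that by blast
  have "p u = nx u \<or> u = nx (p u)" using stepC[OF C(2) u] by blast
  then show ?thesis
  proof
    assume pu: "p u = nx u"
    define D where "D = {x \<in> C. p x = nx x \<and> p (p x) \<noteq> x}"
    have "D = C"
    proof (rule rot_transitive[OF C(1)])
      show "nx ` D \<subseteq> D"
      proof
        fix y assume "y \<in> nx ` D"
        then obtain x where x: "x \<in> C" "p x = nx x" "p (p x) \<noteq> x" "y = p x" by (auto simp: D_def)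
        have y: "y \<in> C" using nx_in[OF C(1) x(1)] x by simp
        have ppy: "p (p y) \<noteq> y" using next_moves[OF x(3)] x(4) by simp
        have "y \<noteq> nx (p y)"
        proof
          assume *: "y = nx (p y)"
          have "p y \<in> C" using stepC[OF y ppy] by blast
          then have "p y = x" using nx_inj[OF C(1) _ x(1)] * x by metis
          then show False using x by simp
        qed
        then have "p y = nx y" using stepC[OF y ppy] by blast
        then show "y \<in> D" using y ppy by (simp add: D_def)
      qed
    qed (use pu u C(2) in \<open>auto simp: D_def\<close>)
    then show ?thesis using step(1) by (auto simp: D_def)
  next
    assume pu: "u = nx (p u)"
    define D where "D = {x \<in> C. x = nx (p x) \<and> p x \<in> C \<and> p (p x) \<noteq> x}"
    have pD: "p ` D \<subseteq> D"
    proof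
      fix y assume "y \<in> p ` D"
      then obtain x where x: "x \<in> C" "x = nx (p x)" "p x \<in> C" "p (p x) \<noteq> x" "y = p x" by (auto simp: D_def)
      have y: "y \<in> C" using x by simp
      have ppy: "p (p y) \<noteq> y" using next_moves[OF x(4)] x(5) by simp
      have "p y \<noteq> nx y" using x by auto
      then have "y = nx (p y)" "p y \<in> C" using stepC[OF y ppy] by auto
      then show "y \<in> D" using y ppy by (simp add: D_def)
    qed
    \<comment> \<open>In the backward direction \<open>D\<close> is invariant under \<open>p\<close>
      only. Finiteness makes \<open>p\<close> surjective on \<open>D\<close>, and this gives the
      invariance under \<open>nx\<close> that transitivity needs.\<close>
    have "D \<subseteq> V" using step(1) by (auto simp: D_def)
    then have "finite D" using assms(1) finite_subset by blast
    then have "p ` D = D"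
      using pD permutes_inj[OF p] by (intro endo_inj_surj) (auto intro: inj_on_subset)
    then have "nx ` D = nx ` (p ` D)" by simp
    also have "\<dots> = D" unfolding image_image by (auto simp: D_def image_iff)
    finally have "nx ` D = D" .
    then have "D = C"
      using pu u C(2) stepC[OF C(2) u] by (intro rot_transitive[OF C(1)]) (auto simp: D_def)
    then have "x = nx (p x) \<and> p x \<in> C \<and> x \<in> V" if "x \<in> C" for x
      using step(1)[of x] that unfolding D_def by blast
    then show ?thesis by (metis subsetI)
  qed
qed

text \<open>At most one prescribed cycle passes through \<open>u\<close>, and only its two rotations
  survive. Reversal preserves both the sign of the permutation and the product of entries, so by
  \<open>rot_weight\<close> each rotation contributes exactly the sum on
  \<open>V - C\<close>.\<close>

lemma long_cycle_sum_nonneg: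
  assumes "finite V" "u \<in> V"
    and IH: "\<And>C. C \<in> \<C> \<Longrightarrow> C \<subseteq> V \<Longrightarrow> u \<in> C \<Longrightarrow> det_sum es (V - C) B z \<ge> (0 :: real)"
  shows "(\<Sum>p | p permutes V \<and> p (p u) \<noteq> u. of_int (sign p) * sign_sum es (perm_term V p z) B) \<ge> 0"
proof (cases "\<exists>C\<in>\<C>. u \<in> C \<and> C \<subseteq> V")
  case False
  have "sign_sum es (perm_term V p z) B = 0" if "p permutes V" "p (p u) \<noteq> u" for p
  proof (rule ccontr)
    assume nz: "sign_sum es (perm_term V p z) B \<noteq> 0"
    from nonzero_term_step(2)[OF assms(1) that(1) nz that(2)] obtain C where C: "C \<in> \<C>" "u \<in> C" by blast
    have "C \<subseteq> V" using nonzero_term_cycle[OF assms(1) that(1) nz that(2) C] by (rule conjunct1)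
    with C False show False by blast
  qed
  then have "(\<Sum>p | p permutes V \<and> p (p u) \<noteq> u. of_int (sign p) * sign_sum es (perm_term V p z) B) = 0"
    by (intro sum.neutral) auto
  then show ?thesis by simp
next
  case True
  then obtain C where C: "C \<in> \<C>" "u \<in> C" "C \<subseteq> V" by blast
  define r where "r = (\<lambda>x. if x \<in> C then nx x else x)"
  define r' where "r' = inv_into UNIV r"
  have r: "r permutes C" unfolding r_def by (rule rot_permutes[OF C(1)])
  then have r': "r' permutes C" unfolding r'_def by (rule permutes_inv)
  have r_r': "r (r' x) = x" "r' (r x) = x" for x
    using r unfolding r'_def by (simp_all add: permutes_inverses)
  have r'_in: "r' x \<in> C" if "x \<in> C" for x using that permutes_in_image[OF r'] by blast
  have finC: "finite C" using C(3) assms(1) finite_subset by blast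
  have nx_r': "nx (r' x) = x" if "x \<in> C" for x
    using r_r'(1)[of x] r'_in[OF that] by (simp add: r_def)
  let ?t = "\<lambda>p. of_int (sign p) * sign_sum es (perm_term V p z) B"
  let ?P = "{p. p permutes V \<and> (\<forall>x\<in>C. p x = r x)}" and ?M = "{p. p permutes V \<and> (\<forall>x\<in>C. p x = r' x)}"
  have moves1: "r (r x) \<noteq> x" if "x \<in> C" for x
    using rot_long[OF C(1) that] nx_in[OF C(1) that] that by (simp add: r_def)
  have moves2: "r' (r' x) \<noteq> x" if "x \<in> C" for x
    using moves1[of "r' (r' x)"] r'_in[OF r'_in[OF that]] by (metis r_r'(1))
  have "(\<Sum>p | p permutes V \<and> p (p u) \<noteq> u. ?t p) = (\<Sum>p\<in>?P \<union> ?M. ?t p)"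
  proof (rule sum.mono_neutral_right)
    show "finite {p. p permutes V \<and> p (p u) \<noteq> u}"
      using finite_permutations[OF assms(1)] by (rule rev_finite_subset) auto
    show "?P \<union> ?M \<subseteq> {p. p permutes V \<and> p (p u) \<noteq> u}"
      using moves1[OF C(2)] moves2[OF C(2)] C(2) r'_in permutes_in_image[OF r] by auto
    show "\<forall>p\<in>{p. p permutes V \<and> p (p u) \<noteq> u} - (?P \<union> ?M). ?t p = 0"
    proof (rule ballI, rule ccontr)
      fix p assume p: "p \<in> {p. p permutes V \<and> p (p u) \<noteq> u} - (?P \<union> ?M)" and "?t p \<noteq> 0"
      then have "(\<forall>x\<in>C. p x = nx x) \<or> (\<forall>x\<in>C. nx (p x) = x \<and> p x \<in> C)"
        using nonzero_term_cycle[OF assms(1) _ _ _ C(1,2), of p z] by auto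
      then have "(\<forall>x\<in>C. p x = r x) \<or> (\<forall>x\<in>C. p x = r' x)"
      proof
        assume "\<forall>x\<in>C. nx (p x) = x \<and> p x \<in> C"
        then have "\<forall>x\<in>C. r (p x) = x" by (simp add: r_def)
        then show ?thesis by (metis r_r'(2))
      qed (simp add: r_def)
      then show False using p by auto
    qed
  qed
  also have "\<dots> = (\<Sum>p\<in>?P. ?t p) + (\<Sum>p\<in>?M. ?t p)"
  proof (rule sum.union_disjoint)
    show "finite ?P" "finite ?M"
      using finite_permutations[OF assms(1)] by (rule rev_finite_subset, auto)+
    have "r u \<noteq> r' u"
      using moves1[OF C(2)] r_r'(1)[of u] by auto
    then show "?P \<inter> ?M = {}"
      using C(2) by force
  qed
  also have "(\<Sum>p\<in>?P. ?t p) = of_int (sign r) * (\<Prod>x\<in>C. B x (nx x)) * det_sum es (V - C) B z"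
  proof (rule det_sum_factor[OF assms(1) C(3) r])
    fix B' assume B': "signing es B B'"
    show "perm_term C r z B' = (\<Prod>x\<in>C. B x (nx x))"
      unfolding perm_term_def
    proof (intro prod.cong refl)
      fix x assume x: "x \<in> C"
      have "r x \<noteq> x" using moves1[OF x] by auto
      then show "B' x (r x) + (if r x = x then z x else 0) = B x (nx x)"
        using x rot_unsigned[OF C(1) x] signing_entries(3)[OF B'] by (simp add: r_def)
    qed
  qed
  also have "(\<Sum>p\<in>?M. ?t p) = of_int (sign r') * (\<Prod>x\<in>C. B x (nx x)) * det_sum es (V - C) B z"
  proof (rule det_sum_factor[OF assms(1) C(3) r'])
    fix B' assume B': "signing es B B'"
    have "perm_term C r' z B' = (\<Prod>x\<in>C. B (r' x) (nx (r' x)))"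
      unfolding perm_term_def
    proof (intro prod.cong refl)
      fix x assume x: "x \<in> C"
      have "r' x \<noteq> x" using moves2[OF x] by auto
      moreover have "\<not> is_signed es x (r' x)"
        using rot_unsigned[OF C(1) r'_in[OF x]] nx_r'[OF x] is_signed_sym by simp
      ultimately show "B' x (r' x) + (if r' x = x then z x else 0) = B (r' x) (nx (r' x))"
        using signing_entries(3)[OF B'] nx_r'[OF x] B_sym by simp
    qed
    also have "\<dots> = (\<Prod>x\<in>C. B x (nx x))"
      using prod.reindex_bij_betw[OF permutes_imp_bij[OF r'], of "\<lambda>x. B x (nx x)"] by simp
    finally show "perm_term C r' z B' = (\<Prod>x\<in>C. B x (nx x))" .
  qed
  also have "sign r' = sign r"
    unfolding r'_def using r finC by (intro sign_inverse) (auto simp: permutation_permutes)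
  also have "of_int (sign r) * (\<Prod>x\<in>C. B x (nx x)) = 1"
    using rot_weight[OF C(1)] by (simp add: r_def)
  finally show ?thesis using IH[OF C(1,3,2)] by simp
qed

text \<open>Permutations are sorted by their behaviour at \<open>u\<close>. Fixing \<open>u\<close>
  and transposing it with a neighbour (sign -1, squared entry 1) give the recursion of the matching
  polynomial; the remaining permutations contribute a nonnegative amount, which is dropped.\<close>

lemma det_sum_expand:
  assumes "finite V" "u \<in> V"
    and IH: "\<And>C. C \<in> \<C> \<Longrightarrow> C \<subseteq> V \<Longrightarrow> u \<in> C \<Longrightarrow> det_sum es (V - C) B z \<ge> (0 :: real)"
  shows "det_sum es V B z \<ge> z u * det_sum es (V - {u}) B z - (\<Sum>v | v \<in> V \<and> E u v. det_sum es (V - {u, v}) B z)"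
proof -
  let ?t = "\<lambda>p. of_int (sign p) * sign_sum es (perm_term V p z) B"
  let ?A = "\<lambda>v. {p. p permutes V \<and> p u = v \<and> p v = u}"
  have finP: "finite {p. p permutes V}" by (rule finite_permutations[OF assms(1)])
  then have finQ: "finite {p. p permutes V \<and> Q p}" for Q by (rule rev_finite_subset) auto
  have split: "{p. p permutes V} = (\<Union>v\<in>V. ?A v) \<union> {p. p permutes V \<and> p (p u) \<noteq> u}"
    using assms(2) by (auto simp: permutes_in_image)
  have "det_sum es V B z = (\<Sum>p\<in>(\<Union>v\<in>V. ?A v). ?t p) + (\<Sum>p | p permutes V \<and> p (p u) \<noteq> u. ?t p)"
    unfolding det_sum_perms split by (rule sum.union_disjoint) (auto simp: finQ assms(1))
  moreover have "(\<Sum>p | p permutes V \<and> p (p u) \<noteq> u. ?t p) \<ge> 0"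
    by (rule long_cycle_sum_nonneg[OF assms])
  moreover have "(\<Sum>p\<in>(\<Union>v\<in>V. ?A v). ?t p) = (\<Sum>v\<in>V. \<Sum>p\<in>?A v. ?t p)"
    by (rule sum.UNION_disjoint) (auto simp: finQ assms(1))
  moreover have "(\<Sum>v\<in>V. \<Sum>p\<in>?A v. ?t p) = (\<Sum>p\<in>?A u. ?t p) + (\<Sum>v\<in>V - {u}. \<Sum>p\<in>?A v. ?t p)"
    by (rule sum.remove[OF assms(1,2)])
  moreover have "(\<Sum>p\<in>?A u. ?t p) = z u * det_sum es (V - {u}) B z"
  proof -
    have "(\<Sum>p | p permutes V \<and> (\<forall>x\<in>{u}. p x = id x). ?t p) = of_int (sign (id :: nat \<Rightarrow> nat)) * z u * det_sum es (V - {u}) B z"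
    proof (rule det_sum_factor[where C = "{u}" and c = id and K = "z u"])
      fix B' assume "signing es B B'"
      then show "perm_term {u} id z B' = z u"
        using signing_entries(2)[of B' u u] E_irrefl by (simp add: perm_term_def)
    qed (use assms in \<open>auto simp: permutes_id\<close>)
    then show ?thesis by (simp add: sign_id)
  qed
  moreover have "(\<Sum>p\<in>?A v. ?t p) = - (if E u v then det_sum es (V - {u, v}) B z else 0)" if "v \<in> V - {u}" for v
  proof -
    let ?c = "Transposition.transpose u v"
    have "(\<Sum>p | p permutes V \<and> (\<forall>x\<in>{u, v}. p x = ?c x). ?t p) =
      of_int (sign ?c) * (if E u v then 1 else 0) * det_sum es (V - {u, v}) B z"
    proof (rule det_sum_factor[where C = "{u, v}" and c = ?c and K = "if E u v then 1 else 0"])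
      fix B' assume "signing es B B'"
      then show "perm_term {u, v} ?c z B' = (if E u v then 1 else 0)"
        using signing_entries(1,2)[of B' u v] that by (auto simp: perm_term_def)
    qed (use assms that in \<open>auto intro: permutes_swap_id\<close>)
    moreover have "sign ?c = -1" using that by (simp add: sign_swap_id)
    ultimately show ?thesis by simp
  qed
  ultimately have "det_sum es V B z \<ge> z u * det_sum es (V - {u}) B z
      + (\<Sum>v\<in>V - {u}. - (if E u v then det_sum es (V - {u, v}) B z else 0))"
    by simp
  also have "(\<Sum>v\<in>V - {u}. - (if E u v then det_sum es (V - {u, v}) B z else 0)) =
    - (\<Sum>v\<in>V - {u}. if E u v then det_sum es (V - {u, v}) B z else 0)"
    by (simp add: sum_negf)
  also have "(\<Sum>v\<in>V - {u}. if E u v then det_sum es (V - {u, v}) B z else 0) =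
      (\<Sum>v | v \<in> V \<and> E u v. det_sum es (V - {u, v}) B z)"
    using assms(1) E_irrefl by (intro sum.mono_neutral_cong_right) auto
  finally show ?thesis by simp
qed

lemma finite_adj: "finite {y. E x y}"
  by (rule finite_subset[of _ "{..<n}"]) (auto dest: E_sym E_less)

text \<open>
  A matching-polynomial estimate: in the expansion along \<open>u\<close> only transpositions and rotations of the
  cycles in \<open>\<C>\<close> survive the sum over signings, and the latter contribute with a positive sign.
\<close>

lemma det_sum_pos:
  assumes z: "\<And>x. z x \<ge> (real (card {y. E x y}) - 1) * g + 1 / g" and "finite V"
  shows "det_sum es V B z > 0 \<and>
    (\<forall>u\<in>V. (\<exists>w. E u w \<and> w \<notin> V) \<longrightarrow> det_sum es V B z \<ge> 1 / g * det_sum es (V - {u}) B z)"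
  using assms(2)
proof (induction V rule: finite_psubset_induct)
  case (psubset V)
  have pos: "det_sum es W B z > 0" if "W \<subset> V" for W using psubset.IH[OF that] by blast
  \<comment> \<open>A neighbour \<open>v\<close> of \<open>u\<close> has lost \<open>u\<close> in
    \<open>V - {u}\<close>, so the second half of the induction hypothesis applies to
    \<open>v\<close> and bounds the smaller minor by \<open>g\<close> times the larger one. This is
    the Heilmann-Lieb argument.\<close>
  have bound: "det_sum es V B z \<ge> (z u - g * card {v. v \<in> V \<and> E u v}) * det_sum es (V - {u}) B z"
    if u: "u \<in> V" for u
  proof -
    have "det_sum es (V - {u, v}) B z \<le> g * det_sum es (V - {u}) B z" if "v \<in> V" "E u v" for v
    proof -
      have "v \<in> V - {u}" "E v u" "u \<notin> V - {u}" using that E_sym E_irrefl by auto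
      moreover have "V - {u} \<subset> V" using u by auto
      ultimately have "det_sum es (V - {u}) B z \<ge> 1 / g * det_sum es (V - {u} - {v}) B z"
        using psubset.IH[of "V - {u}"] by blast
      moreover have "V - {u} - {v} = V - {u, v}" by auto
      ultimately show ?thesis using g_pos by (simp add: field_simps)
    qed
    then have "(\<Sum>v | v \<in> V \<and> E u v. det_sum es (V - {u, v}) B z) \<le>
        (\<Sum>v | v \<in> V \<and> E u v. g * det_sum es (V - {u}) B z)"
      by (intro sum_mono) auto
    moreover have "det_sum es V B z \<ge> z u * det_sum es (V - {u}) B z
        - (\<Sum>v | v \<in> V \<and> E u v. det_sum es (V - {u, v}) B z)"
    proof (rule det_sum_expand[OF psubset.hyps u])
      fix C assume "C \<subseteq> V" "u \<in> C"
      then have "V - C \<subset> V" using u by auto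
      then show "det_sum es (V - C) B z \<ge> 0" using pos by (simp add: less_imp_le)
    qed
    ultimately show ?thesis by (simp add: algebra_simps)
  qed
  have "g * g < 1 * 1" using g_pos g_less by (intro mult_strict_mono) auto
  then have inv_g: "1 / g > g" using g_pos by (simp add: pos_less_divide_eq)
  have "det_sum es V B z > 0"
  proof (cases "V = {}")
    case True
    have "det_sum ls {} B' z > 0" for ls B'
      by (induction ls arbitrary: B') (simp_all add: leibniz_det_def add_pos_pos)
    then show ?thesis using True by simp
  next
    case False
    then obtain u where u: "u \<in> V" by blast
    have "card {v. v \<in> V \<and> E u v} \<le> card {v. E u v}"
      by (intro card_mono finite_adj) auto
    then have "g * card {v. v \<in> V \<and> E u v} \<le> g * card {v. E u v}"
      using g_pos by simp
    then have "z u - g * card {v. v \<in> V \<and> E u v} > 0"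
      using z[of u] inv_g by (simp add: algebra_simps)
    moreover have "V - {u} \<subset> V" using u by auto
    ultimately show ?thesis
      using bound[OF u] pos by (meson less_le_trans mult_pos_pos)
  qed
  \<comment> \<open>With a neighbour missing, at most deg - 1 neighbours subtract \<open>g\<close>
    each from the diagonal (deg - 1) g + 1/g, so the ratio 1/g reproduces itself. With all
    neighbours present there remains 1/g - g, which suffices for positivity.\<close>
  moreover have "det_sum es V B z \<ge> 1 / g * det_sum es (V - {u}) B z"
    if u: "u \<in> V" and w: "E u w" "w \<notin> V" for u w
  proof -
    have "card {v. v \<in> V \<and> E u v} < card {v. E u v}"
      using w by (intro psubset_card_mono finite_adj) auto
    then have "real (card {v. v \<in> V \<and> E u v}) \<le> real (card {v. E u v}) - 1" by simp
    then have "g * card {v. v \<in> V \<and> E u v} \<le> g * (real (card {v. E u v}) - 1)"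
      using g_pos by simp
    then have "1 / g \<le> z u - g * card {v. v \<in> V \<and> E u v}"
      using z[of u] by (simp add: algebra_simps)
    moreover have "V - {u} \<subset> V" using u by auto
    ultimately show ?thesis
      using bound[OF u] pos[of "V - {u}"] by (meson less_imp_le mult_right_mono order_trans)
  qed
  ultimately show ?case by blast
qed

end

context cycle_signing
begin

lemma exists_nonneg_signing:
  obtains B' where "signing es B B'" "\<And>x y. B' x y = B' y x"
    "\<And>f. 0 \<le> (\<Sum>x<n. ((real (card {y. E x y}) - 1) * g + 1 / g) * (f x)\<^sup>2) + (\<Sum>x<n. \<Sum>y<n. B' x y * (f x * f y))"
proof -
  let ?z = "\<lambda>x. (real (card {y. E x y}) - 1) * g + 1 / g"
  have pos: "det_sum es {..<n} B (\<lambda>x. ?z x + t) > 0" if "t \<ge> 0" for t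
    using det_sum_pos[of "\<lambda>x. ?z x + t" "{..<n}"] that by simp
  obtain B' where B': "signing es B B'" "\<And>x y. B' x y = B' y x"
    "\<And>t. t \<ge> 0 \<Longrightarrow> leibniz_det {..<n} B' (\<lambda>x. ?z x + t) > 0"
  proof (rule exists_signing[of "{..<n}" es B ?z])
    show "set es \<subseteq> {(a, b). a \<in> {..<n} \<and> b \<in> {..<n} \<and> a \<noteq> b}"
      using es_edges E_sym E_less by blast
  qed (use pos B_sym in auto)
  show ?thesis
    using quadratic_form_nonneg[OF _ B'(2,3)] by (intro that[OF B'(1,2)]) auto
qed

end

section \<open>Signings that make given disjoint cycles negative\<close>

lemma sign_cycle_of_list:
  assumes "distinct c" "c \<noteq> []"
  shows "sign (cycle_of_list c) = (-1) ^ (length c - 1)"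
  using assms
proof (induction c rule: cycle_of_list.induct)
  case (1 i j cs)
  have "sign (cycle_of_list (i # j # cs)) = sign (Transposition.transpose i j) * sign (cycle_of_list (j # cs))"
    unfolding cycle_of_list.simps by (intro sign_compose permutation_swap_id permutation_of_cycle)
  then show ?case using 1 by (simp add: sign_swap_id del: cycle_of_list.simps)
qed (simp_all add: sign_id)

lemma cycle_of_list_nth:
  assumes "distinct c" "i < length c"
  shows "cycle_of_list c (c ! i) = c ! ((i + 1) mod length c)"
proof -
  have "map (cycle_of_list c) c = rotate1 c"
    using cyclic_rotation[OF assms(1), of 1] by simp
  then have "map (cycle_of_list c) c ! i = rotate1 c ! i" by simp
  then show ?thesis using assms(2) by (simp add: nth_rotate1)
qed

text \<open>The relevant matrix is level minus signed adjacency, so its entries are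
  \<open>- s\<close>. On a cycle of length k, giving \<open>s\<close> the value -1 at one edge and 1
  at the others makes the entries multiply to (-1)^(k - 1), the sign of the rotation, as
  \<open>rot_weight\<close> demands. The empty family yields a signing with no prescription.\<close>

theorem negative_cycle_signing:
  fixes E :: "nat \<Rightarrow> nat \<Rightarrow> bool" and g :: real
  assumes E_sym: "\<And>x y. E x y \<Longrightarrow> E y x" and E_irrefl: "\<And>x. \<not> E x x" and E_less: "\<And>x y. E x y \<Longrightarrow> x < n"
    and g: "0 < g" "g < 1"
    and cyc: "\<And>c. c \<in> \<C> \<Longrightarrow> distinct c \<and> length c \<ge> 3 \<and> (\<forall>i<length c. E (c ! i) (c ! ((i + 1) mod length c)))"
    and disj: "\<And>c c' x. c \<in> \<C> \<Longrightarrow> c' \<in> \<C> \<Longrightarrow> x \<in> set c \<Longrightarrow> x \<in> set c' \<Longrightarrow> c = c'"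
  obtains s :: "nat \<Rightarrow> nat \<Rightarrow> real" where "\<And>x y. s x y = s y x" "\<And>x y. s x y = 1 \<or> s x y = -1"
    "\<And>c. c \<in> \<C> \<Longrightarrow> (\<Prod>i<length c. s (c ! i) (c ! ((i + 1) mod length c))) = -1"
    "\<And>f. (\<Sum>x<n. \<Sum>y | E x y. s x y * (f x * f y)) \<le>
          (\<Sum>x<n. ((real (card {y. E x y}) - 1) * g + 1 / g) * (f x)\<^sup>2)"
proof -
  define nx where "nx x = (if \<exists>c\<in>\<C>. x \<in> set c then cycle_of_list (THE c. c \<in> \<C> \<and> x \<in> set c) x else x)" for x
  have nx: "nx x = cycle_of_list c x" if "c \<in> \<C>" "x \<in> set c" for c x
  proof -
    have "(THE c. c \<in> \<C> \<and> x \<in> set c) = c" using that disj by blast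
    then show ?thesis using that by (auto simp: nx_def)
  qed
  have nx_nth: "nx (c ! i) = c ! ((i + 1) mod length c)" if "c \<in> \<C>" "i < length c" for c i
    using nx[OF that(1)] cycle_of_list_nth[of c i] cyc[OF that(1)] that by simp
  \<comment> \<open>The closing edge, from the last to the first entry of the list, is the one edge
    of each cycle with a different sign; a length of at least 3 keeps it apart from the other
    edges.\<close>
  define ends where "ends x y \<longleftrightarrow> (\<exists>c\<in>\<C>. x = last c \<and> y = hd c \<or> x = hd c \<and> y = last c)" for x y
  define B where "B x y = (if E x y then (if ends x y then 1 else -1) else 0 :: real)" for x y
  define fixed where "fixed x y \<longleftrightarrow> (\<exists>c\<in>\<C>. x \<in> set c \<and> y \<in> set c \<and> (y = nx x \<or> x = nx y))" for x y
  have ends_sym: "ends x y \<longleftrightarrow> ends y x" for x y by (auto simp: ends_def)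
  have ends_iff: "ends (c ! i) (c ! ((i + 1) mod length c)) \<longleftrightarrow> i = length c - 1"
    if c: "c \<in> \<C>" and i: "i < length c" for c i
  proof -
    have d: "distinct c" "length c \<ge> 3" using cyc[OF c] by auto
    then have ne: "c \<noteq> []" by auto
    show ?thesis
    proof
      assume "ends (c ! i) (c ! ((i + 1) mod length c))"
      then obtain c' where c': "c' \<in> \<C>" "c ! i = last c' \<and> c ! ((i + 1) mod length c) = hd c' \<or>
        c ! i = hd c' \<and> c ! ((i + 1) mod length c) = last c'" unfolding ends_def by blast
      moreover have "c' \<noteq> []" using cyc[OF c'(1)] by auto
      ultimately have "c ! i \<in> set c'" by auto
      then have "c' = c" using disj[OF c'(1) c, of "c ! i"] i by auto
      have m: "(i + 1) mod length c < length c" using ne by simp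
      show "i = length c - 1"
      proof (rule ccontr)
        assume "i \<noteq> length c - 1"
        then have "(i + 1) mod length c = i + 1" using i by simp
        then show False
          using c'(2) d ne i m \<open>i \<noteq> length c - 1\<close> \<open>c' = c\<close>
          by (auto simp: last_conv_nth hd_conv_nth nth_eq_iff_index_eq)
      qed
    next
      assume "i = length c - 1"
      then have "c ! i = last c" "c ! ((i + 1) mod length c) = hd c"
        using ne by (auto simp: last_conv_nth hd_conv_nth)
      then show "ends (c ! i) (c ! ((i + 1) mod length c))" using c unfolding ends_def by blast
    qed
  qed
  have prod_ends: "(\<Prod>i<length c. h (ends (c ! i) (c ! ((i + 1) mod length c)))) = h True * h False ^ (length c - 1)"
    if c: "c \<in> \<C>" for c and h :: "bool \<Rightarrow> real"
  proof -
    have "length c > 0" using cyc[OF c] by auto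
    then have "{..<length c} = insert (length c - 1) {..<length c - 1}" by auto
    then have "(\<Prod>i<length c. h (i = length c - 1)) = h True * (\<Prod>i<length c - 1. h (i = length c - 1))" by simp
    also have "(\<Prod>i<length c - 1. h (i = length c - 1)) = (\<Prod>i<length c - 1. h False)"
      by (intro prod.cong arg_cong[where f = h]) auto
    finally have "(\<Prod>i<length c. h (i = length c - 1)) = h True * h False ^ (length c - 1)" by simp
    moreover have "(\<Prod>i<length c. h (ends (c ! i) (c ! ((i + 1) mod length c)))) = (\<Prod>i<length c. h (i = length c - 1))"
      by (intro prod.cong refl arg_cong[where f = h]) (use ends_iff[OF c] in auto)
    ultimately show ?thesis by simp
  qed
  have rot: "(\<lambda>x. if x \<in> set c then nx x else x) = cycle_of_list c" if "c \<in> \<C>" for c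
    using nx[OF that] by (auto simp: fun_eq_iff id_outside_supp)
  have finE: "finite {(a, b). a < b \<and> E a b \<and> \<not> fixed a b}"
    by (rule finite_subset[of _ "{..<n} \<times> {..<n}"]) (auto dest: E_sym E_less)
  then obtain es where es: "set es = {(a, b). a < b \<and> E a b \<and> \<not> fixed a b}" "distinct es"
    using finite_distinct_list by blast
  have fixed_sym: "fixed x y \<longleftrightarrow> fixed y x" for x y by (auto simp: fixed_def)
  have signed: "is_signed es x y \<longleftrightarrow> E x y \<and> \<not> fixed x y" for x y
    using es(1) E_sym E_irrefl fixed_sym[of x y] by (auto simp: is_signed_def) (metis linorder_neqE_nat)
  have reindex: "(\<Prod>x\<in>set c. F x) = (\<Prod>i<length c. F (c ! i))" if "c \<in> \<C>" for c and F :: "nat \<Rightarrow> real"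
    using prod.reindex_bij_betw[OF bij_betw_nth[of c "{..<length c}" "set c"], of F] cyc[OF that] by simp
  interpret cycle_signing E n B es nx "set ` \<C>" g
  proof
    fix C assume "C \<in> set ` \<C>"
    then obtain c where c: "c \<in> \<C>" "C = set c" by blast
    have d: "distinct c" "length c \<ge> 3" "\<And>i. i < length c \<Longrightarrow> E (c ! i) (c ! ((i + 1) mod length c))"
      using cyc[OF c(1)] by auto
    show "(\<lambda>x. if x \<in> C then nx x else x) permutes C"
      using cycle_permutes[of c] by (simp add: rot c)
    show "of_int (sign (\<lambda>x. if x \<in> C then nx x else x)) * (\<Prod>x\<in>C. B x (nx x)) = 1"
    proof -
      have "(\<Prod>x\<in>C. B x (nx x)) = (\<Prod>i<length c. if ends (c ! i) (c ! ((i + 1) mod length c)) then 1 else -1)"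
        unfolding c(2) reindex[OF c(1)] using d by (intro prod.cong) (auto simp: B_def nx_nth[OF c(1)])
      also have "\<dots> = (-1) ^ (length c - 1)"
        using prod_ends[OF c(1), of "\<lambda>b. if b then 1 else -1"] by simp
      finally have "(\<Prod>x\<in>C. B x (nx x)) = (-1) ^ (length c - 1)" .
      moreover have "sign (cycle_of_list c) = (-1) ^ (length c - 1)"
        using d by (intro sign_cycle_of_list) auto
      ultimately show ?thesis
        unfolding c(2) rot[OF c(1)] by (simp add: power_mult_distrib[symmetric])
    qed
    show "D = C" if D: "D \<subseteq> C" "D \<noteq> {}" "nx ` D \<subseteq> D" for D
    proof -
      obtain i where i: "i < length c" "c ! i \<in> D"
        using D(1,2) c(2) by (metis all_not_in_conv in_set_conv_nth subset_iff)
      have step: "c ! ((i + m) mod length c) \<in> D" for m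
      proof (induction m)
        case (Suc m)
        then have "nx (c ! ((i + m) mod length c)) \<in> D" using D(3) by blast
        moreover have "(i + m) mod length c < length c" using i by (intro mod_less_divisor) auto
        ultimately show ?case using nx_nth[OF c(1)] by (simp add: mod_Suc_eq)
      qed (use i in simp)
      have "c ! j \<in> D" if "j < length c" for j
        using step[of "j + length c - i"] that i by simp
      then show ?thesis using D(1) c(2) by (metis in_set_conv_nth subsetI subset_antisym)
    qed
    fix x assume x: "x \<in> C"
    then obtain i where i: "i < length c" "x = c ! i" using c(2) by (metis in_set_conv_nth)
    have lt: "(i + 1) mod length c < length c" using i by (intro mod_less_divisor) auto
    show "nx (nx x) \<noteq> x"
    proof
      assume "nx (nx x) = x"
      then have "c ! ((i + 1 + 1) mod length c) = c ! i"
        using nx_nth[OF c(1) i(1)] nx_nth[OF c(1) lt] i(2) by (simp add: mod_Suc_eq)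
      moreover have "(i + 1 + 1) mod length c < length c" using i by (intro mod_less_divisor) auto
      ultimately have "(i + 2) mod length c = i" using d(1) i(1) by (simp add: nth_eq_iff_index_eq)
      then show False
        using d(2) i(1) by (cases "i + 2 < length c") (auto simp: mod_if not_less split: if_splits)
    qed
    have "nx x \<in> set c" using nx_nth[OF c(1) i(1)] i(2) lt by simp
    then have "fixed x (nx x)" unfolding fixed_def using x c by blast
    then show "\<not> is_signed es x (nx x)" using signed by blast
  next
    show "C = C'" if "C \<in> set ` \<C>" "C' \<in> set ` \<C>" "x \<in> C" "x \<in> C'" for C C' x
      using that disj by blast
    show "\<exists>C\<in>set ` \<C>. x \<in> C \<and> y \<in> C \<and> (y = nx x \<or> x = nx y)" if "E x y" "\<not> is_signed es x y" for x y
      using that signed fixed_def by auto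
    show "B x y = B y x" for x y using ends_sym E_sym by (auto simp: B_def)
  qed (use assms es in \<open>auto simp: B_def\<close>)
  obtain B' where B': "signing es B B'" "\<And>x y. B' x y = B' y x"
    "\<And>f. 0 \<le> (\<Sum>x<n. ((real (card {y. E x y}) - 1) * g + 1 / g) * (f x)\<^sup>2) + (\<Sum>x<n. \<Sum>y<n. B' x y * (f x * f y))"
    using exists_nonneg_signing by blast
  note B'_sq = signing_entries(2)[OF B'(1)] and B'_fixed = signing_entries(3)[OF B'(1)]
  \<comment> \<open>The value 1 off the edges is a default that makes \<open>s\<close> equal to 1 or
    -1 everywhere.\<close>
  define s where "s x y = (if E x y then - B' x y else 1)" for x y
  show ?thesis
  proof (rule that[of s])
    show "s x y = s y x" for x y using B'(2) E_sym by (auto simp: s_def)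
    show "s x y = 1 \<or> s x y = -1" for x y
      using B'_sq[of x y] by (auto simp: s_def square_eq_1_iff split: if_splits)
    show "(\<Prod>i<length c. s (c ! i) (c ! ((i + 1) mod length c))) = -1" if c: "c \<in> \<C>" for c
    proof -
      have "(\<Prod>i<length c. s (c ! i) (c ! ((i + 1) mod length c))) =
        (\<Prod>i<length c. if ends (c ! i) (c ! ((i + 1) mod length c)) then -1 else 1)"
      proof (intro prod.cong refl)
        fix i assume "i \<in> {..<length c}"
        then have i: "i < length c" by simp
        have lt: "(i + 1) mod length c < length c" using i by (intro mod_less_divisor) auto
        have E: "E (c ! i) (c ! ((i + 1) mod length c))" using cyc[OF c] i by blast
        have "fixed (c ! i) (c ! ((i + 1) mod length c))"
          unfolding fixed_def using c i lt nx_nth[OF c i] by (intro bexI[OF _ c]) simp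
        then have "B' (c ! i) (c ! ((i + 1) mod length c)) = B (c ! i) (c ! ((i + 1) mod length c))"
          using signed by (intro B'_fixed) blast
        then show "s (c ! i) (c ! ((i + 1) mod length c)) =
          (if ends (c ! i) (c ! ((i + 1) mod length c)) then -1 else 1)"
          using E by (simp add: s_def B_def)
      qed
      also have "\<dots> = -1" using prod_ends[OF c, of "\<lambda>b. if b then -1 else 1"] by simp
      finally show ?thesis .
    qed
    fix f :: "nat \<Rightarrow> real"
    have zero: "B' x y = 0" if "\<not> E x y" for x y
      using B'_sq[of x y] that by simp
    have "(\<Sum>x<n. \<Sum>y | E x y. s x y * (f x * f y)) = (\<Sum>x<n. \<Sum>y<n. - (B' x y * (f x * f y)))"
    proof (rule sum.cong[OF refl], rule sum.mono_neutral_cong_left)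
      fix x
      show "{y. E x y} \<subseteq> {..<n}" using E_sym E_less by blast
      show "\<forall>y\<in>{..<n} - {y. E x y}. - (B' x y * (f x * f y)) = 0" using zero by auto
    qed (auto simp: s_def)
    then show "(\<Sum>x<n. \<Sum>y | E x y. s x y * (f x * f y)) \<le>
          (\<Sum>x<n. ((real (card {y. E x y}) - 1) * g + 1 / g) * (f x)\<^sup>2)"
      using B'(3)[of f] by (simp add: sum_negf)
  qed
qed

section \<open>Lifts of finite graphs\<close>

definition graph_on :: "nat \<Rightarrow> (nat \<Rightarrow> nat \<Rightarrow> bool) \<Rightarrow> bool" where
  "graph_on n E \<longleftrightarrow> (\<forall>x y. E x y \<longrightarrow> x < n \<and> E y x \<and> x \<noteq> y)"

definition deg :: "(nat \<Rightarrow> nat \<Rightarrow> bool) \<Rightarrow> nat \<Rightarrow> nat" where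
  "deg E x = card {y. E x y}"

text \<open>
  The diagonal weight is \<open>\<lambda>(g) - (d - deg x) g\<close> for \<open>\<lambda>(g) = (d - 1) g + 1 / g\<close>: each of the \<open>d - deg x\<close>
  trees hanging off \<open>x\<close> contributes \<open>g (f x)\<^sup>2\<close> after the tree is minimised out.
\<close>

definition qform :: "nat \<Rightarrow> (nat \<Rightarrow> nat \<Rightarrow> bool) \<Rightarrow> real \<Rightarrow> (nat \<Rightarrow> real) \<Rightarrow> real" where
  "qform n E g f = (\<Sum>x<n. ((real (deg E x) - 1) * g + 1 / g) * (f x)\<^sup>2) - (\<Sum>x<n. \<Sum>y | E x y. f x * f y)"

text \<open>In an \<open>N\<close>-fold cover of a graph on \<open>{0..<n}\<close>, the vertex \<open>x < n * N\<close> lies over \<open>x div N\<close>.\<close>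

definition covers :: "nat \<Rightarrow> (nat \<Rightarrow> nat \<Rightarrow> bool) \<Rightarrow> (nat \<Rightarrow> nat \<Rightarrow> bool) \<Rightarrow> bool" where
  "covers N E' E \<longleftrightarrow> N > 0 \<and> (\<forall>x y. E' x y \<longrightarrow> E (x div N) (y div N)) \<and>
     (\<forall>x w. E (x div N) w \<longrightarrow> (\<exists>!y. y div N = w \<and> E' x y))"

definition fibre :: "nat \<Rightarrow> nat \<Rightarrow> nat set" where
  "fibre N v = {v * N..<v * N + N}"

definition fibre_avg :: "nat \<Rightarrow> (nat \<Rightarrow> real) \<Rightarrow> nat \<Rightarrow> real" where
  "fibre_avg N f v = (\<Sum>x\<in>fibre N v. f x) / real N"

text \<open>Functions of sum zero on every fibre are the new functions of a cover. Together with the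
  lifted functions they span everything, and the form splits accordingly.\<close>

definition new_nonneg :: "nat \<Rightarrow> nat \<Rightarrow> (nat \<Rightarrow> nat \<Rightarrow> bool) \<Rightarrow> real \<Rightarrow> bool" where
  "new_nonneg N n E g \<longleftrightarrow> (\<forall>f. (\<forall>v<n. (\<Sum>x\<in>fibre N v. f x) = 0) \<longrightarrow> qform (n * N) E g f \<ge> 0)"

lemma graph_onD:
  assumes "graph_on n E" "E x y"
  shows "x < n" "y < n" "E y x" "x \<noteq> y"
  using assms unfolding graph_on_def by blast+

lemma finite_nbrs: "graph_on n E \<Longrightarrow> finite {y. E x y}"
  by (rule finite_subset[of _ "{..<n}"]) (auto dest: graph_onD)

lemma in_fibre_iff: "N > 0 \<Longrightarrow> x \<in> fibre N v \<longleftrightarrow> x div N = v"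
  unfolding fibre_def
  by (auto simp: div_nat_eqI algebra_simps) (metis dividend_less_div_times mult.commute add.commute)

lemma card_fibre [simp]: "card (fibre N v) = N"
  by (simp add: fibre_def)

lemma finite_fibre [simp]: "finite (fibre N v)"
  by (simp add: fibre_def)

lemma sum_fibres: "(\<Sum>x<n * N. F x) = (\<Sum>v<n. \<Sum>x\<in>fibre N v. F x)"
  using sum.nat_group[of F N n] by (simp add: fibre_def)

lemma sum_fibre_const: "N > 0 \<Longrightarrow> (\<Sum>x\<in>fibre N v. F (x div N) x) = (\<Sum>x\<in>fibre N v. F v x)"
  by (intro sum.cong) (auto simp: in_fibre_iff)

lemma sum_adj_swap:
  fixes F :: "nat \<Rightarrow> nat \<Rightarrow> real"
  assumes "graph_on n E"
  shows "(\<Sum>x<n. \<Sum>y | E x y. F x y) = (\<Sum>x<n. \<Sum>y | E x y. F y x)"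
proof -
  have *: "(\<Sum>x<n. \<Sum>y | E x y. G x y) = (\<Sum>x<n. \<Sum>y<n. if E x y then G x y else 0)" for G :: "nat \<Rightarrow> nat \<Rightarrow> real"
    using assms by (intro sum.cong refl sum.mono_neutral_cong_left) (auto dest: graph_onD)
  have sym: "E x y \<longleftrightarrow> E y x" for x y using assms by (auto dest: graph_onD)
  show ?thesis
    unfolding * by (subst sum.swap) (use sym in \<open>auto intro!: sum.cong\<close>)
qed

lemma covers_bij:
  assumes "covers N E' E"
  shows "bij_betw (\<lambda>y. y div N) {y. E' x y} {w. E (x div N) w}"
  unfolding bij_betw_def inj_on_def
proof (intro conjI ballI impI equalityI subsetI)
  fix y y' assume "y \<in> {y. E' x y}" "y' \<in> {y. E' x y}" "y div N = y' div N"
  then show "y = y'" using assms unfolding covers_def by (metis mem_Collect_eq)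
next
  fix w assume "w \<in> {w. E (x div N) w}"
  then obtain y where "y div N = w" "E' x y" using assms unfolding covers_def by blast
  then show "w \<in> (\<lambda>y. y div N) ` {y. E' x y}" by blast
next
  fix w assume "w \<in> (\<lambda>y. y div N) ` {y. E' x y}"
  then show "w \<in> {w. E (x div N) w}" using assms unfolding covers_def by blast
qed

lemma covers_deg: "covers N E' E \<Longrightarrow> deg E' x = deg E (x div N)"
  unfolding deg_def by (rule bij_betw_same_card[OF covers_bij])

lemma covers_sum: "covers N E' E \<Longrightarrow> (\<Sum>y | E' x y. F (y div N)) = (\<Sum>w | E (x div N) w. F w)"
  by (rule sum.reindex_bij_betw[OF covers_bij])

lemma covers_inj: "covers N E' E \<Longrightarrow> E' x y \<Longrightarrow> E' x y' \<Longrightarrow> y div N = y' div N \<Longrightarrow> y = y'"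
  unfolding covers_def by blast

lemma qform_add:
  assumes "graph_on n E"
  shows "qform n E g (\<lambda>x. f x + h x) = qform n E g f + qform n E g h
    + 2 * ((\<Sum>x<n. ((real (deg E x) - 1) * g + 1 / g) * (f x * h x)) - (\<Sum>x<n. \<Sum>y | E x y. f y * h x))"
proof -
  have "(\<Sum>x<n. \<Sum>y | E x y. f x * h y) = (\<Sum>x<n. \<Sum>y | E x y. f y * h x)"
    by (rule sum_adj_swap[OF assms])
  moreover have "(\<Sum>x<n. \<Sum>y | E x y. (f x + h x) * (f y + h y)) = (\<Sum>x<n. \<Sum>y | E x y. f x * f y) +
      (\<Sum>x<n. \<Sum>y | E x y. h x * h y) + (\<Sum>x<n. \<Sum>y | E x y. f x * h y) + (\<Sum>x<n. \<Sum>y | E x y. f y * h x)"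
    by (simp add: sum.distrib[symmetric] algebra_simps)
  moreover have "(\<Sum>x<n. ((real (deg E x) - 1) * g + 1 / g) * (f x + h x)\<^sup>2) =
    (\<Sum>x<n. ((real (deg E x) - 1) * g + 1 / g) * (f x)\<^sup>2) + (\<Sum>x<n. ((real (deg E x) - 1) * g + 1 / g) * (h x)\<^sup>2)
    + 2 * (\<Sum>x<n. ((real (deg E x) - 1) * g + 1 / g) * (f x * h x))"
    unfolding sum_distrib_left sum.distrib[symmetric]
    by (intro sum.cong refl) (simp add: power2_eq_square, simp add: algebra_simps)
  ultimately show ?thesis
    unfolding qform_def by simp
qed

lemma qform_lift:
  assumes "covers N E' E"
  shows "qform (n * N) E' g (\<lambda>x. a (x div N)) = N * qform n E g a"
proof -
  have N: "N > 0" using assms by (simp add: covers_def)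
  have "(\<Sum>x<n * N. ((real (deg E' x) - 1) * g + 1 / g) * (a (x div N))\<^sup>2) =
      (\<Sum>v<n. \<Sum>x\<in>fibre N v. ((real (deg E v) - 1) * g + 1 / g) * (a v)\<^sup>2)"
    unfolding sum_fibres covers_deg[OF assms]
    by (intro sum.cong refl sum_fibre_const[OF N, of "\<lambda>v _. ((real (deg E v) - 1) * g + 1 / g) * (a v)\<^sup>2"])
  moreover have "(\<Sum>x<n * N. \<Sum>y | E' x y. a (x div N) * a (y div N)) =
      (\<Sum>v<n. \<Sum>x\<in>fibre N v. \<Sum>w | E v w. a v * a w)"
    unfolding sum_fibres covers_sum[OF assms, of "\<lambda>w. a (_ div N) * a w"]
    by (intro sum.cong refl sum_fibre_const[OF N, of "\<lambda>v _. \<Sum>w | E v w. a v * a w"])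
  ultimately show ?thesis
    by (simp add: qform_def sum_distrib_left right_diff_distrib)
qed

lemma fibre_avg_residual:
  "N > 0 \<Longrightarrow> (\<Sum>x\<in>fibre N v. f x - fibre_avg N f (x div N)) = 0"
  using sum_fibre_const[of N "\<lambda>v x. f x - fibre_avg N f v" v]
  by (simp add: sum_subtractf fibre_avg_def)

text \<open>The diagonal weights and the neighbour sums of a lifted function are constant on fibres,
  so their pairing with a new function vanishes.\<close>

lemma qform_decompose:
  assumes cov: "covers N E' E" and gr: "graph_on (n * N) E'"
    and \<psi>: "\<And>v. v < n \<Longrightarrow> (\<Sum>x\<in>fibre N v. \<psi> x) = 0"
  shows "qform (n * N) E' g (\<lambda>x. a (x div N) + \<psi> x) = N * qform n E g a + qform (n * N) E' g \<psi>"
proof -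
  have N: "N > 0" using cov by (simp add: covers_def)
  have zero: "(\<Sum>x<n * N. b (x div N) * \<psi> x) = 0" for b
  proof -
    have "(\<Sum>x\<in>fibre N v. b (x div N) * \<psi> x) = 0" if "v < n" for v
      using sum_fibre_const[OF N, of "\<lambda>v x. b v * \<psi> x" v] \<psi>[OF that] by (simp add: sum_distrib_left[symmetric])
    then show ?thesis unfolding sum_fibres by simp
  qed
  have "(\<Sum>x<n * N. ((real (deg E' x) - 1) * g + 1 / g) * (a (x div N) * \<psi> x)) = 0"
    using zero[of "\<lambda>v. ((real (deg E v) - 1) * g + 1 / g) * a v"] by (simp add: covers_deg[OF cov] mult.assoc)
  moreover have "(\<Sum>x<n * N. \<Sum>y | E' x y. a (y div N) * \<psi> x) = 0"
    using zero[of "\<lambda>v. \<Sum>w | E v w. a w"]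
    by (simp add: covers_sum[OF cov] sum_distrib_right[symmetric])
  ultimately show ?thesis
    by (simp add: qform_add[OF gr] qform_lift[OF cov])
qed

lemma qform_avg:
  assumes "covers N E' E" "graph_on (n * N) E'"
  shows "qform (n * N) E' g f = N * qform n E g (fibre_avg N f)
    + qform (n * N) E' g (\<lambda>x. f x - fibre_avg N f (x div N))"
proof -
  have "N > 0" using assms by (simp add: covers_def)
  then show ?thesis
    using qform_decompose[OF assms, of "\<lambda>x. f x - fibre_avg N f (x div N)" g "fibre_avg N f"]
    by (simp add: fibre_avg_residual)
qed

lemma covers_trans:
  assumes "covers N E' E" "covers M E'' E'"
  shows "covers (M * N) E'' E"
  unfolding covers_def
proof (intro conjI allI impI)
  show "M * N > 0" using assms by (simp add: covers_def)
  fix x y assume "E'' x y"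
  then show "E (x div (M * N)) (y div (M * N))"
    using assms unfolding covers_def div_mult2_eq by blast
next
  fix x w assume "E (x div (M * N)) w"
  then have "E (x div M div N) w" by (simp add: div_mult2_eq)
  then obtain v where v: "v div N = w" "E' (x div M) v" using assms(1) unfolding covers_def by blast
  then obtain y where y: "y div M = v" "E'' x y" using assms(2) unfolding covers_def by blast
  show "\<exists>!y. y div (M * N) = w \<and> E'' x y"
  proof (rule ex1I[of _ y])
    show "y div (M * N) = w \<and> E'' x y" using v y by (simp add: div_mult2_eq)
    fix y' assume y': "y' div (M * N) = w \<and> E'' x y'"
    then have "E' (x div M) (y' div M)" using assms(2) unfolding covers_def by blast
    then have "y' div M = v"
      using covers_inj[OF assms(1) _ v(2), of "y' div M"] v(1) y' by (simp add: div_mult2_eq)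
    then show "y' = y" using covers_inj[OF assms(2) _ y(2), of y'] y y' by simp
  qed
qed

text \<open>A new function of the composite cover splits into its averages over the fibres of size
  \<open>M\<close>, which are new for the cover of size \<open>N\<close>, and a residual that is new
  for the cover of size \<open>M\<close>.\<close>

lemma new_nonneg_trans:
  assumes "new_nonneg N n E' g" "covers M E'' E'" "graph_on (n * (M * N)) E''" "new_nonneg M (n * N) E'' g" "N > 0"
  shows "new_nonneg (M * N) n E'' g"
  unfolding new_nonneg_def
proof (intro allI impI)
  fix f :: "nat \<Rightarrow> real" assume f: "\<forall>v<n. (\<Sum>x\<in>fibre (M * N) v. f x) = 0"
  have M: "M > 0" using assms by (simp add: covers_def)
  have eq: "n * N * M = n * (M * N)" by (simp add: ac_simps)
  have "(\<Sum>u\<in>fibre N v. fibre_avg M f u) = 0" if "v < n" for v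
  proof -
    have "(\<Sum>u\<in>fibre N v. \<Sum>x\<in>fibre M u. f x) = (\<Sum>x\<in>(\<Union>u\<in>fibre N v. fibre M u). f x)"
      using M by (intro sum.UNION_disjoint[symmetric]) (auto simp: in_fibre_iff)
    also have "(\<Union>u\<in>fibre N v. fibre M u) = fibre (M * N) v"
      using M assms(5) by (auto simp: in_fibre_iff div_mult2_eq)
    finally show ?thesis using f that by (simp add: fibre_avg_def sum_divide_distrib[symmetric])
  qed
  then have "qform (n * N) E' g (fibre_avg M f) \<ge> 0"
    using assms(1) unfolding new_nonneg_def by blast
  moreover have "qform (n * (M * N)) E'' g (\<lambda>x. f x - fibre_avg M f (x div M)) \<ge> 0"
    using assms(4) fibre_avg_residual[OF M, of f] unfolding new_nonneg_def eq by blast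
  ultimately show "qform (n * (M * N)) E'' g f \<ge> 0"
    using qform_avg[OF assms(2), of "n * N" g f] assms(3) by (simp add: eq)
qed

section \<open>Two-lifts and signed adjacency matrices\<close>

definition two_lift :: "(nat \<Rightarrow> nat \<Rightarrow> bool) \<Rightarrow> (nat \<Rightarrow> nat \<Rightarrow> real) \<Rightarrow> nat \<Rightarrow> nat \<Rightarrow> bool" where
  "two_lift E s x y \<longleftrightarrow> E (x div 2) (y div 2) \<and> (x mod 2 = y mod 2 \<longleftrightarrow> s (x div 2) (y div 2) = 1)"

lemma two_lift_covers: "covers 2 (two_lift E s) E"
  unfolding covers_def
proof (intro conjI allI impI)
  fix x w assume E: "E (x div 2) w"
  define y where "y = 2 * w + (if s (x div 2) w = 1 then x mod 2 else 1 - x mod 2)"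
  have y: "y div 2 = w" "y mod 2 = (if s (x div 2) w = 1 then x mod 2 else 1 - x mod 2)"
    unfolding y_def by (auto split: if_splits)
  have flip: "x mod 2 \<noteq> 1 - x mod 2" for x :: nat by presburger
  have flip2: "x mod 2 \<noteq> y mod 2 \<Longrightarrow> y mod 2 = 1 - x mod 2" for x y :: nat by presburger
  show "\<exists>!y. y div 2 = w \<and> two_lift E s x y"
  proof (rule ex1I[of _ y])
    show "y div 2 = w \<and> two_lift E s x y"
      using E y flip[of x] by (simp add: two_lift_def)
    fix y' assume y': "y' div 2 = w \<and> two_lift E s x y'"
    then have "y' mod 2 = y mod 2"
      using y flip2[of x y'] by (auto simp: two_lift_def)
    then show "y' = y" using y' y(1) by (metis div_mult_mod_eq)
  qed
qed (auto simp: two_lift_def)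

lemma graph_on_two_lift:
  assumes "graph_on n E" "\<And>x y. s x y = s y x"
  shows "graph_on (n * 2) (two_lift E s)"
  unfolding graph_on_def
proof (intro allI impI)
  fix x y assume "two_lift E s x y"
  then have xy: "E (x div 2) (y div 2)" "x mod 2 = y mod 2 \<longleftrightarrow> s (x div 2) (y div 2) = 1"
    by (auto simp: two_lift_def)
  have "x < n * 2" using graph_onD(1)[OF assms(1) xy(1)] by auto
  moreover have "two_lift E s y x"
    using graph_onD(3)[OF assms(1) xy(1)] xy(2) assms(2) by (auto simp: two_lift_def)
  moreover have "x \<noteq> y" using graph_onD(4)[OF assms(1) xy(1)] by auto
  ultimately show "x < n * 2 \<and> two_lift E s y x \<and> x \<noteq> y" by blast
qed

text \<open>A new function takes opposite values on the two sheets, and on such functions the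
  adjacency matrix of the lift acts as the signed adjacency matrix \<open>s\<close> of the
  base.\<close>

lemma new_nonneg_two_lift:
  assumes gr: "graph_on n E" and s: "\<And>x y. s x y = 1 \<or> s x y = -1"
    and pos: "\<And>f. (\<Sum>x<n. \<Sum>y | E x y. s x y * (f x * f y)) \<le> (\<Sum>x<n. ((real (deg E x) - 1) * g + 1 / g) * (f x)\<^sup>2)"
  shows "new_nonneg 2 n (two_lift E s) g"
  unfolding new_nonneg_def
proof (intro allI impI)
  fix f :: "nat \<Rightarrow> real" assume f: "\<forall>v<n. (\<Sum>x\<in>fibre 2 v. f x) = 0"
  note cov = two_lift_covers[of E s]
  have fib: "fibre 2 v = {2 * v, 2 * v + 1}" for v by (auto simp: fibre_def)
  define h where "h v = f (2 * v)" for v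
  have f_eq: "f x = (if x mod 2 = 0 then 1 else -1) * h (x div 2)" if "x div 2 < n" for x
  proof -
    have "f (2 * (x div 2)) + f (2 * (x div 2) + 1) = 0" using f that by (simp add: fib)
    moreover have "x = 2 * (x div 2) + x mod 2" by simp
    ultimately show ?thesis using mod2_eq_if[of x] by (auto simp: h_def split: if_splits)
  qed
  have "(\<Sum>x<n * 2. \<Sum>y | two_lift E s x y. f x * f y) = (\<Sum>x<n * 2. \<Sum>y | two_lift E s x y.
      s (x div 2) (y div 2) * (h (x div 2) * h (y div 2)))"
  proof (intro sum.cong refl)
    fix x y assume "y \<in> {y. two_lift E s x y}"
    then have y: "E (x div 2) (y div 2)" "x mod 2 = y mod 2 \<longleftrightarrow> s (x div 2) (y div 2) = 1"
      by (auto simp: two_lift_def)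
    have "(if x mod 2 = 0 then 1 else -1) * (if y mod 2 = 0 then 1 else -1) = s (x div 2) (y div 2)"
      using y(2) s[of "x div 2" "y div 2"] by (cases "x mod 2 = 0"; cases "y mod 2 = 0") auto
    moreover have "f x * f y = ((if x mod 2 = 0 then 1 else -1) * (if y mod 2 = 0 then 1 else -1)) * (h (x div 2) * h (y div 2))"
      unfolding f_eq[OF graph_onD(1)[OF gr y(1)]] f_eq[OF graph_onD(2)[OF gr y(1)]]
      by (simp only: mult_ac)
    ultimately show "f x * f y = s (x div 2) (y div 2) * (h (x div 2) * h (y div 2))" by (simp only:)
  qed
  also have "\<dots> = (\<Sum>x<n * 2. \<Sum>w | E (x div 2) w. s (x div 2) w * (h (x div 2) * h w))"
    by (intro sum.cong refl covers_sum[OF cov, of "\<lambda>w. s (_ div 2) w * (h (_ div 2) * h w)"])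
  also have "\<dots> = (\<Sum>v<n. \<Sum>x\<in>fibre 2 v. \<Sum>w | E v w. s v w * (h v * h w))"
    unfolding sum_fibres
    by (intro sum.cong refl sum_fibre_const[of 2 "\<lambda>v _. \<Sum>w | E v w. s v w * (h v * h w)"]) simp
  also have "\<dots> = 2 * (\<Sum>v<n. \<Sum>w | E v w. s v w * (h v * h w))"
    by (simp add: sum_distrib_left)
  also have "\<dots> \<le> 2 * (\<Sum>v<n. ((real (deg E v) - 1) * g + 1 / g) * (h v)\<^sup>2)"
    using pos[of h] by simp
  also have "\<dots> = (\<Sum>v<n. \<Sum>x\<in>fibre 2 v. ((real (deg E v) - 1) * g + 1 / g) * (h v)\<^sup>2)"
    by (simp add: sum_distrib_left)
  also have "\<dots> = (\<Sum>v<n. \<Sum>x\<in>fibre 2 v. ((real (deg E (x div 2)) - 1) * g + 1 / g) * (h (x div 2))\<^sup>2)"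
    by (rule sum.cong[OF refl], rule sum_fibre_const[of 2 "\<lambda>v _. ((real (deg E v) - 1) * g + 1 / g) * (h v)\<^sup>2", symmetric]) simp
  also have "\<dots> = (\<Sum>x<n * 2. ((real (deg (two_lift E s) x) - 1) * g + 1 / g) * (f x)\<^sup>2)"
    unfolding sum_fibres covers_deg[OF cov]
    by (intro sum.cong refl) (auto simp: fib f_eq power_mult_distrib)
  finally show "qform (n * 2) (two_lift E s) g f \<ge> 0" by (simp add: qform_def)
qed

section \<open>Regular expanders of large girth\<close>

definition nb_walk :: "(nat \<Rightarrow> nat \<Rightarrow> bool) \<Rightarrow> nat list \<Rightarrow> bool" where
  "nb_walk E xs \<longleftrightarrow> (\<forall>i. Suc i < length xs \<longrightarrow> E (xs ! i) (xs ! Suc i)) \<and>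
     (\<forall>i. Suc (Suc i) < length xs \<longrightarrow> xs ! i \<noteq> xs ! Suc (Suc i))"

text \<open>Walks are used instead of cycles because non-backtracking walks project along covers,
  whereas a cycle of the cover may project to a walk with repetitions. Backtracking across the base
  point is not excluded. \<open>L\<close> bounds the number of listed vertices, so going once round
  a cycle of length k takes k + 1 entries; the lower bound 2 excludes the trivial walk.\<close>

definition closed_walks :: "(nat \<Rightarrow> nat \<Rightarrow> bool) \<Rightarrow> nat \<Rightarrow> nat \<Rightarrow> nat list set" where
  "closed_walks E L v = {xs. nb_walk E xs \<and> 2 \<le> length xs \<and> length xs \<le> L \<and> hd xs = v \<and> last xs = v}"

definition cyc :: "(nat \<Rightarrow> nat \<Rightarrow> bool) \<Rightarrow> nat list \<Rightarrow> bool" where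
  "cyc E c \<longleftrightarrow> distinct c \<and> length c \<ge> 3 \<and> (\<forall>i<length c. E (c ! i) (c ! ((i + 1) mod length c)))"

text \<open>Take two equal entries at minimal distance k. Distance 1 would be a loop and distance 2
  a backtracking, so k is at least 3, and minimality makes the entries in between distinct.\<close>

lemma closed_walk_cycle:
  assumes gr: "graph_on n E" and xs: "nb_walk E xs" "2 \<le> length xs" "hd xs = last xs"
  obtains c where "cyc E c" "length c < length xs" "set c \<subseteq> set xs"
proof -
  define P where "P k \<longleftrightarrow> k > 0 \<and> (\<exists>i. i + k < length xs \<and> xs ! i = xs ! (i + k))" for k
  have "xs \<noteq> []" using xs(2) by auto
  then have "P (length xs - 1)"
    unfolding P_def using xs(2,3) by (intro conjI exI[of _ 0]) (auto simp: hd_conv_nth last_conv_nth)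
  define k where "k = (LEAST k. P k)"
  have "P k" unfolding k_def by (rule LeastI) fact
  then obtain i where i: "k > 0" "i + k < length xs" "xs ! i = xs ! (i + k)" unfolding P_def by blast
  have min: "\<not> P j" if "j < k" for j using not_less_Least that unfolding k_def by blast
  have walk: "E (xs ! j) (xs ! Suc j)" if "Suc j < length xs" for j using xs(1) that by (simp add: nb_walk_def)
  have nb: "xs ! j \<noteq> xs ! Suc (Suc j)" if "Suc (Suc j) < length xs" for j using xs(1) that by (simp add: nb_walk_def)
  have "k \<noteq> 1" using walk[of i] i graph_onD(4)[OF gr, of "xs ! i" "xs ! Suc i"] by auto
  moreover have "k \<noteq> 2" using nb[of i] i by (auto simp: numeral_2_eq_2)
  ultimately have k3: "k \<ge> 3" using i(1) by linarith
  define c where "c = take k (drop i xs)"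
  have len: "length c = k" using i(2) by (simp add: c_def)
  have nth: "c ! m = xs ! (i + m)" if "m < k" for m using that i(2) by (simp add: c_def)
  have "xs ! (i + a) \<noteq> xs ! (i + b)" if "a < b" "b < k" for a b
  proof
    assume "xs ! (i + a) = xs ! (i + b)"
    then have "P (b - a)" unfolding P_def using that i(2) by (intro conjI exI[of _ "i + a"]) auto
    then show False using min[of "b - a"] that by simp
  qed
  then have "distinct c" unfolding distinct_conv_nth len by (metis linorder_neqE_nat nth)
  moreover have "E (c ! m) (c ! ((m + 1) mod k))" if "m < k" for m
  proof (cases "m + 1 = k")
    case True
    then show ?thesis using nth[of m] nth[of 0] i walk[of "i + m"] that by auto
  next
    case False
    then show ?thesis using nth[of m] nth[of "m + 1"] i walk[of "i + m"] that by auto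
  qed
  ultimately have "cyc E c" unfolding cyc_def len using k3 by blast
  moreover have "length c < length xs" using i(2) len by simp
  moreover have "set c \<subseteq> set xs" unfolding c_def using set_take_subset set_drop_subset by fast
  ultimately show ?thesis using that by blast
qed

definition around :: "nat list \<Rightarrow> nat \<Rightarrow> nat list" where
  "around c i = map (\<lambda>j. c ! ((i + j) mod length c)) [0..<length c + 1]"

lemma around_closed_walk:
  assumes c: "cyc E c" and "length c + 1 \<le> L" "i < length c"
  shows "around c i \<in> closed_walks E L (c ! i)"
proof -
  let ?k = "length c"
  have c': "distinct c" "?k \<ge> 3" "\<And>i. i < ?k \<Longrightarrow> E (c ! i) (c ! ((i + 1) mod ?k))"
    using c by (auto simp: cyc_def)
  have len: "length (around c i) = ?k + 1" by (simp add: around_def)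
  have nth: "around c i ! j = c ! ((i + j) mod ?k)" if "j < ?k + 1" for j
    using that unfolding around_def by (subst nth_map) (auto simp del: upt_Suc)
  have "E (around c i ! j) (around c i ! Suc j)" if "Suc j < ?k + 1" for j
  proof -
    have "(i + j) mod ?k < ?k" using c'(2) by (intro mod_less_divisor) linarith
    then show ?thesis
      using c'(3)[of "(i + j) mod ?k"] nth[of j] nth[of "Suc j"] that by (simp add: mod_Suc_eq)
  qed
  moreover have "around c i ! j \<noteq> around c i ! Suc (Suc j)" if "Suc (Suc j) < ?k + 1" for j
  proof -
    define a where "a = (i + j) mod ?k"
    have "c \<noteq> []" using c'(2) by auto
    then have a: "a < ?k" "(i + Suc (Suc j)) mod ?k < ?k" by (simp_all add: a_def)
    have "(i + Suc (Suc j)) mod ?k = (a + 2) mod ?k" unfolding a_def by (simp add: mod_simps)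
    moreover have "(a + 2) mod ?k \<noteq> a"
      using a c'(2) by (cases "a + 2 < ?k") (auto simp: mod_if)
    ultimately show ?thesis
      using a c'(1) nth[of j] nth[of "Suc (Suc j)"] that by (simp add: a_def[symmetric] nth_eq_iff_index_eq)
  qed
  ultimately have "nb_walk E (around c i)" by (simp add: nb_walk_def len)
  moreover have "around c i \<noteq> []" using len by auto
  then have "hd (around c i) = c ! i" "last (around c i) = c ! i"
    using nth[of 0] nth[of ?k] len assms(3) by (auto simp: hd_conv_nth last_conv_nth)
  ultimately show ?thesis using assms(2) c'(2) by (simp add: closed_walks_def len)
qed

lemma around_prod:
  fixes s :: "nat \<Rightarrow> nat \<Rightarrow> real"
  assumes "i < length c"
  shows "(\<Prod>j<length c. s (around c i ! j) (around c i ! Suc j)) =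
    (\<Prod>j<length c. s (c ! j) (c ! ((j + 1) mod length c)))"
proof -
  let ?k = "length c"
  have nth: "around c i ! j = c ! ((i + j) mod ?k)" if "j < ?k + 1" for j
    using that unfolding around_def by (subst nth_map) (auto simp del: upt_Suc)
  have shift: "(i + j) mod ?k = (if i + j < ?k then i + j else i + j - ?k)" if "j < ?k" for j
    using assms that by (simp add: mod_if)
  have inj: "inj_on (\<lambda>j. (i + j) mod ?k) {..<?k}"
    using assms by (intro inj_onI) (simp add: shift split: if_splits)
  moreover have "(\<lambda>j. (i + j) mod ?k) ` {..<?k} \<subseteq> {..<?k}"
    using assms by (intro image_subsetI) (simp, intro mod_less_divisor, linarith)
  ultimately have "bij_betw (\<lambda>j. (i + j) mod ?k) {..<?k} {..<?k}"
    by (simp add: bij_betw_def endo_inj_surj)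
  then have "(\<Prod>j<?k. s (c ! ((i + j) mod ?k)) (c ! (((i + j) mod ?k + 1) mod ?k))) =
     (\<Prod>j<?k. s (c ! j) (c ! ((j + 1) mod ?k)))"
    by (rule prod.reindex_bij_betw)
  moreover have "(\<Prod>j<?k. s (around c i ! j) (around c i ! Suc j)) =
     (\<Prod>j<?k. s (c ! ((i + j) mod ?k)) (c ! (((i + j) mod ?k + 1) mod ?k)))"
    by (intro prod.cong refl) (simp add: nth mod_Suc_eq)
  ultimately show ?thesis by simp
qed

section \<open>Closed walks under covers\<close>

lemma nb_walk_project:
  assumes cov: "covers N E' E" and gr: "graph_on m E'" and ys: "nb_walk E' ys"
  shows "nb_walk E (map (\<lambda>y. y div N) ys)"
  unfolding nb_walk_def
proof (intro conjI allI impI)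
  fix i assume "Suc i < length (map (\<lambda>y. y div N) ys)"
  then show "E (map (\<lambda>y. y div N) ys ! i) (map (\<lambda>y. y div N) ys ! Suc i)"
    using ys cov by (auto simp: nb_walk_def covers_def)
next
  fix i assume i: "Suc (Suc i) < length (map (\<lambda>y. y div N) ys)"
  then have "E' (ys ! Suc i) (ys ! i)" "E' (ys ! Suc i) (ys ! Suc (Suc i))" "ys ! i \<noteq> ys ! Suc (Suc i)"
    using ys graph_onD(3)[OF gr] by (auto simp: nb_walk_def)
  then show "map (\<lambda>y. y div N) ys ! i \<noteq> map (\<lambda>y. y div N) ys ! Suc (Suc i)"
    using covers_inj[OF cov] i by auto
qed

lemma closed_walks_project:
  assumes "covers N E' E" "graph_on m E'" "ys \<in> closed_walks E' L v"
  shows "map (\<lambda>y. y div N) ys \<in> closed_walks E L (v div N)"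
proof -
  have "ys \<noteq> []" using assms(3) by (auto simp: closed_walks_def)
  then show ?thesis
    using assms nb_walk_project[OF assms(1,2)] by (auto simp: closed_walks_def hd_map last_map)
qed

text \<open>Unique path lifting from the fixed starting vertex \<open>v\<close>.\<close>

lemma project_inj:
  assumes cov: "covers N E' E"
  shows "inj_on (map (\<lambda>y. y div N)) (closed_walks E' L v)"
proof (rule inj_onI)
  fix xs ys assume xs: "xs \<in> closed_walks E' L v" and ys: "ys \<in> closed_walks E' L v"
    and eq: "map (\<lambda>y. y div N) xs = map (\<lambda>y. y div N) ys"
  have len: "length xs = length ys" using eq map_eq_imp_length_eq by blast
  have "xs ! i = ys ! i" if "i < length xs" for i
    using that
  proof (induction i)
    case 0
    then have "xs \<noteq> []" "ys \<noteq> []" using len by auto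
    then show ?case using xs ys by (simp add: closed_walks_def hd_conv_nth)
  next
    case (Suc i)
    then have "E' (xs ! i) (xs ! Suc i)" "E' (xs ! i) (ys ! Suc i)"
      using xs ys len by (auto simp: closed_walks_def nb_walk_def)
    moreover have "xs ! Suc i div N = ys ! Suc i div N"
      using eq Suc.prems len by (metis nth_map)
    ultimately show ?case using covers_inj[OF cov] by blast
  qed
  then show "xs = ys" using len by (intro nth_equalityI) auto
qed

lemma closed_walk_vertices:
  assumes "graph_on n E" "xs \<in> closed_walks E L v"
  shows "set xs \<subseteq> {..<n}"
proof
  fix x assume "x \<in> set xs"
  then obtain i where i: "i < length xs" "x = xs ! i" by (metis in_set_conv_nth)
  show "x \<in> {..<n}"
  proof (cases "Suc i < length xs")
    case True
    then show ?thesis using assms i graph_onD(1)[OF assms(1), of x "xs ! Suc i"]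
      by (auto simp: closed_walks_def nb_walk_def)
  next
    case False
    then have "Suc (i - 1) < length xs" "Suc (i - 1) = i" using i assms(2) by (auto simp: closed_walks_def)
    moreover have "E (xs ! j) (xs ! Suc j)" if "Suc j < length xs" for j
      using assms(2) that by (simp add: closed_walks_def nb_walk_def)
    ultimately have "E (xs ! (i - 1)) x" unfolding i(2) by metis
    then show ?thesis using graph_onD(2)[OF assms(1)] by blast
  qed
qed

lemma finite_closed_walks:
  assumes "graph_on n E"
  shows "finite (closed_walks E L v)"
  by (rule finite_subset[OF _ finite_lists_length_le[of "{..<n}" L]])
    (use closed_walk_vertices[OF assms] in \<open>auto simp: closed_walks_def\<close>)

definition closed_count :: "(nat \<Rightarrow> nat \<Rightarrow> bool) \<Rightarrow> nat \<Rightarrow> nat \<Rightarrow> nat" where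
  "closed_count E L v = card (closed_walks E L v)"

lemma closed_count_cover:
  assumes "covers N E' E" "graph_on m E'" "graph_on n E"
  shows "closed_count E' L v \<le> closed_count E L (v div N)"
  unfolding closed_count_def
  by (rule card_inj_on_le[OF project_inj[OF assms(1)] _ finite_closed_walks[OF assms(3)]])
    (use closed_walks_project[OF assms(1,2)] in blast)

lemma two_lift_walk_parity:
  fixes s :: "nat \<Rightarrow> nat \<Rightarrow> real"
  assumes ys: "nb_walk (two_lift E s) ys" and s: "\<And>x y. s x y = 1 \<or> s x y = -1"
  shows "m < length ys \<Longrightarrow> (\<Prod>j<m. s (ys ! j div 2) (ys ! Suc j div 2)) = (if ys ! 0 mod 2 = ys ! m mod 2 then 1 else -1)"
proof (induction m)
  case (Suc m)
  have "two_lift E s (ys ! m) (ys ! Suc m)" using ys Suc.prems by (simp add: nb_walk_def)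
  then have "ys ! m mod 2 = ys ! Suc m mod 2 \<longleftrightarrow> s (ys ! m div 2) (ys ! Suc m div 2) = 1"
    by (simp add: two_lift_def)
  then have step: "s (ys ! m div 2) (ys ! Suc m div 2) = (if ys ! m mod 2 = ys ! Suc m mod 2 then 1 else -1)"
    using s[of "ys ! m div 2" "ys ! Suc m div 2"] by (simp only: split: if_split) blast
  have IH: "(\<Prod>j<m. s (ys ! j div 2) (ys ! Suc j div 2)) = (if ys ! 0 mod 2 = ys ! m mod 2 then 1 else -1)"
    using Suc.prems by (intro Suc.IH) simp
  have parity: "(if a = b then 1 else -1) * (if b = c then 1 else -1) = (if a = c then 1 else - 1 :: real)"
    if "a < 2" "b < 2" "c < 2" for a b c :: nat
    using that by (auto simp: less_2_cases_iff)
  show ?case unfolding prod.lessThan_Suc IH step by (rule parity) simp_all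
qed simp

text \<open>Projection of closed walks is injective and misses the walk once round \<open>c\<close>:
  the sign product -1 makes any lift of it end on the other sheet.\<close>

lemma closed_count_two_lift:
  fixes s :: "nat \<Rightarrow> nat \<Rightarrow> real"
  assumes gr: "graph_on n E" "graph_on (n * 2) (two_lift E s)" and s: "\<And>x y. s x y = 1 \<or> s x y = -1"
    and c: "cyc E c" "length c + 1 \<le> L" "v div 2 \<in> set c"
    and neg: "(\<Prod>i<length c. s (c ! i) (c ! ((i + 1) mod length c))) = -1"
  shows "closed_count (two_lift E s) L v < closed_count E L (v div 2)"
proof -
  let ?\<pi> = "map (\<lambda>y. y div 2)"
  obtain i where i: "i < length c" "c ! i = v div 2" using c(3) by (metis in_set_conv_nth)
  have w: "around c i \<in> closed_walks E L (v div 2)" using around_closed_walk[OF c(1,2) i(1)] i(2) by simp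
  have "around c i \<notin> ?\<pi> ` closed_walks (two_lift E s) L v"
  proof
    assume "around c i \<in> ?\<pi> ` closed_walks (two_lift E s) L v"
    then obtain ys where ys: "ys \<in> closed_walks (two_lift E s) L v" "around c i = ?\<pi> ys" by blast
    have len: "length ys = length c + 1" using arg_cong[OF ys(2), of length] by (simp add: around_def)
    have "ys \<noteq> []" using len by auto
    then have "ys ! 0 = ys ! length c" using ys(1) len by (auto simp: closed_walks_def hd_conv_nth last_conv_nth)
    moreover have "(\<Prod>j<length c. s (ys ! j div 2) (ys ! Suc j div 2)) = (if ys ! 0 mod 2 = ys ! length c mod 2 then 1 else -1)"
      using ys(1) len by (intro two_lift_walk_parity[OF _ s]) (auto simp: closed_walks_def)
    ultimately have "(\<Prod>j<length c. s (ys ! j div 2) (ys ! Suc j div 2)) = 1" by simp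
    moreover have "(\<Prod>j<length c. s (ys ! j div 2) (ys ! Suc j div 2)) = (\<Prod>j<length c. s (around c i ! j) (around c i ! Suc j))"
      unfolding ys(2) using len by (intro prod.cong) auto
    ultimately show False using around_prod[OF i(1), of s] neg by simp
  qed
  then have "?\<pi> ` closed_walks (two_lift E s) L v \<subset> closed_walks E L (v div 2)"
    using closed_walks_project[OF two_lift_covers gr(2)] w by blast
  then have "card (?\<pi> ` closed_walks (two_lift E s) L v) < closed_count E L (v div 2)"
    unfolding closed_count_def by (rule psubset_card_mono[OF finite_closed_walks[OF gr(1)]])
  then show ?thesis
    unfolding closed_count_def by (simp add: card_image[OF project_inj[OF two_lift_covers]])
qed

text \<open>
  Short cycles need not be disjoint, so only a maximal disjoint family is made negative.  Every
  short closed walk meets the family, and the walks that wind once around its cycles do not lift to closed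
  walks; hence the total number of short closed walks along a short closed walk decreases.
\<close>

lemma kill_short_cycles:
  assumes gr: "graph_on n E" and g: "0 < g" "g < 1"
    and M: "\<And>v ws. ws \<in> closed_walks E L v \<Longrightarrow> sum_list (map (closed_count E L) ws) \<le> Suc m"
  obtains s where "graph_on (n * 2) (two_lift E s)" "new_nonneg 2 n (two_lift E s) g"
    "\<And>v ws. ws \<in> closed_walks (two_lift E s) L v \<Longrightarrow> sum_list (map (closed_count (two_lift E s) L) ws) \<le> m"
proof -
  define short where "short c \<longleftrightarrow> cyc E c \<and> length c + 1 \<le> L" for c
  define F where "F = {\<C>. (\<forall>c\<in>\<C>. short c) \<and> (\<forall>c\<in>\<C>. \<forall>c'\<in>\<C>. set c \<inter> set c' \<noteq> {} \<longrightarrow> c = c')}"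
  have "finite {c. short c}"
  proof (rule finite_subset[OF _ finite_lists_length_le[of "{..<n}" L]])
    have "x < n" if c: "short c" "x \<in> set c" for c x
    proof -
      obtain i where "i < length c" "x = c ! i" using c(2) by (metis in_set_conv_nth)
      then have "E x (c ! ((i + 1) mod length c))" using c(1) by (auto simp: short_def cyc_def)
      then show ?thesis by (rule graph_onD(1)[OF gr])
    qed
    then show "{c. short c} \<subseteq> {xs. set xs \<subseteq> {..<n} \<and> length xs \<le> L}"
      by (auto simp: short_def)
  qed simp
  moreover have "F \<subseteq> Pow {c. short c}" by (auto simp: F_def)
  ultimately have "finite F" using finite_subset by blast
  moreover have "{} \<in> F" by (simp add: F_def)
  ultimately obtain \<C> where \<C>: "\<C> \<in> F" "\<And>\<C>'. \<C>' \<in> F \<Longrightarrow> \<C> \<subseteq> \<C>' \<Longrightarrow> \<C> = \<C>'"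
    using finite_has_maximal[of F] by blast
  have short: "short c" if "c \<in> \<C>" for c using \<C>(1) that by (simp add: F_def)
  have disj: "c = c'" if "c \<in> \<C>" "c' \<in> \<C>" "x \<in> set c" "x \<in> set c'" for c c' x
    using \<C>(1) that unfolding F_def by blast
  have hit: "\<exists>c'\<in>\<C>. set c \<inter> set c' \<noteq> {}" if c: "short c" for c
  proof (rule ccontr)
    assume no: "\<not> ?thesis"
    have "insert c \<C> \<in> F"
      using \<C>(1) c no by (auto simp: F_def Int_commute)
    then have "\<C> = insert c \<C>" by (rule \<C>(2)) (rule subset_insertI)
    then have "c \<in> \<C>" by (metis insertI1)
    moreover have "set c \<noteq> {}" using c by (auto simp: short_def cyc_def)
    ultimately show False using no by (metis Int_absorb)
  qed
  obtain s :: "nat \<Rightarrow> nat \<Rightarrow> real" where s: "\<And>x y. s x y = s y x" "\<And>x y. s x y = 1 \<or> s x y = -1"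
    "\<And>c. c \<in> \<C> \<Longrightarrow> (\<Prod>i<length c. s (c ! i) (c ! ((i + 1) mod length c))) = -1"
    "\<And>f. (\<Sum>x<n. \<Sum>y | E x y. s x y * (f x * f y)) \<le>
          (\<Sum>x<n. ((real (card {y. E x y}) - 1) * g + 1 / g) * (f x)\<^sup>2)"
  proof (rule negative_cycle_signing[of E n g \<C>])
    show "E x y \<Longrightarrow> E y x" "\<not> E x x" "E x y \<Longrightarrow> x < n" for x y using gr by (auto dest: graph_onD)
    show "distinct c \<and> length c \<ge> 3 \<and> (\<forall>i<length c. E (c ! i) (c ! ((i + 1) mod length c)))" if "c \<in> \<C>" for c
      using short[OF that] by (simp add: short_def cyc_def)
  qed (use g disj in blast)+
  show ?thesis
  proof (rule that[of s])
    show gr2: "graph_on (n * 2) (two_lift E s)" by (rule graph_on_two_lift[OF gr s(1)])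
    show "new_nonneg 2 n (two_lift E s) g"
      using s(4) by (intro new_nonneg_two_lift[OF gr s(2)]) (simp add: deg_def)
    fix v ys assume ys: "ys \<in> closed_walks (two_lift E s) L v"
    let ?ws = "map (\<lambda>y. y div 2) ys"
    have ws: "?ws \<in> closed_walks E L (v div 2)" by (rule closed_walks_project[OF two_lift_covers gr2 ys])
    then obtain c where c: "cyc E c" "length c < length ?ws" "set c \<subseteq> set ?ws"
      using closed_walk_cycle[OF gr, of ?ws] unfolding closed_walks_def by (metis (mono_tags, lifting) mem_Collect_eq)
    then have "short c" using ws by (auto simp: short_def closed_walks_def)
    then obtain c' x where c': "c' \<in> \<C>" "x \<in> set c" "x \<in> set c'" using hit by blast
    obtain y where y: "y \<in> set ys" "x = y div 2" using c'(2) c(3) by auto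
    have le: "closed_count (two_lift E s) L y \<le> closed_count E L (y div 2)" for y
      by (rule closed_count_cover[OF two_lift_covers gr2 gr])
    have less: "closed_count (two_lift E s) L y < closed_count E L (y div 2)"
      using short[OF c'(1)] c' y by (intro closed_count_two_lift[OF gr gr2 s(2) _ _ _ s(3)[OF c'(1)]]) (auto simp: short_def)
    obtain as bs where ab: "ys = as @ y # bs" using y(1) by (meson split_list)
    have mono: "sum_list (map (closed_count (two_lift E s) L) zs) \<le> sum_list (map (closed_count E L) (map (\<lambda>y. y div 2) zs))" for zs
      using le by (induction zs) (auto intro: add_mono)
    have "sum_list (map (closed_count (two_lift E s) L) ys) < sum_list (map (closed_count E L) ?ws)"
      using mono[of as] mono[of bs] less unfolding ab by simp
    also have "\<dots> \<le> Suc m" by (rule M[OF ws])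
    finally show "sum_list (map (closed_count (two_lift E s) L) ys) \<le> m" by simp
  qed
qed

text \<open>For a \<open>d\<close>-regular graph the diagonal of the form is constant, equal to (d -
  1) g + 1/g. The last condition thus says that all eigenvalues apart from that of the constant
  functions are at most this level.\<close>

definition expander_on :: "nat \<Rightarrow> nat \<Rightarrow> (nat \<Rightarrow> nat \<Rightarrow> bool) \<Rightarrow> real \<Rightarrow> bool" where
  "expander_on d n E g \<longleftrightarrow> n > 0 \<and> graph_on n E \<and> (\<forall>x<n. deg E x = d) \<and>
     (\<forall>f. (\<Sum>x<n. f x) = 0 \<longrightarrow> qform n E g f \<ge> 0)"

lemma expander_on_cover:
  assumes E: "expander_on d n E g" and cov: "covers N E' E" and gr: "graph_on (n * N) E'" and new: "new_nonneg N n E' g"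
  shows "expander_on d (n * N) E' g"
  unfolding expander_on_def
proof (intro conjI allI impI gr)
  have N: "N > 0" using cov by (simp add: covers_def)
  have E': "n > 0" "\<And>x. x < n \<Longrightarrow> deg E x = d" "\<And>f. (\<Sum>x<n. f x) = 0 \<Longrightarrow> qform n E g f \<ge> 0"
    using E unfolding expander_on_def by blast+
  show "n * N > 0" using E'(1) N by simp
  show "deg E' x = d" if "x < n * N" for x
    unfolding covers_deg[OF cov] using that by (intro E'(2) less_mult_imp_div_less)
  fix f :: "nat \<Rightarrow> real" assume f: "(\<Sum>x<n * N. f x) = 0"
  have "(\<Sum>v<n. fibre_avg N f v) = 0"
    using f unfolding sum_fibres fibre_avg_def by (simp add: sum_divide_distrib[symmetric])
  then have "qform n E g (fibre_avg N f) \<ge> 0" by (rule E'(3))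
  moreover have "qform (n * N) E' g (\<lambda>x. f x - fibre_avg N f (x div N)) \<ge> 0"
    using new fibre_avg_residual[OF N, of f] unfolding new_nonneg_def by blast
  ultimately show "qform (n * N) E' g f \<ge> 0" 
    using qform_avg[OF cov gr, of g f] by simp
qed

text \<open>On functions of sum zero the adjacency matrix of a complete graph is minus the
  identity.\<close>

lemma complete_graph_expander:
  assumes "0 < g"
  shows "expander_on d (d + 1) (\<lambda>x y. x < d + 1 \<and> y < d + 1 \<and> x \<noteq> y) g"
proof -
  let ?E = "\<lambda>x y. x < d + 1 \<and> y < d + 1 \<and> x \<noteq> y"
  have nb: "{y. ?E x y} = {..<d + 1} - {x}" if "x < d + 1" for x using that by auto
  have dg: "deg ?E x = d" if "x < d + 1" for x using that unfolding deg_def nb[OF that] by simp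
  have "qform (d + 1) ?E g f \<ge> 0" if f: "(\<Sum>x<d + 1. f x) = 0" for f
  proof -
    have "(\<Sum>y | ?E x y. f x * f y) = - (f x)\<^sup>2" if "x < d + 1" for x
    proof -
      have "(\<Sum>y | ?E x y. f x * f y) = f x * (\<Sum>y\<in>{..<d + 1} - {x}. f y)"
        unfolding nb[OF that] by (simp add: sum_distrib_left)
      also have "(\<Sum>y\<in>{..<d + 1} - {x}. f y) = - f x"
        using f that by (subst sum_diff1) auto
      finally show ?thesis by (simp add: power2_eq_square)
    qed
    then have adj: "(\<Sum>x<d + 1. \<Sum>y | ?E x y. f x * f y) = (\<Sum>x<d + 1. - (f x)\<^sup>2)"
      by (intro sum.cong) auto
    have "qform (d + 1) ?E g f = (\<Sum>x<d + 1. ((real d - 1) * g + 1 / g) * (f x)\<^sup>2) - (\<Sum>x<d + 1. - (f x)\<^sup>2)"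
      unfolding qform_def adj using dg by simp
    also have "\<dots> = (\<Sum>x<d + 1. ((real d - 1) * g + 1 / g + 1) * (f x)\<^sup>2)"
      unfolding sum_subtractf[symmetric] by (intro sum.cong refl) (simp add: algebra_simps)
    also have "\<dots> \<ge> 0"
    proof (cases "d = 0")
      case True
      then have "f 0 = 0" using f by simp
      then show ?thesis using True by simp
    next
      case False
      then have "(real d - 1) * g \<ge> 0" using assms by simp
      then have "(real d - 1) * g + 1 / g + 1 \<ge> 0" using assms by (simp add: add_nonneg_nonneg)
      then show ?thesis by (intro sum_nonneg mult_nonneg_nonneg) auto
    qed
    finally show ?thesis .
  qed
  moreover have "graph_on (d + 1) ?E" by (auto simp: graph_on_def)
  ultimately show ?thesis using dg unfolding expander_on_def by auto
qed

text \<open>Induction on a bound for the number of short closed walks counted along any short closed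
  walk. Each two-lift lowers the bound. At 0 no short closed walk is left, since a walk is itself
  counted at its starting vertex.\<close>

theorem high_girth_expander:
  assumes g: "0 < g" "g < 1"
  obtains n E where "expander_on d n E g" "\<And>v. closed_walks E L v = {}"
proof -
  have "\<exists>n' E'. expander_on d n' E' g \<and> (\<forall>v. closed_walks E' L v = {})"
    if "expander_on d n E g" "\<And>v ws. ws \<in> closed_walks E L v \<Longrightarrow> sum_list (map (closed_count E L) ws) \<le> m" for n E m
    using that
  proof (induction m arbitrary: n E)
    case (0 n E)
    have gr: "graph_on n E" using 0(1) by (simp add: expander_on_def)
    have "closed_walks E L v = {}" for v
    proof (rule ccontr)
      assume "closed_walks E L v \<noteq> {}"
      then obtain ws where ws: "ws \<in> closed_walks E L v" by blast
      then have "v \<in> set ws" by (cases ws) (auto simp: closed_walks_def)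
      then have "closed_count E L v \<in> set (map (closed_count E L) ws)" by simp
      then have "closed_count E L v \<le> sum_list (map (closed_count E L) ws)" by (rule member_le_sum_list) simp
      also have "\<dots> \<le> 0" by (rule 0(2)[OF ws])
      finally have "closed_count E L v = 0" by simp
      then show False using ws finite_closed_walks[OF gr] by (auto simp: closed_count_def)
    qed
    then show ?case using 0(1) by blast
  next
    case (Suc m n E)
    have gr: "graph_on n E" using Suc.prems(1) by (simp add: expander_on_def)
    obtain s where s: "graph_on (n * 2) (two_lift E s)" "new_nonneg 2 n (two_lift E s) g"
      "\<And>v ws. ws \<in> closed_walks (two_lift E s) L v \<Longrightarrow> sum_list (map (closed_count (two_lift E s) L) ws) \<le> m"
    proof (rule kill_short_cycles[OF gr g, of L m])
      show "sum_list (map (closed_count E L) ws) \<le> Suc m" if "ws \<in> closed_walks E L v" for v ws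
        by (rule Suc.prems(2)[OF that])
    qed blast
    show ?case
      by (rule Suc.IH[OF expander_on_cover[OF Suc.prems(1) two_lift_covers s(1,2)] s(3)])
  qed
  moreover obtain n E where E: "expander_on d n E g" using complete_graph_expander[OF g(1)] by blast
  moreover have "\<exists>m. \<forall>v ws. ws \<in> closed_walks E L v \<longrightarrow> sum_list (map (closed_count E L) ws) \<le> m"
  proof -
    have gr: "graph_on n E" using E by (simp add: expander_on_def)
    have "finite {xs. set xs \<subseteq> {..<n} \<and> length xs \<le> L}" by (simp add: finite_lists_length_le)
    then have "finite ((\<lambda>ws. sum_list (map (closed_count E L) ws)) ` {xs. set xs \<subseteq> {..<n} \<and> length xs \<le> L})"
      by (rule finite_imageI)
    then obtain m where m: "\<And>ws. set ws \<subseteq> {..<n} \<Longrightarrow> length ws \<le> L \<Longrightarrow> sum_list (map (closed_count E L) ws) \<le> m"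
      unfolding finite_nat_set_iff_bounded_le by blast
    show ?thesis
    proof (intro exI[of _ m] allI impI)
      fix v ws assume ws: "ws \<in> closed_walks E L v"
      then have "length ws \<le> L" by (simp add: closed_walks_def)
      then show "sum_list (map (closed_count E L) ws) \<le> m"
        by (rule m[OF closed_walk_vertices[OF gr ws]])
    qed
  qed
  ultimately show ?thesis using that by metis
qed

text \<open>No cycle is prescribed here: a cover never acquires short closed walks that its base
  lacks, so only the form needs attention.\<close>

lemma iterated_lift:
  assumes gr: "graph_on n E" and g: "0 < g" "g < 1"
  obtains E' where "graph_on (n * 2 ^ k) E'" "covers (2 ^ k) E' E" "new_nonneg (2 ^ k) n E' g"
proof -
  have "\<exists>E'. graph_on (n * 2 ^ k) E' \<and> covers (2 ^ k) E' E \<and> new_nonneg (2 ^ k) n E' g"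
  proof (induction k)
    case 0
    have "covers 1 E E" by (auto simp: covers_def)
    moreover have "qform n E g f = 0" if "\<forall>v<n. (\<Sum>x\<in>fibre 1 v. f x) = 0" for f
    proof -
      have "f v = 0" if "v < n" for v using that \<open>\<forall>v<n. (\<Sum>x\<in>fibre 1 v. f x) = 0\<close> by (simp add: fibre_def)
      then show ?thesis by (simp add: qform_def)
    qed
    ultimately show ?case using gr by (auto simp: new_nonneg_def)
  next
    case (Suc k)
    then obtain E' where E': "graph_on (n * 2 ^ k) E'" "covers (2 ^ k) E' E" "new_nonneg (2 ^ k) n E' g" by blast
    obtain s :: "nat \<Rightarrow> nat \<Rightarrow> real" where s: "\<And>x y. s x y = s y x" "\<And>x y. s x y = 1 \<or> s x y = -1"
      "\<And>f. (\<Sum>x<n * 2 ^ k. \<Sum>y | E' x y. s x y * (f x * f y)) \<le>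
          (\<Sum>x<n * 2 ^ k. ((real (card {y. E' x y}) - 1) * g + 1 / g) * (f x)\<^sup>2)"
    proof (rule negative_cycle_signing[of E' "n * 2 ^ k" g "{}"])
      show "E' x y \<Longrightarrow> E' y x" "\<not> E' x x" "E' x y \<Longrightarrow> x < n * 2 ^ k" for x y using E'(1) by (auto dest: graph_onD)
    qed (use g in auto)
    have gr2: "graph_on (n * (2 * 2 ^ k)) (two_lift E' s)"
      using graph_on_two_lift[of "n * 2 ^ k" E' s, OF E'(1) s(1)] by (simp add: ac_simps)
    have new: "new_nonneg 2 (n * 2 ^ k) (two_lift E' s) g"
      using s(3) by (intro new_nonneg_two_lift[OF E'(1) s(2)]) (simp add: deg_def)
    show ?case
      using gr2 covers_trans[OF E'(2) two_lift_covers, of s] new_nonneg_trans[OF E'(3) two_lift_covers gr2 new]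
      by (intro exI[of _ "two_lift E' s"]) auto
  qed
  then show ?thesis using that by blast
qed

section \<open>Lifting and cutting\<close>

fun nbhd :: "(nat \<Rightarrow> nat \<Rightarrow> bool) \<Rightarrow> nat \<Rightarrow> nat \<Rightarrow> nat set" where
  "nbhd E 0 x = {x}"
| "nbhd E (Suc r) x = nbhd E r x \<union> (\<Union>y\<in>nbhd E r x. {z. E y z})"

lemma nbhd_self: "x \<in> nbhd E r x"
  by (induction r) auto

lemma nbhd_mono: "r \<le> r' \<Longrightarrow> nbhd E r x \<subseteq> nbhd E r' x"
  by (induction r' rule: dec_induct) auto

lemma nbhd_step: "E x y \<Longrightarrow> nbhd E r y \<subseteq> nbhd E (Suc r) x"
  by (induction r) auto

lemma nbhd_sym:
  assumes "\<And>x y. E x y \<Longrightarrow> E y x"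
  shows "y \<in> nbhd E r x \<Longrightarrow> x \<in> nbhd E r y"
proof (induction r arbitrary: y)
  case (Suc r)
  then consider "y \<in> nbhd E r x" | z where "z \<in> nbhd E r x" "E z y" by auto
  then show ?case
  proof cases
    case 2
    then show ?thesis using Suc.IH[of z] nbhd_step[of E y z r] assms by blast
  qed (use Suc.IH nbhd_mono[of r "Suc r" E y] in auto)
qed simp

lemma finite_nbhd: "graph_on n E \<Longrightarrow> finite (nbhd E r x)"
  by (induction r) (auto simp: finite_nbrs)

lemma card_nbhd:
  assumes "graph_on n E" "\<And>x. deg E x \<le> d"
  shows "card (nbhd E r x) \<le> (d + 1) ^ r"
proof (induction r)
  case (Suc r)
  have "card (nbhd E (Suc r) x) \<le> card (nbhd E r x) + card (\<Union>y\<in>nbhd E r x. {z. E y z})"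
    by (simp add: card_Un_le)
  also have "card (\<Union>y\<in>nbhd E r x. {z. E y z}) \<le> (\<Sum>y\<in>nbhd E r x. card {z. E y z})"
    by (rule card_UN_le[OF finite_nbhd[OF assms(1)]])
  also have "\<dots> \<le> (\<Sum>y\<in>nbhd E r x. d)"
    using assms(2) by (intro sum_mono) (simp add: deg_def)
  finally have "card (nbhd E (Suc r) x) \<le> (d + 1) * card (nbhd E r x)" by (simp add: mult.commute)
  also have "\<dots> \<le> (d + 1) * (d + 1) ^ r" by (rule mult_le_mono2[OF Suc])
  finally show ?case by simp
qed simp

lemma nbhd_project:
  assumes "covers N E' E"
  shows "y \<in> nbhd E' r x \<Longrightarrow> y div N \<in> nbhd E r (x div N)"
proof (induction r arbitrary: y)
  case (Suc r)
  then consider "y \<in> nbhd E' r x" | z where "z \<in> nbhd E' r x" "E' z y" by auto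
  then show ?case
  proof cases
    case 2
    then have "E (z div N) (y div N)" using assms unfolding covers_def by blast
    then show ?thesis using Suc.IH[OF 2(1)] by auto
  qed (use Suc.IH in auto)
qed simp

text \<open>
  Each \<open>u \<in> U\<close> is the tail of a chosen lift \<open>(u, \<tau> u)\<close> of a directed edge in \<open>A\<close>; every directed edge
  has exactly one lift, opposite directions have opposite lifts, and different lifts are more than \<open>r\<close> apart.
\<close>

definition dart_system :: "nat \<Rightarrow> nat \<Rightarrow> (nat \<Rightarrow> nat \<Rightarrow> bool) \<Rightarrow> (nat \<times> nat) set \<Rightarrow> nat set \<Rightarrow> (nat \<Rightarrow> nat) \<Rightarrow> bool" where
  "dart_system N r E' A U \<tau> \<longleftrightarrow>
     (\<forall>u\<in>U. \<tau> u \<in> U \<and> E' u (\<tau> u) \<and> \<tau> (\<tau> u) = u \<and> (u div N, \<tau> u div N) \<in> A) \<and>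
     (\<forall>(v, w)\<in>A. \<exists>u\<in>U. u div N = v \<and> \<tau> u div N = w) \<and>
     (\<forall>u\<in>U. \<forall>u'\<in>U. u div N = u' div N \<longrightarrow> \<tau> u div N = \<tau> u' div N \<longrightarrow> u = u') \<and>
     (\<forall>u\<in>U. \<forall>u'\<in>U. u' \<in> nbhd E' r u \<longrightarrow> u' = u \<or> u' = \<tau> u)"

lemma dart_systemD:
  assumes "dart_system N r E' A U \<tau>"
  shows "u \<in> U \<Longrightarrow> \<tau> u \<in> U" "u \<in> U \<Longrightarrow> E' u (\<tau> u)" "u \<in> U \<Longrightarrow> \<tau> (\<tau> u) = u"
    "u \<in> U \<Longrightarrow> (u div N, \<tau> u div N) \<in> A"
    "(v, w) \<in> A \<Longrightarrow> \<exists>u\<in>U. u div N = v \<and> \<tau> u div N = w"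
    "u \<in> U \<Longrightarrow> u' \<in> U \<Longrightarrow> u div N = u' div N \<Longrightarrow> \<tau> u div N = \<tau> u' div N \<Longrightarrow> u = u'"
    "u \<in> U \<Longrightarrow> u' \<in> U \<Longrightarrow> u' \<in> nbhd E' r u \<Longrightarrow> u' = u \<or> u' = \<tau> u"
proof -
  note D = assms[unfolded dart_system_def]
  show "u \<in> U \<Longrightarrow> \<tau> u \<in> U" "u \<in> U \<Longrightarrow> E' u (\<tau> u)" "u \<in> U \<Longrightarrow> \<tau> (\<tau> u) = u"
    "u \<in> U \<Longrightarrow> (u div N, \<tau> u div N) \<in> A"
    using bspec[OF D[THEN conjunct1], of u] by blast+
  show "(v, w) \<in> A \<Longrightarrow> \<exists>u\<in>U. u div N = v \<and> \<tau> u div N = w"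
    using bspec[OF D[THEN conjunct2, THEN conjunct1], of "(v, w)"] by simp
  show "u \<in> U \<Longrightarrow> u' \<in> U \<Longrightarrow> u div N = u' div N \<Longrightarrow> \<tau> u div N = \<tau> u' div N \<Longrightarrow> u = u'"
    using bspec[OF bspec[OF D[THEN conjunct2, THEN conjunct2, THEN conjunct1], of u], of u'] by blast
  show "u \<in> U \<Longrightarrow> u' \<in> U \<Longrightarrow> u' \<in> nbhd E' r u \<Longrightarrow> u' = u \<or> u' = \<tau> u"
    using bspec[OF bspec[OF D[THEN conjunct2, THEN conjunct2, THEN conjunct2], of u], of u'] by blast
qed

text \<open>A greedy choice. Only tails lying over the ball of radius \<open>Suc r\<close> about
  \<open>v\<close> can be close to a lift of \<open>v\<close>. Each fibre holds at most
  \<open>d\<close> tails, since tails in a fibre are told apart by where their heads project, and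
  each tail excludes one ball, so fewer than \<open>N\<close> lifts are excluded. The extra unit of
  radius protects the other end \<open>y\<close> as well. The bound on \<open>N\<close> does not
  involve \<open>n\<close>.\<close>

lemma dart_system_extend:
  assumes gr: "graph_on n E" "graph_on (n * N) E'" and cov: "covers N E' E" and deg: "\<And>x. deg E x \<le> d"
    and N: "N > d * ((d + 1) ^ Suc r * (d + 1) ^ Suc r)"
    and D: "dart_system N r E' A U \<tau>" and A: "\<And>v w. (v, w) \<in> A \<Longrightarrow> E v w"
    and vw: "E v w" "(v, w) \<notin> A" "(w, v) \<notin> A"
  shows "\<exists>U \<tau>. dart_system N r E' (insert (v, w) (insert (w, v) A)) U \<tau>"
proof -
  let ?R = "Suc r" and ?C = "(d + 1) ^ Suc r"
  have N0: "N > 0" using cov by (simp add: covers_def)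
  have sym': "E' x y \<Longrightarrow> E' y x" for x y using graph_onD(3)[OF gr(2)] by blast
  note U = dart_systemD(1-4)[OF D] and U_inj = dart_systemD(6)[OF D]
  have deg': "deg E' x \<le> d" for x using covers_deg[OF cov] deg by simp
  have fibU: "finite {u \<in> U. u div N = z} \<and> card {u \<in> U. u div N = z} \<le> d" for z
  proof -
    have inj: "inj_on (\<lambda>u. \<tau> u div N) {u \<in> U. u div N = z}"
      using U_inj by (auto simp: inj_on_def)
    moreover have sub: "(\<lambda>u. \<tau> u div N) ` {u \<in> U. u div N = z} \<subseteq> {y. E z y}"
      using U(4) A by blast
    ultimately have "card {u \<in> U. u div N = z} \<le> card {y. E z y}"
      by (intro card_inj_on_le finite_nbrs[OF gr(1)])
    then show ?thesis
      using deg[of z] finite_imageD[OF finite_subset[OF sub finite_nbrs[OF gr(1)]] inj] by (simp add: deg_def)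
  qed
  define W where "W = (\<Union>z\<in>nbhd E ?R v. {u \<in> U. u div N = z})"
  have "card W \<le> (\<Sum>z\<in>nbhd E ?R v. card {u \<in> U. u div N = z})"
    unfolding W_def by (rule card_UN_le[OF finite_nbhd[OF gr(1)]])
  also have "\<dots> \<le> (\<Sum>z\<in>nbhd E ?R v. d)" using fibU by (intro sum_mono) blast
  also have "\<dots> \<le> ?C * d" using card_nbhd[OF gr(1) deg, of ?R v] by simp
  finally have cardW: "card W \<le> ?C * d" .
  have finW: "finite W" unfolding W_def using fibU finite_nbhd[OF gr(1)] by blast
  define X where "X = (\<Union>u\<in>W. nbhd E' ?R u)"
  have "card X \<le> (\<Sum>u\<in>W. card (nbhd E' ?R u))" unfolding X_def by (rule card_UN_le[OF finW])
  also have "\<dots> \<le> (\<Sum>u\<in>W. ?C)" by (intro sum_mono card_nbhd[OF gr(2) deg'])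
  also have "\<dots> \<le> ?C * d * ?C" using cardW by simp
  also have "\<dots> < card (fibre N v)" using N by (simp add: ac_simps)
  finally have "card X < card (fibre N v)" .
  moreover have "finite X" unfolding X_def using finW finite_nbhd[OF gr(2)] by blast
  ultimately have "\<not> fibre N v \<subseteq> X" using card_mono leD by blast
  then obtain x where x: "x div N = v" "x \<notin> X" using in_fibre_iff[OF N0] by blast
  have far_x: "u \<notin> nbhd E' ?R x" if "u \<in> U" for u
  proof
    assume u: "u \<in> nbhd E' ?R x"
    then have "u div N \<in> nbhd E ?R v" using nbhd_project[OF cov] x(1) by blast
    then have "u \<in> W" using that by (auto simp: W_def)
    moreover have "x \<in> nbhd E' ?R u" by (rule nbhd_sym[OF sym' u])
    ultimately show False using x(2) by (auto simp: X_def)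
  qed
  obtain y where y: "y div N = w" "E' x y" using cov vw(1) x(1) unfolding covers_def by blast
  have far: "u \<notin> nbhd E' r x" "u \<notin> nbhd E' r y" "x \<notin> nbhd E' r u" "y \<notin> nbhd E' r u" if "u \<in> U" for u
  proof -
    show 1: "u \<notin> nbhd E' r x" using far_x[OF that] nbhd_mono[of r ?R E' x] by auto
    show 2: "u \<notin> nbhd E' r y" using far_x[OF that] nbhd_step[of E' x y r] y(2) by auto
    show "x \<notin> nbhd E' r u" using 1 nbhd_sym[of E', OF sym'] by blast
    show "y \<notin> nbhd E' r u" using 2 nbhd_sym[of E', OF sym'] by blast
  qed
  have xyU: "x \<notin> U" "y \<notin> U" using far nbhd_self by blast+
  have xy: "x \<noteq> y" using graph_onD(4)[OF gr(2) y(2)] by simp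
  have vw_ne: "v \<noteq> w" using graph_onD(4)[OF gr(1) vw(1)] by simp
  define \<tau>' where "\<tau>' u = (if u = x then y else if u = y then x else \<tau> u)" for u
  have \<tau>'U: "\<tau>' u = \<tau> u" if "u \<in> U" for u using that xyU by (auto simp: \<tau>'_def)
  have \<tau>'xy: "\<tau>' x = y" "\<tau>' y = x" using xy by (auto simp: \<tau>'_def)
  have "dart_system N r E' (insert (v, w) (insert (w, v) A)) (insert x (insert y U)) \<tau>'"
    unfolding dart_system_def
  proof (intro conjI)
    show "\<forall>u\<in>insert x (insert y U). \<tau>' u \<in> insert x (insert y U) \<and> E' u (\<tau>' u) \<and> \<tau>' (\<tau>' u) = u \<and>
        (u div N, \<tau>' u div N) \<in> insert (v, w) (insert (w, v) A)"
      using U \<tau>'U \<tau>'xy x(1) y sym' by simp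
    show "\<forall>(v, w)\<in>insert (v, w) (insert (w, v) A). \<exists>u\<in>insert x (insert y U). u div N = v \<and> \<tau>' u div N = w"
    proof (safe)
      show "\<exists>u\<in>insert x (insert y U). u div N = v \<and> \<tau>' u div N = w"
        by (rule bexI[of _ x]) (simp_all add: x(1) y(1) \<tau>'xy)
      show "\<exists>u\<in>insert x (insert y U). u div N = w \<and> \<tau>' u div N = v"
        by (rule bexI[of _ y]) (simp_all add: x(1) y(1) \<tau>'xy)
      fix a b assume "(a, b) \<in> A"
      then obtain u where "u \<in> U" "u div N = a" "\<tau> u div N = b" using dart_systemD(5)[OF D] by blast
      then show "\<exists>u\<in>insert x (insert y U). u div N = a \<and> \<tau>' u div N = b" using \<tau>'U by auto
    qed
    show "\<forall>u\<in>insert x (insert y U). \<forall>u'\<in>insert x (insert y U). u div N = u' div N \<longrightarrow>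
        \<tau>' u div N = \<tau>' u' div N \<longrightarrow> u = u'"
    proof (intro ballI impI)
      have 1: "\<not> (a div N = v \<and> \<tau> a div N = w)" "\<not> (a div N = w \<and> \<tau> a div N = v)" if "a \<in> U" for a
        using U(4)[OF that] vw(2,3) by auto
      fix u u' assume u: "u \<in> insert x (insert y U)" "u' \<in> insert x (insert y U)"
        and eq: "u div N = u' div N" "\<tau>' u div N = \<tau>' u' div N"
      consider "u = u'" | "u \<in> {x, y}" "u' \<in> {x, y}" "u \<noteq> u'" | "u \<in> {x, y}" "u' \<in> U"
        | "u \<in> U" "u' \<in> {x, y}" | "u \<in> U" "u' \<in> U"
        using u by blast
      then show "u = u'"
      proof cases
        case 2
        then show ?thesis using eq(1) x(1) y(1) vw_ne by auto
      next
        case 3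
        then show ?thesis using eq 1[OF 3(2)] x(1) y(1) \<tau>'xy \<tau>'U[OF 3(2)] by auto
      next
        case 4
        then show ?thesis using eq 1[OF 4(1)] x(1) y(1) \<tau>'xy \<tau>'U[OF 4(1)] by auto
      next
        case 5
        then show ?thesis using eq U_inj[OF 5] \<tau>'U[OF 5(1)] \<tau>'U[OF 5(2)] by simp
      qed simp
    qed
    show "\<forall>u\<in>insert x (insert y U). \<forall>u'\<in>insert x (insert y U). u' \<in> nbhd E' r u \<longrightarrow> u' = u \<or> u' = \<tau>' u"
    proof (intro ballI impI)
      fix u u' assume u: "u \<in> insert x (insert y U)" "u' \<in> insert x (insert y U)" "u' \<in> nbhd E' r u"
      consider "u \<in> {x, y}" "u' \<in> {x, y}" | "u \<in> {x, y}" "u' \<in> U" | "u \<in> U" "u' \<in> {x, y}" | "u \<in> U" "u' \<in> U"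
        using u by blast
      then show "u' = u \<or> u' = \<tau>' u"
      proof cases
        case 1
        then show ?thesis using \<tau>'xy by auto
      next
        case 2
        then show ?thesis using u(3) far[OF 2(2)] by auto
      next
        case 3
        then show ?thesis using u(3) far[OF 3(1)] by auto
      next
        case 4
        then show ?thesis using dart_systemD(7)[OF D 4 u(3)] \<tau>'U[OF 4(1)] by simp
      qed
    qed
  qed
  then show ?thesis by blast
qed

lemma exists_dart_system:
  assumes gr: "graph_on n E" "graph_on (n * N) E'" and cov: "covers N E' E" and deg: "\<And>x. deg E x \<le> d"
    and N: "N > d * ((d + 1) ^ Suc r * (d + 1) ^ Suc r)"
  obtains U \<tau> where "dart_system N r E' {(v, w). E v w} U \<tau>"
proof -
  have "\<exists>U \<tau>. dart_system N r E' (P \<union> P\<inverse>) U \<tau>" if "finite P" "P \<subseteq> {(v, w). v < w \<and> E v w}" for P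
    using that
  proof (induction P rule: finite_induct)
    case empty
    have "dart_system N r E' {} {} id" by (simp add: dart_system_def)
    then show ?case by auto
  next
    case (insert e P)
    obtain v w where e: "e = (v, w)" "v < w" "E v w" using insert.prems by auto
    obtain U \<tau> where D: "dart_system N r E' (P \<union> P\<inverse>) U \<tau>" using insert by blast
    have new: "(v, w) \<notin> P \<union> P\<inverse>" "(w, v) \<notin> P \<union> P\<inverse>" using insert.hyps(2) insert.prems e(1,2) by auto
    have edges: "E a b" if "(a, b) \<in> P \<union> P\<inverse>" for a b
      using that insert.prems graph_onD(3)[OF gr(1)] by auto
    have "insert (v, w) (insert (w, v) (P \<union> P\<inverse>)) = insert e P \<union> (insert e P)\<inverse>"
      using e(1) by auto
    then show ?case using dart_system_extend[OF gr cov deg N D edges e(3) new] by simp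
  qed
  moreover have "finite {(v, w). v < w \<and> E v w}"
    by (rule finite_subset[of _ "{..<n} \<times> {..<n}"]) (auto dest: graph_onD[OF gr(1)])
  moreover have "{(v, w). v < w \<and> E v w} \<union> {(v, w). v < w \<and> E v w}\<inverse> = {(v, w). E v w}"
    using graph_onD(3,4)[OF gr(1)] by (auto) (metis linorder_neqE_nat)
  ultimately have "\<exists>U \<tau>. dart_system N r E' {(v, w). E v w} U \<tau>" by force
  then show ?thesis using that by blast
qed

text \<open>
  \<open>branch E U \<tau> r u x p\<close>: \<open>x\<close> is reached from the dart \<open>u\<close> by a non-backtracking walk of length \<open>r\<close>
  that avoids \<open>\<tau> u\<close>, and \<open>p\<close> is the vertex before \<open>x\<close>.
\<close>

inductive branch :: "(nat \<Rightarrow> nat \<Rightarrow> bool) \<Rightarrow> nat set \<Rightarrow> (nat \<Rightarrow> nat) \<Rightarrow> nat \<Rightarrow> nat \<Rightarrow> nat \<Rightarrow> nat \<Rightarrow> bool"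
  for E U \<tau> where
  root: "u \<in> U \<Longrightarrow> branch E U \<tau> 0 u u (\<tau> u)"
| step: "branch E U \<tau> r u x p \<Longrightarrow> E x y \<Longrightarrow> y \<noteq> p \<Longrightarrow> branch E U \<tau> (Suc r) u y x"

inductive_cases branch_0E: "branch E U \<tau> 0 u x p"
inductive_cases branch_SucE: "branch E U \<tau> (Suc r) u x p"

lemma nb_walk_snoc:
  assumes "nb_walk E xs" "length xs = Suc (Suc k)" "E (xs ! Suc k) y" "y \<noteq> xs ! k"
  shows "nb_walk E (xs @ [y])"
  using assms unfolding nb_walk_def by (auto simp: nth_append less_Suc_eq)

lemma nb_walk_nbhd:
  assumes "nb_walk E xs" "i + k < length xs"
  shows "xs ! (i + k) \<in> nbhd E k (xs ! i)"
  using assms(2)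
proof (induction k)
  case (Suc k)
  then have "xs ! (i + k) \<in> nbhd E k (xs ! i)" "E (xs ! (i + k)) (xs ! (i + Suc k))"
    using assms(1) by (auto simp: nb_walk_def)
  then show ?case by auto
qed simp

lemma nb_walk_sub:
  assumes "nb_walk E xs" "i + k \<le> length xs"
  shows "nb_walk E (take k (drop i xs))"
  using assms unfolding nb_walk_def by (auto simp: add.assoc)

text \<open>Follow \<open>xs\<close> to the common end and return along \<open>ys\<close>; the
  differing predecessors prevent backtracking at the joint.\<close>

lemma nb_walk_glue:
  assumes xs: "nb_walk E xs" "length xs = Suc (Suc a)" and ys: "nb_walk E ys" "length ys = Suc (Suc b)"
    and eq: "xs ! Suc a = ys ! Suc b" and ne: "xs ! a \<noteq> ys ! b" and sym: "\<forall>x y. E x y \<longrightarrow> E y x"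
  defines "zs \<equiv> xs @ tl (rev ys)"
  shows "nb_walk E zs" "length zs = a + b + 3"
    "\<And>i. i \<le> Suc a \<Longrightarrow> zs ! i = xs ! i" "\<And>i. i \<le> Suc b \<Longrightarrow> zs ! (a + b + 2 - i) = ys ! i"
proof -
  show len: "length zs = a + b + 3" using xs(2) ys(2) by (simp add: zs_def)
  show z1: "zs ! i = xs ! i" if "i \<le> Suc a" for i using that xs(2) by (simp add: zs_def nth_append)
  have z2': "zs ! (Suc a + j) = ys ! (Suc b - j)" if "j \<le> Suc b" for j
  proof (cases j)
    case 0
    then show ?thesis using z1[of "Suc a"] eq by simp
  next
    case (Suc k)
    then show ?thesis
      using that xs(2) ys(2) by (simp add: zs_def nth_append nth_tl rev_nth)
  qed
  show z2: "zs ! (a + b + 2 - i) = ys ! i" if "i \<le> Suc b" for i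
  proof -
    have "Suc a + (Suc b - i) = a + b + 2 - i" "Suc b - (Suc b - i) = i" using that by arith+
    then show ?thesis using z2'[of "Suc b - i"] by (metis diff_le_self)
  qed
  have X: "Suc i < length xs \<Longrightarrow> E (xs ! i) (xs ! Suc i)" "Suc (Suc i) < length xs \<Longrightarrow> xs ! i \<noteq> xs ! Suc (Suc i)" for i
    using xs(1) by (auto simp: nb_walk_def)
  have Y: "Suc i < length ys \<Longrightarrow> E (ys ! i) (ys ! Suc i)" "Suc (Suc i) < length ys \<Longrightarrow> ys ! i \<noteq> ys ! Suc (Suc i)" for i
    using ys(1) by (auto simp: nb_walk_def)
  show "nb_walk E zs"
    unfolding nb_walk_def len
  proof (intro conjI allI impI)
    fix i assume i: "Suc i < a + b + 3"
    show "E (zs ! i) (zs ! Suc i)"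
    proof (cases "i \<le> a")
      case True
      then show ?thesis using X(1)[of i] z1[of i] z1[of "Suc i"] xs(2) by simp
    next
      case False
      define j where "j = i - Suc a"
      have j: "i = Suc a + j" "Suc j \<le> Suc b" using False i by (auto simp: j_def)
      have "E (ys ! (b - j)) (ys ! Suc (b - j))" using Y(1)[of "b - j"] ys(2) j by simp
      moreover have "zs ! i = ys ! Suc (b - j)" using z2'[of j] j by (simp add: Suc_diff_le)
      moreover have "zs ! Suc i = ys ! (b - j)" using z2'[of "Suc j"] j by simp
      ultimately show ?thesis using sym by simp
    qed
  next
    fix i assume i: "Suc (Suc i) < a + b + 3"
    consider "Suc i \<le> a" | "i = a" | "i > a" by linarith
    then show "zs ! i \<noteq> zs ! Suc (Suc i)"
    proof cases
      case 1
      then show ?thesis using X(2)[of i] z1[of i] z1[of "Suc (Suc i)"] xs(2) by simp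
    next
      case 2
      then show ?thesis using ne z1[of a] z2'[of 1] by simp
    next
      case 3
      define j where "j = i - Suc a"
      have j: "i = Suc a + j" "Suc (Suc j) \<le> Suc b" using 3 i by (auto simp: j_def)
      have "ys ! (b - Suc j) \<noteq> ys ! Suc (Suc (b - Suc j))" using Y(2)[of "b - Suc j"] ys(2) j by simp
      moreover have "zs ! i = ys ! Suc (Suc (b - Suc j))"
        using z2'[of j] j by (simp add: Suc_diff_Suc Suc_diff_le)
      moreover have "zs ! Suc (Suc i) = ys ! (b - Suc j)" using z2'[of "Suc (Suc j)"] j by simp
      ultimately show ?thesis by simp
    qed
  qed
qed

lemma branch_walk:
  assumes "branch E U \<tau> r u x p" and "\<And>u. u \<in> U \<Longrightarrow> E (\<tau> u) u"
  shows "\<exists>xs. nb_walk E xs \<and> length xs = Suc (Suc r) \<and> xs ! 0 = \<tau> u \<and> xs ! 1 = u \<and> xs ! r = p \<and> xs ! Suc r = x"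
  using assms(1)
proof (induction rule: branch.induct)
  case (root u)
  have "nb_walk E [\<tau> u, u]" using assms(2)[OF root] by (simp add: nb_walk_def)
  then show ?case by (intro exI[of _ "[\<tau> u, u]"]) simp
next
  case (step r u x p y)
  then obtain xs where xs: "nb_walk E xs" "length xs = Suc (Suc r)" "xs ! 0 = \<tau> u" "xs ! 1 = u" "xs ! r = p" "xs ! Suc r = x"
    by blast
  have "nb_walk E (xs @ [y])" using nb_walk_snoc[OF xs(1,2)] xs(5,6) step by simp
  moreover have "(xs @ [y]) ! 0 = \<tau> u" "(xs @ [y]) ! 1 = u" "(xs @ [y]) ! Suc r = x" "(xs @ [y]) ! Suc (Suc r) = y"
    using xs by (simp_all add: nth_append)
  ultimately show ?case using xs(2) by (intro exI[of _ "xs @ [y]"]) simp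
qed

section \<open>Disjoint trees growing from the darts\<close>

locale dart_stage =
  fixes n N d h :: nat and E E' :: "nat \<Rightarrow> nat \<Rightarrow> bool" and U :: "nat set" and \<tau> :: "nat \<Rightarrow> nat"
  assumes gr: "graph_on n E" and gr': "graph_on (n * N) E'" and cov: "covers N E' E"
    and deg_le: "deg E x \<le> d"
    and darts: "dart_system N (2 * h + 2) E' {(v, w). E v w} U \<tau>"
    and no_closed: "closed_walks E' (2 * h + 4) v = {}"
begin

lemmas \<tau>_in = dart_systemD(1)[OF darts] and \<tau>_adj = dart_systemD(2)[OF darts]
  and \<tau>_inv = dart_systemD(3)[OF darts] and far = dart_systemD(7)[OF darts]

lemma E'_sym: "E' x y \<Longrightarrow> E' y x"
  by (rule graph_onD(3)[OF gr'])

abbreviation "br \<equiv> branch E' U \<tau>"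

text \<open>The trees of depth \<open>h + 1\<close> at the darts are embedded and pairwise disjoint.
  Two arrivals at \<open>x\<close> through the same predecessor reduce to shorter branches. Through
  different predecessors they glue to a walk from \<open>u\<close> to \<open>u'\<close> with at most
  2h + 2 edges; separation leaves only \<open>u' = u\<close> or \<open>u' = \<tau> u\<close>, and in
  both cases a short closed walk results.\<close>

lemma branch_unique:
  assumes "br r u x p" "br r' u' x p'" "r \<le> h + 1" "r' \<le> h + 1"
  shows "r = r' \<and> u = u' \<and> p = p'"
  using assms
proof (induction "r + r'" arbitrary: r r' x p p' u u' rule: less_induct)
  case less
  have rev_adj: "\<And>u. u \<in> U \<Longrightarrow> E' (\<tau> u) u" using \<tau>_adj E'_sym by blast
  show ?case
  proof (cases "p = p'")
    case True
    show ?thesis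
    proof (cases r; cases r')
      fix a b assume ab: "r = Suc a" "r' = Suc b"
      obtain q where q: "br a u p q" using less.prems(1) unfolding ab by (elim branch_SucE) blast
      obtain q' where q': "br b u' p q'" using less.prems(2) True unfolding ab by (elim branch_SucE) blast
      have "a = b \<and> u = u' \<and> q = q'" using less.prems(3,4) ab by (intro less.hyps[OF _ q q']) auto
      then show ?thesis using True ab by simp
    next
      assume "r = 0" "r' = 0"
      then show ?thesis using less.prems(1,2) True by (auto elim!: branch_0E)
    next
      fix b assume b: "r = 0" "r' = Suc b"
      have x: "u = x" "p = \<tau> x" "x \<in> U" using less.prems(1) unfolding b by (auto elim!: branch_0E)
      obtain q' where q': "br b u' p q'" "x \<noteq> q'" using less.prems(2) True unfolding b by (elim branch_SucE) blast
      \<comment> \<open>The predecessor of a root is the other end of its dart, itself a root with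
        predecessor \<open>x\<close>, so the descent continues across the dart.\<close>
      have "br 0 p p x" using branch.root[of "\<tau> x" U E' \<tau>] \<tau>_in[OF x(3)] \<tau>_inv[OF x(3)] x(2) by simp
      then have "0 = b \<and> p = u' \<and> x = q'" using less.prems(3,4) b by (intro less.hyps[OF _ _ q'(1)]) auto
      then show ?thesis using q'(2) by simp
    next
      fix b assume b: "r = Suc b" "r' = 0"
      have x: "u' = x" "p' = \<tau> x" "x \<in> U" using less.prems(2) unfolding b by (auto elim!: branch_0E)
      obtain q where q: "br b u p q" "x \<noteq> q" using less.prems(1) unfolding b by (elim branch_SucE) blast
      have "br 0 p p x" using branch.root[of "\<tau> x" U E' \<tau>] \<tau>_in[OF x(3)] \<tau>_inv[OF x(3)] x(2) True by simp
      then have "0 = b \<and> p = u \<and> x = q" using less.prems(3,4) b by (intro less.hyps[OF _ _ q(1)]) auto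
      then show ?thesis using q(2) by simp
    qed
  next
    case False
    obtain xs where xs: "nb_walk E' xs" "length xs = Suc (Suc r)" "xs ! 0 = \<tau> u" "xs ! 1 = u" "xs ! r = p" "xs ! Suc r = x"
      using branch_walk[OF less.prems(1) rev_adj] by blast
    obtain ys where ys: "nb_walk E' ys" "length ys = Suc (Suc r')" "ys ! 0 = \<tau> u'" "ys ! 1 = u'" "ys ! r' = p'" "ys ! Suc r' = x"
      using branch_walk[OF less.prems(2) rev_adj] by blast
    define zs where "zs = xs @ tl (rev ys)"
    have eq: "xs ! Suc r = ys ! Suc r'" and ne: "xs ! r \<noteq> ys ! r'" using xs ys False by simp_all
    have "\<forall>x y. E' x y \<longrightarrow> E' y x" using E'_sym by blast
    note glue = nb_walk_glue[OF xs(1,2) ys(1,2) eq ne this, folded zs_def]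
    have z0: "zs ! 0 = \<tau> u" "zs ! 1 = u" using glue(3)[of 0] glue(3)[of 1] xs(3,4) by simp_all
    have ze: "zs ! (r + r' + 1) = u'" using glue(4)[of 1] ys(4) by simp
    have uU: "u \<in> U" if "br r u x p" for r u x p using that by (induction rule: branch.induct)
    have "u' \<in> nbhd E' (r + r') u" using nb_walk_nbhd[OF glue(1), of 1 "r + r'"] z0(2) ze glue(2) by simp
    then have "u' \<in> nbhd E' (2 * h + 2) u" using nbhd_mono[of "r + r'" "2 * h + 2" E' u] less.prems(3,4) by auto
    then have "u' = u \<or> u' = \<tau> u" using far uU[OF less.prems(1)] uU[OF less.prems(2)] by blast
    then have False
    proof
      assume "u' = u"
      have "r + r' \<noteq> 0"
      proof
        assume "r + r' = 0"
        then have "br 0 u x p" "br 0 u' x p'" using less.prems(1,2) by simp_all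
        then show False using False by (auto elim!: branch_0E)
      qed
      define ws where "ws = take (r + r' + 1) (drop 1 zs)"
      have len: "length ws = r + r' + 1" using glue(2) by (simp add: ws_def)
      then have "ws \<noteq> []" by auto
      then have "hd ws = u" "last ws = u"
        using len z0(2) ze \<open>u' = u\<close> glue(2) by (simp_all add: hd_conv_nth last_conv_nth) (simp_all add: ws_def)
      moreover have "nb_walk E' ws" unfolding ws_def by (rule nb_walk_sub[OF glue(1)], unfold glue(2), linarith)
      moreover have "2 \<le> length ws" "length ws \<le> 2 * h + 4"
        using len \<open>r + r' \<noteq> 0\<close> less.prems(3,4) by linarith+
      ultimately have "ws \<in> closed_walks E' (2 * h + 4) u" by (simp add: closed_walks_def)
      then show False using no_closed by blast
    next
      assume "u' = \<tau> u"
      \<comment> \<open>This is the longer of the two closed walks: starting at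
        \<open>\<tau> u\<close> it has up to 2h + 4 entries, the length in
        \<open>no_closed\<close>.\<close>
      define ws where "ws = take (r + r' + 2) (drop 0 zs)"
      have len: "length ws = r + r' + 2" using glue(2) by (simp add: ws_def)
      then have "ws \<noteq> []" by auto
      then have "hd ws = \<tau> u" "last ws = \<tau> u"
        using len z0(1) ze \<open>u' = \<tau> u\<close> glue(2) by (simp_all add: hd_conv_nth last_conv_nth) (simp_all add: ws_def)
      moreover have "nb_walk E' ws" unfolding ws_def by (rule nb_walk_sub[OF glue(1)], unfold glue(2), linarith)
      ultimately have "ws \<in> closed_walks E' (2 * h + 4) (\<tau> u)"
        using len less.prems(3,4) by (simp add: closed_walks_def)
      then show False using no_closed by blast
    qed
    then show ?thesis ..
  qed
qed

text \<open>The value \<open>\<psi> u\<close> is copied to all vertices at depth \<open>r\<close> in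
  the tree of \<open>u\<close>. By uniqueness of branches the choice operator is harmless for
  \<open>r \<le> h + 1\<close>.\<close>

definition level :: "nat \<Rightarrow> (nat \<Rightarrow> real) \<Rightarrow> nat \<Rightarrow> real" where
  "level r \<psi> x = (if \<exists>u p. br r u x p then \<psi> (SOME u. \<exists>p. br r u x p) else 0)"

lemma level_eq:
  assumes "br r u x p" "r \<le> h + 1"
  shows "level r \<psi> x = \<psi> u"
proof -
  have "(SOME u. \<exists>p. br r u x p) = u"
    using branch_unique[OF _ assms(1) assms(2) assms(2)] assms(1) by (intro some_equality) blast+
  then show ?thesis using assms(1) by (auto simp: level_def)
qed

lemma level_nonzero: "level r \<psi> x \<noteq> 0 \<Longrightarrow> \<exists>u p. br r u x p"
  by (auto simp: level_def split: if_splits)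

lemma level_zero: "(\<And>u p. \<not> br r u x p) \<Longrightarrow> level r \<psi> x = 0"
  by (simp add: level_def)

lemma level_other: "br r u x p \<Longrightarrow> r \<le> h + 1 \<Longrightarrow> r' \<le> h + 1 \<Longrightarrow> r \<noteq> r' \<Longrightarrow> level r' \<psi> x = 0"
proof (rule level_zero)
  fix u' p' assume "br r u x p" "r \<le> h + 1" "r' \<le> h + 1" "r \<noteq> r'"
  then show "\<not> br r' u' x p'" using branch_unique[of r u x p r' u' p'] by blast
qed

lemma level_0: "level 0 \<psi> x = (if x \<in> U then \<psi> x else 0)"
proof (cases "x \<in> U")
  case True
  then show ?thesis using level_eq[OF branch.root[of x U E' \<tau>]] by simp
next
  case False
  have "\<not> br 0 u x p" for u p
  proof
    assume "br 0 u x p"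
    then show False using \<open>x \<notin> U\<close> by cases simp
  qed
  then show ?thesis using level_zero[of 0 x \<psi>] False by simp
qed

lemma branch_parent:
  assumes "br r u x p"
  shows "E' x p" "r = 0 \<Longrightarrow> br 0 p p x" "r = Suc k \<Longrightarrow> \<exists>q. br k u p q \<and> x \<noteq> q"
proof -
  show "E' x p" using assms by cases (auto intro: E'_sym \<tau>_adj)
  show "br 0 p p x" if "r = 0"
  proof -
    have "x \<in> U" "p = \<tau> x" using assms unfolding that by (cases, simp)+
    then show ?thesis using branch.root[of "\<tau> x" U E' \<tau>] by (simp add: \<tau>_in \<tau>_inv)
  qed
  show "\<exists>q. br k u p q \<and> x \<noteq> q" if "r = Suc k"
    using assms unfolding that by cases blast
qed

lemma finite_nbrs': "finite {y. E' x y}"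
  by (rule finite_nbrs[OF gr'])

text \<open>Separation leaves a root no neighbour in \<open>U\<close> except its partner, and any
  other vertex at most one neighbour in \<open>U\<close>.\<close>

lemma sum_level_0: "(\<Sum>y | E' x y. level 0 \<psi> y) = level 1 \<psi> x + (if x \<in> U then \<psi> (\<tau> x) else 0)"
proof (cases "x \<in> U")
  case True
  have "level 1 \<psi> x = 0" using level_other[OF branch.root[OF True], of 1] by simp
  moreover have "(\<Sum>y | E' x y. level 0 \<psi> y) = (\<Sum>y | E' x y. if y = \<tau> x then \<psi> y else 0)"
  proof (intro sum.cong refl)
    fix y assume "y \<in> {y. E' x y}"
    then have "y \<in> nbhd E' (2 * h + 2) x" using nbhd_mono[of 1 "2 * h + 2" E' x] by auto
    moreover have "y \<noteq> x" using \<open>y \<in> {y. E' x y}\<close> graph_onD(4)[OF gr'] by blast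
    ultimately have "y \<notin> U \<or> y = \<tau> x" using far[OF True] by blast
    then show "level 0 \<psi> y = (if y = \<tau> x then \<psi> y else 0)"
      unfolding level_0 using \<tau>_in[OF True] by metis
  qed
  ultimately show ?thesis using True \<tau>_adj[OF True] finite_nbrs'[of x] by simp
next
  case False
  have child: "br 1 y x y" if "y \<in> U" "E' x y" for y
  proof -
    have "x \<noteq> \<tau> y" using False \<tau>_in[OF that(1)] by auto
    then show ?thesis using branch.step[OF branch.root[OF that(1)], of E' x] E'_sym[OF that(2)] by simp
  qed
  show ?thesis
  proof (cases "\<exists>y\<in>U. E' x y")
    case True
    then obtain y where y: "y \<in> U" "E' x y" by blast
    have "(\<Sum>z | E' x z. level 0 \<psi> z) = (\<Sum>z | E' x z. if z = y then \<psi> y else 0)"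
    proof (intro sum.cong refl)
      fix z assume "z \<in> {z. E' x z}"
      then have "z \<notin> U \<or> z = y" using branch_unique[OF child[OF y] child, of z] by auto
      then show "level 0 \<psi> z = (if z = y then \<psi> y else 0)"
        unfolding level_0 using y(1) by metis
    qed
    also have "\<dots> = \<psi> y" using y(2) by (subst sum.delta[OF finite_nbrs']) simp
    also have "\<psi> y = level 1 \<psi> x" by (rule level_eq[OF child[OF y], symmetric]) simp
    finally show ?thesis using False by simp
  next
    case no: False
    have "level 1 \<psi> x = 0"
    proof (rule level_zero)
      fix u p
      show "\<not> br 1 u x p"
      proof
        assume b: "br 1 u x p"
        from branch_parent(3)[OF b One_nat_def] obtain q where "br 0 u p q" by blast
        then have "p \<in> U" by cases simp
        then show False using no branch_parent(1)[OF b] by blast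
      qed
    qed
    moreover have "(\<Sum>y | E' x y. level 0 \<psi> y) = 0" using no by (intro sum.neutral) (auto simp: level_0)
    ultimately show ?thesis using False by simp
  qed
qed

text \<open>The adjacency recursion of a tree: a vertex at depth r + 2 sees its parent, a vertex at
  depth r sees its deg - 1 children, and nothing else is adjacent to depth r + 1.\<close>

lemma sum_level_Suc:
  assumes r: "Suc r \<le> h"
  shows "(\<Sum>y | E' x y. level (Suc r) \<psi> y) = level (Suc (Suc r)) \<psi> x + (real (deg E' x) - 1) * level r \<psi> x"
proof -
  have cases: "br (Suc (Suc r)) u x y \<or> (y \<noteq> x \<and> (\<exists>p. br r u x p))" if "br (Suc r) u y q" "E' x y" for u y q
  proof (cases "x = q")
    case True
    then show ?thesis using branch_parent(3)[OF that(1) refl] graph_onD(4)[OF gr' that(2)] by blast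
  next
    case False
    then show ?thesis using branch.step[OF that(1)] E'_sym[OF that(2)] by blast
  qed
  consider u p where "br (Suc (Suc r)) u x p" | u p where "br r u x p"
    | "\<And>u p. \<not> br (Suc (Suc r)) u x p" "\<And>u p. \<not> br r u x p" by blast
  then show ?thesis
  proof cases
    case 1
    obtain q where q: "br (Suc r) u p q" using branch_parent(3)[OF 1 refl] by blast
    have "(\<Sum>y | E' x y. level (Suc r) \<psi> y) = (\<Sum>y | E' x y. if y = p then \<psi> u else 0)"
    proof (intro sum.cong refl)
      fix y assume y: "y \<in> {y. E' x y}"
      show "level (Suc r) \<psi> y = (if y = p then \<psi> u else 0)"
      proof (cases "y = p")
        case True
        then show ?thesis using level_eq[OF q] r by simp
      next
        case False
        have "\<not> br (Suc r) u' y q'" for u' q'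
        proof
          assume "br (Suc r) u' y q'"
          then consider "br (Suc (Suc r)) u' x y" | p' where "br r u' x p'" using cases y by blast
          then show False
            using branch_unique[OF 1, of "Suc (Suc r)" u' y] branch_unique[OF 1, of r u'] r False by cases auto
        qed
        then show ?thesis using False level_zero by simp
      qed
    qed
    also have "\<dots> = \<psi> u"
      using branch_parent(1)[OF 1] by (subst sum.delta[OF finite_nbrs']) simp
    also have "\<psi> u = level (Suc (Suc r)) \<psi> x" using r by (intro level_eq[OF 1, symmetric]) simp
    finally have "(\<Sum>y | E' x y. level (Suc r) \<psi> y) = level (Suc (Suc r)) \<psi> x" .
    moreover have "level r \<psi> x = 0" using r by (intro level_other[OF 1]) auto
    ultimately show ?thesis by simp
  next
    case 2
    have Exp: "E' x p" by (rule branch_parent(1)[OF 2])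
    have "level (Suc r) \<psi> p = 0"
    proof (cases r)
      case 0
      then show ?thesis using level_other[of 0 p p x "Suc r"] branch_parent(2)[OF 2] r by simp
    next
      case (Suc k)
      then obtain q where "br k u p q" using branch_parent(3)[OF 2] by blast
      then show ?thesis using Suc r by (intro level_other) auto
    qed
    moreover have "level (Suc r) \<psi> y = \<psi> u" if "y \<in> {y. E' x y} - {p}" for y
      using that r by (intro level_eq[of _ _ _ x] branch.step[OF 2]) auto
    ultimately have "(\<Sum>y | E' x y. level (Suc r) \<psi> y) = real (card ({y. E' x y} - {p})) * \<psi> u"
      using Exp finite_nbrs'[of x] by (subst sum.remove[of _ p]) auto
    also have "real (card ({y. E' x y} - {p})) = real (deg E' x) - 1"
    proof -
      have "card {y. E' x y} = Suc (card ({y. E' x y} - {p}))"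
        using Exp finite_nbrs'[of x] by (intro card.remove) auto
      then show ?thesis by (simp add: deg_def)
    qed
    moreover have "level (Suc (Suc r)) \<psi> x = 0" using r by (intro level_other[OF 2]) auto
    moreover have "level r \<psi> x = \<psi> u" using r by (intro level_eq[OF 2]) auto
    ultimately show ?thesis by simp
  next
    case 3
    have "level (Suc r) \<psi> y = 0" if "E' x y" for y
      using cases[OF _ that] 3 by (intro level_zero) blast
    then have "(\<Sum>y | E' x y. level (Suc r) \<psi> y) = 0" by (intro sum.neutral) auto
    then show ?thesis using 3 level_zero by simp
  qed
qed

end

section \<open>The operator of the form and elementary estimates\<close>

definition qop :: "(nat \<Rightarrow> nat \<Rightarrow> bool) \<Rightarrow> real \<Rightarrow> (nat \<Rightarrow> real) \<Rightarrow> nat \<Rightarrow> real" where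
  "qop E g f x = ((real (deg E x) - 1) * g + 1 / g) * f x - (\<Sum>y | E x y. f y)"

lemma qform_qop: "qform n E g f = (\<Sum>x<n. f x * qop E g f x)"
  by (simp add: qform_def qop_def sum_subtractf[symmetric] sum_distrib_left algebra_simps power2_eq_square)

lemma qform_diff:
  assumes "graph_on n E"
  shows "qform n E g (\<lambda>x. f x - h x) = qform n E g f - 2 * (\<Sum>x<n. f x * qop E g h x) + qform n E g h"
proof -
  have "qform n E g (\<lambda>x. f x + - h x) = qform n E g f + qform n E g (\<lambda>x. - h x)
    + 2 * ((\<Sum>x<n. ((real (deg E x) - 1) * g + 1 / g) * (f x * - h x)) - (\<Sum>x<n. \<Sum>y | E x y. f y * - h x))"
    by (rule qform_add[OF assms])
  also have "qform n E g (\<lambda>x. - h x) = qform n E g h" by (simp add: qform_def)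
  also have "(\<Sum>x<n. \<Sum>y | E x y. f y * - h x) = (\<Sum>x<n. \<Sum>y | E x y. f x * - h y)"
    by (rule sum_adj_swap[OF assms])
  also have "(\<Sum>x<n. ((real (deg E x) - 1) * g + 1 / g) * (f x * - h x)) - (\<Sum>x<n. \<Sum>y | E x y. f x * - h y)
    = - (\<Sum>x<n. f x * qop E g h x)"
    unfolding sum_negf[symmetric] sum_subtractf[symmetric]
    by (intro sum.cong refl) (simp add: qop_def sum_distrib_left sum_negf algebra_simps)
  finally show ?thesis by simp
qed

lemma square_sum_le:
  fixes a :: "'a \<Rightarrow> real"
  shows "(\<Sum>i\<in>I. a i)\<^sup>2 \<le> real (card I) * (\<Sum>i\<in>I. (a i)\<^sup>2)"
  using Cauchy_Schwarz_ineq_sum[of "\<lambda>_. 1" a I] by simp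

lemma sum_adj_square:
  fixes a :: "nat \<Rightarrow> real"
  assumes "graph_on n E"
  shows "(\<Sum>x<n. \<Sum>y | E x y. a y) = (\<Sum>x<n. real (deg E x) * a x)"
  using sum_adj_swap[OF assms, of "\<lambda>x y. a y"] by (simp add: deg_def)

lemma adj_form_le:
  fixes a :: "nat \<Rightarrow> real"
  assumes gr: "graph_on n E" and deg: "\<And>x. deg E x \<le> d"
  shows "(\<Sum>x<n. \<Sum>y | E x y. a x * a y) \<le> d * (\<Sum>x<n. (a x)\<^sup>2)"
proof -
  have "a x * a y \<le> ((a x)\<^sup>2 + (a y)\<^sup>2) / 2" for x y
    using sum_squares_ge_zero[of "a x - a y" 0] by (simp add: power2_eq_square algebra_simps)
  then have "(\<Sum>x<n. \<Sum>y | E x y. a x * a y) \<le> (\<Sum>x<n. \<Sum>y | E x y. ((a x)\<^sup>2 + (a y)\<^sup>2) / 2)"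
    by (intro sum_mono)
  also have "\<dots> = ((\<Sum>x<n. \<Sum>y | E x y. (a x)\<^sup>2) + (\<Sum>x<n. \<Sum>y | E x y. (a y)\<^sup>2)) / 2"
    by (simp add: sum_divide_distrib[symmetric] sum.distrib)
  also have "\<dots> = (\<Sum>x<n. real (deg E x) * (a x)\<^sup>2)"
    unfolding sum_adj_square[OF gr] by (simp add: deg_def)
  also have "\<dots> \<le> (\<Sum>x<n. real d * (a x)\<^sup>2)"
    using deg by (intro sum_mono mult_right_mono) auto
  finally show ?thesis by (simp add: sum_distrib_left)
qed

lemma qform_lower:
  assumes gr: "graph_on n E" and deg: "\<And>x. deg E x \<le> d" and g: "0 < g" "g < 1"
  shows "qform n E g a \<ge> - (d * (\<Sum>x<n. (a x)\<^sup>2))"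
proof -
  have "1 / g > 1" using g by simp
  then have "(real (deg E x) - 1) * g + 1 / g \<ge> 0" for x
  proof -
    have "real (deg E x) * g \<ge> 0" using g by simp
    then show ?thesis using g \<open>1 / g > 1\<close> unfolding left_diff_distrib by linarith
  qed
  then have "(\<Sum>x<n. ((real (deg E x) - 1) * g + 1 / g) * (a x)\<^sup>2) \<ge> 0"
    by (intro sum_nonneg mult_nonneg_nonneg) auto
  then show ?thesis using adj_form_le[OF gr deg, of a] unfolding qform_def by linarith
qed

text \<open>The coefficients g^r solve the tree recursion at level D g + 1/g, so the interior terms
  cancel. What remains is the root term and two terms where the sum is truncated.\<close>

lemma telescope_levels:
  fixes l :: "nat \<Rightarrow> real"
  assumes "g \<noteq> 0"
  shows "(D * g + 1 / g) * (\<Sum>r\<le>h. g ^ r * l r) - l 1 - (\<Sum>r<h. g ^ Suc r * (l (Suc (Suc r)) + D * l r))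
    = l 0 / g + D * g ^ Suc h * l h - g ^ h * l (Suc h)"
proof (induction h)
  case (Suc h)
  have "(D * g + 1 / g) * (\<Sum>r\<le>Suc h. g ^ r * l r) - l 1 - (\<Sum>r<Suc h. g ^ Suc r * (l (Suc (Suc r)) + D * l r))
    = (l 0 / g + D * g ^ Suc h * l h - g ^ h * l (Suc h)) + (D * g + 1 / g) * (g ^ Suc h * l (Suc h))
      - g ^ Suc h * (l (Suc (Suc h)) + D * l h)"
    using Suc by (simp add: algebra_simps)
  also have "\<dots> = l 0 / g + D * g ^ Suc (Suc h) * l (Suc h) - g ^ Suc h * l (Suc (Suc h))"
    using assms by (simp add: field_simps)
  finally show ?case .
qed (simp add: algebra_simps)

lemma covers_ex1: "covers N E' E \<Longrightarrow> E (x div N) w \<Longrightarrow> \<exists>!y. y div N = w \<and> E' x y"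
  unfolding covers_def by (elim conjE) (erule allE, erule allE, erule mp)

lemma covers_adj: "covers N E' E \<Longrightarrow> E' x y \<Longrightarrow> E (x div N) (y div N)"
  unfolding covers_def by (elim conjE) (erule allE, erule allE, erule mp)

lemma fibre_adj_sum:
  fixes F :: "nat \<Rightarrow> real"
  assumes cov: "covers N E' E" and gr: "graph_on n E" and gr': "graph_on (n * N) E'"
  shows "(\<Sum>x\<in>fibre N v. \<Sum>y | E' x y. F y) = (\<Sum>w | E v w. \<Sum>y\<in>fibre N w. F y)"
proof -
  have N: "N > 0" using cov unfolding covers_def by (rule conjunct1)
  have "(\<Sum>x\<in>fibre N v. \<Sum>y | E' x y. F y) = (\<Sum>(x, y)\<in>Sigma (fibre N v) (\<lambda>x. {y. E' x y}). F y)"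
    using finite_nbrs[OF gr'] by (intro sum.Sigma) simp_all
  also have "\<dots> = (\<Sum>(w, y)\<in>Sigma {w. E v w} (fibre N). F y)"
  proof (rule sum.reindex_bij_witness[of _ "\<lambda>(w, y). (THE x. x div N = v \<and> E' y x, y)" "\<lambda>(x, y). (y div N, y)"])
    have the: "(THE x. x div N = v \<and> E' y x) div N = v \<and> E' y (THE x. x div N = v \<and> E' y x)"
      if "E v (y div N)" for y
      by (rule theI'[OF covers_ex1[OF cov graph_onD(3)[OF gr that]]])
    fix b assume b: "b \<in> Sigma {w. E v w} (fibre N)"
    then obtain w y where wy: "b = (w, y)" "E v w" "y div N = w" using in_fibre_iff[OF N] by auto
    note t = the[of y] 
    show "(case (case b of (w, y) \<Rightarrow> (THE x. x div N = v \<and> E' y x, y)) of (x, y) \<Rightarrow> (y div N, y)) = b"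
      using wy by simp
    show "(case b of (w, y) \<Rightarrow> (THE x. x div N = v \<and> E' y x, y)) \<in> Sigma (fibre N v) (\<lambda>x. {y. E' x y})"
      using wy t in_fibre_iff[OF N] graph_onD(3)[OF gr'] by auto
  next
    fix a assume "a \<in> Sigma (fibre N v) (\<lambda>x. {y. E' x y})"
    then obtain x y where xy: "a = (x, y)" "x div N = v" "E' x y" using in_fibre_iff[OF N] by auto
    have yx: "E' y x" by (rule graph_onD(3)[OF gr' xy(3)])
    have "(THE x. x div N = v \<and> E' y x) = x"
    proof (rule the_equality)
      show "x div N = v \<and> E' y x" using xy(2) yx ..
      fix x' assume x': "x' div N = v \<and> E' y x'"
      show "x' = x" by (rule covers_inj[OF cov conjunct2[OF x'] yx]) (simp add: x' xy(2))
    qed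
    then show "(case (case a of (x, y) \<Rightarrow> (y div N, y)) of (w, y) \<Rightarrow> (THE x. x div N = v \<and> E' y x, y)) = a"
      using xy by simp
    have "E v (y div N)" using covers_adj[OF cov xy(3)] xy(2) by simp
    then show "(case a of (x, y) \<Rightarrow> (y div N, y)) \<in> Sigma {w. E v w} (fibre N)"
      using xy in_fibre_iff[OF N] by auto
  qed auto
  also have "\<dots> = (\<Sum>w | E v w. \<Sum>y\<in>fibre N w. F y)"
    using finite_nbrs[OF gr] by (intro sum.Sigma[symmetric]) simp_all
  finally show ?thesis .
qed

context dart_stage
begin

lemma U_less: "u \<in> U \<Longrightarrow> u < n * N"
  using graph_onD(1)[OF gr' \<tau>_adj] by blast

lemma finite_U: "finite U"
  by (rule finite_subset[of _ "{..<n * N}"]) (use U_less in auto)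

lemma sum_U: "(\<Sum>x<n * N. if x \<in> U then F x else 0) = (\<Sum>x\<in>U. F x)"
  using U_less by (intro sum.mono_neutral_cong_right) auto

lemma sum_\<tau>: "(\<Sum>u\<in>U. F (\<tau> u)) = (\<Sum>u\<in>U. F u)"
  by (rule sum.reindex_bij_witness[of _ \<tau> \<tau>]) (auto simp: \<tau>_in \<tau>_inv)

lemma N_pos: "N > 0"
  using cov by (simp add: covers_def)

lemma deg'_le: "deg E' x \<le> d"
  using covers_deg[OF cov] deg_le by simp

lemma level_square: "level r (\<lambda>x. (\<psi> x)\<^sup>2) x = (level r \<psi> x)\<^sup>2"
  by (simp add: level_def)

lemma level_abs: "level r (\<lambda>x. \<bar>\<psi> x\<bar>) x = \<bar>level r \<psi> x\<bar>"
  by (simp add: level_def)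

text \<open>The neighbour sums of a level are added up in two ways, by degrees and by the tree
  recursion.\<close>

lemma sum_level_growth:
  "r \<le> h \<Longrightarrow> (\<Sum>x<n * N. level (Suc r) \<psi> x) = (\<Sum>x<n * N. (real (deg E' x) - 1) * level r \<psi> x)"
proof (induction r)
  case 0
  have "(\<Sum>x<n * N. real (deg E' x) * level 0 \<psi> x) = (\<Sum>x<n * N. level 1 \<psi> x + (if x \<in> U then \<psi> (\<tau> x) else 0))"
    unfolding sum_adj_square[OF gr', symmetric] sum_level_0 ..
  also have "\<dots> = (\<Sum>x<n * N. level 1 \<psi> x) + (\<Sum>x<n * N. level 0 \<psi> x)"
    unfolding sum.distrib level_0 sum_U sum_\<tau>[of \<psi>] ..
  finally show ?case by (simp add: left_diff_distrib sum_subtractf)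
next
  case (Suc r)
  have "(\<Sum>x<n * N. real (deg E' x) * level (Suc r) \<psi> x) =
      (\<Sum>x<n * N. level (Suc (Suc r)) \<psi> x + (real (deg E' x) - 1) * level r \<psi> x)"
    unfolding sum_adj_square[OF gr', symmetric] sum_level_Suc[OF Suc.prems] ..
  also have "\<dots> = (\<Sum>x<n * N. level (Suc (Suc r)) \<psi> x) + (\<Sum>x<n * N. level (Suc r) \<psi> x)"
    using Suc by (simp add: sum.distrib)
  finally show ?case by (simp add: left_diff_distrib sum_subtractf)
qed

lemma level_norm:
  assumes "d \<ge> 1" "r \<le> h + 1"
  shows "(\<Sum>x<n * N. (level r \<psi> x)\<^sup>2) \<le> (real d - 1) ^ r * (\<Sum>u\<in>U. (\<psi> u)\<^sup>2)"
  using assms(2)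
proof (induction r)
  case 0
  have "(\<Sum>x<n * N. (level 0 \<psi> x)\<^sup>2) = (\<Sum>x<n * N. if x \<in> U then (\<psi> x)\<^sup>2 else 0)"
    by (intro sum.cong refl) (simp add: level_0)
  then show ?case by (simp add: sum_U)
next
  case (Suc r)
  have "(\<Sum>x<n * N. (level (Suc r) \<psi> x)\<^sup>2) = (\<Sum>x<n * N. (real (deg E' x) - 1) * (level r \<psi> x)\<^sup>2)"
    using sum_level_growth[of r "\<lambda>x. (\<psi> x)\<^sup>2"] Suc.prems by (simp add: level_square)
  also have "\<dots> \<le> (\<Sum>x<n * N. (real d - 1) * (level r \<psi> x)\<^sup>2)"
    using deg'_le by (intro sum_mono mult_right_mono) auto
  also have "\<dots> = (real d - 1) * (\<Sum>x<n * N. (level r \<psi> x)\<^sup>2)" by (simp add: sum_distrib_left)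
  also have "\<dots> \<le> (real d - 1) * ((real d - 1) ^ r * (\<Sum>u\<in>U. (\<psi> u)\<^sup>2))"
    using Suc assms(1) by (intro mult_left_mono) auto
  finally show ?case by simp
qed

definition fibre_mass :: "nat \<Rightarrow> (nat \<Rightarrow> real) \<Rightarrow> nat \<Rightarrow> real" where
  "fibre_mass r \<psi> v = (\<Sum>x\<in>fibre N v. \<bar>level r \<psi> x\<bar>)"

lemma fibre_mass_nonneg: "fibre_mass r \<psi> v \<ge> 0"
  unfolding fibre_mass_def by (intro sum_nonneg) auto

lemma fibre_mass_step:
  assumes "r \<le> h"
  shows "fibre_mass (Suc r) \<psi> v \<le> (\<Sum>w | E v w. fibre_mass r \<psi> w)"
proof -
  let ?a = "\<lambda>x. \<bar>\<psi> x\<bar>"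
  have "\<bar>level (Suc r) \<psi> x\<bar> \<le> (\<Sum>y | E' x y. \<bar>level r \<psi> y\<bar>)" for x
  proof (cases r)
    case 0
    then show ?thesis using sum_level_0[of ?a x] by (simp add: level_abs)
  next
    case (Suc k)
    have "(real (deg E' x) - 1) * level k ?a x \<ge> 0"
    proof (cases "level k ?a x = 0")
      case False
      then obtain u p where "br k u x p" using level_nonzero by blast
      then have "p \<in> {y. E' x y}" using branch_parent(1) by blast
      then have "deg E' x > 0" unfolding deg_def using finite_nbrs'[of x] card_gt_0_iff by blast
      then show ?thesis unfolding level_abs by (intro mult_nonneg_nonneg) auto
    qed simp
    then show ?thesis using sum_level_Suc[of k ?a x] assms Suc by (simp add: level_abs)
  qed
  then have "fibre_mass (Suc r) \<psi> v \<le> (\<Sum>x\<in>fibre N v. \<Sum>y | E' x y. \<bar>level r \<psi> y\<bar>)"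
    unfolding fibre_mass_def by (intro sum_mono)
  then show ?thesis unfolding fibre_adj_sum[OF cov gr gr'] fibre_mass_def .
qed

lemma card_U_fibre: "card (fibre N v \<inter> U) \<le> d"
proof -
  have "card (fibre N v \<inter> U) \<le> card {w. E v w}"
  proof (rule card_inj_on_le[of "\<lambda>u. \<tau> u div N"])
    show "inj_on (\<lambda>u. \<tau> u div N) (fibre N v \<inter> U)"
      using dart_systemD(6)[OF darts] in_fibre_iff[OF N_pos] by (intro inj_onI) auto
    show "(\<lambda>u. \<tau> u div N) ` (fibre N v \<inter> U) \<subseteq> {w. E v w}"
      using dart_systemD(4)[OF darts] in_fibre_iff[OF N_pos] by auto
  qed (rule finite_nbrs[OF gr])
  then show ?thesis using deg_le[of v] by (simp add: deg_def)
qed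

text \<open>The point is that \<open>N\<close> does not occur, so the fibre averages of the levels
  are of order 1/N. A fibre holds at most \<open>d\<close> roots, which costs one factor
  \<open>d\<close>; each further level costs two, one from Cauchy-Schwarz and one from counting
  edges of the base.\<close>

lemma fibre_mass_norm:
  "r \<le> h + 1 \<Longrightarrow> (\<Sum>v<n. (fibre_mass r \<psi> v)\<^sup>2) \<le> real d ^ (2 * r + 1) * (\<Sum>u\<in>U. (\<psi> u)\<^sup>2)"
proof (induction r)
  case 0
  have "(fibre_mass 0 \<psi> v)\<^sup>2 \<le> d * (\<Sum>x\<in>fibre N v. if x \<in> U then (\<psi> x)\<^sup>2 else 0)" for v
  proof -
    have "fibre_mass 0 \<psi> v = (\<Sum>x\<in>fibre N v \<inter> U. \<bar>\<psi> x\<bar>)"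
      unfolding fibre_mass_def level_0 by (simp add: sum.inter_restrict if_distrib[of abs] cong: if_cong)
    then have "(fibre_mass 0 \<psi> v)\<^sup>2 \<le> card (fibre N v \<inter> U) * (\<Sum>x\<in>fibre N v \<inter> U. (\<psi> x)\<^sup>2)"
      using square_sum_le[of "\<lambda>x. \<bar>\<psi> x\<bar>" "fibre N v \<inter> U"] by simp
    also have "\<dots> \<le> d * (\<Sum>x\<in>fibre N v \<inter> U. (\<psi> x)\<^sup>2)"
      using card_U_fibre[of v] by (intro mult_right_mono sum_nonneg) auto
    finally show ?thesis by (simp add: sum.inter_restrict)
  qed
  then have "(\<Sum>v<n. (fibre_mass 0 \<psi> v)\<^sup>2) \<le> (\<Sum>v<n. d * (\<Sum>x\<in>fibre N v. if x \<in> U then (\<psi> x)\<^sup>2 else 0))"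
    by (intro sum_mono)
  also have "\<dots> = d * (\<Sum>u\<in>U. (\<psi> u)\<^sup>2)"
    unfolding sum_distrib_left[symmetric] sum_fibres[symmetric] sum_U ..
  finally show ?case by simp
next
  case (Suc r)
  have "(fibre_mass (Suc r) \<psi> v)\<^sup>2 \<le> d * (\<Sum>w | E v w. (fibre_mass r \<psi> w)\<^sup>2)" for v
  proof -
    have "(fibre_mass (Suc r) \<psi> v)\<^sup>2 \<le> (\<Sum>w | E v w. fibre_mass r \<psi> w)\<^sup>2"
      using fibre_mass_step Suc.prems fibre_mass_nonneg by (intro power_mono) auto
    also have "\<dots> \<le> deg E v * (\<Sum>w | E v w. (fibre_mass r \<psi> w)\<^sup>2)"
      unfolding deg_def by (rule square_sum_le)
    also have "\<dots> \<le> d * (\<Sum>w | E v w. (fibre_mass r \<psi> w)\<^sup>2)"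
      using deg_le by (intro mult_right_mono sum_nonneg) auto
    finally show ?thesis .
  qed
  then have "(\<Sum>v<n. (fibre_mass (Suc r) \<psi> v)\<^sup>2) \<le> (\<Sum>v<n. d * (\<Sum>w | E v w. (fibre_mass r \<psi> w)\<^sup>2))"
    by (intro sum_mono)
  also have "\<dots> = d * (\<Sum>v<n. real (deg E v) * (fibre_mass r \<psi> v)\<^sup>2)"
    unfolding sum_distrib_left[symmetric] sum_adj_square[OF gr] ..
  also have "\<dots> \<le> d * (\<Sum>v<n. d * (fibre_mass r \<psi> v)\<^sup>2)"
    using deg_le by (intro mult_left_mono sum_mono mult_right_mono) auto
  also have "\<dots> = d * (d * (\<Sum>v<n. (fibre_mass r \<psi> v)\<^sup>2))" by (simp add: sum_distrib_left)
  also have "\<dots> \<le> d * (d * (real d ^ (2 * r + 1) * (\<Sum>u\<in>U. (\<psi> u)\<^sup>2)))"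
    using Suc by (intro mult_left_mono) auto
  finally show ?case by (simp add: mult_ac)
qed

text \<open>
  The function that agrees with \<open>\<psi>\<close> on \<open>U\<close> and decays geometrically away from it is almost harmonic
  for \<open>qop\<close> off \<open>U\<close>, so pairing it with \<open>\<psi>\<close> bounds the values of \<open>\<psi>\<close> on \<open>U\<close> in terms of the form.
\<close>

definition bump :: "real \<Rightarrow> (nat \<Rightarrow> real) \<Rightarrow> nat \<Rightarrow> real" where
  "bump g \<psi> x = (\<Sum>r\<le>h. g ^ r * level r \<psi> x)"

text \<open>The defect in the tree recursion caused by truncating at depth \<open>h\<close>.\<close>

definition bump_err :: "real \<Rightarrow> (nat \<Rightarrow> real) \<Rightarrow> nat \<Rightarrow> real" where
  "bump_err g \<psi> x = (real (deg E' x) - 1) * g ^ Suc h * level h \<psi> x - g ^ h * level (Suc h) \<psi> x"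

lemma qop_bump:
  assumes "g \<noteq> 0"
  shows "qop E' g (bump g \<psi>) x = (if x \<in> U then \<psi> x / g - \<psi> (\<tau> x) else 0) + bump_err g \<psi> x"
proof -
  let ?l = "\<lambda>r. level r \<psi> x" and ?D = "real (deg E' x) - 1"
  have "(\<Sum>y | E' x y. bump g \<psi> y) = (\<Sum>r\<le>h. g ^ r * (\<Sum>y | E' x y. level r \<psi> y))"
    unfolding bump_def sum_distrib_left by (rule sum.swap)
  also have "\<dots> = (\<Sum>y | E' x y. level 0 \<psi> y) + (\<Sum>r<h. g ^ Suc r * (\<Sum>y | E' x y. level (Suc r) \<psi> y))"
    unfolding sum.atMost_shift by simp
  also have "\<dots> = ?l 1 + (if x \<in> U then \<psi> (\<tau> x) else 0) + (\<Sum>r<h. g ^ Suc r * (?l (Suc (Suc r)) + ?D * ?l r))"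
    using sum_level_0 by (intro arg_cong2[where f = "(+)"] sum.cong refl) (auto simp: sum_level_Suc)
  finally have "qop E' g (bump g \<psi>) x = ((?D * g + 1 / g) * (\<Sum>r\<le>h. g ^ r * ?l r) - ?l 1
      - (\<Sum>r<h. g ^ Suc r * (?l (Suc (Suc r)) + ?D * ?l r))) - (if x \<in> U then \<psi> (\<tau> x) else 0)"
    unfolding qop_def bump_def by simp
  also have "\<dots> = (level 0 \<psi> x / g - (if x \<in> U then \<psi> (\<tau> x) else 0)) + bump_err g \<psi> x"
    using telescope_levels[OF assms, of ?D ?l h] unfolding bump_err_def by linarith
  finally show ?thesis by (simp add: level_0)
qed

lemma bump_U: "u \<in> U \<Longrightarrow> bump g \<psi> u = \<psi> u"
proof -
  assume u: "u \<in> U"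
  have "bump g \<psi> u = (\<Sum>r\<le>h. if r = 0 then \<psi> u else 0)"
    unfolding bump_def
  proof (intro sum.cong refl)
    fix r assume "r \<in> {..h}"
    then show "g ^ r * level r \<psi> u = (if r = 0 then \<psi> u else 0)"
      using level_other[OF branch.root[OF u], of r \<psi>] u by (auto simp: level_0)
  qed
  then show ?thesis by simp
qed

lemma level_mult_zero:
  assumes "r \<le> h + 1" "r' \<le> h + 1" "r \<noteq> r'"
  shows "level r \<psi> x * level r' \<psi> x = 0"
proof (cases "level r \<psi> x = 0")
  case False
  then obtain u p where "br r u x p" using level_nonzero by blast
  then show ?thesis using level_other[OF _ assms] by simp
qed simp

text \<open>Levels of different depth have disjoint supports, so only depth \<open>h\<close>
  contributes.\<close>

lemma bump_mult_err:
  "bump g \<psi> x * bump_err g \<psi> x = (real (deg E' x) - 1) * g ^ (2 * h + 1) * (level h \<psi> x)\<^sup>2"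
proof -
  have "bump g \<psi> x * level h \<psi> x = (\<Sum>r\<le>h. if r = h then g ^ h * (level h \<psi> x)\<^sup>2 else 0)"
    unfolding bump_def sum_distrib_right
  proof (intro sum.cong refl)
    fix r assume "r \<in> {..h}"
    then show "g ^ r * level r \<psi> x * level h \<psi> x = (if r = h then g ^ h * (level h \<psi> x)\<^sup>2 else 0)"
      using level_mult_zero[of r h \<psi> x] by (auto simp: power2_eq_square)
  qed
  then have 1: "bump g \<psi> x * level h \<psi> x = g ^ h * (level h \<psi> x)\<^sup>2" by simp
  have 2: "bump g \<psi> x * level (Suc h) \<psi> x = 0"
    unfolding bump_def sum_distrib_right
  proof (intro sum.neutral ballI)
    fix r assume "r \<in> {..h}"
    then show "g ^ r * level r \<psi> x * level (Suc h) \<psi> x = 0"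
      using level_mult_zero[of r "Suc h" \<psi> x] by auto
  qed
  have "bump g \<psi> x * bump_err g \<psi> x = (real (deg E' x) - 1) * g ^ Suc h * (bump g \<psi> x * level h \<psi> x)
      - g ^ h * (bump g \<psi> x * level (Suc h) \<psi> x)"
    unfolding bump_err_def by (simp add: algebra_simps)
  also have "\<dots> = (real (deg E' x) - 1) * g ^ (2 * h + 1) * (level h \<psi> x)\<^sup>2"
    unfolding 1 2 by (simp add: mult_2 power_add)
  finally show ?thesis .
qed


lemma fibre_avg_bump:
  assumes g: "0 < g" "g < 1"
  shows "(\<Sum>v<n. (fibre_avg N (bump g \<psi>) v)\<^sup>2) \<le> (real h + 1)\<^sup>2 * real d ^ (2 * h + 1) / (real N)\<^sup>2 * (\<Sum>u\<in>U. (\<psi> u)\<^sup>2)"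
proof -
  define Z where "Z = (\<Sum>u\<in>U. (\<psi> u)\<^sup>2)"
  have Z: "Z \<ge> 0" unfolding Z_def by (intro sum_nonneg) auto
  have point: "(\<Sum>x\<in>fibre N v. bump g \<psi> x)\<^sup>2 \<le> (real h + 1) * (\<Sum>r\<le>h. (fibre_mass r \<psi> v)\<^sup>2)" for v
  proof -
    have "\<bar>\<Sum>x\<in>fibre N v. bump g \<psi> x\<bar> = \<bar>\<Sum>r\<le>h. \<Sum>x\<in>fibre N v. g ^ r * level r \<psi> x\<bar>"
      unfolding bump_def by (subst sum.swap) simp
    also have "\<dots> \<le> (\<Sum>r\<le>h. \<bar>\<Sum>x\<in>fibre N v. g ^ r * level r \<psi> x\<bar>)" by (rule sum_abs)
    also have "\<dots> \<le> (\<Sum>r\<le>h. fibre_mass r \<psi> v)"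
    proof (intro sum_mono)
      fix r
      have "\<bar>\<Sum>x\<in>fibre N v. g ^ r * level r \<psi> x\<bar> \<le> (\<Sum>x\<in>fibre N v. \<bar>g ^ r * level r \<psi> x\<bar>)" by (rule sum_abs)
      also have "\<dots> \<le> fibre_mass r \<psi> v"
        unfolding fibre_mass_def
      proof (intro sum_mono)
        fix x
        have "g ^ r \<le> 1" using g by (simp add: power_le_one)
        then show "\<bar>g ^ r * level r \<psi> x\<bar> \<le> \<bar>level r \<psi> x\<bar>"
          using g by (simp add: abs_mult mult_left_le_one_le)
      qed
      finally show "\<bar>\<Sum>x\<in>fibre N v. g ^ r * level r \<psi> x\<bar> \<le> fibre_mass r \<psi> v" .
    qed
    finally have "(\<Sum>x\<in>fibre N v. bump g \<psi> x)\<^sup>2 \<le> (\<Sum>r\<le>h. fibre_mass r \<psi> v)\<^sup>2"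
      by (metis abs_ge_zero power2_abs power_mono)
    also have "\<dots> \<le> (real h + 1) * (\<Sum>r\<le>h. (fibre_mass r \<psi> v)\<^sup>2)"
      using square_sum_le[of "\<lambda>r. fibre_mass r \<psi> v" "{..h}"] by (simp add: add.commute)
    finally show ?thesis .
  qed
  have "(\<Sum>v<n. (\<Sum>x\<in>fibre N v. bump g \<psi> x)\<^sup>2) \<le> (\<Sum>v<n. (real h + 1) * (\<Sum>r\<le>h. (fibre_mass r \<psi> v)\<^sup>2))"
    by (intro sum_mono point)
  also have "\<dots> = (real h + 1) * (\<Sum>r\<le>h. \<Sum>v<n. (fibre_mass r \<psi> v)\<^sup>2)"
    unfolding sum_distrib_left[symmetric] by (subst sum.swap) simp
  also have "\<dots> \<le> (real h + 1) * (\<Sum>r\<le>h. real d ^ (2 * h + 1) * Z)"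
  proof (intro mult_left_mono sum_mono)
    fix r assume r: "r \<in> {..h}"
    have "(\<Sum>v<n. (fibre_mass r \<psi> v)\<^sup>2) \<le> real d ^ (2 * r + 1) * Z"
      unfolding Z_def using r by (intro fibre_mass_norm) simp
    also have "\<dots> \<le> real d ^ (2 * h + 1) * Z"
    proof (cases "d = 0")
      case False
      then show ?thesis using r Z by (intro mult_right_mono power_increasing) auto
    qed simp
    finally show "(\<Sum>v<n. (fibre_mass r \<psi> v)\<^sup>2) \<le> real d ^ (2 * h + 1) * Z" .
  qed simp
  also have "\<dots> = (real h + 1)\<^sup>2 * real d ^ (2 * h + 1) * Z"
    by (simp add: power2_eq_square add.commute)
  finally have "(\<Sum>v<n. (\<Sum>x\<in>fibre N v. bump g \<psi> x)\<^sup>2) / (real N)\<^sup>2 \<le> (real h + 1)\<^sup>2 * real d ^ (2 * h + 1) * Z / (real N)\<^sup>2"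
    by (rule divide_right_mono) simp
  then show ?thesis
    unfolding fibre_avg_def Z_def power_divide sum_divide_distrib[symmetric] by simp
qed

text \<open>The summands are, in order, the truncation error paired with \<open>\<psi>\<close> by
  Young's inequality with parameter \<open>\<eta>\<close>, the truncation error paired with
  \<open>bump\<close> itself, and the fibre averages of \<open>bump\<close>, which is not a new
  function. If (d - 1) g^2 < 1, the first two decrease geometrically in \<open>h\<close>; for fixed
  \<open>h\<close> the last decreases with \<open>N\<close>.\<close>

definition loss :: "real \<Rightarrow> real \<Rightarrow> real" where
  "loss g \<eta> = 4 * (real d - 1) * ((real d - 1) * g\<^sup>2) ^ h / \<eta> + (real d - 1) * g * ((real d - 1) * g\<^sup>2) ^ h
     + real d * ((real h + 1)\<^sup>2 * real d ^ (2 * h + 1)) / real N"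

text \<open>A Dirichlet principle with prescribed values on \<open>U\<close>: expand the form at
  \<open>\<psi>\<close> minus \<open>bump\<close>. This difference is new up to the fibre averages
  of \<open>bump\<close>, so the form there is almost nonnegative. The operator sends
  \<open>bump\<close> to something concentrated on \<open>U\<close>, so the mixed pairing and the
  pure one are both the dart sum \<open>K\<close> up to truncation errors.\<close>

lemma new_part_bound:
  assumes d: "d \<ge> 2" and g: "0 < g" "g < 1" "(real d - 1) * g\<^sup>2 \<le> 1" and \<eta>: "\<eta> > 0"
    and new: "new_nonneg N n E' g" and \<psi>: "\<And>v. v < n \<Longrightarrow> (\<Sum>x\<in>fibre N v. \<psi> x) = 0"
  shows "qform (n * N) E' g \<psi> + \<eta> * (\<Sum>x<n * N. (\<psi> x)\<^sup>2)
    \<ge> (\<Sum>u\<in>U. \<psi> u * (\<psi> u / g - \<psi> (\<tau> u))) - loss g \<eta> * (\<Sum>u\<in>U. (\<psi> u)\<^sup>2)"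
proof -
  define q where "q = (real d - 1) * g\<^sup>2"
  define Z where "Z = (\<Sum>u\<in>U. (\<psi> u)\<^sup>2)"
  define K where "K = (\<Sum>u\<in>U. \<psi> u * (\<psi> u / g - \<psi> (\<tau> u)))"
  let ?M = "n * N" and ?G = "bump g \<psi>" and ?D = "real d - 1"
  have q: "0 \<le> q" "q \<le> 1" using d g by (auto simp: q_def)
  have Z: "Z \<ge> 0" unfolding Z_def by (intro sum_nonneg) auto
  have K_sum: "(\<Sum>x<?M. F x * (if x \<in> U then \<psi> x / g - \<psi> (\<tau> x) else 0)) = K"
    if "\<And>u. u \<in> U \<Longrightarrow> F u = \<psi> u" for F
  proof -
    have "(\<Sum>x<?M. F x * (if x \<in> U then \<psi> x / g - \<psi> (\<tau> x) else 0)) =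
        (\<Sum>x<?M. if x \<in> U then \<psi> x * (\<psi> x / g - \<psi> (\<tau> x)) else 0)"
      using that by (intro sum.cong) auto
    then show ?thesis by (simp add: sum_U K_def)
  qed
  have qop: "(\<Sum>x<?M. F x * qop E' g ?G x) = K + (\<Sum>x<?M. F x * bump_err g \<psi> x)"
    if "\<And>u. u \<in> U \<Longrightarrow> F u = \<psi> u" for F
    using g K_sum[OF that] by (simp add: qop_bump distrib_left sum.distrib)
  have norm: "(\<Sum>x<?M. (level r \<psi> x)\<^sup>2) \<le> ?D ^ r * Z" if "r \<le> h + 1" for r
    unfolding Z_def using d that by (intro level_norm) auto
  have qh: "g ^ (2 * h) * ?D ^ h = q ^ h"
    unfolding q_def power_mult_distrib power_mult[symmetric] by simp
  have err1: "(\<Sum>x<?M. ?G x * bump_err g \<psi> x) \<le> ?D * g * q ^ h * Z"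
  proof -
    have "(\<Sum>x<?M. ?G x * bump_err g \<psi> x) \<le> (\<Sum>x<?M. ?D * g ^ (2 * h + 1) * (level h \<psi> x)\<^sup>2)"
      unfolding bump_mult_err using deg'_le g by (intro sum_mono mult_right_mono) auto
    also have "\<dots> = ?D * g ^ (2 * h + 1) * (\<Sum>x<?M. (level h \<psi> x)\<^sup>2)" by (simp add: sum_distrib_left)
    also have "\<dots> \<le> ?D * g ^ (2 * h + 1) * (?D ^ h * Z)"
      using d g norm[of h] by (intro mult_left_mono) auto
    also have "\<dots> = ?D * g * (g ^ (2 * h) * ?D ^ h) * Z" by simp
    finally show ?thesis unfolding qh .
  qed
  have err2: "(\<Sum>x<?M. (bump_err g \<psi> x)\<^sup>2) \<le> 4 * ?D * q ^ h * Z"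
  proof -
    have "(bump_err g \<psi> x)\<^sup>2 \<le> 2 * ?D\<^sup>2 * g ^ (2 * h) * g\<^sup>2 * (level h \<psi> x)\<^sup>2 + 2 * g ^ (2 * h) * (level (Suc h) \<psi> x)\<^sup>2" for x
    proof -
      have sq: "(a - b)\<^sup>2 \<le> 2 * a\<^sup>2 + 2 * b\<^sup>2" for a b :: real
        using zero_le_power2[of "a + b"] by (simp add: power2_eq_square algebra_simps)
      have "\<bar>real (deg E' x) - 1\<bar> \<le> ?D" using deg'_le[of x] d by (auto simp: abs_le_iff)
      then have "(real (deg E' x) - 1)\<^sup>2 \<le> ?D\<^sup>2" by (simp add: abs_le_square_iff[symmetric])
      then have "(real (deg E' x) - 1)\<^sup>2 * (g ^ (2 * h) * g\<^sup>2 * (level h \<psi> x)\<^sup>2) \<le> ?D\<^sup>2 * (g ^ (2 * h) * g\<^sup>2 * (level h \<psi> x)\<^sup>2)"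
        using g by (intro mult_right_mono) auto
      moreover have "((real (deg E' x) - 1) * g ^ Suc h * level h \<psi> x)\<^sup>2 = (real (deg E' x) - 1)\<^sup>2 * (g ^ (2 * h) * g\<^sup>2 * (level h \<psi> x)\<^sup>2)"
        by (simp add: power_mult_distrib power_mult[symmetric] mult.commute)
      moreover have "(g ^ h * level (Suc h) \<psi> x)\<^sup>2 = g ^ (2 * h) * (level (Suc h) \<psi> x)\<^sup>2"
        by (simp add: power_mult_distrib power_mult[symmetric] mult.commute)
      ultimately show ?thesis
        using sq[of "(real (deg E' x) - 1) * g ^ Suc h * level h \<psi> x" "g ^ h * level (Suc h) \<psi> x"]
        unfolding bump_err_def by (simp add: mult.assoc)
    qed
    then have "(\<Sum>x<?M. (bump_err g \<psi> x)\<^sup>2) \<le>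
        (\<Sum>x<?M. 2 * ?D\<^sup>2 * g ^ (2 * h) * g\<^sup>2 * (level h \<psi> x)\<^sup>2 + 2 * g ^ (2 * h) * (level (Suc h) \<psi> x)\<^sup>2)"
      by (intro sum_mono)
    also have "\<dots> = 2 * ?D\<^sup>2 * g ^ (2 * h) * g\<^sup>2 * (\<Sum>x<?M. (level h \<psi> x)\<^sup>2) + 2 * g ^ (2 * h) * (\<Sum>x<?M. (level (Suc h) \<psi> x)\<^sup>2)"
      by (simp add: sum.distrib sum_distrib_left)
    also have "\<dots> \<le> 2 * ?D\<^sup>2 * g ^ (2 * h) * g\<^sup>2 * (?D ^ h * Z) + 2 * g ^ (2 * h) * (?D ^ Suc h * Z)"
      using g norm[of h] norm[of "Suc h"] by (intro add_mono mult_left_mono) auto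
    also have "\<dots> = 2 * ?D * (g ^ (2 * h) * ?D ^ h) * (q + 1) * Z"
      by (simp add: q_def power2_eq_square algebra_simps)
    also have "\<dots> \<le> 2 * ?D * q ^ h * 2 * Z"
      unfolding qh using q Z d by (intro mult_right_mono mult_left_mono) auto
    also have "2 * ?D * q ^ h * 2 * Z = 4 * ?D * q ^ h * Z" by (simp only: mult.commute mult.left_commute mult.assoc)
    finally show ?thesis .
  qed
  have young: "- 2 * (\<Sum>x<?M. \<psi> x * bump_err g \<psi> x) \<le> \<eta> * (\<Sum>x<?M. (\<psi> x)\<^sup>2) + (\<Sum>x<?M. (bump_err g \<psi> x)\<^sup>2) / \<eta>"
  proof -
    have "- 2 * (a * b) \<le> \<eta> * a\<^sup>2 + b\<^sup>2 / \<eta>" for a b :: real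
    proof -
      have "0 \<le> (\<eta> * a + b)\<^sup>2 / \<eta>" using \<eta> by simp
      also have "\<dots> = \<eta> * a\<^sup>2 + b\<^sup>2 / \<eta> + 2 * (a * b)" using \<eta> by (simp add: power2_eq_square field_simps)
      finally show ?thesis by simp
    qed
    then have "(\<Sum>x<?M. - 2 * (\<psi> x * bump_err g \<psi> x)) \<le> (\<Sum>x<?M. \<eta> * (\<psi> x)\<^sup>2 + (bump_err g \<psi> x)\<^sup>2 / \<eta>)"
      by (intro sum_mono)
    then show ?thesis by (simp add: sum.distrib sum_distrib_left sum_divide_distrib sum_negf)
  qed
  have err3: "(\<Sum>x<?M. (bump_err g \<psi> x)\<^sup>2) / \<eta> \<le> 4 * ?D * q ^ h / \<eta> * Z"
    using divide_right_mono[OF err2, of \<eta>] \<eta> by simp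
  \<comment> \<open>The fibre averages of the difference are minus those of \<open>bump\<close>.
    Their squares are of order 1/N^2 while the lifted part carries the factor \<open>N\<close>,
    which leaves 1/N.\<close>
  have low: "qform ?M E' g (\<lambda>x. \<psi> x - ?G x) \<ge> - (d * ((real h + 1)\<^sup>2 * real d ^ (2 * h + 1)) / N * Z)"
  proof -
    define a where "a = fibre_avg N (\<lambda>x. \<psi> x - ?G x)"
    have a: "a v = - fibre_avg N ?G v" if "v < n" for v
      using \<psi>[OF that] by (simp add: a_def fibre_avg_def sum_subtractf)
    have "qform ?M E' g (\<lambda>x. (\<psi> x - ?G x) - a (x div N)) \<ge> 0"
      using new fibre_avg_residual[OF N_pos, of "\<lambda>x. \<psi> x - ?G x"] unfolding new_nonneg_def a_def by blast
    then have "qform ?M E' g (\<lambda>x. \<psi> x - ?G x) \<ge> N * qform n E g a"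
      using qform_avg[OF cov gr', of g "\<lambda>x. \<psi> x - ?G x"] by (simp add: a_def)
    moreover have "N * qform n E g a \<ge> N * - (d * (\<Sum>v<n. (a v)\<^sup>2))"
      by (intro mult_left_mono qform_lower[OF gr deg_le g(1,2)]) simp
    moreover have "(\<Sum>v<n. (a v)\<^sup>2) = (\<Sum>v<n. (fibre_avg N ?G v)\<^sup>2)"
      by (intro sum.cong refl) (simp add: a)
    moreover have "N * (d * (\<Sum>v<n. (fibre_avg N ?G v)\<^sup>2)) \<le> N * (d * ((real h + 1)\<^sup>2 * real d ^ (2 * h + 1) / (real N)\<^sup>2 * Z))"
      unfolding Z_def by (intro mult_left_mono fibre_avg_bump[OF g(1,2)]) auto
    moreover have "N * (d * ((real h + 1)\<^sup>2 * real d ^ (2 * h + 1) / (real N)\<^sup>2 * Z)) = d * ((real h + 1)\<^sup>2 * real d ^ (2 * h + 1)) / N * Z"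
      using N_pos by (simp add: power2_eq_square)
    ultimately show ?thesis by simp
  qed
  have "qform ?M E' g ?G = K + (\<Sum>x<?M. ?G x * bump_err g \<psi> x)"
    unfolding qform_qop by (rule qop) (rule bump_U)
  moreover have "(\<Sum>x<?M. \<psi> x * qop E' g ?G x) = K + (\<Sum>x<?M. \<psi> x * bump_err g \<psi> x)"
    by (rule qop) simp
  ultimately have "qform ?M E' g (\<lambda>x. \<psi> x - ?G x) = qform ?M E' g \<psi> - K - 2 * (\<Sum>x<?M. \<psi> x * bump_err g \<psi> x)
      + (\<Sum>x<?M. ?G x * bump_err g \<psi> x)"
    unfolding qform_diff[OF gr'] by simp
  then have "qform ?M E' g \<psi> + \<eta> * (\<Sum>x<?M. (\<psi> x)\<^sup>2) \<ge> K
      - (4 * ?D * q ^ h / \<eta> * Z + ?D * g * q ^ h * Z + d * ((real h + 1)\<^sup>2 * real d ^ (2 * h + 1)) / N * Z)"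
    using low young err1 err3 by linarith
  also have "4 * ?D * q ^ h / \<eta> * Z + ?D * g * q ^ h * Z + d * ((real h + 1)\<^sup>2 * real d ^ (2 * h + 1)) / N * Z = loss g \<eta> * Z"
    unfolding loss_def q_def by (simp only: distrib_right)
  finally show ?thesis unfolding K_def Z_def .
qed

section \<open>Deleting the chosen edges\<close>

definition cut :: "nat \<Rightarrow> nat \<Rightarrow> bool" where
  "cut x y \<longleftrightarrow> E' x y \<and> \<not> (x \<in> U \<and> y = \<tau> x)"

lemma graph_on_cut: "graph_on (n * N) cut"
  unfolding graph_on_def cut_def using gr' \<tau>_in \<tau>_inv by (auto dest: graph_onD)

lemma nbrs_cut: "{y. cut x y} = {y. E' x y} - (if x \<in> U then {\<tau> x} else {})"
  by (auto simp: cut_def)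

lemma deg_cut: "real (deg cut x) = real (deg E' x) - (if x \<in> U then 1 else 0)"
proof (cases "x \<in> U")
  case True
  then have "card {y. E' x y} = Suc (card ({y. E' x y} - {\<tau> x}))"
    using \<tau>_adj[OF True] finite_nbrs'[of x] by (intro card.remove) auto
  then show ?thesis using True by (simp add: deg_def nbrs_cut)
qed (simp add: deg_def nbrs_cut)

lemma deg_cut_le: "deg cut x \<le> d"
proof -
  have "deg cut x \<le> deg E' x"
    unfolding deg_def by (intro card_mono finite_nbrs') (auto simp: cut_def)
  then show ?thesis using deg'_le[of x] by simp
qed

text \<open>Each end of a deleted edge loses one neighbour and so gains one attached tree, which
  lowers its diagonal weight by \<open>g\<close>.\<close>

lemma qform_cut: "qform (n * N) cut g f = qform (n * N) E' g f - (\<Sum>u\<in>U. g * (f u)\<^sup>2 - f u * f (\<tau> u))"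
proof -
  have "(\<Sum>x<n * N. ((real (deg cut x) - 1) * g + 1 / g) * (f x)\<^sup>2) =
    (\<Sum>x<n * N. ((real (deg E' x) - 1) * g + 1 / g) * (f x)\<^sup>2 - (if x \<in> U then g * (f x)\<^sup>2 else 0))"
    by (intro sum.cong refl) (simp add: deg_cut algebra_simps)
  moreover have "(\<Sum>x<n * N. \<Sum>y | cut x y. f x * f y) = (\<Sum>x<n * N. (\<Sum>y | E' x y. f x * f y) - (if x \<in> U then f x * f (\<tau> x) else 0))"
  proof (intro sum.cong refl)
    fix x
    show "(\<Sum>y | cut x y. f x * f y) = (\<Sum>y | E' x y. f x * f y) - (if x \<in> U then f x * f (\<tau> x) else 0)"
    proof (cases "x \<in> U")
      case True
      then have "(\<Sum>y | E' x y. f x * f y) = f x * f (\<tau> x) + (\<Sum>y\<in>{y. E' x y} - {\<tau> x}. f x * f y)"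
        using \<tau>_adj[OF True] finite_nbrs'[of x] by (intro sum.remove) auto
      then show ?thesis using True by (simp add: nbrs_cut)
    qed (simp add: nbrs_cut)
  qed
  ultimately show ?thesis
    unfolding qform_def by (simp add: sum_subtractf sum_U)
qed

text \<open>\<open>U\<close> is in bijection with the directed edges of the base. This is the reason
  for deleting one lift of every edge: lifted functions on the deleted edges reproduce sums over the
  base.\<close>

lemma sum_darts: "(\<Sum>u\<in>U. F (u div N) (\<tau> u div N)) = (\<Sum>v<n. \<Sum>w | E v w. F v w)"
proof -
  have "(\<Sum>u\<in>U. F (u div N) (\<tau> u div N)) = (\<Sum>(v, w)\<in>{(v, w). E v w}. F v w)"
  proof -
    have "bij_betw (\<lambda>u. (u div N, \<tau> u div N)) U {(v, w). E v w}"
      unfolding bij_betw_def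
    proof
      show "inj_on (\<lambda>u. (u div N, \<tau> u div N)) U"
        by (intro inj_onI) (use dart_systemD(6)[OF darts] in auto)
      show "(\<lambda>u. (u div N, \<tau> u div N)) ` U = {(v, w). E v w}"
        using dart_systemD(4,5)[OF darts] by fast
    qed
    from sum.reindex_bij_betw[OF this, of "\<lambda>(v, w). F v w"] show ?thesis by simp
  qed
  also have "{(v, w). E v w} = Sigma {..<n} (\<lambda>v. {w. E v w})"
    using graph_onD(1)[OF gr] by auto
  also have "(\<Sum>(v, w)\<in>\<dots>. F v w) = (\<Sum>v<n. \<Sum>w | E v w. F v w)"
    using finite_nbrs[OF gr] by (intro sum.Sigma[symmetric]) simp_all
  finally show ?thesis .
qed

lemma complete_square:
  fixes c g x y z w :: real
  assumes "c > 0"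
  shows "c * z\<^sup>2 - 2 * z * (g * x - y) \<ge> - ((g * x - y)\<^sup>2 / c)"
proof -
  have "0 \<le> (c * z - (g * x - y))\<^sup>2 / c" using assms by simp
  also have "\<dots> = c * z\<^sup>2 - 2 * z * (g * x - y) + (g * x - y)\<^sup>2 / c"
    using assms by (simp add: power2_eq_square field_simps)
  finally show ?thesis by simp
qed

text \<open>Split \<open>f\<close> into its fibre averages and a new part \<open>\<psi>\<close>. In
  the sum of the dart terms from \<open>new_part_bound\<close> and from the deletion, the products
  of \<open>\<psi>\<close> at the two ends of an edge cancel, so each dart carries a quadratic in
  \<open>\<psi> u\<close> alone with leading coefficient \<open>c\<close>. Completing the square
  removes \<open>\<psi>\<close>, and \<open>sum_darts\<close> expresses the rest through the
  base.\<close>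

lemma cut_lower_bound:
  assumes d: "d \<ge> 2" and g: "0 < g" "g < 1" "(real d - 1) * g\<^sup>2 \<le> 1" and t: "0 < t" "t \<le> 1" and e: "e > 0"
    and new: "\<And>\<psi>. (\<And>v. v < n \<Longrightarrow> (\<Sum>x\<in>fibre N v. \<psi> x) = 0) \<Longrightarrow> qform (n * N) E' g \<psi> \<ge> e * (\<Sum>x<n * N. (\<psi> x)\<^sup>2)"
    and c: "c = 1 / g - g - (t * (1 / g + 1) + loss g (t * e))" "c > 0"
  shows "qform (n * N) cut g f \<ge> (N - (2 * g / c + 1)) * qform n E g (fibre_avg N f)
     + (\<Sum>v<n. ((2 * g / c + 1) * ((real (deg E v) - 1) * g + 1 / g) - ((1 + g\<^sup>2) / c + g) * real (deg E v)) * (fibre_avg N f v)\<^sup>2)"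
proof -
  define a where "a = fibre_avg N f"
  define \<psi> where "\<psi> x = f x - a (x div N)" for x
  let ?M = "n * N" and ?L = "loss g (t * e)"
  define Z where "Z = (\<Sum>u\<in>U. (\<psi> u)\<^sup>2)"
  define K where "K = (\<Sum>u\<in>U. \<psi> u * (\<psi> u / g - \<psi> (\<tau> u)))"
  have Z: "Z \<ge> 0" unfolding Z_def by (intro sum_nonneg) auto
  have \<psi>_new: "(\<Sum>x\<in>fibre N v. \<psi> x) = 0" for v
    unfolding \<psi>_def a_def by (rule fibre_avg_residual[OF N_pos])
  have nn: "new_nonneg N n E' g"
    unfolding new_nonneg_def using new e by (meson mult_nonneg_nonneg less_imp_le order_trans sum_nonneg zero_le_power2)
  have loss0: "?L \<ge> 0"
    unfolding loss_def using d g t e by (intro add_nonneg_nonneg mult_nonneg_nonneg divide_nonneg_nonneg) auto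
  \<comment> \<open>A share \<open>t\<close> of the form is held back: strict positivity with
    constant \<open>e\<close> on this share pays for the term \<open>t * e\<close> times the squared
    norm of \<open>\<psi>\<close>. The price is \<open>t * K\<close>, which is at most t (1/g + 1)
    Z.\<close>
  have "(1 - t) * qform ?M E' g \<psi> + t * qform ?M E' g \<psi> \<ge> K - (t * (1 / g + 1) + ?L) * Z"
  proof -
    have "qform ?M E' g \<psi> \<ge> K - ?L * Z - t * e * (\<Sum>x<?M. (\<psi> x)\<^sup>2)"
      using new_part_bound[OF d g _ nn \<psi>_new, of "t * e"] t e unfolding K_def Z_def by simp
    then have "(1 - t) * qform ?M E' g \<psi> \<ge> (1 - t) * (K - ?L * Z - t * e * (\<Sum>x<?M. (\<psi> x)\<^sup>2))"
      using t by (intro mult_left_mono) auto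
    moreover have "t * qform ?M E' g \<psi> \<ge> t * (e * (\<Sum>x<?M. (\<psi> x)\<^sup>2))"
      using t new[OF \<psi>_new] by (intro mult_left_mono) auto
    moreover have "t * K \<le> t * ((1 / g + 1) * Z)"
    proof (intro mult_left_mono)
      have "\<psi> u * (\<psi> u / g - \<psi> (\<tau> u)) \<le> (1 / g) * (\<psi> u)\<^sup>2 + ((\<psi> u)\<^sup>2 + (\<psi> (\<tau> u))\<^sup>2) / 2" for u
        using zero_le_power2[of "\<psi> u + \<psi> (\<tau> u)"] by (simp add: power2_eq_square algebra_simps add_divide_distrib)
      then have "K \<le> (\<Sum>u\<in>U. (1 / g) * (\<psi> u)\<^sup>2 + ((\<psi> u)\<^sup>2 + (\<psi> (\<tau> u))\<^sup>2) / 2)"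
        unfolding K_def by (intro sum_mono)
      also have "\<dots> = (1 / g) * Z + (Z + (\<Sum>u\<in>U. (\<psi> (\<tau> u))\<^sup>2)) / 2"
        unfolding Z_def sum.distrib sum_distrib_left[symmetric] sum_divide_distrib[symmetric] by simp
      also have "(\<Sum>u\<in>U. (\<psi> (\<tau> u))\<^sup>2) = Z"
        unfolding Z_def by (rule sum_\<tau>)
      finally show "K \<le> (1 / g + 1) * Z" by (simp add: algebra_simps)
    qed (use t in simp)
    moreover have "t * (t * e * (\<Sum>x<?M. (\<psi> x)\<^sup>2)) \<ge> 0" "t * (?L * Z) \<ge> 0"
      using t e loss0 Z by (auto intro!: mult_nonneg_nonneg sum_nonneg)
    ultimately show ?thesis by (simp add: algebra_simps)
  qed
  then have new_low: "qform ?M E' g \<psi> \<ge> K - (1 / g - g - c) * Z"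
    unfolding c(1) by (simp add: algebra_simps)
  have f: "f x = a (x div N) + \<psi> x" for x by (simp add: \<psi>_def)
  have dec: "qform ?M E' g f = N * qform n E g a + qform ?M E' g \<psi>"
    using qform_avg[OF cov gr', of g f] unfolding a_def \<psi>_def by simp
  define X where "X u = a (u div N)" for u
  have X2: "(\<Sum>u\<in>U. (X u)\<^sup>2) = (\<Sum>v<n. real (deg E v) * (a v)\<^sup>2)"
    unfolding X_def using sum_darts[of "\<lambda>v w. (a v)\<^sup>2"] by (simp add: deg_def)
  have XX: "(\<Sum>u\<in>U. X u * X (\<tau> u)) = (\<Sum>v<n. ((real (deg E v) - 1) * g + 1 / g) * (a v)\<^sup>2) - qform n E g a"
    unfolding X_def using sum_darts[of "\<lambda>v w. a v * a w"] by (simp add: qform_def)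
  have "K - (1 / g - g - c) * Z - (\<Sum>u\<in>U. g * (f u)\<^sup>2 - f u * f (\<tau> u)) =
     (\<Sum>u\<in>U. (c * (\<psi> u)\<^sup>2 - 2 * \<psi> u * (g * X u - X (\<tau> u))) - g * (X u)\<^sup>2 + X u * X (\<tau> u))"
  proof -
    have "(\<Sum>u\<in>U. X u * \<psi> (\<tau> u)) = (\<Sum>u\<in>U. X (\<tau> u) * \<psi> u)"
      using sum_\<tau>[of "\<lambda>u. X (\<tau> u) * \<psi> u"] by (simp add: \<tau>_inv)
    moreover have "K - (1 / g - g - c) * Z - (\<Sum>u\<in>U. g * (f u)\<^sup>2 - f u * f (\<tau> u)) =
      (\<Sum>u\<in>U. (c * (\<psi> u)\<^sup>2 - 2 * \<psi> u * (g * X u - X (\<tau> u))) - g * (X u)\<^sup>2 + X u * X (\<tau> u))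
      + (\<Sum>u\<in>U. X u * \<psi> (\<tau> u)) - (\<Sum>u\<in>U. X (\<tau> u) * \<psi> u)"
      unfolding K_def Z_def f X_def[symmetric] sum_distrib_left sum_subtractf[symmetric] sum.distrib[symmetric]
      by (intro sum.cong refl) (simp add: power2_eq_square algebra_simps)
    ultimately show ?thesis by simp
  qed
  also have "\<dots> \<ge> (\<Sum>u\<in>U. - ((g * X u - X (\<tau> u))\<^sup>2 / c) - g * (X u)\<^sup>2 + X u * X (\<tau> u))"
    using complete_square[OF c(2)] by (intro sum_mono add_mono diff_mono) auto
  also have "(\<Sum>u\<in>U. - ((g * X u - X (\<tau> u))\<^sup>2 / c) - g * (X u)\<^sup>2 + X u * X (\<tau> u)) =
     (2 * g / c + 1) * (\<Sum>u\<in>U. X u * X (\<tau> u)) - (g\<^sup>2 / c + g) * (\<Sum>u\<in>U. (X u)\<^sup>2) - 1 / c * (\<Sum>u\<in>U. (X (\<tau> u))\<^sup>2)"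
    unfolding sum_distrib_left sum_subtractf[symmetric]
    using c(2) by (intro sum.cong refl) (simp add: power2_eq_square field_simps)
  also have "(\<Sum>u\<in>U. (X (\<tau> u))\<^sup>2) = (\<Sum>u\<in>U. (X u)\<^sup>2)" by (rule sum_\<tau>)
  finally have "qform ?M cut g f \<ge> N * qform n E g a + ((2 * g / c + 1) * (\<Sum>u\<in>U. X u * X (\<tau> u))
      - (g\<^sup>2 / c + g) * (\<Sum>u\<in>U. (X u)\<^sup>2) - 1 / c * (\<Sum>u\<in>U. (X u)\<^sup>2))"
    using new_low unfolding qform_cut dec by linarith
  also have "N * qform n E g a + ((2 * g / c + 1) * (\<Sum>u\<in>U. X u * X (\<tau> u))
      - (g\<^sup>2 / c + g) * (\<Sum>u\<in>U. (X u)\<^sup>2) - 1 / c * (\<Sum>u\<in>U. (X u)\<^sup>2)) =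
    (N - (2 * g / c + 1)) * qform n E g a + ((2 * g / c + 1) * (\<Sum>v<n. ((real (deg E v) - 1) * g + 1 / g) * (a v)\<^sup>2)
      - ((1 + g\<^sup>2) / c + g) * (\<Sum>v<n. real (deg E v) * (a v)\<^sup>2))"
    unfolding X2 XX by (simp add: algebra_simps add_divide_distrib)
  also have "(2 * g / c + 1) * (\<Sum>v<n. ((real (deg E v) - 1) * g + 1 / g) * (a v)\<^sup>2)
      - ((1 + g\<^sup>2) / c + g) * (\<Sum>v<n. real (deg E v) * (a v)\<^sup>2) =
      (\<Sum>v<n. ((2 * g / c + 1) * ((real (deg E v) - 1) * g + 1 / g) - ((1 + g\<^sup>2) / c + g) * real (deg E v)) * (a v)\<^sup>2)"
    unfolding sum_distrib_left sum_subtractf[symmetric] by (intro sum.cong refl) (simp add: algebra_simps)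
  finally show ?thesis unfolding a_def .
qed

end

section \<open>Levels, and the gain of one cut\<close>

definition lam :: "nat \<Rightarrow> real \<Rightarrow> real" where
  "lam d g = (real d - 1) * g + 1 / g"

lemma lam_less:
  assumes "d \<ge> 2" "0 < g" "g < g'" "(real d - 1) * g'\<^sup>2 \<le> 1"
  shows "lam d g' < lam d g"
proof -
  have "(real d - 1) * (g * g') < (real d - 1) * (g' * g')"
    using assms by (intro mult_strict_left_mono mult_strict_right_mono) auto
  also have "\<dots> \<le> 1" using assms(4) by (simp add: power2_eq_square)
  finally have lt: "real d - 1 < 1 / (g * g')" using assms by (simp add: field_simps)
  have "lam d g - lam d g' = (g' - g) * (1 / (g * g') - (real d - 1))"
    using assms by (simp add: lam_def field_simps)
  also have "\<dots> > 0" using assms lt by (intro mult_pos_pos) auto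
  finally show ?thesis by simp
qed

lemma lam_le:
  assumes "d \<ge> 2" "0 < g" "g \<le> g'" "(real d - 1) * g'\<^sup>2 \<le> 1"
  shows "lam d g' \<le> lam d g"
  using lam_less[of d g g'] assms by (cases "g = g'") auto

text \<open>The diagonal weight is the level minus (d - deg) g, so passing from \<open>g'\<close>
  down to \<open>g\<close> adds the difference of levels and a nonnegative multiple of
  \<open>g' - g\<close>.\<close>

lemma qform_lam_diff:
  assumes deg: "\<And>x. x < n \<Longrightarrow> deg E x \<le> d" and g: "0 < g" "g \<le> g'"
  shows "qform n E g f \<ge> qform n E g' f + (lam d g - lam d g') * (\<Sum>x<n. (f x)\<^sup>2)"
proof -
  have "(lam d g - lam d g') * (\<Sum>x<n. (f x)\<^sup>2) + (\<Sum>x<n. ((real (deg E x) - 1) * g' + 1 / g') * (f x)\<^sup>2)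
      = (\<Sum>x<n. (lam d g - lam d g' + ((real (deg E x) - 1) * g' + 1 / g')) * (f x)\<^sup>2)"
    by (simp add: sum_distrib_left sum.distrib distrib_right)
  also have "\<dots> \<le> (\<Sum>x<n. ((real (deg E x) - 1) * g + 1 / g) * (f x)\<^sup>2)"
  proof (intro sum_mono mult_right_mono)
    fix x assume "x \<in> {..<n}"
    then have "(real d - deg E x) * (g' - g) \<ge> 0" using deg g by (intro mult_nonneg_nonneg) auto
    then show "lam d g - lam d g' + ((real (deg E x) - 1) * g' + 1 / g') \<le> (real (deg E x) - 1) * g + 1 / g"
      by (simp add: lam_def algebra_simps)
  qed simp
  finally show ?thesis unfolding qform_def by simp
qed

context dart_stage
begin

lemma cut_closed_walks:
  assumes "\<And>v. closed_walks E L v = {}"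
  shows "closed_walks cut L v = {}"
proof (rule ccontr)
  assume "closed_walks cut L v \<noteq> {}"
  then obtain xs where "xs \<in> closed_walks cut L v" by blast
  then have "xs \<in> closed_walks E' L v" by (auto simp: closed_walks_def nb_walk_def cut_def)
  from closed_walks_project[OF cov gr' this] show False using assms by simp
qed

text \<open>Lifted functions as test functions: one stage cannot lower the top level by more than
  \<open>d / N\<close>.\<close>

lemma cut_upper_bound:
  fixes \<phi> :: "nat \<Rightarrow> real"
  assumes "g > 0"
  shows "qform (n * N) cut g (\<lambda>x. \<phi> (x div N)) \<le> N * qform n E g \<phi> + d * (\<Sum>v<n. (\<phi> v)\<^sup>2)"
proof -
  define X where "X u = \<phi> (u div N)" for u
  have X2: "(\<Sum>u\<in>U. (X u)\<^sup>2) = (\<Sum>v<n. real (deg E v) * (\<phi> v)\<^sup>2)"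
    unfolding X_def using sum_darts[of "\<lambda>v w. (\<phi> v)\<^sup>2"] by (simp add: deg_def)
  have "- (\<Sum>u\<in>U. g * (X u)\<^sup>2 - X u * X (\<tau> u)) = (\<Sum>u\<in>U. - (g * (X u)\<^sup>2 - X u * X (\<tau> u)))"
    by (simp only: sum_negf)
  also have "\<dots> \<le> (\<Sum>u\<in>U. ((X u)\<^sup>2 + (X (\<tau> u))\<^sup>2) / 2)"
  proof (intro sum_mono)
    fix u
    have "2 * (g * (X u)\<^sup>2) \<ge> 0" using assms by simp
    moreover have "2 * (X u * X (\<tau> u)) \<le> (X u)\<^sup>2 + (X (\<tau> u))\<^sup>2"
      using sum_squares_bound[of "X u" "X (\<tau> u)"] by (simp add: mult.assoc)
    ultimately show "- (g * (X u)\<^sup>2 - X u * X (\<tau> u)) \<le> ((X u)\<^sup>2 + (X (\<tau> u))\<^sup>2) / 2"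
      by (simp add: field_simps)
  qed
  also have "\<dots> = ((\<Sum>u\<in>U. (X u)\<^sup>2) + (\<Sum>u\<in>U. (X (\<tau> u))\<^sup>2)) / 2"
    unfolding sum_divide_distrib[symmetric] sum.distrib ..
  also have "(\<Sum>u\<in>U. (X (\<tau> u))\<^sup>2) = (\<Sum>u\<in>U. (X u)\<^sup>2)" by (rule sum_\<tau>)
  also have "((\<Sum>u\<in>U. (X u)\<^sup>2) + (\<Sum>u\<in>U. (X u)\<^sup>2)) / 2 \<le> d * (\<Sum>v<n. (\<phi> v)\<^sup>2)"
    unfolding X2 sum_distrib_left using deg_le by (auto intro!: sum_mono mult_right_mono)
  finally show ?thesis
    unfolding qform_cut qform_lift[OF cov] X_def by linarith
qed

text \<open>Without losses \<open>c\<close> is 1/g - g and the coefficient is exactly 1/g - (D - 1)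
  g, hence at least (1 - (d - 1) g^2) / g. The bound on \<open>k\<close> takes at most half of this;
  the other half covers \<open>\<kappa>\<close>.\<close>

lemma cut_coefficient:
  fixes g \<kappa> k :: real
  assumes d: "d \<ge> 3" and g: "0 < g" "(real d - 1) * g\<^sup>2 < 1" and k: "k \<le> (1 - (real d - 1) * g\<^sup>2) / (2 * g)"
    and \<kappa>: "0 \<le> \<kappa>" "\<kappa> \<le> k" and c: "c = 1 / g - g - \<kappa>" and D: "D \<le> real d"
  shows "c > 0" "2 * g / c + 1 \<le> 5" "(2 * g / c + 1) * ((D - 1) * g + 1 / g) - ((1 + g\<^sup>2) / c + g) * D \<ge> k"
proof -
  define q where "q = (real d - 1) * g\<^sup>2"
  have q: "2 * g\<^sup>2 \<le> q" unfolding q_def using d by (intro mult_right_mono) auto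
  have g1: "g\<^sup>2 < 1" using q g unfolding q_def[symmetric] by (smt (verit) zero_le_power2)
  have "c \<ge> 1 / g - g - (1 - q) / (2 * g)" using c \<kappa> k by (simp add: q_def)
  also have "1 / g - g - (1 - q) / (2 * g) = (1 - 2 * g\<^sup>2 + q) / (2 * g)"
    using g by (simp add: field_simps power2_eq_square)
  also have "\<dots> \<ge> 1 / (2 * g)" using q g by (intro divide_right_mono) auto
  finally have cg: "c \<ge> 1 / (2 * g)" .
  then show c0: "c > 0" using g by (smt (verit) divide_pos_pos)
  have "2 * g / c \<le> 4 * g\<^sup>2" using cg c0 g by (simp add: field_simps power2_eq_square)
  then show "2 * g / c + 1 \<le> 5" using g1 by simp
  have "(2 * g / c + 1) * ((D - 1) * g + 1 / g) - ((1 + g\<^sup>2) / c + g) * D =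
      (1 / g - g) / c * (c + 2 * g - D * g)"
    using g c0 by (simp add: field_simps power2_eq_square)
  also have "\<dots> \<ge> 1 * k"
  proof (intro mult_mono)
    show "1 \<le> (1 / g - g) / c" using c \<kappa> c0 by simp
    have "D * g \<le> real d * g" using D g by (intro mult_right_mono) auto
    then have "c + 2 * g - D * g \<ge> 1 / g - (real d - 1) * g - \<kappa>" unfolding c by (simp add: algebra_simps)
    also have "1 / g - (real d - 1) * g - \<kappa> = 2 * ((1 - q) / (2 * g)) - \<kappa>"
      using g by (simp add: q_def field_simps power2_eq_square)
    also have "\<dots> \<ge> k" using k \<kappa> unfolding q_def by linarith
    finally show "k \<le> c + 2 * g - D * g" .
    show "0 \<le> (1 / g - g) / c" using \<open>1 \<le> (1 / g - g) / c\<close> by linarith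
    show "0 \<le> k" using \<kappa> by linarith
  qed
  finally show "(2 * g / c + 1) * ((D - 1) * g + 1 / g) - ((1 + g\<^sup>2) / c + g) * D \<ge> k" by simp
qed

lemma cut_gain:
  assumes d: "d \<ge> 3" and g: "0 < g" "(real d - 1) * g\<^sup>2 < 1" and t: "0 < t" "t \<le> 1" and e: "e > 0"
    and new: "\<And>\<psi>. (\<And>v. v < n \<Longrightarrow> (\<Sum>x\<in>fibre N v. \<psi> x) = 0) \<Longrightarrow> qform (n * N) E' g \<psi> \<ge> e * (\<Sum>x<n * N. (\<psi> x)\<^sup>2)"
    and \<kappa>: "t * (1 / g + 1) + loss g (t * e) \<le> k" and k: "k \<le> (1 - (real d - 1) * g\<^sup>2) / (2 * g)"
  shows "\<exists>\<beta>::real. 0 \<le> \<beta> \<and> \<beta> \<le> 5 \<and> (\<forall>f. qform (n * N) cut g f \<ge>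
     (real N - \<beta>) * qform n E g (fibre_avg N f) + k * (\<Sum>v<n. (fibre_avg N f v)\<^sup>2))"
proof -
  define \<kappa>' where "\<kappa>' = t * (1 / g + 1) + loss g (t * e)"
  define c where "c = 1 / g - g - \<kappa>'"
  have g1: "g < 1"
  proof (rule ccontr)
    assume "\<not> g < 1"
    then have "1 \<le> g\<^sup>2" by simp
    then have "1 * 1 \<le> (real d - 1) * g\<^sup>2" using d by (intro mult_mono) auto
    then show False using g by simp
  qed
  have "\<kappa>' \<ge> 0"
    unfolding \<kappa>'_def loss_def using d g t e by (intro add_nonneg_nonneg mult_nonneg_nonneg divide_nonneg_nonneg) auto
  note coeff = cut_coefficient[OF d g k this \<kappa>[folded \<kappa>'_def] c_def]
  show ?thesis
  proof (intro exI[of _ "2 * g / c + 1"] conjI allI)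
    show "0 \<le> 2 * g / c + 1" using coeff(1)[of 0] g by simp
    show "2 * g / c + 1 \<le> 5" using coeff(2)[of 0] by simp
    fix f :: "nat \<Rightarrow> real"
    have "k * (\<Sum>v<n. (fibre_avg N f v)\<^sup>2) \<le>
      (\<Sum>v<n. ((2 * g / c + 1) * ((real (deg E v) - 1) * g + 1 / g) - ((1 + g\<^sup>2) / c + g) * real (deg E v)) * (fibre_avg N f v)\<^sup>2)"
      unfolding sum_distrib_left using deg_le by (intro sum_mono mult_right_mono coeff(3)) auto
    moreover have "qform (n * N) cut g f \<ge> (N - (2 * g / c + 1)) * qform n E g (fibre_avg N f)
     + (\<Sum>v<n. ((2 * g / c + 1) * ((real (deg E v) - 1) * g + 1 / g) - ((1 + g\<^sup>2) / c + g) * real (deg E v)) * (fibre_avg N f v)\<^sup>2)"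
      using d g g1 t e new coeff(1)[of 0] by (intro cut_lower_bound) (auto simp: c_def \<kappa>'_def)
    ultimately show "(N - (2 * g / c + 1)) * qform n E g (fibre_avg N f) + k * (\<Sum>v<n. (fibre_avg N f v)\<^sup>2)
        \<le> qform (n * N) cut g f" by linarith
  qed
qed

end

text \<open>The quantifier order is the point: \<open>k\<close>, \<open>L0\<close> and
  \<open>N\<close> are fixed before the graph is given, so the stage can be iterated with a uniform
  gain. \<open>\<beta>\<close> is the part of the base form used up by the deletion and may depend
  on \<open>g\<close>.\<close>

theorem cutting_stage:
  assumes d: "d \<ge> 3" and g0: "1 / (real d - 1) \<le> g0" "(real d - 1) * g0\<^sup>2 < 1"
  obtains k L0 N where "k > 0" "N \<ge> M" "N > 0"
    "\<And>n E L. graph_on n E \<Longrightarrow> (\<And>x. deg E x \<le> d) \<Longrightarrow> L \<ge> L0 \<Longrightarrow> (\<And>v. closed_walks E L v = {}) \<Longrightarrow>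
      \<exists>C. graph_on (n * N) C \<and> (\<forall>x. deg C x \<le> d) \<and> (\<forall>v. closed_walks C L v = {}) \<and>
        (\<forall>g :: real. 1 / (real d - 1) \<le> g \<longrightarrow> g \<le> g0 \<longrightarrow> (\<exists>\<beta>::real. 0 \<le> \<beta> \<and> \<beta> \<le> N \<and> (\<forall>f. qform (n * N) C g f \<ge>
            (real N - \<beta>) * qform n E g (fibre_avg N f) + k * (\<Sum>v<n. (fibre_avg N f v)\<^sup>2)))) \<and>
        (\<forall>g. \<forall>\<phi> :: nat \<Rightarrow> real. g > 0 \<longrightarrow> qform (n * N) C g (\<lambda>x. \<phi> (x div N)) \<le> N * qform n E g \<phi> + d * (\<Sum>v<n. (\<phi> v)\<^sup>2))"
proof -
  define D where "D = real d - 1"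
  have D: "D \<ge> 2" using d by (simp add: D_def)
  have g0_pos: "g0 > 0" using g0(1) D unfolding D_def[symmetric] by (smt (verit) divide_pos_pos)
  \<comment> \<open>\<open>g1\<close> is the threshold where the level is 2 sqrt (d - 1). The lift
    is nonnegative there on new functions, so at any \<open>g \<le> g0\<close> it is strictly
    positive on them, with constant at least \<open>e\<close>.\<close>
  define g1 where "g1 = 1 / sqrt D"
  have g1: "g1 > 0" "D * g1\<^sup>2 = 1" using D by (simp_all add: g1_def power_divide)
  have "D * g0\<^sup>2 < D * g1\<^sup>2" using g0(2) g1(2) by (simp add: D_def)
  then have "g0\<^sup>2 < g1\<^sup>2" using D by simp
  then have g01: "g0 < g1" using g1(1) by (rule power2_less_imp_less[OF _ less_imp_le])
  have "2 * g1\<^sup>2 \<le> D * g1\<^sup>2" using D by (intro mult_right_mono) auto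
  then have "g1\<^sup>2 < 1" using g1(2) by linarith
  then have g1_lt: "g1 < 1" using power2_less_imp_less[of g1 1] by simp
  define e where "e = lam d g0 - lam d g1"
  have e: "e > 0" unfolding e_def using lam_less[of d g0 g1] d g0_pos g01 g1(2) by (simp add: D_def)
  define q0 where "q0 = D * g0\<^sup>2"
  have q0: "0 < q0" "q0 < 1" using g0 g0_pos D by (auto simp: q0_def D_def)
  define k where "k = (1 - q0) / (2 * g0)"
  have k: "k > 0" unfolding k_def using q0 g0_pos by simp
  \<comment> \<open>On the range of \<open>g\<close> one has 1/g + 1 \<le> d, so the price of the
    held-back share is at most \<open>t * d\<close>, which is \<open>k / 2\<close>.\<close>
  define t where "t = k / (2 * d)"
  have t: "t > 0" unfolding t_def using k d by simp
  have "k \<le> 1 / g0" unfolding k_def using q0 g0_pos by (intro frac_le) auto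
  also have "1 / g0 \<le> D" using g0(1) g0_pos D unfolding D_def[symmetric] by (simp add: field_simps)
  finally have t1: "t \<le> 1" unfolding t_def using d by (simp add: D_def field_simps)
  define A where "A = 4 * D / (t * e) + D"
  have A: "A > 0" unfolding A_def using D t e by (intro add_nonneg_pos divide_nonneg_nonneg) auto
  \<comment> \<open>\<open>A * q0 ^ h\<close> bounds the first two summands of \<open>loss\<close>.
    They get a budget of \<open>k / 4\<close>; another \<open>k / 4\<close> is left for the summand
    with 1/N.\<close>
  obtain h where h: "q0 ^ h < k / 4 / A"
    using real_arch_pow_inv[of "k / 4 / A" q0] q0 k A by auto
  define W where "W = real d * ((real h + 1)\<^sup>2 * real d ^ (2 * h + 1))"
  define B where "B = d * ((d + 1) ^ Suc (2 * h + 2) * (d + 1) ^ Suc (2 * h + 2))"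
  have "1 < (2 :: real)" by simp
  from real_arch_pow[OF this] obtain j where j: "max (max (real M) 5) (max (4 * W / k) (real B)) < 2 ^ j"
    by blast
  \<comment> \<open>A power of two, since the lift is an iterated two-lift. The four lower bounds
    serve the requested \<open>M\<close>, the bound 5 on \<open>\<beta>\<close>, the last summand of
    \<open>loss\<close>, and the room needed by the dart system.\<close>
  define N :: nat where "N = 2 ^ j"
  have N: "real M < N" "5 < real N" "4 * W / k < N" "real B < N"
    using j by (simp_all add: N_def)
  show thesis
  proof (rule that[of k N "2 * h + 4"])
    show "k > 0" by fact
    show "N \<ge> M" "N > 0" using N(1,2) by simp_all
    fix n E L
    assume gr: "graph_on n E" and deg: "\<And>x. deg E x \<le> d" and L: "L \<ge> 2 * h + 4" and cw: "\<And>v. closed_walks E L v = {}"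
    obtain E' where gr': "graph_on (n * N) E'" and cov: "covers N E' E" and nn: "new_nonneg N n E' g1"
      using iterated_lift[OF gr g1(1) g1_lt, of j] unfolding N_def by blast
    obtain U \<tau> where darts: "dart_system N (2 * h + 2) E' {(v, w). E v w} U \<tau>"
      using exists_dart_system[OF gr gr' cov deg] N(4) unfolding B_def of_nat_less_iff by blast
    have cw': "closed_walks E' (2 * h + 4) v = {}" for v
    proof (rule ccontr)
      assume "closed_walks E' (2 * h + 4) v \<noteq> {}"
      then obtain xs where "xs \<in> closed_walks E' (2 * h + 4) v" by blast
      then have "xs \<in> closed_walks E' L v" using L by (auto simp: closed_walks_def)
      from closed_walks_project[OF cov gr' this] show False using cw by simp
    qed
    interpret dart_stage n N d h E E' U \<tau>
      by unfold_locales (fact gr gr' cov deg darts cw')+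
    show "\<exists>C. graph_on (n * N) C \<and> (\<forall>x. deg C x \<le> d) \<and> (\<forall>v. closed_walks C L v = {}) \<and>
        (\<forall>g :: real. 1 / (real d - 1) \<le> g \<longrightarrow> g \<le> g0 \<longrightarrow> (\<exists>\<beta>::real. 0 \<le> \<beta> \<and> \<beta> \<le> N \<and> (\<forall>f. qform (n * N) C g f \<ge>
            (real N - \<beta>) * qform n E g (fibre_avg N f) + k * (\<Sum>v<n. (fibre_avg N f v)\<^sup>2)))) \<and>
        (\<forall>g. \<forall>\<phi> :: nat \<Rightarrow> real. g > 0 \<longrightarrow> qform (n * N) C g (\<lambda>x. \<phi> (x div N)) \<le> N * qform n E g \<phi> + d * (\<Sum>v<n. (\<phi> v)\<^sup>2))"
    proof (rule exI[of _ cut], intro conjI allI impI)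
      show "graph_on (n * N) cut" "\<And>x. deg cut x \<le> d" by (rule graph_on_cut deg_cut_le)+
      show "closed_walks cut L v = {}" for v by (rule cut_closed_walks[OF cw])
      show "qform (n * N) cut g (\<lambda>x. \<phi> (x div N)) \<le> N * qform n E g \<phi> + d * (\<Sum>v<n. (\<phi> v)\<^sup>2)" if "g > 0" for g :: real and \<phi> :: "nat \<Rightarrow> real"
        by (rule cut_upper_bound[OF that])
      fix g assume g: "1 / (real d - 1) \<le> g" "g \<le> g0"
      have g_pos: "g > 0" using g(1) D unfolding D_def[symmetric] by (smt (verit) divide_pos_pos)
      define q where "q = (real d - 1) * g\<^sup>2"
      have q: "0 \<le> q" "q \<le> q0"
        unfolding q_def q0_def D_def[symmetric] using g g_pos D by (auto intro!: mult_left_mono power_mono)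
      have "\<exists>\<beta>::real. 0 \<le> \<beta> \<and> \<beta> \<le> 5 \<and> (\<forall>f. qform (n * N) cut g f \<ge>
          (real N - \<beta>) * qform n E g (fibre_avg N f) + k * (\<Sum>v<n. (fibre_avg N f v)\<^sup>2))"
      proof (rule cut_gain[OF d g_pos _ t t1 e])
        show "(real d - 1) * g\<^sup>2 < 1" using q q0 by (simp add: q_def)
        show "k \<le> (1 - (real d - 1) * g\<^sup>2) / (2 * g)"
          unfolding k_def q_def[symmetric] using q q0 g g_pos by (intro frac_le) auto
        show "e * (\<Sum>x<n * N. (\<psi> x)\<^sup>2) \<le> qform (n * N) E' g \<psi>" if "\<And>v. v < n \<Longrightarrow> (\<Sum>x\<in>fibre N v. \<psi> x) = 0" for \<psi>
        proof -
          have "qform (n * N) E' g1 \<psi> \<ge> 0" using nn that unfolding new_nonneg_def by blast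
          moreover have "qform (n * N) E' g \<psi> \<ge> qform (n * N) E' g1 \<psi> + (lam d g - lam d g1) * (\<Sum>x<n * N. (\<psi> x)\<^sup>2)"
            using g g01 by (intro qform_lam_diff deg'_le g_pos) auto
          moreover have "e * (\<Sum>x<n * N. (\<psi> x)\<^sup>2) \<le> (lam d g - lam d g1) * (\<Sum>x<n * N. (\<psi> x)\<^sup>2)"
            unfolding e_def using lam_le[of d g g0] d g_pos g(2) g0(2)
            by (intro mult_right_mono) (auto intro!: sum_nonneg)
          ultimately show ?thesis by linarith
        qed
        have "loss g (t * e) \<le> k / 2"
        proof -
          have "q ^ h \<le> q0 ^ h" by (rule power_mono) (use q in auto)
          then have "4 * D * q ^ h / (t * e) + D * g * q ^ h \<le> 4 * D * q0 ^ h / (t * e) + D * 1 * q0 ^ h"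
            using D t e g g_pos g01 g1_lt q q0 by (intro add_mono divide_right_mono mult_mono) auto
          also have "\<dots> = A * q0 ^ h" unfolding A_def by (simp add: algebra_simps)
          also have "\<dots> \<le> k / 4" using h A by (simp add: field_simps)
          finally have "4 * D * q ^ h / (t * e) + D * g * q ^ h \<le> k / 4" .
          moreover have "W / N \<le> k / 4" using N(3) k N(2) by (simp add: field_simps)
          ultimately show ?thesis unfolding loss_def W_def D_def q_def by linarith
        qed
        moreover have "t * (1 / g + 1) \<le> k / 2"
        proof -
          have "1 / g \<le> D" using g(1) g_pos D unfolding D_def[symmetric] by (simp add: field_simps)
          then have "t * (1 / g + 1) \<le> t * d" using t by (intro mult_left_mono) (auto simp: D_def)
          also have "\<dots> = k / 2" using d by (simp add: t_def)
          finally show ?thesis .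
        qed
        ultimately show "t * (1 / g + 1) + loss g (t * e) \<le> k" by linarith
      qed
      then show "\<exists>\<beta>::real. 0 \<le> \<beta> \<and> \<beta> \<le> N \<and> (\<forall>f. qform (n * N) cut g f \<ge>
          (real N - \<beta>) * qform n E g (fibre_avg N f) + k * (\<Sum>v<n. (fibre_avg N f v)\<^sup>2))"
        using N(2) by (meson less_imp_le order_trans)
    qed
  qed
qed

section \<open>Descent of the level\<close>

definition pos_form :: "nat \<Rightarrow> (nat \<Rightarrow> nat \<Rightarrow> bool) \<Rightarrow> real \<Rightarrow> bool" where
  "pos_form n E g \<longleftrightarrow> (\<forall>f. qform n E g f \<ge> 0)"

definition almost_pos_form :: "nat \<Rightarrow> (nat \<Rightarrow> nat \<Rightarrow> bool) \<Rightarrow> real \<Rightarrow> bool" where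
  "almost_pos_form n E g \<longleftrightarrow> (\<exists>c. \<forall>f :: nat \<Rightarrow> real. (\<Sum>x<n. c x * f x) = 0 \<longrightarrow> qform n E g f \<ge> 0)"

text \<open>Pulls a hyperplane of the base back to the cover: \<open>f\<close> satisfies the new
  condition exactly when its fibre averages satisfy the old one.\<close>

lemma sum_fibre_avg:
  fixes c f :: "nat \<Rightarrow> real"
  assumes "N > 0"
  shows "(\<Sum>x<n * N. c (x div N) / N * f x) = (\<Sum>v<n. c v * fibre_avg N f v)"
  unfolding sum_fibres
proof (intro sum.cong refl)
  fix v
  have "(\<Sum>x\<in>fibre N v. c (x div N) / N * f x) = (\<Sum>x\<in>fibre N v. c v / N * f x)"
    using sum_fibre_const[OF assms, of "\<lambda>v x. c v / N * f x" v] .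
  also have "\<dots> = c v / N * (\<Sum>x\<in>fibre N v. f x)" by (simp only: sum_distrib_left)
  finally show "(\<Sum>x\<in>fibre N v. c (x div N) / N * f x) = c v * fibre_avg N f v"
    by (simp add: fibre_avg_def)
qed

text \<open>Raising \<open>g\<close> lowers a diagonal weight at rate at most 1 + 1 / (g g'), and
  both rates are at least 1 / (d - 1), so this is at most d^2.\<close>

lemma qform_increase:
  assumes deg: "\<And>x. deg E x \<le> d" and d: "d \<ge> 2" and g: "1 / (real d - 1) \<le> g" "g \<le> g'" "g' \<le> g + \<delta>"
  shows "qform n E g' f \<ge> qform n E g f - \<delta> * (real d)\<^sup>2 * (\<Sum>x<n. (f x)\<^sup>2)"
proof -
  have D: "real d - 1 > 0" using d by simp
  then have g0: "g > 0" using g(1) by (smt (verit) divide_pos_pos)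
  have "1 / g \<le> real d - 1" using g(1) g0 D by (simp add: field_simps)
  moreover have "1 / g' \<le> 1 / g" using g g0 by (intro frac_le) auto
  ultimately have le: "1 / g \<le> real d - 1" "1 / g' \<le> real d - 1" by linarith+
  have "1 / g * (1 / g') \<le> (real d - 1) * (real d - 1)"
    using le g0 g D by (intro mult_mono) auto
  then have gg: "1 + 1 / (g * g') \<le> (real d)\<^sup>2"
    using d by (simp add: power2_eq_square algebra_simps)
  have "(\<Sum>x<n. ((real (deg E x) - 1) * g + 1 / g) * (f x)\<^sup>2) \<le>
    (\<Sum>x<n. ((real (deg E x) - 1) * g' + 1 / g' + \<delta> * (real d)\<^sup>2) * (f x)\<^sup>2)"
  proof (intro sum_mono mult_right_mono)
    fix x
    have "(real (deg E x) - 1) * g + 1 / g - ((real (deg E x) - 1) * g' + 1 / g') = (g' - g) * (1 / (g * g') + 1) - real (deg E x) * (g' - g)"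
      using g0 g by (simp add: field_simps)
    also have "\<dots> \<le> (g' - g) * (1 / (g * g') + 1)" using g by simp
    also have "\<dots> \<le> \<delta> * (real d)\<^sup>2"
      using g g0 gg by (intro mult_mono) auto
    finally show "(real (deg E x) - 1) * g + 1 / g \<le> (real (deg E x) - 1) * g' + 1 / g' + \<delta> * (real d)\<^sup>2" by simp
  qed simp
  also have "\<dots> = (\<Sum>x<n. ((real (deg E x) - 1) * g' + 1 / g') * (f x)\<^sup>2) + \<delta> * (real d)\<^sup>2 * (\<Sum>x<n. (f x)\<^sup>2)"
    by (simp add: distrib_right sum.distrib sum_distrib_left)
  finally show ?thesis unfolding qform_def by simp
qed

lemma qform_antimono:
  assumes d: "d \<ge> 2" and deg: "\<And>x. deg E x \<le> d" and g: "0 < g" "g \<le> g'" "(real d - 1) * g'\<^sup>2 \<le> 1"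
  shows "qform n E g' f \<le> qform n E g f"
proof -
  have "(lam d g - lam d g') * (\<Sum>x<n. (f x)\<^sup>2) \<ge> 0"
    using lam_le[OF d g] by (intro mult_nonneg_nonneg sum_nonneg) auto
  then show ?thesis using qform_lam_diff[of n E d g g' f] deg g by simp
qed

text \<open>
  Along the stages the level at which the form is nonnegative descends by a fixed step \<open>\<delta>\<close>, because \<open>N\<close>
  and \<open>k\<close> do not depend on the graph; the first stage at which it is nonnegative for \<open>g\<mu>\<close> is the answer.
\<close>

theorem core_graph:
  assumes d: "d \<ge> 3" and g\<mu>: "1 / (real d - 1) \<le> g\<mu>" "lam d g\<mu> < d" and gm: "g\<mu> < gm"
    and g0: "gm \<le> g0" "(real d - 1) * g0\<^sup>2 < 1"
  obtains n E where "n > 0" "graph_on n E" "\<And>x. deg E x \<le> d" "\<And>v. closed_walks E L v = {}"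
    "almost_pos_form n E g0" "pos_form n E g\<mu>" "\<not> pos_form n E gm"
proof -
  define D where "D = real d - 1"
  have D: "D \<ge> 2" using d by (simp add: D_def)
  have g\<mu>_pos: "g\<mu> > 0" using g\<mu>(1) D unfolding D_def[symmetric] by (smt (verit) divide_pos_pos)
  have sq: "D * g\<^sup>2 < 1" if "0 < g" "g \<le> g0" for g
  proof -
    have "D * g\<^sup>2 \<le> D * g0\<^sup>2" using that D by (intro mult_left_mono power_mono) auto
    then show ?thesis using g0 by (simp add: D_def)
  qed
  \<comment> \<open>A stage lowers the top level by at most \<open>d / N\<close>. With
    \<open>N * gap \<ge> d\<close>, a form that is not yet nonnegative at \<open>g\<mu>\<close>
    cannot become nonnegative at \<open>gm\<close> in one stage.\<close>
  define gap where "gap = lam d g\<mu> - lam d gm"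
  have gap: "gap > 0"
    unfolding gap_def using lam_less[of d g\<mu> gm] sq[of gm] d g\<mu>_pos gm g0 by (simp add: D_def)
  have "1 / (real d - 1) \<le> g0" using g\<mu> gm g0 by linarith
  from cutting_stage[OF d this g0(2), of "nat \<lceil>d / gap\<rceil>"]
  obtain k L0 N where k: "k > 0" and N: "N \<ge> nat \<lceil>d / gap\<rceil>" "N > 0" and stage:
    "\<And>n E L. graph_on n E \<Longrightarrow> (\<And>x. deg E x \<le> d) \<Longrightarrow> L \<ge> L0 \<Longrightarrow> (\<And>v. closed_walks E L v = {}) \<Longrightarrow>
      \<exists>C. graph_on (n * N) C \<and> (\<forall>x. deg C x \<le> d) \<and> (\<forall>v. closed_walks C L v = {}) \<and>
        (\<forall>g :: real. 1 / (real d - 1) \<le> g \<longrightarrow> g \<le> g0 \<longrightarrow> (\<exists>\<beta>::real. 0 \<le> \<beta> \<and> \<beta> \<le> N \<and> (\<forall>f. qform (n * N) C g f \<ge>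
            (real N - \<beta>) * qform n E g (fibre_avg N f) + k * (\<Sum>v<n. (fibre_avg N f v)\<^sup>2)))) \<and>
        (\<forall>g. \<forall>\<phi> :: nat \<Rightarrow> real. g > 0 \<longrightarrow> qform (n * N) C g (\<lambda>x. \<phi> (x div N)) \<le> N * qform n E g \<phi> + d * (\<Sum>v<n. (\<phi> v)\<^sup>2))"
    by metis
  have "real N \<ge> d / gap" using N(1) by linarith
  then have N_gap: "N * gap \<ge> d" using gap by (simp add: field_simps)
  \<comment> \<open>The step that the gain \<open>k\<close> can pay for: raising \<open>g\<close> by
    \<open>\<delta>\<close> costs at most \<delta> d^2 times the squared norm of the averages, with
    a factor of at most \<open>N\<close>.\<close>
  define \<delta> where "\<delta> = k / (N * (real d)\<^sup>2)"
  have \<delta>: "\<delta> > 0" unfolding \<delta>_def using k N d by simp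
  define L' where "L' = max L L0"
  define good where "good n E \<longleftrightarrow> n > 0 \<and> graph_on n E \<and> (\<forall>x. deg E x \<le> d) \<and> (\<forall>v. closed_walks E L' v = {})
      \<and> almost_pos_form n E g0" for n E
  define g where "g i = min (1 / D + real i * \<delta>) g\<mu>" for i :: nat
  have gi: "1 / D \<le> g i" "g i \<le> g\<mu>" for i using g\<mu> \<delta> by (auto simp: g_def D_def)
  \<comment> \<open>Either the window has been reached or the form is nonnegative at
    \<open>g i\<close> and not yet at \<open>g\<mu>\<close>. The second alternative becomes
    contradictory once \<open>g i = g\<mu>\<close>. The start 1 / D corresponds to level
    \<open>d\<close>.\<close>
  have "\<exists>n E. good n E \<and> (pos_form n E g\<mu> \<and> \<not> pos_form n E gm \<or> pos_form n E (g i) \<and> \<not> pos_form n E g\<mu>)" for i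
  proof (induction i)
    case 0
    define g1 where "g1 = 1 / sqrt D"
    have g1: "g1 > 0" "D * g1\<^sup>2 = 1" using D by (simp_all add: g1_def power_divide)
    have "2 * g1\<^sup>2 \<le> D * g1\<^sup>2" using D by (intro mult_right_mono) auto
    then have "g1\<^sup>2 < 1" using g1(2) by linarith
    then have g1_lt: "g1 < 1" using power2_less_imp_less[of g1 1] by simp
    have "D * g0\<^sup>2 < D * g1\<^sup>2" using g0(2) g1(2) by (simp add: D_def)
    then have "g0\<^sup>2 < g1\<^sup>2" using D by simp
    then have g01: "g0 < g1" using g1(1) by (rule power2_less_imp_less[OF _ less_imp_le])
    obtain n E where E: "expander_on d n E g1" "\<And>v. closed_walks E L' v = {}"
      using high_girth_expander[OF g1(1) g1_lt] by blast
    have E1: "n > 0" "graph_on n E" "\<And>x. x < n \<Longrightarrow> deg E x = d"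
      "\<And>f :: nat \<Rightarrow> real. (\<Sum>x<n. f x) = 0 \<Longrightarrow> qform n E g1 f \<ge> 0"
      using E(1) unfolding expander_on_def by blast+
    have deg: "deg E x \<le> d" for x
    proof (cases "x < n")
      case False
      then have "{y. E x y} = {}" using graph_onD(1)[OF E1(2)] by blast
      then show ?thesis by (simp add: deg_def)
    qed (simp add: E1)
    have "almost_pos_form n E g0"
      unfolding almost_pos_form_def
    proof (intro exI[of _ "\<lambda>_. 1"] allI impI)
      fix f :: "nat \<Rightarrow> real" assume "(\<Sum>x<n. 1 * f x) = 0"
      then have "qform n E g1 f \<ge> 0" using E1(4) by simp
      moreover have "qform n E g1 f \<le> qform n E g0 f"
        using d deg g01 g1 g\<mu>_pos gm g0 by (intro qform_antimono[of d]) (auto simp: D_def)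
      ultimately show "qform n E g0 f \<ge> 0" by simp
    qed
    then have "good n E" unfolding good_def using E1(1,2) deg E(2) by blast
    moreover have "g 0 = 1 / D" using g\<mu> by (simp add: g_def D_def)
    then have "pos_form n E (g 0)"
      unfolding pos_form_def
    proof (intro allI)
      fix f :: "nat \<Rightarrow> real"
      assume g0': "g 0 = 1 / D"
      have "(\<Sum>x<n. ((real (deg E x) - 1) * g 0 + 1 / g 0) * (f x)\<^sup>2) = d * (\<Sum>x<n. (f x)\<^sup>2)"
        unfolding sum_distrib_left g0' using D E1(3) by (intro sum.cong refl) (simp add: D_def)
      then show "qform n E (g 0) f \<ge> 0"
        unfolding qform_def using adj_form_le[OF E1(2) deg, of f] by simp
    qed
    \<comment> \<open>The constant function has Rayleigh quotient \<open>d\<close>, above the level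
      of \<open>g\<mu>\<close>.\<close>
    moreover have "\<not> pos_form n E g\<mu>"
    proof
      assume "pos_form n E g\<mu>"
      then have "qform n E g\<mu> (\<lambda>_. 1) \<ge> 0" unfolding pos_form_def by blast
      moreover have "qform n E g\<mu> (\<lambda>_. 1) = (\<Sum>x<n. lam d g\<mu> - d)"
        unfolding qform_def sum_subtractf[symmetric] using E1(3)
        by (intro sum.cong refl) (simp add: lam_def deg_def)
      ultimately show False using E1(1) g\<mu>(2) by (simp add: zero_le_mult_iff)
    qed
    ultimately show ?case by blast
  next
    case (Suc i)
    then obtain n E where E: "good n E" "pos_form n E g\<mu> \<and> \<not> pos_form n E gm \<or> pos_form n E (g i) \<and> \<not> pos_form n E g\<mu>"
      by blast
    show ?case
    proof (cases "pos_form n E g\<mu> \<and> \<not> pos_form n E gm")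
      case False
      then have pos: "pos_form n E (g i)" and neg: "\<not> pos_form n E g\<mu>" using E(2) by blast+
      have E1: "n > 0" "graph_on n E" "\<And>x. deg E x \<le> d" "\<And>v. closed_walks E L' v = {}" "almost_pos_form n E g0"
        using E(1) unfolding good_def by blast+
      have "L' \<ge> L0" by (simp add: L'_def)
      from stage[OF E1(2,3) this E1(4)] obtain C where C: "graph_on (n * N) C" "\<forall>x. deg C x \<le> d" "\<forall>v. closed_walks C L' v = {}"
        and low: "\<forall>g :: real. 1 / (real d - 1) \<le> g \<longrightarrow> g \<le> g0 \<longrightarrow> (\<exists>\<beta>::real. 0 \<le> \<beta> \<and> \<beta> \<le> N \<and> (\<forall>f. qform (n * N) C g f \<ge>
            (real N - \<beta>) * qform n E g (fibre_avg N f) + k * (\<Sum>v<n. (fibre_avg N f v)\<^sup>2)))"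
        and up: "\<forall>g. \<forall>\<phi> :: nat \<Rightarrow> real. g > 0 \<longrightarrow> qform (n * N) C g (\<lambda>x. \<phi> (x div N)) \<le> N * qform n E g \<phi> + d * (\<Sum>v<n. (\<phi> v)\<^sup>2)"
        by metis
      have "almost_pos_form (n * N) C g0"
      proof -
        obtain c where c: "\<And>f :: nat \<Rightarrow> real. (\<Sum>x<n. c x * f x) = 0 \<Longrightarrow> qform n E g0 f \<ge> 0"
          using E1(5) unfolding almost_pos_form_def by blast
        obtain \<beta> :: real where \<beta>: "\<beta> \<le> N" "\<And>f. qform (n * N) C g0 f \<ge>
            (real N - \<beta>) * qform n E g0 (fibre_avg N f) + k * (\<Sum>v<n. (fibre_avg N f v)\<^sup>2)"
          using low \<open>1 / (real d - 1) \<le> g0\<close> by blast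
        have "qform (n * N) C g0 f \<ge> 0" if "(\<Sum>x<n * N. c (x div N) / N * f x) = 0" for f :: "nat \<Rightarrow> real"
        proof -
          have "qform n E g0 (fibre_avg N f) \<ge> 0" using that unfolding sum_fibre_avg[OF N(2)] by (rule c)
          then have "(real N - \<beta>) * qform n E g0 (fibre_avg N f) + k * (\<Sum>v<n. (fibre_avg N f v)\<^sup>2) \<ge> 0"
            using \<beta>(1) k by (intro add_nonneg_nonneg mult_nonneg_nonneg sum_nonneg) auto
          then show ?thesis using \<beta>(2)[of f] by linarith
        qed
        then show ?thesis unfolding almost_pos_form_def by (intro exI[of _ "\<lambda>x. c (x div N) / N"]) blast
      qed
      then have "good (n * N) C" unfolding good_def using E1(1) N(2) C by simp
      moreover have "pos_form (n * N) C (g (Suc i))"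
        unfolding pos_form_def
      proof
        fix f :: "nat \<Rightarrow> real"
        have "1 / (real d - 1) \<le> g (Suc i)" "g (Suc i) \<le> g0" using gi[of "Suc i"] gm g0 by (auto simp: D_def)
        with low obtain \<beta> :: real where \<beta>: "0 \<le> \<beta>" "\<beta> \<le> N" "qform (n * N) C (g (Suc i)) f \<ge>
            (real N - \<beta>) * qform n E (g (Suc i)) (fibre_avg N f) + k * (\<Sum>v<n. (fibre_avg N f v)\<^sup>2)"
          by blast
        define S where "S = (\<Sum>v<n. (fibre_avg N f v)\<^sup>2)"
        have S: "S \<ge> 0" unfolding S_def by (intro sum_nonneg) auto
        have "qform n E (g (Suc i)) (fibre_avg N f) \<ge> qform n E (g i) (fibre_avg N f) - \<delta> * (real d)\<^sup>2 * S"
          unfolding S_def using d E1(3) gi(1)[of i] \<delta>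
          by (intro qform_increase) (auto simp: g_def D_def distrib_right)
        moreover have "qform n E (g i) (fibre_avg N f) \<ge> 0" using pos unfolding pos_form_def by blast
        ultimately have "(real N - \<beta>) * qform n E (g (Suc i)) (fibre_avg N f) \<ge> (real N - \<beta>) * - (\<delta> * (real d)\<^sup>2 * S)"
          using \<beta>(2) by (intro mult_left_mono) auto
        moreover have "(real N - \<beta>) * (\<delta> * (real d)\<^sup>2 * S) \<le> N * (\<delta> * (real d)\<^sup>2 * S)"
          using \<beta>(1) \<delta> S by (intro mult_right_mono) auto
        moreover have "N * (\<delta> * (real d)\<^sup>2 * S) = k * S" unfolding \<delta>_def using N d by simp
        ultimately show "qform (n * N) C (g (Suc i)) f \<ge> 0" using \<beta>(3) unfolding S_def[symmetric] by simp
      qed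
      moreover have "\<not> pos_form (n * N) C gm"
      proof
        assume "pos_form (n * N) C gm"
        obtain \<phi> where \<phi>: "qform n E g\<mu> \<phi> < 0" using neg unfolding pos_form_def by (auto simp: not_le)
        define S where "S = (\<Sum>v<n. (\<phi> v)\<^sup>2)"
        have S: "S \<ge> 0" unfolding S_def by (intro sum_nonneg) auto
        have "0 \<le> qform (n * N) C gm (\<lambda>x. \<phi> (x div N))"
          using \<open>pos_form (n * N) C gm\<close> unfolding pos_form_def by blast
        also have "\<dots> \<le> N * qform n E gm \<phi> + d * S"
          using up g\<mu>_pos gm unfolding S_def by simp
        also have "\<dots> < N * (- gap * S) + d * S"
        proof -
          have "qform n E gm \<phi> + gap * S \<le> qform n E g\<mu> \<phi>"
            unfolding gap_def S_def using E1(3) g\<mu>_pos gm by (intro qform_lam_diff) auto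
          then have "N * qform n E gm \<phi> < N * (- gap * S)" using \<phi> N(2) by (intro mult_strict_left_mono) auto
          then show ?thesis by simp
        qed
        also have "\<dots> = (d - N * gap) * S" by (simp add: algebra_simps)
        also have "\<dots> \<le> 0" using N_gap S by (intro mult_nonpos_nonneg) auto
        finally show False by simp
      qed
      ultimately show ?thesis by blast
    qed (use E in blast)
  qed
  moreover obtain i where "real i * \<delta> > g\<mu>" using reals_Archimedean3[OF \<delta>] by blast
  then have "g i = g\<mu>" using D by (simp add: g_def min_absorb2 add_increasing less_imp_le)
  ultimately obtain n E where E: "good n E" "pos_form n E g\<mu>" "\<not> pos_form n E gm" by metis
  show thesis
  proof (rule that[of n E])
    show "n > 0" "graph_on n E" "deg E x \<le> d" "almost_pos_form n E g0" for x
      using E(1) unfolding good_def by blast+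
    show "closed_walks E L v = {}" for v
    proof -
      have "closed_walks E L' v = {}" using E(1) unfolding good_def by blast
      moreover have "closed_walks E L v \<subseteq> closed_walks E L' v" by (auto simp: closed_walks_def L'_def)
      ultimately show ?thesis by blast
    qed
  qed (use E in auto)
qed

section \<open>The infinite tree extension\<close>

locale tree_extension =
  fixes n d :: nat and E :: "nat \<Rightarrow> nat \<Rightarrow> bool"
  assumes gr: "graph_on n E" and n_pos: "n > 0" and deg_le: "deg E x \<le> d" and d: "d \<ge> 3"
begin

definition core :: "nat sgraph" where
  "core = \<lparr>verts = {..<n}, adj = E\<rparr>"

abbreviation "T \<equiv> tree_ext d core"

abbreviation "V \<equiv> verts T"

definition kids :: "nat \<times> nat list \<Rightarrow> nat" where
  "kids x = (if snd x = [] then d - deg E (fst x) else d - 1)"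

definition child :: "nat \<times> nat list \<Rightarrow> nat \<Rightarrow> nat \<times> nat list" where
  "child x k = (fst x, snd x @ [k])"

definition parent :: "nat \<times> nat list \<Rightarrow> nat \<times> nat list" where
  "parent x = (fst x, butlast (snd x))"

definition layer :: "nat \<Rightarrow> (nat \<times> nat list) set" where
  "layer j = {x \<in> V. length (snd x) = j}"

lemma degree_core: "degree core x = deg E x"
  by (simp add: degree_def neighbours_def core_def deg_def)

lemma in_V: "(v, ks) \<in> V \<longleftrightarrow> v < n \<and> (ks = [] \<or> hd ks < d - deg E v \<and> (\<forall>k\<in>set (tl ks). k < d - 1))"
  unfolding tree_ext_def Let_def by (simp add: degree_core) (simp add: core_def)

lemma adj_T: "adj T (v, ks) (w, ls) \<longleftrightarrow> (v, ks) \<in> V \<and> (w, ls) \<in> V \<and>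
    (ks = [] \<and> ls = [] \<and> E v w \<or> v = w \<and> ((\<exists>k. ls = ks @ [k]) \<or> (\<exists>k. ks = ls @ [k])))"
  unfolding tree_ext_def Let_def by (simp add: core_def)

lemma child_in_V: "child x k \<in> V \<longleftrightarrow> x \<in> V \<and> k < kids x"
proof -
  obtain v ks where x: "x = (v, ks)" by (cases x)
  show ?thesis
    by (cases ks) (auto simp: x child_def kids_def in_V)
qed

lemma core_in_V: "(v, []) \<in> V \<longleftrightarrow> v < n"
  by (simp add: in_V)

lemma parent_child [simp]: "parent (child x k) = x"
  by (simp add: parent_def child_def)

lemma child_parent: "snd x \<noteq> [] \<Longrightarrow> child (parent x) (last (snd x)) = x"
  by (simp add: parent_def child_def)

lemma neighbours_T:
  assumes x: "x \<in> V"
  shows "neighbours T x = (if snd x = [] then (\<lambda>w. (w, [])) ` {w. E (fst x) w} else {parent x}) \<union> child x ` {..<kids x}"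
proof (rule Set.set_eqI)
  fix y :: "nat \<times> nat list"
  obtain v ks w ls where xy: "x = (v, ks)" "y = (w, ls)" by (cases x, cases y)
  have "y \<in> neighbours T x \<longleftrightarrow> y \<in> V \<and> (ks = [] \<and> ls = [] \<and> E v w \<or> (\<exists>k. y = child x k) \<or> (\<exists>k. x = child y k))"
    using x by (auto simp: neighbours_def xy adj_T child_def)
  also have "\<dots> \<longleftrightarrow> (ks = [] \<and> ls = [] \<and> E v w) \<or> y \<in> child x ` {..<kids x} \<or> ks \<noteq> [] \<and> y = parent x"
  proof -
    have "y \<in> V \<and> (\<exists>k. y = child x k) \<longleftrightarrow> y \<in> child x ` {..<kids x}"
      using x child_in_V[of x] by auto
    moreover have "y \<in> V \<and> (\<exists>k. x = child y k) \<longleftrightarrow> ks \<noteq> [] \<and> y = parent x"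
    proof
      assume "y \<in> V \<and> (\<exists>k. x = child y k)"
      then show "ks \<noteq> [] \<and> y = parent x" using xy by (auto simp: child_def parent_def)
    next
      assume a: "ks \<noteq> [] \<and> y = parent x"
      then have "x = child y (last ks)" using child_parent[of x] xy by simp
      then show "y \<in> V \<and> (\<exists>k. x = child y k)" using x child_in_V[of y] by auto
    qed
    moreover have "y \<in> V" if "ls = []" "E v w"
      using graph_onD(2)[OF gr that(2)] that xy by (simp add: core_in_V)
    ultimately show ?thesis by blast
  qed
  finally show "y \<in> neighbours T x \<longleftrightarrow> y \<in> (if snd x = [] then (\<lambda>w. (w, [])) ` {w. E (fst x) w} else {parent x}) \<union> child x ` {..<kids x}"
    using xy by auto
qed

lemma inj_child: "inj_on (child x) A"
  by (auto simp: child_def inj_on_def)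

lemma sum_neighbours:
  fixes f :: "nat \<times> nat list \<Rightarrow> real"
  assumes x: "x \<in> V"
  shows "(\<Sum>y\<in>neighbours T x. f y) = (if snd x = [] then \<Sum>w | E (fst x) w. f (w, []) else f (parent x)) + (\<Sum>k<kids x. f (child x k))"
proof -
  have ch: "(\<Sum>y\<in>child x ` {..<kids x}. f y) = (\<Sum>k<kids x. f (child x k))"
    by (subst sum.reindex[OF inj_child]) simp
  show ?thesis
  proof (cases "snd x = []")
    case True
    have "(\<Sum>y\<in>neighbours T x. f y) = (\<Sum>y\<in>(\<lambda>w. (w, [])) ` {w. E (fst x) w}. f y) + (\<Sum>y\<in>child x ` {..<kids x}. f y)"
      unfolding neighbours_T[OF x] if_P[OF True]
      using finite_nbrs[OF gr] by (intro sum.union_disjoint) (auto simp: child_def)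
    also have "(\<Sum>y\<in>(\<lambda>w. (w, [])) ` {w. E (fst x) w}. f y) = (\<Sum>w | E (fst x) w. f (w, []))"
      by (subst sum.reindex) (auto intro: inj_onI)
    finally show ?thesis using True ch by simp
  next
    case False
    have "length (snd (parent x)) \<noteq> length (snd (child x k))" for k
      by (simp add: parent_def child_def)
    then have "parent x \<noteq> child x k" for k by metis
    then have "(\<Sum>y\<in>neighbours T x. f y) = (\<Sum>y\<in>{parent x}. f y) + (\<Sum>y\<in>child x ` {..<kids x}. f y)"
      unfolding neighbours_T[OF x] if_not_P[OF False]
      by (intro sum.union_disjoint) auto
    then show ?thesis using False ch by simp
  qed
qed

lemma finite_neighbours: "x \<in> V \<Longrightarrow> finite (neighbours T x)"
  using finite_nbrs[OF gr] by (simp add: neighbours_T)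

lemma regular_T: "regular d T"
  unfolding regular_def
proof (intro ballI conjI finite_neighbours)
  fix x assume x: "x \<in> V"
  have "real (card (neighbours T x)) = real d"
    using sum_neighbours[OF x, of "\<lambda>_. 1"] deg_le[of "fst x"] d
    by (auto simp: kids_def deg_def of_nat_diff split: if_splits)
  then show "degree T x = d" by (simp add: degree_def)
qed

lemma simple_T: "simple_graph T"
  unfolding simple_graph_def
proof (intro conjI allI impI)
  show "V \<noteq> {}" using core_in_V[of 0] n_pos by blast
  fix x y :: "nat \<times> nat list"
  obtain v ks w ls where xy: "x = (v, ks)" "y = (w, ls)" by (cases x, cases y)
  show "\<not> adj T x x" using graph_onD(4)[OF gr] by (auto simp: xy adj_T)
  assume "adj T x y"
  then show "x \<in> V" "y \<in> V" "adj T y x" using graph_onD(3)[OF gr] by (auto simp: xy adj_T)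
qed

lemma finite_core: "finite_graph core" "max_degree_le core d"
proof -
  have "simple_graph core"
    unfolding simple_graph_def core_def using n_pos graph_onD[OF gr] by auto blast
  then show "finite_graph core" by (simp add: finite_graph_def core_def)
  show "max_degree_le core d"
    unfolding max_degree_le_def degree_core using deg_le finite_nbrs[OF gr] by (auto simp: core_def neighbours_def)
qed

text \<open>At a deepest vertex of a cycle outside the core, both neighbours on the cycle would have
  to be its parent.\<close>

lemma cycle_in_core:
  assumes c: "is_cycle T c"
  shows "cyc E (map fst c)"
proof -
  let ?k = "length c"
  have k: "?k \<ge> 3" "distinct c" and adj: "\<And>i. i < ?k \<Longrightarrow> adj T (c ! i) (c ! ((i + 1) mod ?k))"
    using c by (auto simp: is_cycle_def)
  have sym: "adj T x y \<Longrightarrow> adj T y x" for x y using simple_T unfolding simple_graph_def by blast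
  define m where "m = Max ((\<lambda>x. length (snd x)) ` set c)"
  have c0: "c \<noteq> []" using k by auto
  have "m \<in> (\<lambda>x. length (snd x)) ` set c" unfolding m_def using c0 by (intro Max_in) auto
  then obtain i where i: "i < ?k" "length (snd (c ! i)) = m" by (auto simp: in_set_conv_nth)
  have max: "length (snd (c ! j)) \<le> m" if "j < ?k" for j
    unfolding m_def using that by (intro Max_ge) auto
  have "m = 0"
  proof (rule ccontr)
    assume "m \<noteq> 0"
    have up: "c ! j = parent (c ! i)" if "j < ?k" "adj T (c ! i) (c ! j)" for j
    proof -
      have "c ! i \<in> V" using that(2) simple_T unfolding simple_graph_def by blast
      then have "c ! j = parent (c ! i) \<or> c ! j \<in> child (c ! i) ` {..<kids (c ! i)}"
        using that(2) neighbours_T[of "c ! i"] \<open>m \<noteq> 0\<close> i(2) by (auto simp: neighbours_def)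
      moreover have "c ! j \<noteq> child (c ! i) k" for k
        using max[OF that(1)] i(2) by (auto simp: child_def)
      ultimately show ?thesis by blast
    qed
    define i1 where "i1 = (i + 1) mod ?k"
    define i2 where "i2 = (i + ?k - 1) mod ?k"
    have lt: "i1 < ?k" "i2 < ?k" unfolding i1_def i2_def using c0 by simp_all
    have "(i2 + 1) mod ?k = (i + ?k - 1 + 1) mod ?k" unfolding i2_def by (simp only: mod_simps)
    also have "i + ?k - 1 + 1 = i + ?k" using k(1) by simp
    finally have "(i2 + 1) mod ?k = i" using i(1) by simp
    then have "adj T (c ! i) (c ! i2)" using adj[OF lt(2)] sym by simp
    moreover have "adj T (c ! i) (c ! i1)" using adj[OF i(1)] by (simp add: i1_def)
    ultimately have "c ! i1 = c ! i2" using up lt by metis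
    then have "i1 = i2" using lt k(2) by (simp add: nth_eq_iff_index_eq)
    moreover have "i1 = (if i + 1 = ?k then 0 else i + 1)" unfolding i1_def using i(1) by simp
    moreover have "i2 = (if i = 0 then ?k - 1 else i - 1)"
    proof (cases "i = 0")
      case False
      then have "i + ?k - 1 = (i - 1) + ?k" by simp
      then have "i2 = (i - 1) mod ?k" unfolding i2_def by (simp only: mod_add_self2)
      then show ?thesis using False i(1) by simp
    qed (use c0 in \<open>simp add: i2_def\<close>)
    ultimately show False using i(1) k(1) by (auto split: if_splits)
  qed
  then have nil: "snd (c ! j) = []" if "j < ?k" for j using max[OF that] by simp
  have E: "E (fst (c ! j)) (fst (c ! j'))" if "j < ?k" "j' < ?k" "adj T (c ! j) (c ! j')" for j j'
  proof -
    have "c ! j = (fst (c ! j), [])" "c ! j' = (fst (c ! j'), [])"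
      using nil[OF that(1)] nil[OF that(2)] by (simp_all add: prod_eq_iff)
    then have "adj T (fst (c ! j), []) (fst (c ! j'), [])" using that(3) by simp
    then show ?thesis unfolding adj_T by simp
  qed
  have "inj_on fst (set c)"
    using nil by (intro inj_onI) (metis in_set_conv_nth prod_eqI)
  then have "distinct (map fst c)" using k(2) by (simp add: distinct_map)
  moreover have "E (map fst c ! j) (map fst c ! ((j + 1) mod ?k))" if "j < ?k" for j
  proof -
    have "(j + 1) mod ?k < ?k" using c0 by simp
    then show ?thesis using E[OF that _ adj[OF that]] that by simp
  qed
  ultimately show ?thesis unfolding cyc_def using k(1) by simp
qed

lemma girth_ge:
  assumes "\<And>v. closed_walks E L v = {}"
  shows "enat L \<le> girth T"
  unfolding girth_def
proof (rule INF_greatest)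
  fix c assume "c \<in> {c. is_cycle T c}"
  then have c: "cyc E (map fst c)" using cycle_in_core by blast
  show "enat L \<le> enat (length c)"
  proof (rule ccontr)
    assume "\<not> enat L \<le> enat (length c)"
    then have "length (map fst c) + 1 \<le> L" "0 < length (map fst c)" using c by (auto simp: cyc_def)
    from around_closed_walk[OF c this] show False using assms by blast
  qed
qed

end

section \<open>The adjacency form summed layer by layer\<close>

lemma abs_summable_of_finite_sums:
  fixes F :: "'a \<Rightarrow> real"
  assumes "\<And>X. finite X \<Longrightarrow> X \<subseteq> A \<Longrightarrow> (\<Sum>x\<in>X. \<bar>F x\<bar>) \<le> b"
  shows "F summable_on A" "\<bar>infsum F A\<bar> \<le> b"
proof -
  have abs: "(\<lambda>x. norm (F x)) summable_on A"
    using assms by (intro nonneg_bdd_above_summable_on bdd_aboveI[of _ b]) auto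
  then show "F summable_on A" by (rule Infinite_Sum.abs_summable_summable)
  have "\<bar>infsum F A\<bar> \<le> (\<Sum>\<^sub>\<infinity>x\<in>A. norm (F x))" using Infinite_Sum.norm_infsum_bound[OF abs] by simp
  also have "\<dots> \<le> b" using abs assms by (intro infsum_le_finite_sums) auto
  finally show "\<bar>infsum F A\<bar> \<le> b" .
qed

lemma adj_form_bounded:
  assumes G: "simple_graph G" "regular d G" and f: "f \<in> ell2 (verts G)"
  shows "(\<lambda>x. f x * adj_op G f x) summable_on verts G"
    "\<bar>ell2_inner (verts G) f (adj_op G f)\<bar> \<le> d * (\<Sum>\<^sub>\<infinity>x\<in>verts G. (f x)\<^sup>2)"
proof -
  let ?V = "verts G" and ?S = "\<Sum>\<^sub>\<infinity>x\<in>verts G. (f x)\<^sup>2"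
  have nb: "finite (neighbours G x)" "card (neighbours G x) = d" if "x \<in> ?V" for x
    using G(2) that by (auto simp: regular_def degree_def)
  have adj: "adj G x y \<Longrightarrow> y \<in> ?V" "adj G x y \<Longrightarrow> adj G y x" for x y
    using G(1) unfolding simple_graph_def by blast+
  have fin: "(\<Sum>x\<in>X. (f x)\<^sup>2) \<le> ?S" if "finite X" "X \<subseteq> ?V" for X
    using f that by (intro finite_sum_le_infsum) (auto simp: ell2_def)
  have "(\<Sum>x\<in>X. \<bar>f x * adj_op G f x\<bar>) \<le> d * ?S" if X: "finite X" "X \<subseteq> ?V" for X
  proof -
    define Y where "Y = (\<Union>x\<in>X. neighbours G x)"
    have Y: "finite Y" "Y \<subseteq> ?V" unfolding Y_def using X nb(1) adj(1) by (auto simp: neighbours_def)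
    have "(\<Sum>x\<in>X. \<bar>f x * adj_op G f x\<bar>) \<le> (\<Sum>x\<in>X. \<Sum>y\<in>neighbours G x. (f x)\<^sup>2 / 2 + (f y)\<^sup>2 / 2)"
    proof (intro sum_mono)
      fix x assume "x \<in> X"
      then have "\<bar>f x * adj_op G f x\<bar> = \<bar>\<Sum>y\<in>neighbours G x. f x * f y\<bar>"
        using X by (auto simp: adj_op_def sum_distrib_left)
      also have "\<dots> \<le> (\<Sum>y\<in>neighbours G x. \<bar>f x * f y\<bar>)" by (rule sum_abs)
      also have "\<dots> \<le> (\<Sum>y\<in>neighbours G x. (f x)\<^sup>2 / 2 + (f y)\<^sup>2 / 2)"
      proof (intro sum_mono)
        fix y show "\<bar>f x * f y\<bar> \<le> (f x)\<^sup>2 / 2 + (f y)\<^sup>2 / 2"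
          using sum_squares_bound[of "\<bar>f x\<bar>" "\<bar>f y\<bar>"] by (simp add: abs_mult)
      qed
      finally show "\<bar>f x * adj_op G f x\<bar> \<le> (\<Sum>y\<in>neighbours G x. (f x)\<^sup>2 / 2 + (f y)\<^sup>2 / 2)" .
    qed
    also have "\<dots> = (\<Sum>x\<in>X. d * ((f x)\<^sup>2 / 2)) + (\<Sum>x\<in>X. \<Sum>y\<in>neighbours G x. (f y)\<^sup>2 / 2)"
      unfolding sum.distrib using X nb by (intro arg_cong2[of _ _ _ _ "(+)"] sum.cong) auto
    also have "(\<Sum>x\<in>X. \<Sum>y\<in>neighbours G x. (f y)\<^sup>2 / 2) = (\<Sum>x\<in>X. \<Sum>y | y \<in> Y \<and> adj G x y. (f y)\<^sup>2 / 2)"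
      by (intro sum.cong) (auto simp: Y_def neighbours_def)
    also have "\<dots> = (\<Sum>y\<in>Y. \<Sum>x | x \<in> X \<and> adj G x y. (f y)\<^sup>2 / 2)"
      by (rule sum.swap_restrict[OF X(1) Y(1)])
    also have "\<dots> \<le> (\<Sum>y\<in>Y. d * ((f y)\<^sup>2 / 2))"
    proof (intro sum_mono)
      fix y assume y: "y \<in> Y"
      have "card {x. x \<in> X \<and> adj G x y} \<le> card (neighbours G y)"
        using nb(1)[of y] y Y adj(2) by (intro card_mono) (auto simp: neighbours_def)
      then have "card {x. x \<in> X \<and> adj G x y} \<le> d" using nb(2) y Y by auto
      then show "(\<Sum>x | x \<in> X \<and> adj G x y. (f y)\<^sup>2 / 2) \<le> d * ((f y)\<^sup>2 / 2)"
        unfolding sum_constant by (intro mult_right_mono) auto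
    qed
    also have "(\<Sum>x\<in>X. d * ((f x)\<^sup>2 / 2)) + (\<Sum>y\<in>Y. d * ((f y)\<^sup>2 / 2)) = d / 2 * ((\<Sum>x\<in>X. (f x)\<^sup>2) + (\<Sum>y\<in>Y. (f y)\<^sup>2))"
      unfolding distrib_left sum_distrib_left by simp
    also have "\<dots> \<le> d / 2 * (?S + ?S)"
      using fin X Y by (intro mult_left_mono add_mono) auto
    finally show ?thesis by simp
  qed
  from abs_summable_of_finite_sums[of ?V, OF this]
  show "(\<lambda>x. f x * adj_op G f x) summable_on ?V" "\<bar>ell2_inner ?V f (adj_op G f)\<bar> \<le> d * ?S"
    unfolding ell2_inner_def by blast+
qed

context tree_extension
begin

lemma layer_0: "layer 0 = (\<lambda>v. (v, [])) ` {..<n}"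
  by (auto simp: layer_def core_in_V)

lemma sum_layer_0: "(\<Sum>x\<in>layer 0. F x) = (\<Sum>v<n. F (v, []))"
  unfolding layer_0 by (subst sum.reindex) (auto intro: inj_onI)

lemma layer_Suc: "layer (Suc j) = (\<lambda>(x, k). child x k) ` (SIGMA x:layer j. {..<kids x})"
proof (rule Set.set_eqI)
  fix y :: "nat \<times> nat list"
  show "y \<in> layer (Suc j) \<longleftrightarrow> y \<in> (\<lambda>(x, k). child x k) ` (SIGMA x:layer j. {..<kids x})"
  proof
    assume y: "y \<in> layer (Suc j)"
    then have ne: "snd y \<noteq> []" "length (snd y) = Suc j" "y \<in> V" by (auto simp: layer_def)
    have "parent y \<in> V" "last (snd y) < kids (parent y)"
      using child_in_V[of "parent y" "last (snd y)"] ne child_parent[OF ne(1)] by simp_all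
    moreover have "length (snd (parent y)) = j" using ne by (simp add: parent_def)
    ultimately have "(parent y, last (snd y)) \<in> (SIGMA x:layer j. {..<kids x})" by (simp add: layer_def)
    then show "y \<in> (\<lambda>(x, k). child x k) ` (SIGMA x:layer j. {..<kids x})"
      using child_parent[OF ne(1)] by (intro image_eqI[of _ _ "(parent y, last (snd y))"]) simp_all
  next
    assume "y \<in> (\<lambda>(x, k). child x k) ` (SIGMA x:layer j. {..<kids x})"
    then obtain x k where y: "y = child x k" "x \<in> layer j" "k < kids x" by (elim imageE SigmaE) simp
    then show "y \<in> layer (Suc j)" using child_in_V[of x k] by (simp add: layer_def) (simp add: child_def)
  qed
qed

lemma finite_layer: "finite (layer j)"
  by (induction j) (simp_all add: layer_0 layer_Suc)

lemma sum_layer_Suc: "(\<Sum>y\<in>layer (Suc j). F y) = (\<Sum>x\<in>layer j. \<Sum>k<kids x. F (child x k))"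
proof -
  have "inj_on (\<lambda>(x, k). child x k) (SIGMA x:layer j. {..<kids x})"
    by (intro inj_onI) (auto simp: child_def prod_eq_iff)
  then have "(\<Sum>y\<in>layer (Suc j). F y) = (\<Sum>(x, k)\<in>(SIGMA x:layer j. {..<kids x}). F (child x k))"
    unfolding layer_Suc by (subst sum.reindex) (auto simp: case_prod_unfold)
  then show ?thesis using finite_layer[of j] by (simp add: sum.Sigma)
qed

lemma sum_layers: "(\<Sum>x\<in>(\<Union>j\<le>m. layer j). F x) = (\<Sum>j\<le>m. \<Sum>x\<in>layer j. F x)"
  using finite_layer by (intro sum.UNION_disjoint) (auto simp: layer_def)

lemma finite_subset_layers:
  assumes "finite X" "X \<subseteq> V"
  shows "\<exists>m. \<forall>m'\<ge>m. X \<subseteq> (\<Union>j\<le>m'. layer j)"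
proof (intro exI allI impI)
  fix m' assume "m' \<ge> Max (insert 0 ((\<lambda>x. length (snd x)) ` X))"
  then have "length (snd x) \<le> m'" if "x \<in> X" for x
    using that assms(1) by (meson Max_ge finite_imageI finite_insert image_eqI insertI2 order_trans)
  then show "X \<subseteq> (\<Union>j\<le>m'. layer j)" using assms(2) unfolding layer_def by blast
qed

text \<open>Finitely many layers form a finite set and together they exhaust \<open>V\<close>, so
  infinite sums are limits of finite ones and the identities below are finite computations.\<close>

lemma layer_sums:
  fixes F :: "nat \<times> nat list \<Rightarrow> real"
  assumes "F summable_on V"
  shows "(\<lambda>m. \<Sum>j\<le>m. \<Sum>x\<in>layer j. F x) \<longlonglongrightarrow> infsum F V"
proof -
  have "(sum F \<longlongrightarrow> infsum F V) (finite_subsets_at_top V)"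
    using has_sum_infsum[OF assms] unfolding has_sum_def .
  moreover have "filterlim (\<lambda>m. \<Union>j\<le>m. layer j) (finite_subsets_at_top V) sequentially"
    unfolding filterlim_finite_subsets_at_top
  proof (intro allI impI)
    fix X assume "finite X \<and> X \<subseteq> V"
    then obtain m where m: "\<forall>m'\<ge>m. X \<subseteq> (\<Union>j\<le>m'. layer j)"
      using finite_subset_layers by blast
    have "(\<Union>j\<le>m'. layer j) \<subseteq> V" for m' by (auto simp: layer_def)
    then show "\<forall>\<^sub>F m' in sequentially. finite (\<Union>j\<le>m'. layer j) \<and> X \<subseteq> (\<Union>j\<le>m'. layer j) \<and> (\<Union>j\<le>m'. layer j) \<subseteq> V"
      using m finite_layer by (intro eventually_sequentiallyI[of m]) blast
  qed
  ultimately have "((\<lambda>m. sum F (\<Union>j\<le>m. layer j)) \<longlongrightarrow> infsum F V) sequentially"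
    by (rule filterlim_compose)
  then show ?thesis unfolding sum_layers .
qed

definition mass :: "(nat \<times> nat list \<Rightarrow> real) \<Rightarrow> nat \<Rightarrow> real" where
  "mass f j = (\<Sum>x\<in>layer j. (f x)\<^sup>2)"

definition kid_mass :: "(nat \<times> nat list \<Rightarrow> real) \<Rightarrow> nat \<Rightarrow> real" where
  "kid_mass f j = (\<Sum>x\<in>layer j. real (kids x) * (f x)\<^sup>2)"

definition links :: "(nat \<times> nat list \<Rightarrow> real) \<Rightarrow> nat \<Rightarrow> real" where
  "links f j = (\<Sum>x\<in>layer j. \<Sum>k<kids x. f x * f (child x k))"

definition core_links :: "(nat \<times> nat list \<Rightarrow> real) \<Rightarrow> real" where
  "core_links f = (\<Sum>v<n. \<Sum>w | E v w. f (v, []) * f (w, []))"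

lemma kid_mass_Suc: "kid_mass f (Suc j) = (real d - 1) * mass f (Suc j)"
  unfolding kid_mass_def mass_def sum_distrib_left
  using d by (intro sum.cong refl) (auto simp: layer_def kids_def of_nat_diff)

lemma layer_form_0: "(\<Sum>x\<in>layer 0. f x * adj_op T f x) = core_links f + links f 0"
  unfolding sum_layer_0 core_links_def links_def sum.distrib[symmetric]
  by (intro sum.cong refl) (simp add: adj_op_def core_in_V sum_neighbours distrib_left sum_distrib_left)

lemma layer_form_Suc: "(\<Sum>x\<in>layer (Suc j). f x * adj_op T f x) = links f j + links f (Suc j)"
proof -
  have "(\<Sum>x\<in>layer (Suc j). f x * adj_op T f x) = (\<Sum>x\<in>layer (Suc j). f (parent x) * f x + (\<Sum>k<kids x. f x * f (child x k)))"
  proof (intro sum.cong refl)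
    fix x assume "x \<in> layer (Suc j)"
    then have x: "x \<in> V" "snd x \<noteq> []" by (auto simp: layer_def)
    show "f x * adj_op T f x = f (parent x) * f x + (\<Sum>k<kids x. f x * f (child x k))"
      unfolding adj_op_def if_P[OF x(1)] sum_neighbours[OF x(1)] if_not_P[OF x(2)]
      by (simp add: distrib_left sum_distrib_left)
  qed
  also have "\<dots> = (\<Sum>x\<in>layer (Suc j). f (parent x) * f x) + links f (Suc j)"
    by (simp add: links_def sum.distrib)
  also have "(\<Sum>x\<in>layer (Suc j). f (parent x) * f x) = links f j"
    unfolding sum_layer_Suc links_def by simp
  finally show ?thesis .
qed

text \<open>The edges leaving the outermost layer are seen from one end only, hence the last term
  without the factor 2.\<close>

lemma layers_form:
  "(\<Sum>j\<le>m. \<Sum>x\<in>layer j. f x * adj_op T f x) = core_links f + 2 * (\<Sum>j<m. links f j) + links f m"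
  by (induction m) (simp_all add: layer_form_0 layer_form_Suc)

lemma core_form:
  "core_links f + g * kid_mass f 0 = lam d g * mass f 0 - qform n E g (\<lambda>v. f (v, []))"
proof -
  have "g * kid_mass f 0 = (\<Sum>v<n. lam d g * (f (v, []))\<^sup>2 - ((real (deg E v) - 1) * g + 1 / g) * (f (v, []))\<^sup>2)"
    unfolding kid_mass_def sum_layer_0 sum_distrib_left
    using deg_le by (intro sum.cong refl) (simp add: kids_def lam_def of_nat_diff algebra_simps)
  then show ?thesis
    by (simp add: core_links_def qform_def mass_def sum_layer_0 sum_subtractf sum_distrib_left)
qed

text \<open>The weighted inequality of arithmetic and geometric means, with equality exactly when
  each child carries \<open>g\<close> times the value of its parent. This singles out the decay used
  in \<open>extension\<close>.\<close>

lemma links_le: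
  assumes g: "g > 0"
  shows "2 * links f j \<le> g * kid_mass f j + mass f (Suc j) / g"
proof -
  have "2 * links f j = (\<Sum>x\<in>layer j. \<Sum>k<kids x. 2 * (f x * f (child x k)))"
    by (simp add: links_def sum_distrib_left)
  also have "\<dots> \<le> (\<Sum>x\<in>layer j. \<Sum>k<kids x. g * (f x)\<^sup>2 + (f (child x k))\<^sup>2 / g)"
  proof (intro sum_mono)
    fix x k
    have "0 \<le> (g * f x - f (child x k))\<^sup>2 / g" using g by simp
    also have "\<dots> = g * (f x)\<^sup>2 + (f (child x k))\<^sup>2 / g - 2 * (f x * f (child x k))"
      using g by (simp add: power2_eq_square field_simps)
    finally show "2 * (f x * f (child x k)) \<le> g * (f x)\<^sup>2 + (f (child x k))\<^sup>2 / g" by simp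
  qed
  also have "\<dots> = g * kid_mass f j + mass f (Suc j) / g"
    unfolding kid_mass_def mass_def sum_layer_Suc sum_distrib_left sum_divide_distrib sum.distrib
    by (simp add: mult.left_commute)
  finally show ?thesis .
qed

text \<open>A tree vertex is charged (d - 1) g for the edges to its children and 1/g for the edge to
  its parent, exactly the level. Only the core leaves a remainder, the form
  \<open>qform\<close>.\<close>

lemma partial_form_le:
  assumes g: "g > 0"
  shows "core_links f + 2 * (\<Sum>j<m. links f j) + g * kid_mass f m \<le>
    lam d g * (\<Sum>j\<le>m. mass f j) - qform n E g (\<lambda>v. f (v, []))"
proof (induction m)
  case 0
  then show ?case using core_form[of f g] by simp
next
  case (Suc m)
  have "g * kid_mass f (Suc m) + mass f (Suc m) / g = lam d g * mass f (Suc m)"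
    by (simp add: kid_mass_Suc lam_def algebra_simps)
  then show ?case using Suc links_le[OF g, of f m] by (simp add: distrib_left)
qed

lemma mass_nonneg: "mass f j \<ge> 0"
  unfolding mass_def by (intro sum_nonneg) auto

lemma mass_sums:
  assumes "f \<in> ell2 V"
  shows "(\<lambda>m. \<Sum>j\<le>m. mass f j) \<longlonglongrightarrow> (\<Sum>\<^sub>\<infinity>x\<in>V. (f x)\<^sup>2)"
  unfolding mass_def using assms by (intro layer_sums) (simp add: ell2_def)

lemma form_le:
  assumes f: "f \<in> ell2 V" and g: "g > 0"
  shows "ell2_inner V f (adj_op T f) \<le> lam d g * (\<Sum>\<^sub>\<infinity>x\<in>V. (f x)\<^sup>2) - qform n E g (\<lambda>v. f (v, []))"
proof (rule LIMSEQ_le)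
  let ?S = "\<Sum>\<^sub>\<infinity>x\<in>V. (f x)\<^sup>2"
  show "(\<lambda>m. \<Sum>j\<le>m. \<Sum>x\<in>layer j. f x * adj_op T f x) \<longlonglongrightarrow> ell2_inner V f (adj_op T f)"
    unfolding ell2_inner_def by (intro layer_sums adj_form_bounded(1)[OF simple_T regular_T f])
  \<comment> \<open>Square summability makes the mass of a single layer tend to 0, so the boundary
    term disappears in the limit.\<close>
  have "(\<lambda>m. (\<Sum>j\<le>Suc m. mass f j) - (\<Sum>j\<le>m. mass f j)) \<longlonglongrightarrow> ?S - ?S"
    by (intro tendsto_diff mass_sums[OF f] LIMSEQ_Suc[OF mass_sums[OF f]])
  then have "(\<lambda>m. mass f (Suc m)) \<longlonglongrightarrow> 0" by simp
  then have "(\<lambda>m. lam d g * (\<Sum>j\<le>m. mass f j) - qform n E g (\<lambda>v. f (v, [])) + mass f (Suc m) / g)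
     \<longlonglongrightarrow> lam d g * ?S - qform n E g (\<lambda>v. f (v, [])) + 0 / g"
    using g by (intro tendsto_intros mass_sums[OF f]) auto
  then show "(\<lambda>m. lam d g * (\<Sum>j\<le>m. mass f j) - qform n E g (\<lambda>v. f (v, [])) + mass f (Suc m) / g)
     \<longlonglongrightarrow> lam d g * ?S - qform n E g (\<lambda>v. f (v, []))" by simp
  show "\<exists>N. \<forall>m\<ge>N. (\<Sum>j\<le>m. \<Sum>x\<in>layer j. f x * adj_op T f x)
      \<le> lam d g * (\<Sum>j\<le>m. mass f j) - qform n E g (\<lambda>v. f (v, [])) + mass f (Suc m) / g"
  proof (intro exI allI impI)
    fix m
    have "kid_mass f m \<ge> 0" unfolding kid_mass_def by (intro sum_nonneg) auto
    then have "g * kid_mass f m \<ge> 0" "mass f (Suc m) / g \<ge> 0" using g mass_nonneg by simp_all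
    then show "(\<Sum>j\<le>m. \<Sum>x\<in>layer j. f x * adj_op T f x)
      \<le> lam d g * (\<Sum>j\<le>m. mass f j) - qform n E g (\<lambda>v. f (v, [])) + mass f (Suc m) / g"
      unfolding layers_form using partial_form_le[OF g, of f m] links_le[OF g, of f m] by linarith
  qed
qed

definition extension :: "real \<Rightarrow> (nat \<Rightarrow> real) \<Rightarrow> nat \<times> nat list \<Rightarrow> real" where
  "extension g \<phi> x = (if x \<in> V then \<phi> (fst x) * g ^ length (snd x) else 0)"

lemma extension_child: "x \<in> layer j \<Longrightarrow> k < kids x \<Longrightarrow> extension g \<phi> (child x k) = g * extension g \<phi> x"
  unfolding extension_def using child_in_V[of x k] by (simp add: layer_def) (simp add: child_def)

lemma links_extension: "links (extension g \<phi>) j = g * kid_mass (extension g \<phi>) j"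
  unfolding links_def kid_mass_def sum_distrib_left
  by (intro sum.cong refl) (simp add: extension_child power2_eq_square mult_ac)

lemma mass_extension: "mass (extension g \<phi>) (Suc j) = g\<^sup>2 * kid_mass (extension g \<phi>) j"
  unfolding mass_def kid_mass_def sum_layer_Suc sum_distrib_left
  by (intro sum.cong refl) (simp add: extension_child power_mult_distrib mult_ac)

text \<open>From the first layer on, the layer masses form a geometric sequence of ratio (d - 1)
  g^2. This is where strict inequality at the threshold matters.\<close>

lemma extension_in_ell2:
  assumes g: "(real d - 1) * g\<^sup>2 < 1"
  shows "extension g \<phi> \<in> ell2 V"
proof -
  define q where "q = (real d - 1) * g\<^sup>2"
  let ?f = "extension g \<phi>"
  have q: "(1 - q) * (\<Sum>j<m. mass ?f (Suc j)) = mass ?f 1 - mass ?f (Suc m)" for m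
  proof (induction m)
    case (Suc m)
    have "mass ?f (Suc (Suc m)) = q * mass ?f (Suc m)"
      unfolding mass_extension[of g \<phi> "Suc m"] kid_mass_Suc by (simp add: q_def)
    then show ?case unfolding sum.lessThan_Suc distrib_left Suc.IH by (simp add: left_diff_distrib)
  qed simp
  have q1: "1 - q > 0" using g by (simp add: q_def)
  have bound: "(\<Sum>j\<le>m. mass ?f j) \<le> mass ?f 0 + mass ?f 1 / (1 - q)" for m
  proof -
    have "(1 - q) * (\<Sum>j<m. mass ?f (Suc j)) \<le> mass ?f 1" using q[of m] mass_nonneg[of ?f "Suc m"] by simp
    then have "(\<Sum>j<m. mass ?f (Suc j)) \<le> mass ?f 1 / (1 - q)"
      using q1 by (simp add: pos_le_divide_eq mult.commute)
    then show ?thesis unfolding sum.atMost_shift by (rule add_left_mono)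
  qed
  have "(\<Sum>x\<in>X. \<bar>(?f x)\<^sup>2\<bar>) \<le> mass ?f 0 + mass ?f 1 / (1 - q)" if "finite X" "X \<subseteq> V" for X
  proof -
    obtain m where "X \<subseteq> (\<Union>j\<le>m. layer j)" using finite_subset_layers[OF \<open>finite X\<close> \<open>X \<subseteq> V\<close>] order_refl by blast
    then have "(\<Sum>x\<in>X. (?f x)\<^sup>2) \<le> (\<Sum>x\<in>(\<Union>j\<le>m. layer j). (?f x)\<^sup>2)"
      using finite_layer by (intro sum_mono2) auto
    also have "\<dots> = (\<Sum>j\<le>m. mass ?f j)" unfolding sum_layers mass_def ..
    finally show ?thesis using bound[of m] by simp
  qed
  from abs_summable_of_finite_sums(1)[of V, OF this]
  have "(\<lambda>x. (?f x)\<^sup>2) summable_on V" by blast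
  then show ?thesis by (simp add: ell2_def extension_def)
qed

text \<open>All inequalities behind \<open>form_le\<close> are equalities for this function, so a
  negative value of \<open>qform\<close> is a witness for the top eigenvalue.\<close>

lemma form_extension:
  assumes g: "g > 0" "(real d - 1) * g\<^sup>2 < 1"
  shows "ell2_inner V (extension g \<phi>) (adj_op T (extension g \<phi>)) =
    lam d g * (\<Sum>\<^sub>\<infinity>x\<in>V. (extension g \<phi> x)\<^sup>2) - qform n E g \<phi>"
proof -
  let ?f = "extension g \<phi>"
  note f = extension_in_ell2[OF g(2), of \<phi>]
  have qf: "qform n E g (\<lambda>v. ?f (v, [])) = qform n E g \<phi>"
  proof -
    have "E v w \<Longrightarrow> w < n" for v w using graph_onD(2)[OF gr] by blast
    then show ?thesis
      unfolding qform_def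
      by (intro arg_cong2[of _ _ _ _ "(-)"] sum.cong refl) (auto simp: extension_def core_in_V)
  qed
  have part: "core_links ?f + 2 * (\<Sum>j<m. links ?f j) + links ?f m = lam d g * (\<Sum>j\<le>m. mass ?f j) - qform n E g \<phi>" for m
  proof (induction m)
    case 0
    then show ?case using core_form[of ?f g] by (simp add: links_extension qf)
  next
    case (Suc m)
    have "links ?f m = mass ?f (Suc m) / g"
      using g by (simp add: links_extension mass_extension power2_eq_square)
    moreover have "links ?f (Suc m) = g * ((real d - 1) * mass ?f (Suc m))"
      by (simp add: links_extension kid_mass_Suc)
    ultimately have "links ?f m + links ?f (Suc m) = lam d g * mass ?f (Suc m)"
      by (simp add: lam_def algebra_simps)
    then show ?case using Suc by (simp add: distrib_left)
  qed
  have "(\<lambda>m. \<Sum>j\<le>m. \<Sum>x\<in>layer j. ?f x * adj_op T ?f x) \<longlonglongrightarrow> ell2_inner V ?f (adj_op T ?f)"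
    unfolding ell2_inner_def by (intro layer_sums adj_form_bounded(1)[OF simple_T regular_T f])
  moreover have "(\<lambda>m. lam d g * (\<Sum>j\<le>m. mass ?f j) - qform n E g \<phi>) \<longlonglongrightarrow> lam d g * (\<Sum>\<^sub>\<infinity>x\<in>V. (?f x)\<^sup>2) - qform n E g \<phi>"
    by (intro tendsto_intros mass_sums[OF f])
  ultimately show ?thesis
    unfolding layers_form part by (rule LIMSEQ_unique)
qed

end

section \<open>Eigenvalues\<close>

lemma subspace_ell2: "subspace (ell2 V)"
proof (rule real_vector.subspaceI)
  show "0 \<in> ell2 V" by (simp add: ell2_def)
  fix f g :: "'a \<Rightarrow> real" assume f: "f \<in> ell2 V" and g: "g \<in> ell2 V"
  let ?S = "\<lambda>f. \<Sum>\<^sub>\<infinity>x\<in>V. (f x)\<^sup>2"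
  have "(\<Sum>x\<in>X. \<bar>((f + g) x)\<^sup>2\<bar>) \<le> 2 * ?S f + 2 * ?S g" if X: "finite X" "X \<subseteq> V" for X
  proof -
    have sq: "(f x + g x)\<^sup>2 \<le> 2 * (f x)\<^sup>2 + 2 * (g x)\<^sup>2" for x
      using sum_squares_bound[of "f x" "g x"] by (simp add: power2_sum)
    have "(\<Sum>x\<in>X. \<bar>((f + g) x)\<^sup>2\<bar>) \<le> (\<Sum>x\<in>X. 2 * (f x)\<^sup>2 + 2 * (g x)\<^sup>2)"
      using sq by (intro sum_mono) simp
    also have "\<dots> = 2 * (\<Sum>x\<in>X. (f x)\<^sup>2) + 2 * (\<Sum>x\<in>X. (g x)\<^sup>2)"
      by (simp add: sum.distrib sum_distrib_left)
    also have "\<dots> \<le> 2 * ?S f + 2 * ?S g"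
      using f g X by (intro add_mono mult_left_mono finite_sum_le_infsum) (auto simp: ell2_def)
    finally show ?thesis .
  qed
  from abs_summable_of_finite_sums(1)[of V, OF this]
  have "(\<lambda>x. ((f + g) x)\<^sup>2) summable_on V" by blast
  then show "f + g \<in> ell2 V" using f g by (simp add: ell2_def)
next
  fix c :: real and f :: "'a \<Rightarrow> real" assume f: "f \<in> ell2 V"
  then have "(\<lambda>x. c\<^sup>2 * (f x)\<^sup>2) summable_on V" by (intro summable_on_cmult_right) (simp add: ell2_def)
  then show "c *\<^sub>R f \<in> ell2 V" using f by (simp add: ell2_def scaleR_fun_def power_mult_distrib)
qed

lemma ell2_finite_support:
  assumes "finite {x. f x \<noteq> 0}" "{x. f x \<noteq> 0} \<subseteq> V"
  shows "f \<in> ell2 V"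
proof -
  have "(\<lambda>x. (f x)\<^sup>2) summable_on V"
    by (rule finite_nonzero_values_imp_summable_on) (rule finite_subset[OF _ assms(1)], auto)
  then show ?thesis using assms(2) by (auto simp: ell2_def)
qed

lemma ell2_norm_square: "(ell2_norm V f)\<^sup>2 = (\<Sum>\<^sub>\<infinity>x\<in>V. (f x)\<^sup>2)"
proof -
  have "ell2_inner V f f = (\<Sum>\<^sub>\<infinity>x\<in>V. (f x)\<^sup>2)" by (simp add: ell2_inner_def power2_eq_square)
  moreover have "(\<Sum>\<^sub>\<infinity>x\<in>V. (f x)\<^sup>2) \<ge> 0" by (intro infsum_nonneg) simp
  ultimately show ?thesis by (simp add: ell2_norm_def)
qed

lemma ell2_norm_pos:
  assumes f: "f \<in> ell2 V" and "f \<noteq> 0"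
  shows "ell2_norm V f > 0"
proof -
  obtain x where x: "f x \<noteq> 0" using \<open>f \<noteq> 0\<close> by (auto simp: fun_eq_iff)
  then have "x \<in> V" using f by (auto simp: ell2_def)
  then have "(\<Sum>y\<in>{x}. (f y)\<^sup>2) \<le> (\<Sum>\<^sub>\<infinity>x\<in>V. (f x)\<^sup>2)"
    using f by (intro finite_sum_le_infsum) (auto simp: ell2_def)
  then have "(f x)\<^sup>2 \<le> (ell2_norm V f)\<^sup>2" unfolding ell2_norm_square by simp
  moreover have "(f x)\<^sup>2 > 0" using x by simp
  ultimately have "(ell2_norm V f)\<^sup>2 > 0" by linarith
  moreover have "ell2_norm V f \<ge> 0"
    unfolding ell2_norm_def ell2_inner_def by (intro real_sqrt_ge_zero infsum_nonneg) simp
  ultimately show ?thesis by (simp add: zero_less_power2 less_le)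
qed

lemma form_scale:
  "ell2_inner V (c *\<^sub>R f) (adj_op G (c *\<^sub>R f)) = c\<^sup>2 * ell2_inner V f (adj_op G f)"
proof -
  have "(c *\<^sub>R f) x * adj_op G (c *\<^sub>R f) x = c\<^sup>2 * (f x * adj_op G f x)" for x
    by (simp add: adj_op_def scaleR_fun_def sum_distrib_left[symmetric] power2_eq_square)
  then show ?thesis unfolding ell2_inner_def by (simp add: infsum_cmult_right')
qed

lemma ell2_norm_scale: "ell2_norm V (c *\<^sub>R f) = \<bar>c\<bar> * ell2_norm V f"
proof -
  have "(c *\<^sub>R f) x * (c *\<^sub>R f) x = c\<^sup>2 * (f x * f x)" for x
    by (simp add: scaleR_fun_def power2_eq_square)
  then show ?thesis
    unfolding ell2_norm_def ell2_inner_def by (simp add: infsum_cmult_right' real_sqrt_mult)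
qed

lemma normalize:
  assumes S: "subspace S" "S \<subseteq> ell2 V" and v: "v \<in> S" "v \<noteq> 0"
  obtains u where "u \<in> S" "ell2_norm V u = 1"
    "ell2_inner V u (adj_op G u) = ell2_inner V v (adj_op G v) / (\<Sum>\<^sub>\<infinity>x\<in>V. (v x)\<^sup>2)"
proof
  have pos: "ell2_norm V v > 0" using S v by (intro ell2_norm_pos) auto
  let ?u = "(1 / ell2_norm V v) *\<^sub>R v"
  show "?u \<in> S" using S(1) v(1) by (rule real_vector.subspace_scale)
  show "ell2_norm V ?u = 1" unfolding ell2_norm_scale using pos by simp
  show "ell2_inner V ?u (adj_op G ?u) = ell2_inner V v (adj_op G v) / (\<Sum>\<^sub>\<infinity>x\<in>V. (v x)\<^sup>2)"
    unfolding form_scale ell2_norm_square[symmetric] by (simp add: power_divide)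
qed

section \<open>Min-max values of regular graphs\<close>

locale regular_graph =
  fixes G :: "'v sgraph" and d :: nat
  assumes G: "simple_graph G" "regular d G"
begin

abbreviation "V \<equiv> verts G"
abbreviation "form f \<equiv> ell2_inner V f (adj_op G f)"
abbreviation "unit_vectors S \<equiv> {v \<in> S. ell2_norm V v = 1}"
abbreviation "subspaces i \<equiv> {S. subspace S \<and> S \<subseteq> ell2 V \<and> dim S = i}"

lemma form_bound: "f \<in> ell2 V \<Longrightarrow> ell2_norm V f = 1 \<Longrightarrow> \<bar>form f\<bar> \<le> d"
  using adj_form_bounded(2)[OF G, of f] by (simp add: ell2_norm_square[symmetric])

lemma bdd_below_form: "S \<subseteq> ell2 V \<Longrightarrow> bdd_below (form ` unit_vectors S)"
  using form_bound by (intro bdd_belowI[of _ "- real d"]) (force simp: abs_le_iff)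

lemma form_INF_le:
  assumes S: "subspace S" "S \<subseteq> ell2 V" and v: "v \<in> S" "v \<noteq> 0" and le: "form v \<le> l * (\<Sum>\<^sub>\<infinity>x\<in>V. (v x)\<^sup>2)"
  shows "(INF v\<in>unit_vectors S. form v) \<le> l"
proof -
  obtain u where u: "u \<in> S" "ell2_norm V u = 1" "form u = form v / (\<Sum>\<^sub>\<infinity>x\<in>V. (v x)\<^sup>2)"
    using normalize[OF S v] by blast
  have "(\<Sum>\<^sub>\<infinity>x\<in>V. (v x)\<^sup>2) > 0"
    unfolding ell2_norm_square[symmetric] using S v by (intro zero_less_power ell2_norm_pos) auto
  then have "form u \<le> l" using le u(3) by (simp add: divide_le_eq)
  then show ?thesis using bdd_below_form[OF S(2)] u by (intro cINF_lower2[of _ _ u]) auto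
qed

lemma subspace_nonzero:
  assumes "S \<in> subspaces i" "i > 0"
  obtains v where "v \<in> S" "v \<noteq> 0"
proof -
  obtain B where B: "B \<subseteq> S" "independent B" "card B = dim S" by (rule real_vector.basis_exists[of S])
  then have "B \<noteq> {}" using assms by auto
  then obtain v where "v \<in> B" by blast
  then show thesis using that B real_vector.dependent_zero[of B] by blast
qed

text \<open>Suprema of reals require bounded sets. A positive \<open>i\<close> guarantees a nonzero
  vector in every subspace considered, hence a nonempty set of unit vectors.\<close>

lemma bdd_above_INF:
  assumes "i > 0"
  shows "bdd_above ((\<lambda>S. INF v\<in>unit_vectors S. form v) ` subspaces i)"
proof (rule bdd_aboveI)
  fix m assume "m \<in> (\<lambda>S. INF v\<in>unit_vectors S. form v) ` subspaces i"
  then obtain S where S: "S \<in> subspaces i" "m = (INF v\<in>unit_vectors S. form v)" by blast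
  obtain v where v: "v \<in> S" "v \<noteq> 0" by (rule subspace_nonzero[OF S(1) assms])
  have "form v \<le> d * (\<Sum>\<^sub>\<infinity>x\<in>V. (v x)\<^sup>2)" using adj_form_bounded(2)[OF G, of v] S v by auto
  then show "m \<le> d" unfolding S(2) using S(1) v by (intro form_INF_le) auto
qed

lemma graph_eigenvalue_le:
  assumes "subspaces i \<noteq> {}"
    and "\<And>S. S \<in> subspaces i \<Longrightarrow> \<exists>v\<in>S. v \<noteq> 0 \<and> form v \<le> l * (\<Sum>\<^sub>\<infinity>x\<in>V. (v x)\<^sup>2)"
  shows "graph_eigenvalue i G \<le> l"
  unfolding graph_eigenvalue_def
proof (rule cSUP_least[OF assms(1)])
  fix S assume S: "S \<in> subspaces i"
  with assms(2) obtain v where "v \<in> S" "v \<noteq> 0" "form v \<le> l * (\<Sum>\<^sub>\<infinity>x\<in>V. (v x)\<^sup>2)" by blast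
  then show "(INF v\<in>unit_vectors S. form v) \<le> l" using S by (intro form_INF_le) auto
qed

lemma line_in_subspaces:
  assumes "f \<in> ell2 V" "f \<noteq> 0"
  shows "span {f} \<in> subspaces 1"
proof -
  have "independent {f}" using assms(2) by (simp add: real_vector.independent_insert)
  from real_vector.dim_eq_card_independent[OF this] have "dim (span {f}) = 1" by simp
  moreover have "span {f} \<subseteq> ell2 V" using assms(1) subspace_ell2 by (intro real_vector.span_minimal) auto
  ultimately show ?thesis by simp
qed

lemma graph_eigenvalue_1_ge:
  assumes f: "f \<in> ell2 V" "f \<noteq> 0" and ge: "form f \<ge> l * (\<Sum>\<^sub>\<infinity>x\<in>V. (f x)\<^sup>2)"
  shows "graph_eigenvalue 1 G \<ge> l"
  unfolding graph_eigenvalue_def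
proof (rule cSUP_upper2[OF bdd_above_INF line_in_subspaces[OF f]])
  show "l \<le> (INF v\<in>unit_vectors (span {f}). form v)"
  proof (rule cINF_greatest)
    have sp: "subspace (span {f})" "span {f} \<subseteq> ell2 V" using line_in_subspaces[OF f] by simp_all
    have "f \<in> span {f}" by (rule real_vector.span_base) simp
    then obtain u where "u \<in> span {f}" "ell2_norm V u = 1" by (rule normalize[OF sp _ f(2)])
    then show "unit_vectors (span {f}) \<noteq> {}" by auto
    fix v assume v: "v \<in> unit_vectors (span {f})"
    then obtain c where c: "v = c *\<^sub>R f" by (auto simp: real_vector.span_singleton)
    then have "\<bar>c\<bar> * ell2_norm V f = 1" using v by (simp add: ell2_norm_scale)
    then have "(\<bar>c\<bar> * ell2_norm V f)\<^sup>2 = 1" by simp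
    then have "c\<^sup>2 * (\<Sum>\<^sub>\<infinity>x\<in>V. (f x)\<^sup>2) = 1"
      unfolding power_mult_distrib power2_abs ell2_norm_square .
    then have "l = c\<^sup>2 * (l * (\<Sum>\<^sub>\<infinity>x\<in>V. (f x)\<^sup>2))" by simp
    also have "\<dots> \<le> c\<^sup>2 * form f" using ge by (intro mult_left_mono) auto
    also have "\<dots> = form v" unfolding c form_scale ..
    finally show "l \<le> form v" .
  qed
qed simp

lemma plane_exists:
  assumes "x \<in> V" "y \<in> V" "x \<noteq> y"
  shows "subspaces 2 \<noteq> {}"
proof -
  define \<delta> :: "'v \<Rightarrow> 'v \<Rightarrow> real" where "\<delta> x = (\<lambda>z. if z = x then 1 else 0)" for x
  have ell2: "\<delta> z \<in> ell2 V" if "z \<in> V" for z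
    using that by (intro ell2_finite_support) (auto simp: \<delta>_def)
  have nz: "\<delta> y \<noteq> 0" by (auto simp: \<delta>_def fun_eq_iff)
  have ns: "\<delta> x \<notin> span {\<delta> y}"
  proof
    assume "\<delta> x \<in> span {\<delta> y}"
    then obtain c where "\<delta> x = c *\<^sub>R \<delta> y" by (auto simp: real_vector.span_singleton)
    then have "\<delta> x x = c * \<delta> y x" by (simp add: scaleR_fun_def)
    then show False using assms(3) by (simp add: \<delta>_def)
  qed
  then have ne: "\<delta> x \<noteq> \<delta> y" using real_vector.span_base[of "\<delta> y" "{\<delta> y}"] by auto
  have "independent {\<delta> x, \<delta> y}"
    using nz ns ne by (simp add: real_vector.independent_insert)
  from real_vector.dim_eq_card_independent[OF this] have "dim (span {\<delta> x, \<delta> y}) = 2"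
    using ne by simp
  moreover have "span {\<delta> x, \<delta> y} \<subseteq> ell2 V"
    using ell2 assms subspace_ell2 by (intro real_vector.span_minimal) auto
  ultimately show ?thesis by blast
qed

text \<open>A suitable combination of two basis vectors lies in the kernel of \<open>l\<close>. In
  this way nonnegativity on a hyperplane bounds the second eigenvalue.\<close>

lemma plane_meets_kernel:
  assumes S: "S \<in> subspaces 2" and add: "\<And>f g. l (f + g) = l f + (l g :: real)" and scale: "\<And>c f. l (c *\<^sub>R f) = c * l f"
  obtains v where "v \<in> S" "v \<noteq> 0" "l v = 0"
proof -
  obtain B where B: "B \<subseteq> S" "independent B" "card B = dim S" by (rule real_vector.basis_exists[of S])
  then have "card B = 2" using S by simp
  then obtain a b where ab: "B = {a, b}" "a \<noteq> b" by (auto simp: card_2_iff)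
  then have ind: "independent {a, b}" "a \<in> S" "b \<in> S" using B by auto
  have a0: "a \<noteq> 0" using ind(1) real_vector.dependent_zero[of "{a, b}"] by auto
  show thesis
  proof (cases "l a = 0")
    case True
    then show ?thesis using that a0 ind(2) by blast
  next
    case False
    define v where "v = l b *\<^sub>R a + (- l a) *\<^sub>R b"
    have "v \<in> S" unfolding v_def using S ind(2,3) by (intro real_vector.subspace_add real_vector.subspace_scale) auto
    moreover have "l v = 0" unfolding v_def add scale by simp
    moreover have "v \<noteq> 0"
    proof
      assume "v = 0"
      then have "l a *\<^sub>R b = l b *\<^sub>R a" unfolding v_def by (simp add: add_eq_0_iff)
      then have "(1 / l a) *\<^sub>R (l a *\<^sub>R b) = (1 / l a) *\<^sub>R (l b *\<^sub>R a)" by simp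
      then have "b = (l b / l a) *\<^sub>R a" using False by simp
      then have "b \<in> span {a}" by (metis real_vector.span_base real_vector.span_scale singletonI)
      moreover have "independent (insert b {a})" using ind(1) by (simp add: insert_commute)
      ultimately show False using ab(2) by (simp add: real_vector.independent_insert)
    qed
    ultimately show ?thesis using that by blast
  qed
qed

end

section \<open>Eigenvalues of the tree extension\<close>

context tree_extension
begin

sublocale T: regular_graph T d
  by unfold_locales (rule simple_T regular_T)+

lemma eigenvalue_1_le:
  assumes "pos_form n E g" "g > 0"
  shows "graph_eigenvalue 1 T \<le> lam d g"
proof (rule T.graph_eigenvalue_le)
  define f :: "nat \<times> nat list \<Rightarrow> real" where "f = (\<lambda>x. if x = (0, []) then 1 else 0)"
  have "f \<in> ell2 V" using n_pos by (intro ell2_finite_support) (auto simp: f_def core_in_V)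
  moreover have "f (0, []) \<noteq> 0" by (simp add: f_def)
  then have "f \<noteq> 0" by (auto simp: fun_eq_iff)
  ultimately show "T.subspaces 1 \<noteq> {}" using T.line_in_subspaces by blast
  fix S assume S: "S \<in> T.subspaces 1"
  then obtain v where v: "v \<in> S" "v \<noteq> 0" by (rule T.subspace_nonzero) simp
  have "qform n E g (\<lambda>x. v (x, [])) \<ge> 0" using assms(1) unfolding pos_form_def by blast
  moreover have "v \<in> ell2 V" using S v by auto
  ultimately have "T.form v \<le> lam d g * (\<Sum>\<^sub>\<infinity>x\<in>V. (v x)\<^sup>2)" using form_le[of v g] assms(2) by simp
  then show "\<exists>v\<in>S. v \<noteq> 0 \<and> T.form v \<le> lam d g * (\<Sum>\<^sub>\<infinity>x\<in>V. (v x)\<^sup>2)" using v by blast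
qed

lemma eigenvalue_2_le:
  assumes "almost_pos_form n E g" "g > 0"
  shows "graph_eigenvalue 2 T \<le> lam d g"
proof (rule T.graph_eigenvalue_le)
  have "(0, []) \<in> V" using n_pos by (simp add: core_in_V)
  moreover then have "card (neighbours T (0, [])) > 0" using regular_T d by (auto simp: regular_def degree_def)
  then obtain y where "adj T (0, []) y" by (auto simp: card_gt_0_iff neighbours_def)
  then have "y \<in> V" "(0, []) \<noteq> y" using simple_T unfolding simple_graph_def by blast+
  ultimately show "T.subspaces 2 \<noteq> {}" by (rule T.plane_exists)
  fix S assume S: "S \<in> T.subspaces 2"
  obtain c where c: "\<And>f :: nat \<Rightarrow> real. (\<Sum>x<n. c x * f x) = 0 \<Longrightarrow> qform n E g f \<ge> 0"
    using assms(1) unfolding almost_pos_form_def by blast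
  obtain v where v: "v \<in> S" "v \<noteq> 0" "(\<Sum>x<n. c x * v (x, [])) = 0"
    by (rule T.plane_meets_kernel[OF S, of "\<lambda>f. \<Sum>x<n. c x * f (x, [])"])
      (simp_all add: scaleR_fun_def distrib_left sum.distrib sum_distrib_left mult.left_commute)
  have "qform n E g (\<lambda>x. v (x, [])) \<ge> 0" by (rule c[OF v(3)])
  moreover have "v \<in> ell2 V" using S v by auto
  ultimately have "T.form v \<le> lam d g * (\<Sum>\<^sub>\<infinity>x\<in>V. (v x)\<^sup>2)" using form_le[of v g] assms(2) by simp
  then show "\<exists>v\<in>S. v \<noteq> 0 \<and> T.form v \<le> lam d g * (\<Sum>\<^sub>\<infinity>x\<in>V. (v x)\<^sup>2)" using v by blast
qed

lemma eigenvalue_1_ge: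
  assumes neg: "\<not> pos_form n E g" and g: "g > 0" "(real d - 1) * g\<^sup>2 < 1"
  shows "graph_eigenvalue 1 T \<ge> lam d g"
proof -
  obtain \<phi> where \<phi>: "qform n E g \<phi> < 0" using neg unfolding pos_form_def by (auto simp: not_le)
  let ?f = "extension g \<phi>"
  note eq = form_extension[OF g, of \<phi>]
  have "?f \<noteq> 0"
  proof
    assume "?f = 0"
    then show False using eq \<phi> by (simp add: ell2_inner_def)
  qed
  then show ?thesis using \<phi> eq extension_in_ell2[OF g(2)] by (intro T.graph_eigenvalue_1_ge) auto
qed

end

text \<open>The intermediate value theorem between 1 / (d - 1), with level \<open>d\<close>, and 1 /
  sqrt (d - 1), with level 2 sqrt (d - 1). The strict lower bound on \<open>l\<close> excludes the
  right end.\<close>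

lemma lam_surj:
  assumes d: "d \<ge> 3" and l: "2 * sqrt (real d - 1) < l" "l \<le> d"
  obtains g where "1 / (real d - 1) \<le> g" "(real d - 1) * g\<^sup>2 < 1" "lam d g = l"
proof -
  define D where "D = real d - 1"
  have D: "D \<ge> 2" using d by (simp add: D_def)
  have sD: "sqrt D \<ge> 1" "sqrt D * sqrt D = D" using D by simp_all
  have le: "1 / D \<le> 1 / sqrt D"
  proof (rule frac_le)
    have "sqrt D * 1 \<le> sqrt D * sqrt D" using sD(1) by (intro mult_left_mono) auto
    then show "sqrt D \<le> D" using sD by simp
  qed (use sD in auto)
  have "\<exists>g. 1 / D \<le> g \<and> g \<le> 1 / sqrt D \<and> lam d g = l"
  proof (rule IVT2'[OF _ _ le])
    have "lam d (1 / sqrt D) = D / sqrt D + sqrt D" unfolding lam_def by (simp add: D_def)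
    also have "D / sqrt D = sqrt D" using D by (simp add: real_div_sqrt)
    finally show "lam d (1 / sqrt D) \<le> l" using l(1) by (simp add: D_def)
    show "l \<le> lam d (1 / D)" using l(2) D unfolding lam_def by (simp add: D_def)
    show "continuous_on {1 / D..1 / sqrt D} (lam d)"
      unfolding lam_def
    proof (intro continuous_intros ballI)
      fix x assume "x \<in> {1 / D..1 / sqrt D}"
      moreover have "1 / D > 0" using D by simp
      ultimately have "x > 0" unfolding atLeastAtMost_iff by linarith
      then show "x \<noteq> 0" by simp
    qed
  qed
  then obtain g where g: "1 / D \<le> g" "g \<le> 1 / sqrt D" "lam d g = l" by blast
  have "g \<noteq> 1 / sqrt D"
  proof
    assume "g = 1 / sqrt D"
    then have "l = D / sqrt D + sqrt D" using g(3) unfolding lam_def by (simp add: D_def)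
    also have "D / sqrt D = sqrt D" using D by (simp add: real_div_sqrt)
    finally show False using l(1) by (simp add: D_def)
  qed
  moreover have "1 / D > 0" using D by simp
  then have "0 \<le> g" using g(1) by linarith
  ultimately have "g\<^sup>2 < (1 / sqrt D)\<^sup>2" using g(2) by (intro power_strict_mono) auto
  then have "D * g\<^sup>2 < D * (1 / sqrt D)\<^sup>2" using D by simp
  also have "\<dots> = 1" using D by (simp add: power_divide)
  finally show thesis using that g by (simp add: D_def)
qed

theorem theorem1p3:
  fixes d :: nat and \<mu> \<epsilon> R :: real
  assumes "d \<ge> 3"
    and "2 * sqrt (real d - 1) < \<mu>" and "\<mu> < real d"
    and "\<epsilon> > 0"
    and "R > 0"
  shows "\<exists>G :: (nat \<times> nat list) sgraph.
           simple_graph G \<and> regular d G \<and>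
           (\<exists>G0 :: nat sgraph. finite_graph G0 \<and> max_degree_le G0 d \<and> G = tree_ext d G0) \<and>
           ereal_of_enat (girth G) \<ge> ereal R \<and>
           \<bar>graph_eigenvalue 1 G - \<mu>\<bar> < \<epsilon> \<and>
           graph_eigenvalue 2 G < 2 * sqrt (real d - 1) + \<epsilon>"
proof -
  define \<theta> where "\<theta> = 2 * sqrt (real d - 1)"
  \<comment> \<open>\<open>\<theta>'\<close> lies strictly above the threshold and below both
    \<theta> + \<epsilon> and \<mu>; it bounds the second eigenvalue. The lower end
    \<open>\<mu>'\<close> of the window is within \<epsilon> of \<mu> and kept at least
    \<open>\<theta>'\<close>, so that \<open>gm \<le> g0\<close>.\<close>
  define \<theta>' where "\<theta>' = \<theta> + min \<epsilon> (\<mu> - \<theta>) / 2"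
  define \<mu>' where "\<mu>' = max \<theta>' (\<mu> - \<epsilon> / 2)"
  have bounds: "\<theta> < \<theta>'" "\<theta>' < \<theta> + \<epsilon>" "\<theta>' \<le> \<mu>'" "\<mu>' < \<mu>" "\<mu> - \<epsilon> < \<mu>'"
    using assms(2,4) unfolding \<mu>'_def \<theta>'_def \<theta>_def[symmetric] by (auto simp: min_def max_def field_simps)
  have "\<theta>' \<le> d" "\<mu>' \<le> d" "\<mu> \<le> d" using bounds assms(3) by linarith+
  note surj = lam_surj[OF assms(1), folded \<theta>_def]
  obtain g0 where g0: "1 / (real d - 1) \<le> g0" "(real d - 1) * g0\<^sup>2 < 1" "lam d g0 = \<theta>'"
    using surj[of \<theta>'] bounds \<open>\<theta>' \<le> d\<close> by blast
  obtain gm where gm: "1 / (real d - 1) \<le> gm" "(real d - 1) * gm\<^sup>2 < 1" "lam d gm = \<mu>'"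
    using surj[of \<mu>'] bounds \<open>\<mu>' \<le> d\<close> by (metis less_le_trans)
  obtain g\<mu> where g\<mu>: "1 / (real d - 1) \<le> g\<mu>" "(real d - 1) * g\<mu>\<^sup>2 < 1" "lam d g\<mu> = \<mu>"
    using surj[of \<mu>] assms(2) \<open>\<mu> \<le> d\<close> unfolding \<theta>_def by blast
  have "1 / (real d - 1) > 0" using assms(1) by simp
  then have pos: "g0 > 0" "gm > 0" "g\<mu> > 0" using g0(1) gm(1) g\<mu>(1) by linarith+
  have "g\<mu> < gm"
  proof (rule ccontr)
    assume "\<not> g\<mu> < gm"
    then have "lam d g\<mu> \<le> lam d gm" using assms(1) pos g\<mu>(2) by (intro lam_le) auto
    then show False using g\<mu>(3) gm(3) bounds by simp
  qed
  moreover have "gm \<le> g0"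
  proof (rule ccontr)
    assume "\<not> gm \<le> g0"
    then have "lam d gm < lam d g0" using assms(1) pos gm(2) by (intro lam_less) auto
    then show False using g0(3) gm(3) bounds by simp
  qed
  moreover have "lam d g\<mu> < d" using g\<mu>(3) assms(3) by simp
  ultimately obtain n E where F: "n > 0" "graph_on n E" "\<And>x. deg E x \<le> d" "\<And>v. closed_walks E (nat \<lceil>R\<rceil>) v = {}"
    "almost_pos_form n E g0" "pos_form n E g\<mu>" "\<not> pos_form n E gm"
    using core_graph[OF assms(1) g\<mu>(1), of gm g0 "nat \<lceil>R\<rceil>"] g0(2) by metis
  interpret tree_extension n d E by unfold_locales (fact F assms)+
  have "graph_eigenvalue 1 T \<le> \<mu>" using eigenvalue_1_le[OF F(6) pos(3)] g\<mu>(3) by simp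
  moreover have "graph_eigenvalue 1 T \<ge> \<mu>'" using eigenvalue_1_ge[OF F(7) pos(2) gm(2)] gm(3) by simp
  moreover have "graph_eigenvalue 2 T \<le> \<theta>'" using eigenvalue_2_le[OF F(5) pos(1)] g0(3) by simp
  moreover have "ereal R \<le> ereal_of_enat (girth T)"
  proof -
    have "R \<le> real (nat \<lceil>R\<rceil>)" by linarith
    then have "ereal R \<le> ereal_of_enat (enat (nat \<lceil>R\<rceil>))" by simp
    also have "\<dots> \<le> ereal_of_enat (girth T)" using girth_ge[OF F(4)] by (simp only: ereal_of_enat_le_iff)
    finally show ?thesis .
  qed
  ultimately show ?thesis
    using simple_T regular_T finite_core bounds assms(4) unfolding \<theta>_def[symmetric]
    by (intro exI[of _ T] conjI exI[of _ core]) auto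
qed

end
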